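(* There exists a constant $C>0$ such that for every $n>0$ and every algebraic subset $\Delta\subset\mathrm{End}(V^{\otimes(n+1)})$ with $\dim\Delta = p$ and $\deg\Delta = D$, there exists a Boolean function $f:\{0,1\}^n\to\{0,1\}$ whose stringent quantum complexity relative to $\Delta$ is at least \[ C\cdot\frac{2^n}{p\cdot n+\log D}. \]
   Context: $V$ is a 2-dimensional complex Hermitian space with orthonormal basis $|0\rangle,|1\rangle$; $V^{\otimes m}$ has orthonormal basis $|\mathbf{x}\rangle = |x_{m-1}\rangle\otimes\cdots\otimes|x_0\rangle$ for bit strings. $\mathrm{End}(V^{\otimes(n+1)})$ is regarded as a complex affine space and $\Delta$ as a complex algebraic subset of it. For a Boolean function $f$, $U_f$ is the unitary on $V^{\otimes(n+1)}$ with $U_f(|\mathbf{x}\rangle\otimes|y\rangle) = |\mathbf{x}\rangle\otimes|f(x)\oplus y\rangle$ for $x\in\{0,1\}^n$, $y\in\{0,1\}$. For $\Delta\subset\mathrm{End}(V^{\otimes(n+1)})$, the stringent quantum complexity of $f$ relative to $\Delta$ is $\mathrm{rank}_{\mathrm{End}(V^{\otimes(n+1)}),\Delta}(U_f)$, the smallest $t$ such that $U_f = \alpha_1\cdots\alpha_t$ with all $\alpha_i\in\Delta$ ($\infty$ if none). *)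

theory Defs
  imports "Jordan_Normal_Form.Matrix" "HOL-Library.Extended_Real"
begin

definition aff_space :: "nat \<Rightarrow> (nat \<Rightarrow> complex) set" where
  "aff_space N = {x. \<forall>k\<ge>N. x k = 0}"

inductive poly_fun :: "nat \<Rightarrow> ((nat \<Rightarrow> complex) \<Rightarrow> complex) \<Rightarrow> bool" for N where
  pf_const: "poly_fun N (\<lambda>x. c)"
| pf_var: "k < N \<Longrightarrow> poly_fun N (\<lambda>x. x k)"
| pf_add: "poly_fun N g \<Longrightarrow> poly_fun N h \<Longrightarrow> poly_fun N (\<lambda>x. g x + h x)"
| pf_mult: "poly_fun N g \<Longrightarrow> poly_fun N h \<Longrightarrow> poly_fun N (\<lambda>x. g x * h x)"

definition alg_set :: "nat \<Rightarrow> (nat \<Rightarrow> complex) set \<Rightarrow> bool" where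
  "alg_set N X \<longleftrightarrow> (\<exists>G. (\<forall>g\<in>G. poly_fun N g) \<and>
      X = {x \<in> aff_space N. \<forall>g\<in>G. g x = 0})"

definition irred_alg_set :: "nat \<Rightarrow> (nat \<Rightarrow> complex) set \<Rightarrow> bool" where
  "irred_alg_set N X \<longleftrightarrow> alg_set N X \<and> X \<noteq> {} \<and>
     (\<forall>Y Z. alg_set N Y \<and> alg_set N Z \<and> X = Y \<union> Z \<longrightarrow> X = Y \<or> X = Z)"

definition alg_dim :: "nat \<Rightarrow> (nat \<Rightarrow> complex) set \<Rightarrow> nat" where
  "alg_dim N X = Sup {k. \<exists>Z. (\<forall>i\<le>k. irred_alg_set N (Z i) \<and> Z i \<subseteq> X) \<and>
                              (\<forall>i<k. Z i \<subset> Z (Suc i))}"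

definition irred_components :: "nat \<Rightarrow> (nat \<Rightarrow> complex) set \<Rightarrow> (nat \<Rightarrow> complex) set set" where
  "irred_components N X = {V. irred_alg_set N V \<and> V \<subseteq> X \<and>
      (\<forall>W. irred_alg_set N W \<and> V \<subseteq> W \<and> W \<subseteq> X \<longrightarrow> W = V)}"

definition affine_subspace_codim :: "nat \<Rightarrow> nat \<Rightarrow> (nat \<Rightarrow> complex) set \<Rightarrow> bool" where
  "affine_subspace_codim N r E \<longleftrightarrow> r \<le> N \<and> (\<exists>L c.
      (\<forall>a. (\<forall>k<N. (\<Sum>i<r. a i * L i k) = 0) \<longrightarrow> (\<forall>i<r. a i = 0)) \<and>
      E = {x \<in> aff_space N. \<forall>i<r. (\<Sum>k<N. L i k * x k) = c i})"

text \<open>Degree of an irreducible algebraic set V of dimension r (Heintz): the maximal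
  number of points of V \<inter> E, E an affine subspace of dimension N - r with V \<inter> E finite.\<close>
definition irred_degree :: "nat \<Rightarrow> (nat \<Rightarrow> complex) set \<Rightarrow> nat" where
  "irred_degree N V = Sup {card (V \<inter> E) | E.
      affine_subspace_codim N (alg_dim N V) E \<and> finite (V \<inter> E)}"

definition alg_degree :: "nat \<Rightarrow> (nat \<Rightarrow> complex) set \<Rightarrow> nat" where
  "alg_degree N X = (\<Sum>V\<in>irred_components N X. irred_degree N V)"

definition mat_coords :: "nat \<Rightarrow> complex mat \<Rightarrow> (nat \<Rightarrow> complex)" where
  "mat_coords d M = (\<lambda>k. if k < d * d then M $$ (k div d, k mod d) else 0)"

definition alg_subset_End :: "nat \<Rightarrow> complex mat set \<Rightarrow> bool" where
  "alg_subset_End m \<Delta> \<longleftrightarrow> \<Delta> \<subseteq> carrier_mat (2^m) (2^m) \<and>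
      alg_set (2^m * 2^m) (mat_coords (2^m) ` \<Delta>)"

definition dim_End :: "nat \<Rightarrow> complex mat set \<Rightarrow> nat" where
  "dim_End m \<Delta> = alg_dim (2^m * 2^m) (mat_coords (2^m) ` \<Delta>)"

definition deg_End :: "nat \<Rightarrow> complex mat set \<Rightarrow> nat" where
  "deg_End m \<Delta> = alg_degree (2^m * 2^m) (mat_coords (2^m) ` \<Delta>)"

text \<open>A Boolean function f on {0,1}^n is encoded as f :: nat => bool on {..<2^n}, the
  bit string x_(n-1)...x_0 being identified with the number sum x_k 2^k.  The basis
  vector |x> \<otimes> |y> of V^{\<otimes>(n+1)} has index 2*x + y.\<close>
definition U_oracle :: "nat \<Rightarrow> (nat \<Rightarrow> bool) \<Rightarrow> complex mat" where
  "U_oracle n f = mat (2^(n+1)) (2^(n+1)) (\<lambda>(i, j).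
      if i div 2 = j div 2 \<and> (odd i \<longleftrightarrow> (f (j div 2) \<noteq> odd j)) then 1 else 0)"

definition mat_list_prod :: "nat \<Rightarrow> complex mat list \<Rightarrow> complex mat" where
  "mat_list_prod d as = foldr (\<lambda>A B. A * B) as (1\<^sub>m d)"

text \<open>rank_{End,\<Delta>}(U): least t with U = \<alpha>_1 ... \<alpha>_t, \<alpha>_i \<in> \<Delta>; \<infinity> if none.\<close>
definition rank_End :: "nat \<Rightarrow> complex mat set \<Rightarrow> complex mat \<Rightarrow> enat" where
  "rank_End m \<Delta> U = (INF t \<in> {t. \<exists>as. length as = t \<and> set as \<subseteq> \<Delta> \<and>
        mat_list_prod (2^m) as = U}. enat t)"

definition stringent_qc :: "nat \<Rightarrow> complex mat set \<Rightarrow> (nat \<Rightarrow> bool) \<Rightarrow> enat" where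
  "stringent_qc n \<Delta> f = rank_End (n+1) \<Delta> (U_oracle n f)"

end

theory Submission
  imports Defs "HOL-Analysis.Topology_Euclidean_Space"
    "HOL-Computational_Algebra.Fundamental_Theorem_Algebra"
begin

text \<open>On the algebraic set \<open>X\<close> of coordinate vectors of \<open>\<Delta>\<close> there is, for every \<open>s\<close>, a set \<open>P\<close> of at
  most \<open>D (s + 1)\<^sup>p\<close> points such that a polynomial of degree at most \<open>s\<close> vanishing on \<open>P\<close> vanishes on
  \<open>X\<close>. For a component of dimension \<open>r\<close>, take the fibres of a linear Noether normalisation over a
  grid-like set of \<open>(s + 1)\<^sup>r\<close> generic points of affine \<open>r\<close>-space; each fibre is a section by an
  affine subspace, so it has at most as many points as the degree.

  The diagonal entries \<open>(2x, 2x)\<close> of a product \<open>\<alpha>\<^sub>1 \<dots> \<alpha>\<^sub>t\<close> are linear in each factor and equal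
  \<open>1 - f x\<close> for \<open>U\<^sub>f\<close>. For each \<open>f\<close> the product over \<open>x\<close> of these entries or their complements has
  degree \<open>2\<^sup>n\<close> in each factor, is \<open>1\<close> at \<open>U\<^sub>f\<close> and \<open>0\<close> at the other oracles. Replacing the factors one
  at a time, such functions are determined on \<open>\<Delta>\<^sup>t\<close> by their values on \<open>P\<^sup>t\<close>, where \<open>s = 2\<^sup>n\<close>; hence
  at most \<open>|P|\<^sup>t\<close> oracles are products of \<open>t\<close> elements of \<open>\<Delta>\<close>. If all complexities were below the
  bound, summing over \<open>t\<close> would leave fewer than \<open>2\<close> to the \<open>2\<^sup>n\<close> Boolean functions.\<close>

section \<open>Polynomial functions with a degree bound\<close>

text \<open>The number of test points must involve the true degree of a component, not a constant of
  some normalisation, so exact fibre sizes matter: a good fibre has as many points as the function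
  field has degree over the base. Conversely \<open>irred_degree\<close> and \<open>alg_dim\<close>
  are suprema of natural numbers, informative only for bounded sets; hence the crude bound on finite
  linear sections and the dimension theory for chains. The obstacle in spreading zeros from
  \<open>s + 1\<close> good points to a whole line is that the line may cross bad fibres. The monic
  relation of \<open>f\<close> survives there: its coefficients are polynomials of growth
  \<open>s * (n - l)\<close>, and each of its roots is a value of \<open>f\<close> on the fibre.
  Both facts are obtained analytically, from growth estimates and limits of roots. The constant 1/3:
  with \<open>\<kappa>\<close> the denominator of the bound,
  \<open>2 ^ n + 1 \<le> 2 ^ (2 * n)\<close> gives at most \<open>2 powr (2 * \<kappa>)\<close> test
  points, and counting the possible lengths costs at most one more \<open>\<kappa>\<close> per
  factor, since \<open>\<kappa> \<ge> 1\<close> whenever the bound is positive.\<close>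

inductive pd :: "nat set \<Rightarrow> nat \<Rightarrow> ((nat \<Rightarrow> complex) \<Rightarrow> complex) \<Rightarrow> bool" for I where
  pd_const0: "pd I 0 (\<lambda>x. c)"
| pd_var1: "i \<in> I \<Longrightarrow> pd I 1 (\<lambda>x. x i)"
| pd_add: "pd I e f \<Longrightarrow> pd I e g \<Longrightarrow> pd I e (\<lambda>x. f x + g x)"
| pd_mult: "pd I a f \<Longrightarrow> pd I b g \<Longrightarrow> pd I (a + b) (\<lambda>x. f x * g x)"
| pd_mono: "pd I a f \<Longrightarrow> a \<le> b \<Longrightarrow> pd I b f"

lemma pd_const [simp, intro]: "pd I e (\<lambda>x. c)"
  using pd_mono[OF pd_const0] by simp

lemma pd_var: "i \<in> I \<Longrightarrow> 1 \<le> e \<Longrightarrow> pd I e (\<lambda>x. x i)"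
  using pd_mono[OF pd_var1] by simp

lemma pd_mult_le: "pd I a f \<Longrightarrow> pd I b g \<Longrightarrow> a + b \<le> e \<Longrightarrow> pd I e (\<lambda>x. f x * g x)"
  using pd_mono[OF pd_mult] by blast

lemma pd_cmult: "pd I e f \<Longrightarrow> pd I e (\<lambda>x. c * f x)"
  using pd_mult_le[OF pd_const0, of I e f e c] by simp

lemma pd_uminus: "pd I e f \<Longrightarrow> pd I e (\<lambda>x. - f x)"
  using pd_cmult[of I e f "-1"] by simp

lemma pd_diff: "pd I e f \<Longrightarrow> pd I e g \<Longrightarrow> pd I e (\<lambda>x. f x - g x)"
  using pd_add[OF _ pd_uminus] by fastforce

lemma pd_sum: "(\<And>s. s \<in> S \<Longrightarrow> pd I e (f s)) \<Longrightarrow> pd I e (\<lambda>x. \<Sum>s\<in>S. f s x)"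
proof (induction S rule: infinite_finite_induct)
  case (insert s S)
  then show ?case using pd_add[of I e "f s" "\<lambda>x. \<Sum>s\<in>S. f s x"] by auto
qed auto

lemma pd_prod:
  "finite S \<Longrightarrow> (\<And>s. s \<in> S \<Longrightarrow> pd I (e s) (f s)) \<Longrightarrow> pd I (\<Sum>s\<in>S. e s) (\<lambda>x. \<Prod>s\<in>S. f s x)"
proof (induction S rule: finite_induct)
  case (insert s S)
  then show ?case using pd_mult[of I "e s" "f s" "sum e S" "\<lambda>x. \<Prod>s\<in>S. f s x"] by auto
qed auto

lemma pd_power: "pd I e f \<Longrightarrow> pd I (n * e) (\<lambda>x. f x ^ n)"
  using pd_prod[of "{..<n}" I "\<lambda>_. e" "\<lambda>_. f"] by simp

lemma pd_subset: "pd I e f \<Longrightarrow> I \<subseteq> J \<Longrightarrow> pd J e f"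
proof (induction rule: pd.induct)
  case (pd_mono a f b)
  then show ?case by (auto intro: pd.pd_mono)
qed (auto intro: pd_var pd_add pd_mult)

lemma pd_cong: "pd I e f \<Longrightarrow> (\<And>i. i \<in> I \<Longrightarrow> x i = y i) \<Longrightarrow> f x = f y"
  by (induction rule: pd.induct) auto

lemma pd_subst:
  assumes "pd I e f" "\<And>i. i \<in> I \<Longrightarrow> pd J k (u i)"
  shows "pd J (k * e) (\<lambda>x. f (\<lambda>i. u i x))"
  using assms
proof (induction rule: pd.induct)
  case (pd_mult a f b g)
  then have "pd J (k * a) (\<lambda>x. f (\<lambda>i. u i x))" "pd J (k * b) (\<lambda>x. g (\<lambda>i. u i x))" by blast+
  from pd.pd_mult[OF this] show ?case by (simp add: algebra_simps)
next
  case (pd_mono a f b)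
  then have "pd J (k * a) (\<lambda>x. f (\<lambda>i. u i x))" by blast
  then show ?case using pd_mono(2) by (rule pd.pd_mono[OF _ mult_le_mono2])
next
  case (pd_add e f g)
  then show ?case using pd.pd_add by fastforce
qed auto

lemma pd_subst1:
  assumes "pd I e f" "\<And>i. i \<in> I \<Longrightarrow> pd J 1 (u i)"
  shows "pd J e (\<lambda>x. f (\<lambda>i. u i x))"
  using pd_subst[OF assms] by simp

lemma pd_fun_upd:
  assumes "pd I e f"
  shows "pd (I - {i}) e (\<lambda>x. f (x(i := c)))"
proof -
  have "pd (I - {i}) e (\<lambda>x. f (\<lambda>j. (if j = i then (\<lambda>x. c) else (\<lambda>x. x j)) x))"
    by (rule pd_subst1[OF assms]) (auto intro: pd_var)
  moreover have "(\<lambda>x. f (\<lambda>j. (if j = i then (\<lambda>x. c) else (\<lambda>x. x j)) x)) = (\<lambda>x. f (x(i := c)))"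
    by (intro ext arg_cong[where f = f]) auto
  ultimately show ?thesis by simp
qed

lemma poly_fun_iff: "poly_fun N f \<longleftrightarrow> (\<exists>e. pd {..<N} e f)"
proof
  assume "poly_fun N f"
  then show "\<exists>e. pd {..<N} e f"
  proof (induction rule: poly_fun.induct)
    case (pf_add g h)
    then obtain a b where "pd {..<N} a g" "pd {..<N} b h" by auto
    then have "pd {..<N} (max a b) g" "pd {..<N} (max a b) h" by (auto elim: pd_mono)
    then show ?case by (auto intro: pd_add)
  next
    case (pf_mult g h)
    then show ?case by (auto intro: pd_mult)
  qed (auto intro: pd_var)
next
  assume "\<exists>e. pd {..<N} e f"
  then obtain e where "pd {..<N} e f" ..
  then show "poly_fun N f" by (induction rule: pd.induct) (auto intro: poly_fun.intros)
qed

text \<open>The zero clause for \<open>l > e\<close> is there for the product case: it lets the two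
  expansions be multiplied as a Cauchy product whose convolution sums run over all
  \<open>k \<le> l\<close>.\<close>

lemma pd_expand0:
  assumes "pd I e f"
  shows "\<exists>c. (\<forall>l. pd I (e - l) (c l)) \<and> (\<forall>l>e. c l = (\<lambda>x. 0)) \<and>
    (\<forall>x t. f (\<lambda>i. x i + t * v i) = (\<Sum>l\<le>e. c l x * t ^ l))"
  using assms
proof (induction rule: pd.induct)
  case (pd_const0 c)
  then show ?case by (intro exI[of _ "\<lambda>l x. if l = 0 then c else 0"]) auto
next
  case (pd_var1 i)
  then show ?case
    by (intro exI[of _ "\<lambda>l. if l = 0 then (\<lambda>x. x i) else (\<lambda>x. if l = 1 then v i else 0)"])
      (auto intro: pd_var)
next
  case (pd_add e f g)
  then obtain c d where c: "\<forall>l. pd I (e - l) (c l)" "\<forall>l>e. c l = (\<lambda>x. 0)"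
      "\<forall>x t. f (\<lambda>i. x i + t * v i) = (\<Sum>l\<le>e. c l x * t ^ l)"
    and d: "\<forall>l. pd I (e - l) (d l)" "\<forall>l>e. d l = (\<lambda>x. 0)"
      "\<forall>x t. g (\<lambda>i. x i + t * v i) = (\<Sum>l\<le>e. d l x * t ^ l)" by auto
  then show ?case
    by (intro exI[of _ "\<lambda>l x. c l x + d l x"]) (auto intro: pd.pd_add simp: sum.distrib algebra_simps)
next
  case (pd_mult a f b g)
  then obtain c d where c: "\<forall>l. pd I (a - l) (c l)" "\<forall>l>a. c l = (\<lambda>x. 0)"
      "\<forall>x t. f (\<lambda>i. x i + t * v i) = (\<Sum>l\<le>a. c l x * t ^ l)"
    and d: "\<forall>l. pd I (b - l) (d l)" "\<forall>l>b. d l = (\<lambda>x. 0)"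
      "\<forall>x t. g (\<lambda>i. x i + t * v i) = (\<Sum>l\<le>b. d l x * t ^ l)" by auto
  have "pd I (a + b - l) (\<lambda>x. c k x * d (l - k) x)" if "k \<le> l" for k l
  proof (cases "k \<le> a \<and> l - k \<le> b")
    case True
    have "pd I (a - k) (c k)" "pd I (b - (l - k)) (d (l - k))" using c(1) d(1) by blast+
    then show ?thesis using True that by (rule_tac pd_mult_le) auto
  next
    case False
    then have "c k = (\<lambda>x. 0) \<or> d (l - k) = (\<lambda>x. 0)" using c(2) d(2) by auto
    then show ?thesis by auto
  qed
  moreover have "(\<Sum>k\<le>l. c k x * d (l - k) x) = 0" if "l > a + b" for l x
  proof (intro sum.neutral ballI)
    fix k assume "k \<in> {..l}"
    then have "k > a \<or> l - k > b" using that by auto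
    then show "c k x * d (l - k) x = 0" using c(2) d(2) by auto
  qed
  moreover have "(\<Sum>i\<le>a. c i x * t ^ i) * (\<Sum>j\<le>b. d j x * t ^ j) =
      (\<Sum>l\<le>a + b. (\<Sum>k\<le>l. c k x * d (l - k) x) * t ^ l)" for x t
    using c(2) d(2) by (intro polynomial_product) auto
  ultimately show ?case using c(3) d(3)
    by (intro exI[of _ "\<lambda>l x. \<Sum>k\<le>l. c k x * d (l - k) x"]) (auto intro!: pd_sum)
next
  case (pd_mono a f b)
  then obtain c where c: "\<forall>l. pd I (a - l) (c l)" "\<forall>l>a. c l = (\<lambda>x. 0)"
      "\<forall>x t. f (\<lambda>i. x i + t * v i) = (\<Sum>l\<le>a. c l x * t ^ l)" by auto
  have "(\<Sum>l\<le>a. c l x * t ^ l) = (\<Sum>l\<le>b. c l x * t ^ l)" for x t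
    using pd_mono(2) c(2) by (intro sum.mono_neutral_left) auto
  moreover have "pd I (b - l) (c l)" for l
    using pd.pd_mono[of I "a - l" "c l" "b - l"] c(1) pd_mono(2) by simp
  ultimately show ?case using c(2,3) pd_mono(2) by (intro exI[of _ c]) auto
qed

lemma pd_expand:
  assumes "pd I e f"
  shows "\<exists>c. (\<forall>l. pd I (e - l) (c l)) \<and> (\<forall>x t. f (\<lambda>i. x i + t * v i) = (\<Sum>l\<le>e. c l x * t ^ l))"
proof -
  from pd_expand0[OF assms, of v]
  obtain c where "\<forall>l. pd I (e - l) (c l)" "\<forall>x t. f (\<lambda>i. x i + t * v i) = (\<Sum>l\<le>e. c l x * t ^ l)"
    by (elim exE conjE)
  then show ?thesis by (intro exI[of _ c] conjI)
qed

text \<open>The line through \<open>x\<close> in the direction of the \<open>i\<close>-th unit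
  vector can be started at \<open>x(i := 0)\<close>, so the coefficients do not see coordinate
  \<open>i\<close>.\<close>

lemma pd_expand_var:
  assumes "pd I e f"
  shows "\<exists>c. (\<forall>l. pd (I - {i}) (e - l) (c l)) \<and> (\<forall>x. f x = (\<Sum>l\<le>e. c l x * x i ^ l))"
proof -
  define v :: "nat \<Rightarrow> complex" where "v = (\<lambda>j. if j = i then 1 else 0)"
  from pd_expand[OF assms, of v]
  obtain c where c: "\<forall>l. pd I (e - l) (c l)" "\<forall>x t. f (\<lambda>i. x i + t * v i) = (\<Sum>l\<le>e. c l x * t ^ l)"
    by (elim exE conjE)
  have "f x = (\<Sum>l\<le>e. c l (x(i := 0)) * x i ^ l)" for x
  proof -
    have "x = (\<lambda>j. (x(i := 0)) j + x i * v j)" by (auto simp: v_def)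
    then have "f x = f (\<lambda>j. (x(i := 0)) j + x i * v j)" by simp
    then show ?thesis using c(2)[rule_format, of "x(i := 0)" "x i"] by simp
  qed
  moreover have "pd (I - {i}) (e - l) (\<lambda>x. c l (x(i := 0)))" for l
    by (rule pd_fun_upd) (use c(1) in simp)
  ultimately show ?thesis by (intro exI[of _ "\<lambda>l x. c l (x(i := 0))"]) simp
qed

lemma poly_sum_monom: "poly (\<Sum>l\<le>e. monom (c l) l) t = (\<Sum>l\<le>e. c l * t ^ l)"
  for t :: complex
  by (simp add: poly_sum poly_monom)

lemma pd_line:
  assumes "pd I e f"
  shows "\<exists>p. degree p \<le> e \<and> (\<forall>t. f (\<lambda>i. x i + t * v i) = poly p t)"
proof -
  from pd_expand[OF assms, of v]
  obtain c where c: "\<forall>x t. f (\<lambda>i. x i + t * v i) = (\<Sum>l\<le>e. c l x * t ^ l)"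
    by (elim exE conjE)
  have "degree (monom (c l x) l) \<le> e" if "l \<le> e" for l
    using degree_monom_le[of "c l x" l] that by linarith
  then have "degree (\<Sum>l\<le>e. monom (c l x) l) \<le> e"
    by (intro degree_sum_le) auto
  moreover have "f (\<lambda>i. x i + t * v i) = poly (\<Sum>l\<le>e. monom (c l x) l) t" for t
    unfolding poly_sum_monom using c by simp
  ultimately show ?thesis by (intro exI[of _ "\<Sum>l\<le>e. monom (c l x) l"]) simp
qed

lemma pd_line_upd:
  assumes "pd I e f"
  shows "\<exists>p. degree p \<le> e \<and> (\<forall>t. f (x(i := t)) = poly p t)"
proof -
  have "(\<lambda>j. (x(i := 0)) j + t * (if j = i then 1 else 0)) = x(i := t)" for t
    by auto
  then show ?thesis
    using pd_line[OF assms, of "x(i := 0)" "\<lambda>j. if j = i then 1 else 0"] by simp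
qed

lemma pd_line_zeros_finite:
  assumes "pd I e f" "f (\<lambda>i. x i + s * v i) \<noteq> 0"
  shows "finite {t. f (\<lambda>i. x i + t * v i) = 0}"
proof -
  obtain p where p: "\<And>t. f (\<lambda>i. x i + t * v i) = poly p t"
    using pd_line[OF assms(1), of x v] by (elim exE conjE) simp
  have "poly p s \<noteq> 0" using p[of s] assms(2) by metis
  then have "p \<noteq> 0" by auto
  then show ?thesis using poly_roots_finite[of p] p by simp
qed

lemma pd_segment_zeros_finite:
  assumes "pd I e f" "f y \<noteq> 0"
  shows "finite {t. f (\<lambda>i. x i + t * (y i - x i)) = 0}"
  using pd_line_zeros_finite[OF assms(1), of x 1 "\<lambda>i. y i - x i"] assms(2) by simp

text \<open>Join a common nonzero point of the earlier functions to a nonzero point of the new one: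
  each function has finitely many zeros on that line. This stands in for the polynomial ring being a
  domain.\<close>

lemma pd_prod_nonzero:
  assumes "finite S" "\<And>s. s \<in> S \<Longrightarrow> pd I (e s) (f s)" "\<And>s. s \<in> S \<Longrightarrow> \<exists>x. f s x \<noteq> 0"
  shows "\<exists>x. \<forall>s\<in>S. f s x \<noteq> 0"
  using assms
proof (induction S rule: finite_induct)
  case (insert s S)
  have "\<exists>x. \<forall>s\<in>S. f s x \<noteq> 0" using insert.prems by (intro insert.IH) auto
  then obtain x where x: "\<forall>s\<in>S. f s x \<noteq> 0" by blast
  obtain y where y: "f s y \<noteq> 0" using insert.prems(2)[of s] by blast
  define l where "l = (\<lambda>t i. x i + t * (y i - x i))"
  have "finite {t. f s (l t) = 0}" unfolding l_def
    using insert.prems(1)[of s] y by (intro pd_segment_zeros_finite) auto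
  moreover have "finite {t. f s' (l t) = 0}" if "s' \<in> S" for s'
    unfolding l_def
    using insert.prems(1)[of s'] x that
    by (intro pd_line_zeros_finite[of I "e s'" _ _ 0 "\<lambda>i. y i - x i"]) auto
  ultimately have "finite ({t. f s (l t) = 0} \<union> (\<Union>s'\<in>S. {t. f s' (l t) = 0}))"
    using insert(1) by auto
  then obtain t where "t \<notin> {t. f s (l t) = 0} \<union> (\<Union>s'\<in>S. {t. f s' (l t) = 0})"
    using ex_new_if_finite[OF infinite_UNIV_char_0] by blast
  then show ?case by (intro exI[of _ "l t"]) auto
qed auto

lemma pd_mult_nonzero:
  assumes "pd I a f" "pd I b g" "f x \<noteq> 0" "g y \<noteq> 0"
  shows "\<exists>z. f z \<noteq> 0 \<and> g z \<noteq> 0"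
proof -
  have "\<exists>z. \<forall>s\<in>{True, False}. (if s then f else g) z \<noteq> 0"
    using assms by (intro pd_prod_nonzero[of _ I "\<lambda>s. if s then a else b"]) auto
  then show ?thesis by auto
qed

lemma pd_growth:
  assumes "pd I e f" "finite I"
  shows "\<exists>C\<ge>0. \<forall>x. cmod (f x) \<le> C * (1 + (\<Sum>i\<in>I. cmod (x i))) ^ e"
  using assms
proof (induction rule: pd.induct)
  case (pd_const0 c)
  then show ?case by (intro exI[of _ "cmod c"]) auto
next
  case (pd_var1 i)
  have "cmod (x i) \<le> 1 * (1 + (\<Sum>i\<in>I. cmod (x i))) ^ 1" for x
    using member_le_sum[of i I "\<lambda>i. cmod (x i)"] pd_var1 by auto
  then show ?case by (intro exI[of _ 1]) auto
next
  case (pd_add e f g)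
  then obtain C D where C: "C \<ge> 0" "\<forall>x. cmod (f x) \<le> C * (1 + (\<Sum>i\<in>I. cmod (x i))) ^ e"
    and D: "D \<ge> 0" "\<forall>x. cmod (g x) \<le> D * (1 + (\<Sum>i\<in>I. cmod (x i))) ^ e" by auto
  have "cmod (f x + g x) \<le> (C + D) * (1 + (\<Sum>i\<in>I. cmod (x i))) ^ e" for x
    using norm_triangle_ineq[of "f x" "g x"] C(2)[rule_format, of x] D(2)[rule_format, of x]
    by (simp add: algebra_simps)
  then show ?case using C D by (intro exI[of _ "C + D"]) auto
next
  case (pd_mult a f b g)
  then obtain C D where C: "C \<ge> 0" "\<forall>x. cmod (f x) \<le> C * (1 + (\<Sum>i\<in>I. cmod (x i))) ^ a"
    and D: "D \<ge> 0" "\<forall>x. cmod (g x) \<le> D * (1 + (\<Sum>i\<in>I. cmod (x i))) ^ b" by auto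
  have "cmod (f x * g x) \<le> (C * D) * (1 + (\<Sum>i\<in>I. cmod (x i))) ^ (a + b)" for x
  proof -
    have "cmod (f x * g x) \<le> (C * (1 + (\<Sum>i\<in>I. cmod (x i))) ^ a) * (D * (1 + (\<Sum>i\<in>I. cmod (x i))) ^ b)"
      unfolding norm_mult using C D by (intro mult_mono) (auto intro!: mult_nonneg_nonneg add_nonneg_nonneg sum_nonneg zero_le_power)
    then show ?thesis by (simp add: power_add algebra_simps)
  qed
  then show ?case using C D by (intro exI[of _ "C * D"]) auto
next
  case (pd_mono a f b)
  then obtain C where C: "C \<ge> 0" "\<forall>x. cmod (f x) \<le> C * (1 + (\<Sum>i\<in>I. cmod (x i))) ^ a" by auto
  have "cmod (f x) \<le> C * (1 + (\<Sum>i\<in>I. cmod (x i))) ^ b" for x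
  proof -
    have "(1 + (\<Sum>i\<in>I. cmod (x i))) ^ a \<le> (1 + (\<Sum>i\<in>I. cmod (x i))) ^ b"
      using pd_mono(2) by (intro power_increasing) (auto intro: sum_nonneg)
    then have "C * (1 + (\<Sum>i\<in>I. cmod (x i))) ^ a \<le> C * (1 + (\<Sum>i\<in>I. cmod (x i))) ^ b"
      using C(1) by (rule mult_left_mono)
    then show ?thesis using C(2)[rule_format, of x] by linarith
  qed
  then show ?case using C by blast
qed

lemma pd_tendsto:
  assumes "pd I e f" "\<And>i. i \<in> I \<Longrightarrow> ((\<lambda>n. X n i) \<longlongrightarrow> x i) F"
  shows "((\<lambda>n. f (X n)) \<longlongrightarrow> f x) F"
  using assms
proof (induction rule: pd.induct)
  case (pd_add e f g)
  then show ?case by (intro tendsto_add) auto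
next
  case (pd_mult a f b g)
  then show ?case by (intro tendsto_mult) auto
qed auto

lemma pd_grid_zero:
  assumes "finite I" "pd I e f" "\<And>i. i \<in> I \<Longrightarrow> card (S i) > e"
    and "\<And>x. (\<And>i. i \<in> I \<Longrightarrow> x i \<in> S i) \<Longrightarrow> f x = 0"
  shows "f x = 0"
  using assms
proof (induction I arbitrary: f x rule: finite_induct)
  case (insert i I)
  \<comment> \<open>With the other coordinates on the grid, the restriction to the line in direction
    \<open>i\<close> has degree at most \<open>e\<close> and more than \<open>e\<close>
    zeros.\<close>
  have line: "f (z(i := t)) = 0" if z: "\<And>j. j \<in> I \<Longrightarrow> z j \<in> S j" for z t
  proof -
    obtain p where p: "degree p \<le> e" "\<And>t. f (z(i := t)) = poly p t"
      using pd_line_upd[OF insert.prems(1), of z i] by (elim exE conjE) simp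
    have "poly p t = 0" if "t \<in> S i" for t
    proof -
      have "f (z(i := t)) = 0" using z that insert.hyps(2) by (intro insert.prems(3)) auto
      then show ?thesis using p(2) by simp
    qed
    then have sub: "S i \<subseteq> {t. poly p t = 0}" by blast
    have "p = 0"
    proof (rule ccontr)
      assume "p \<noteq> 0"
      then have "card (S i) \<le> e"
        using card_mono[OF poly_roots_finite sub] card_poly_roots_bound[of p] p(1) by auto
      then show False using insert.prems(2)[of i] by simp
    qed
    then show ?thesis using p(2) by simp
  qed
  have "insert i I - {i} = I" using insert.hyps(2) by simp
  then have pd': "pd I e (\<lambda>z. f (z(i := x i)))"
    using pd_fun_upd[OF insert.prems(1), of i "x i"] by (simp only:)
  have "f (x(i := x i)) = 0"
  proof (rule insert.IH[OF pd', of x])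
    show "e < card (S j)" if "j \<in> I" for j using insert.prems(2) that by simp
    show "f (z(i := x i)) = 0" if "\<And>j. j \<in> I \<Longrightarrow> z j \<in> S j" for z
      using line[OF that] .
  qed
  then show ?case by simp
next
  case empty
  then show ?case by simp
qed

lemma card_PiE_const: "finite I \<Longrightarrow> card (PiE I (\<lambda>_. {..t})) = (t + 1) ^ card I" for t :: nat
  by (simp add: card_PiE)

text \<open>Products of Lagrange basis polynomials, dual to a grid of
  \<open>(t + 1) ^ card I\<close> points. The family is that large while its degree grows only
  linearly in \<open>t\<close>; dimension is measured by such families.\<close>

definition lagr :: "nat set \<Rightarrow> nat \<Rightarrow> (nat \<Rightarrow> nat) \<Rightarrow> (nat \<Rightarrow> complex) \<Rightarrow> complex" where
  "lagr I t p = (\<lambda>y. \<Prod>i\<in>I. \<Prod>c\<in>{..t} - {p i}. (y i - of_nat c) / (of_nat (p i) - of_nat c))"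

lemma pd_lagr:
  assumes "finite I" "p \<in> PiE I (\<lambda>_. {..t})"
  shows "pd I (card I * t) (lagr I t p)"
proof -
  have "pd I (\<Sum>i\<in>I. \<Sum>c\<in>{..t} - {p i}. 1)
    (\<lambda>y. \<Prod>i\<in>I. \<Prod>c\<in>{..t} - {p i}. (y i - of_nat c) / (of_nat (p i) - of_nat c))"
  proof (intro pd_prod assms(1))
    fix i c assume "i \<in> I"
    then have "pd I 1 (\<lambda>y. inverse (of_nat (p i) - of_nat c) * (y i - of_nat c))"
      by (intro pd_cmult pd_diff pd_var) auto
    then show "pd I 1 (\<lambda>y. (y i - of_nat c) / (of_nat (p i) - of_nat c))" by (simp add: field_simps)
  qed auto
  moreover have "(\<Sum>i\<in>I. \<Sum>c\<in>{..t} - {p i}. 1) = card I * t"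
  proof -
    have "p i \<in> {..t}" if "i \<in> I" for i using assms(2) that by auto
    then show ?thesis by (simp add: card_Diff_singleton)
  qed
  ultimately show ?thesis unfolding lagr_def by simp
qed

lemma lagr_eval:
  assumes "finite I" "p \<in> PiE I (\<lambda>_. {..t})" "p' \<in> PiE I (\<lambda>_. {..t})"
  shows "lagr I t p (\<lambda>i. of_nat (p' i)) = (if p = p' then 1 else 0)"
proof (cases "p = p'")
  case True
  then show ?thesis unfolding lagr_def by (auto intro!: prod.neutral)
next
  case False
  then obtain i where i: "i \<in> I" "p i \<noteq> p' i" using assms PiE_ext by metis
  have "p' i \<in> {..t} - {p i}" using assms i by auto
  then have "(\<Prod>c\<in>{..t} - {p i}. ((of_nat (p' i) :: complex) - of_nat c) / (of_nat (p i) - of_nat c)) = 0"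
    by (intro prod_zero) auto
  then show ?thesis using False i assms(1) unfolding lagr_def by (auto intro!: prod_zero)
qed

text \<open>For each pair a coordinate \<open>k z z'\<close> in which the two points differ is
  chosen; products of normalised differences are the indicator functions.\<close>

lemma separating_polys:
  assumes "finite Z" "Z \<subseteq> aff_space N"
  obtains q e where "\<And>z. z \<in> Z \<Longrightarrow> pd {..<N} q (e z)"
    "\<And>z z'. z \<in> Z \<Longrightarrow> z' \<in> Z \<Longrightarrow> e z z' = (if z = z' then 1 else 0)"
proof -
  have "\<exists>k<N. z k \<noteq> z' k" if "z \<in> Z" "z' \<in> Z" "z \<noteq> z'" for z z'
  proof (rule ccontr)
    assume neg: "\<not> ?thesis"
    have "z \<in> aff_space N" "z' \<in> aff_space N" using that assms(2) by blast+
    then have "z k = z' k" for k using neg by (cases "k < N") (auto simp: aff_space_def)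
    then show False using that by auto
  qed
  then obtain k where k: "\<And>z z'. z \<in> Z \<Longrightarrow> z' \<in> Z \<Longrightarrow> z \<noteq> z' \<Longrightarrow> k z z' < N \<and> z (k z z') \<noteq> z' (k z z')"
    by metis
  define e where "e = (\<lambda>z x. \<Prod>z'\<in>Z - {z}. inverse (z (k z z') - z' (k z z')) * (x (k z z') - z' (k z z')))"
  have "pd {..<N} (\<Sum>z'\<in>Z - {z}. 1) (e z)" if "z \<in> Z" for z
    unfolding e_def using k that assms(1) by (intro pd_prod pd_cmult pd_diff pd_var) auto
  then have "pd {..<N} (card Z) (e z)" if "z \<in> Z" for z
    by (rule pd_mono) (use that assms(1) in \<open>auto intro: card_Diff1_le\<close>)
  moreover have "e z z' = (if z = z' then 1 else 0)" if "z \<in> Z" "z' \<in> Z" for z z'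
  proof (cases "z = z'")
    case True
    have "z (k z y) - y (k z y) \<noteq> 0" if "y \<in> Z - {z}" for y
      using k[of z y] that \<open>z \<in> Z\<close> by auto
    then show ?thesis using True unfolding e_def by (auto intro!: prod.neutral)
  next
    case False
    then show ?thesis using that assms(1) unfolding e_def by (auto intro!: prod_zero)
  qed
  ultimately show ?thesis by (rule that[of "card Z" e])
qed

text \<open>Gaussian elimination: one equation is removed with a pivot row \<open>s\<close>, by
  induction on the number of equations.\<close>

lemma lin_dep:
  fixes a :: "'a \<Rightarrow> 'b \<Rightarrow> 'c::field"
  assumes "finite T" "finite S" "card T < card S"
  shows "\<exists>c. (\<exists>i\<in>S. c i \<noteq> 0) \<and> (\<forall>j\<in>T. (\<Sum>i\<in>S. c i * a i j) = 0)"
  using assms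
proof (induction T arbitrary: S a rule: finite_induct)
  case empty
  then obtain s where "s \<in> S" by fastforce
  then show ?case by (intro exI[of _ "\<lambda>_. 1"]) auto
next
  case (insert j T)
  show ?case
  proof (cases "\<forall>i\<in>S. a i j = 0")
    case True
    have "card T < card S" using insert by simp
    then obtain c where "\<exists>i\<in>S. c i \<noteq> 0" "\<forall>j\<in>T. (\<Sum>i\<in>S. c i * a i j) = 0"
      using insert.IH[OF insert.prems(1)] by blast
    then show ?thesis using True by (intro exI[of _ c]) auto
  next
    case False
    then obtain s where s: "s \<in> S" "a s j \<noteq> 0" by auto
    define b where "b = (\<lambda>i k. a i k - a i j / a s j * a s k)"
    have "card T < card (S - {s})" using insert s by simp
    then obtain c where c: "\<exists>i\<in>S - {s}. c i \<noteq> 0" "\<forall>k\<in>T. (\<Sum>i\<in>S - {s}. c i * b i k) = 0"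
      using insert.IH[of "S - {s}" b] insert.prems by auto
    \<comment> \<open>The entry at the pivot is chosen so that equation \<open>j\<close> holds as
      well.\<close>
    define d where "d = c(s := - (\<Sum>i\<in>S - {s}. c i * (a i j / a s j)))"
    have d: "(\<Sum>i\<in>S. d i * a i k) = (\<Sum>i\<in>S - {s}. c i * b i k)" for k
    proof -
      have "(\<Sum>i\<in>S. d i * a i k) = d s * a s k + (\<Sum>i\<in>S - {s}. d i * a i k)"
        using insert.prems(1) s(1) by (simp add: sum.remove)
      also have "(\<Sum>i\<in>S - {s}. d i * a i k) = (\<Sum>i\<in>S - {s}. c i * a i k)"
        by (intro sum.cong) (auto simp: d_def)
      also have "d s * a s k = - (\<Sum>i\<in>S - {s}. c i * (a i j / a s j * a s k))"
        by (simp add: d_def sum_distrib_right mult.assoc)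
      finally show ?thesis by (simp add: b_def sum_subtractf right_diff_distrib)
    qed
    have "b i j = 0" for i using s(2) by (simp add: b_def)
    then have "\<forall>k\<in>insert j T. (\<Sum>i\<in>S. d i * a i k) = 0" using d c(2) by simp
    moreover have "\<exists>i\<in>S. d i \<noteq> 0" using c(1) by (auto simp: d_def)
    ultimately show ?thesis by blast
  qed
qed

section \<open>Algebraic sets\<close>

lemma poly_fun_const [simp, intro]: "poly_fun N (\<lambda>x. c)"
  by (rule pf_const)

lemma poly_fun_uminus: "poly_fun N f \<Longrightarrow> poly_fun N (\<lambda>x. - f x)"
  using pf_mult[OF pf_const[of N "-1"]] by fastforce

lemma poly_fun_diff: "poly_fun N f \<Longrightarrow> poly_fun N g \<Longrightarrow> poly_fun N (\<lambda>x. f x - g x)"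
  using pf_add[OF _ poly_fun_uminus] by fastforce

lemma poly_fun_sum: "(\<And>s. s \<in> S \<Longrightarrow> poly_fun N (f s)) \<Longrightarrow> poly_fun N (\<lambda>x. \<Sum>s\<in>S. f s x)"
proof (induction S rule: infinite_finite_induct)
  case (insert s S)
  then have "poly_fun N (\<lambda>x. f s x + (\<Sum>s\<in>S. f s x))" by (intro pf_add) auto
  then show ?case using insert.hyps by simp
qed auto

lemma poly_fun_prod: "(\<And>s. s \<in> S \<Longrightarrow> poly_fun N (f s)) \<Longrightarrow> poly_fun N (\<lambda>x. \<Prod>s\<in>S. f s x)"
proof (induction S rule: infinite_finite_induct)
  case (insert s S)
  then have "poly_fun N (\<lambda>x. f s x * (\<Prod>s\<in>S. f s x))" by (intro pf_mult) auto
  then show ?case using insert.hyps by simp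
qed auto

lemma poly_fun_power: "poly_fun N f \<Longrightarrow> poly_fun N (\<lambda>x. f x ^ n)"
  using poly_fun_prod[of "{..<n}" N "\<lambda>_. f"] by simp

lemma poly_fun_pd: "pd {..<N} e f \<Longrightarrow> poly_fun N f"
  using poly_fun_iff by auto

lemma poly_fun_cong: "poly_fun N f \<Longrightarrow> (\<And>i. i < N \<Longrightarrow> x i = y i) \<Longrightarrow> f x = f y"
  by (induction rule: poly_fun.induct) auto

lemma alg_set_subset_aff: "alg_set N X \<Longrightarrow> X \<subseteq> aff_space N"
  by (auto simp: alg_set_def)

lemma alg_setI:
  "(\<And>g. g \<in> G \<Longrightarrow> poly_fun N g) \<Longrightarrow> X = {x \<in> aff_space N. \<forall>g\<in>G. g x = 0} \<Longrightarrow> alg_set N X"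
  unfolding alg_set_def by (intro exI[of _ G]) auto

lemma alg_set_separate:
  assumes "alg_set N X" "p \<in> aff_space N" "p \<notin> X"
  shows "\<exists>g. poly_fun N g \<and> (\<forall>x\<in>X. g x = 0) \<and> g p \<noteq> 0"
proof -
  from assms(1)[unfolded alg_set_def] obtain G
    where G: "\<forall>g\<in>G. poly_fun N g" "X = {x \<in> aff_space N. \<forall>g\<in>G. g x = 0}"
    by (elim exE conjE)
  then obtain g where "g \<in> G" "g p \<noteq> 0" using assms by auto
  then show ?thesis using G by (intro exI[of _ g]) auto
qed

lemma alg_set_memI:
  assumes "alg_set N X" "p \<in> aff_space N"
    "\<And>g. poly_fun N g \<Longrightarrow> (\<forall>x\<in>X. g x = 0) \<Longrightarrow> g p = 0"
  shows "p \<in> X"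
proof (rule ccontr)
  assume "p \<notin> X"
  from alg_set_separate[OF assms(1,2) this] obtain g
    where g: "poly_fun N g" "\<forall>x\<in>X. g x = 0" "g p \<noteq> 0" by (elim exE conjE)
  from assms(3)[OF g(1,2)] g(3) show False by simp
qed

lemma alg_set_Int:
  assumes "alg_set N X" "alg_set N Y"
  shows "alg_set N (X \<inter> Y)"
proof -
  from assms(1)[unfolded alg_set_def] obtain G
    where G: "\<forall>g\<in>G. poly_fun N g" "X = {x \<in> aff_space N. \<forall>g\<in>G. g x = 0}"
    by (elim exE conjE)
  from assms(2)[unfolded alg_set_def] obtain H
    where H: "\<forall>g\<in>H. poly_fun N g" "Y = {x \<in> aff_space N. \<forall>g\<in>H. g x = 0}"
    by (elim exE conjE)
  show ?thesis using G H by (intro alg_setI[of "G \<union> H"]) auto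
qed

lemma alg_set_zero_locus: "poly_fun N f \<Longrightarrow> alg_set N {x \<in> aff_space N. f x = 0}"
  by (rule alg_setI[of "{f}"]) auto

lemma alg_set_Int_zero:
  assumes "alg_set N X" "poly_fun N f"
  shows "alg_set N {x \<in> X. f x = 0}"
proof -
  have "{x \<in> X. f x = 0} = X \<inter> {x \<in> aff_space N. f x = 0}"
    using alg_set_subset_aff[OF assms(1)] by auto
  then show ?thesis using alg_set_Int[OF assms(1) alg_set_zero_locus[OF assms(2)]] by simp
qed

lemma alg_set_empty: "alg_set N {}"
  by (rule alg_setI[of "{\<lambda>x. 1}"]) auto

lemma alg_set_Un:
  assumes "alg_set N X" "alg_set N Y"
  shows "alg_set N (X \<union> Y)"
proof -
  from assms(1)[unfolded alg_set_def] obtain G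
    where G: "\<forall>g\<in>G. poly_fun N g" "X = {x \<in> aff_space N. \<forall>g\<in>G. g x = 0}"
    by (elim exE conjE)
  from assms(2)[unfolded alg_set_def] obtain H
    where H: "\<forall>g\<in>H. poly_fun N g" "Y = {x \<in> aff_space N. \<forall>g\<in>H. g x = 0}"
    by (elim exE conjE)
  show ?thesis
  proof (rule alg_setI[of "(\<lambda>(g, h). (\<lambda>x. g x * h x)) ` (G \<times> H)"])
    show "poly_fun N k" if "k \<in> (\<lambda>(g, h). (\<lambda>x. g x * h x)) ` (G \<times> H)" for k
      using that G(1) H(1) by (auto intro: pf_mult)
    show "X \<union> Y = {x \<in> aff_space N. \<forall>g\<in>(\<lambda>(g, h) x. g x * h x) ` (G \<times> H). g x = 0}"
      unfolding G(2) H(2) by auto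
  qed
qed

lemma alg_set_Union: "finite F \<Longrightarrow> (\<And>W. W \<in> F \<Longrightarrow> alg_set N W) \<Longrightarrow> alg_set N (\<Union>F)"
  by (induction F rule: finite_induct) (auto intro: alg_set_empty alg_set_Un)

lemma alg_set_singleton:
  assumes "p \<in> aff_space N"
  shows "alg_set N {p}"
proof (rule alg_setI[of "(\<lambda>k x. x k - p k) ` {..<N}"])
  show "poly_fun N g" if "g \<in> (\<lambda>k x. x k - p k) ` {..<N}" for g
    using that by (auto intro!: poly_fun_diff pf_var)
  have "x = p" if "x \<in> aff_space N" "\<And>k. k < N \<Longrightarrow> x k = p k" for x
  proof
    fix k show "x k = p k" using that assms by (cases "k < N") (auto simp: aff_space_def)
  qed
  then show "{p} = {x \<in> aff_space N. \<forall>g\<in>(\<lambda>k x. x k - p k) ` {..<N}. g x = 0}"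
    using assms by auto
qed

section \<open>Irreducible algebraic sets\<close>

lemma irred_alg_set_aff: "irred_alg_set N V \<Longrightarrow> V \<subseteq> aff_space N"
  using alg_set_subset_aff[of N V] by (simp add: irred_alg_set_def)

lemma irred_subset_Un:
  assumes "irred_alg_set N V" "alg_set N Y" "alg_set N Z" "V \<subseteq> Y \<union> Z"
  shows "V \<subseteq> Y \<or> V \<subseteq> Z"
proof -
  have "alg_set N (V \<inter> Y)" "alg_set N (V \<inter> Z)" "V = (V \<inter> Y) \<union> (V \<inter> Z)"
    using assms alg_set_Int by (auto simp: irred_alg_set_def)
  then have "V = V \<inter> Y \<or> V = V \<inter> Z" using assms(1) unfolding irred_alg_set_def by blast
  then show ?thesis by blast
qed

lemma irred_subset_Union:
  assumes "irred_alg_set N V" "finite F" "\<And>W. W \<in> F \<Longrightarrow> alg_set N W" "V \<subseteq> \<Union>F"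
  shows "\<exists>W\<in>F. V \<subseteq> W"
  using assms(2-)
proof (induction F rule: finite_induct)
  case empty
  then show ?case using assms(1) by (auto simp: irred_alg_set_def)
next
  case (insert W F)
  have "V \<subseteq> W \<or> V \<subseteq> \<Union>F"
    using insert.prems insert.hyps by (intro irred_subset_Un[OF assms(1)] alg_set_Union) auto
  then show ?case using insert by auto
qed

lemma irred_mult_zero:
  assumes "irred_alg_set N V" "poly_fun N f" "poly_fun N g" "\<And>x. x \<in> V \<Longrightarrow> f x * g x = 0"
  shows "(\<forall>x\<in>V. f x = 0) \<or> (\<forall>x\<in>V. g x = 0)"
proof -
  have "V \<subseteq> {x \<in> aff_space N. f x = 0} \<union> {x \<in> aff_space N. g x = 0}"
    using assms(4) irred_alg_set_aff[OF assms(1)] by auto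
  from irred_subset_Un[OF assms(1) alg_set_zero_locus[OF assms(2)] alg_set_zero_locus[OF assms(3)] this]
  show ?thesis by auto
qed

text \<open>A proper splitting \<open>V = Y \<union> Z\<close> yields zero divisors: a function
  vanishing on \<open>Y\<close> but not at some point of \<open>V\<close> outside \<open>Y\<close>,
  and one doing the same for \<open>Z\<close>.\<close>

lemma irredI_domain:
  assumes "alg_set N V" "V \<noteq> {}"
    "\<And>f g. poly_fun N f \<Longrightarrow> poly_fun N g \<Longrightarrow> (\<And>x. x \<in> V \<Longrightarrow> f x * g x = 0) \<Longrightarrow>
      (\<forall>x\<in>V. f x = 0) \<or> (\<forall>x\<in>V. g x = 0)"
  shows "irred_alg_set N V"
  unfolding irred_alg_set_def
proof (intro conjI assms(1,2) allI impI, elim conjE)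
  fix Y Z assume YZ: "alg_set N Y" "alg_set N Z" "V = Y \<union> Z"
  show "V = Y \<or> V = Z"
  proof (rule ccontr)
    assume "\<not> ?thesis"
    then obtain p q where p: "p \<in> V" "p \<notin> Y" and q: "q \<in> V" "q \<notin> Z" using YZ by blast
    have aff: "V \<subseteq> aff_space N" using alg_set_subset_aff[OF assms(1)] .
    have "p \<in> aff_space N" "q \<in> aff_space N" using p q aff by auto
    from alg_set_separate[OF YZ(1) \<open>p \<in> aff_space N\<close> p(2)]
    obtain f where f: "poly_fun N f" "\<forall>x\<in>Y. f x = 0" "f p \<noteq> 0" by (elim exE conjE)
    from alg_set_separate[OF YZ(2) \<open>q \<in> aff_space N\<close> q(2)]
    obtain g where g: "poly_fun N g" "\<forall>x\<in>Z. g x = 0" "g q \<noteq> 0" by (elim exE conjE)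
    have "f x * g x = 0" if "x \<in> V" for x using that f(2) g(2) YZ(3) by auto
    from assms(3)[OF f(1) g(1) this] show False using f g p q by blast
  qed
qed

subsection \<open>Descending chains\<close>

text \<open>The ideal generated by \<open>F\<close>. Adding one multiple at a time gives induction
  on the number of generators used.\<close>

inductive_set idl :: "nat \<Rightarrow> ((nat \<Rightarrow> complex) \<Rightarrow> complex) set \<Rightarrow> ((nat \<Rightarrow> complex) \<Rightarrow> complex) set"
  for N F where
  idl_zero: "(\<lambda>x. 0) \<in> idl N F"
| idl_step: "f \<in> F \<Longrightarrow> poly_fun N a \<Longrightarrow> g \<in> idl N F \<Longrightarrow> (\<lambda>x. a x * f x + g x) \<in> idl N F"

lemma idl_base: "f \<in> F \<Longrightarrow> f \<in> idl N F"
  using idl_step[OF _ poly_fun_const[of N 1] idl_zero, of f F] by simp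

lemma idl_add: "g \<in> idl N F \<Longrightarrow> h \<in> idl N F \<Longrightarrow> (\<lambda>x. g x + h x) \<in> idl N F"
proof (induction rule: idl.induct)
  case (idl_step f a g)
  then have "(\<lambda>x. a x * f x + (g x + h x)) \<in> idl N F" by (intro idl.idl_step) auto
  then show ?case by (simp add: add.assoc)
qed simp

lemma idl_mult: "g \<in> idl N F \<Longrightarrow> poly_fun N b \<Longrightarrow> (\<lambda>x. b x * g x) \<in> idl N F"
proof (induction rule: idl.induct)
  case (idl_step f a g)
  have "poly_fun N (\<lambda>x. b x * a x)" using idl_step by (intro pf_mult)
  then have "(\<lambda>x. (\<lambda>x. b x * a x) x * f x + (\<lambda>x. b x * g x) x) \<in> idl N F"
    using idl_step by (intro idl.idl_step) auto
  then show ?case by (simp add: algebra_simps)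
qed (auto intro: idl_zero)

lemma idl_diff: "g \<in> idl N F \<Longrightarrow> h \<in> idl N F \<Longrightarrow> (\<lambda>x. g x - h x) \<in> idl N F"
  using idl_add[OF _ idl_mult[OF _ poly_fun_const[of N "-1"]], of g F h] by simp

lemma idl_subset: "g \<in> idl N F \<Longrightarrow> F \<subseteq> idl N F' \<Longrightarrow> g \<in> idl N F'"
proof (induction rule: idl.induct)
  case (idl_step f a g)
  then have "(\<lambda>x. a x * f x) \<in> idl N F'" using idl_mult[of f N F' a] by auto
  moreover have "g \<in> idl N F'" using idl_step by simp
  ultimately show ?case by (rule idl_add)
qed (auto intro: idl_zero)

lemma idl_mono: "F \<subseteq> F' \<Longrightarrow> g \<in> idl N F \<Longrightarrow> g \<in> idl N F'"
  using idl_subset idl_base by blast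

lemma idl_poly_fun: "g \<in> idl N F \<Longrightarrow> (\<And>f. f \<in> F \<Longrightarrow> poly_fun N f) \<Longrightarrow> poly_fun N g"
proof (induction rule: idl.induct)
  case (idl_step f a g)
  then show ?case by (intro pf_add pf_mult) auto
qed auto

lemma idl_zero_at: "g \<in> idl N F \<Longrightarrow> (\<And>f. f \<in> F \<Longrightarrow> f x = 0) \<Longrightarrow> g x = 0"
  by (induction rule: idl.induct) auto

lemma idl_range_finite: "g \<in> idl N (range f) \<Longrightarrow> \<exists>m::nat. g \<in> idl N (f ` {..<m})"
proof (induction rule: idl.induct)
  case (idl_step h a g)
  then obtain m k where m: "g \<in> idl N (f ` {..<m})" and k: "h = f k" by auto
  have "f ` {..<m} \<subseteq> f ` {..<max m (Suc k)}" by auto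
  from idl_mono[OF this m] have "g \<in> idl N (f ` {..<max m (Suc k)})" .
  moreover have "h \<in> f ` {..<max m (Suc k)}" using k by auto
  ultimately have "(\<lambda>x. a x * h x + g x) \<in> idl N (f ` {..<max m (Suc k)})"
    using idl_step(2) by (intro idl.idl_step)
  then show ?case by (rule exI)
qed (auto intro: idl_zero)

text \<open>\<open>d\<close> bounds the degree in coordinate \<open>N\<close>; \<open>c d\<close>
  may be zero. For the minimal bounds chosen below, \<open>c d\<close> acts as leading
  coefficient.\<close>

definition var_deg_le :: "nat \<Rightarrow> ((nat \<Rightarrow> complex) \<Rightarrow> complex) \<Rightarrow> nat \<Rightarrow> (nat \<Rightarrow> (nat \<Rightarrow> complex) \<Rightarrow> complex) \<Rightarrow> bool" where
  "var_deg_le N g d c \<longleftrightarrow> (\<forall>l. poly_fun N (c l)) \<and> g = (\<lambda>x. \<Sum>l\<le>d. c l x * x N ^ l)"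

lemma var_deg_le_exists:
  assumes "poly_fun (Suc N) g"
  shows "\<exists>d c. var_deg_le N g d c"
proof -
  obtain e where "pd {..<Suc N} e g" using assms poly_fun_iff by blast
  from pd_expand_var[OF this, of N] obtain c where
    c: "\<forall>l. pd ({..<Suc N} - {N}) (e - l) (c l)" "\<forall>x. g x = (\<Sum>l\<le>e. c l x * x N ^ l)"
    by (elim exE conjE)
  have "{..<Suc N} - {N} = {..<N}" by auto
  then have "poly_fun N (c l)" for l using poly_fun_pd[of N "e - l" "c l"] c(1) by simp
  then have "\<forall>l. poly_fun N (c l)" by simp
  moreover have "g = (\<lambda>x. \<Sum>l\<le>e. c l x * x N ^ l)" using c(2) by (intro ext) blast
  ultimately show ?thesis unfolding var_deg_le_def by (intro exI[of _ e] exI[of _ c] conjI)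
qed

text \<open>Noetherianity in the form suited to descending chains: a sequence cannot leave the ideal
  of its predecessors at every step. The proof is Hilbert's, by leading coefficients in the last
  variable.\<close>

lemma hilbert_basis:
  assumes "\<And>i. poly_fun N (f i)"
  shows "\<exists>m::nat. f m \<in> idl N (f ` {..<m})"
  using assms
proof (induction N arbitrary: f)
  case 0
  have const: "\<exists>c. g = (\<lambda>x. c)" if "poly_fun 0 g" for g
    using that by (induction rule: poly_fun.induct) auto
  obtain c where c: "f 0 = (\<lambda>x. c)" using const[OF 0] by blast
  obtain d where d: "f 1 = (\<lambda>x. d)" using const[OF 0] by blast
  show ?case
  proof (cases "c = 0")
    case True
    then show ?thesis using c idl_zero by (intro exI[of _ 0]) auto
  next
    case False
    have "(\<lambda>x. (\<lambda>x. d / c) x * f 0 x + (\<lambda>x. 0) x) \<in> idl 0 (f ` {..<1})"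
      by (intro idl_step idl_zero) auto
    then have "f 1 \<in> idl 0 (f ` {..<1})" using False c d by simp
    then show ?thesis by blast
  qed
next
  case (Suc N)
  show ?case
  proof (rule ccontr)
    assume no: "\<nexists>m. f m \<in> idl (Suc N) (f ` {..<m})"
    define J where "J = idl (Suc N) (range f)"
    have poly_J: "poly_fun (Suc N) g" if "g \<in> J" for g
      using that idl_poly_fun Suc.prems unfolding J_def by fastforce
    \<comment> \<open>A finite part of \<open>J\<close> already lies in the ideal of an initial
      segment, and by \<open>no\<close> the next member of the sequence is outside that
      ideal.\<close>
    have ex: "\<exists>h. h \<in> J \<and> h \<notin> idl (Suc N) A" if "finite A" "A \<subseteq> J" for A
    proof -
      have "\<exists>m. \<forall>g\<in>A. g \<in> idl (Suc N) (f ` {..<m})"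
        using that
      proof (induction A rule: finite_induct)
        case (insert a A)
        then obtain m where m: "\<forall>g\<in>A. g \<in> idl (Suc N) (f ` {..<m})" by auto
        obtain k where k: "a \<in> idl (Suc N) (f ` {..<k})"
          using insert.prems idl_range_finite unfolding J_def by blast
        have "f ` {..<m} \<subseteq> f ` {..<max m k}" "f ` {..<k} \<subseteq> f ` {..<max m k}" by auto
        then have "\<forall>g\<in>insert a A. g \<in> idl (Suc N) (f ` {..<max m k})"
          using m k idl_mono by blast
        then show ?case by blast
      qed auto
      then obtain m where m: "A \<subseteq> idl (Suc N) (f ` {..<m})" by blast
      have "f m \<in> J" unfolding J_def by (rule idl_base) auto
      moreover have "f m \<notin> idl (Suc N) A" using no m idl_subset by blast
      ultimately show ?thesis by blast
    qed
    define P where "P = (\<lambda>A h d c. h \<in> J \<and> h \<notin> idl (Suc N) A \<and> var_deg_le N h d c \<and>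
      (\<forall>h' d' c'. h' \<in> J \<and> h' \<notin> idl (Suc N) A \<and> var_deg_le N h' d' c' \<longrightarrow> d \<le> d'))"
    have exP: "\<exists>h d c. P A h d c" if A: "finite A" "A \<subseteq> J" for A
    proof -
      define Q where "Q = (\<lambda>d. \<exists>h c. h \<in> J \<and> h \<notin> idl (Suc N) A \<and> var_deg_le N h d c)"
      obtain h where "h \<in> J" "h \<notin> idl (Suc N) A" using ex[OF A] by blast
      then have "\<exists>d. Q d" unfolding Q_def using var_deg_le_exists[OF poly_J] by blast
      then have "Q (LEAST d. Q d)" by (rule LeastI_ex)
      then obtain h c where "h \<in> J" "h \<notin> idl (Suc N) A" "var_deg_le N h (LEAST d. Q d) c"
        unfolding Q_def by blast
      moreover have "(LEAST d. Q d) \<le> d'" if "h' \<in> J \<and> h' \<notin> idl (Suc N) A \<and> var_deg_le N h' d' c'" for h' d' c'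
        by (rule Least_le) (use that in \<open>auto simp: Q_def\<close>)
      ultimately show ?thesis unfolding P_def by blast
    qed
    define pick where "pick = (\<lambda>A. SOME h. \<exists>d c. P A h d c)"
    have pick: "\<exists>d c. P A (pick A) d c" if "finite A" "A \<subseteq> J" for A
      unfolding pick_def by (rule someI_ex[of "\<lambda>h. \<exists>d c. P A h d c", OF exP[OF that]])
    define B where "B = rec_nat {} (\<lambda>_ A. insert (pick A) A)"
    have B0: "B 0 = {}" and BS: "B (Suc k) = insert (pick (B k)) (B k)" for k
      by (auto simp: B_def)
    define g where "g = (\<lambda>k. pick (B k))"
    have Bfin: "finite (B k) \<and> B k \<subseteq> J" for k
    proof (induction k)
      case (Suc k)
      then have "pick (B k) \<in> J" using pick[of "B k"] unfolding P_def by blast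
      then show ?case using Suc BS by auto
    qed (auto simp: B0)
    have Bg: "B k = g ` {..<k}" for k
      by (induction k) (auto simp: B0 BS g_def lessThan_Suc)
    have exdc: "\<forall>k. \<exists>dc. P (g ` {..<k}) (g k) (fst dc) (snd dc)"
    proof
      fix k
      from pick[of "B k"] Bfin[of k] obtain d c where dc: "P (B k) (pick (B k)) d c"
        by (elim exE conjE) (use pick[of "B k"] in blast)
      have gk: "g k = pick (B k)" by (simp add: g_def)
      from dc have "P (g ` {..<k}) (g k) d c" unfolding gk Bg .
      then show "\<exists>dc. P (g ` {..<k}) (g k) (fst dc) (snd dc)"
        by (intro exI[of _ "(d, c)"]) simp
    qed
    from choice[OF exdc] obtain dc where dc: "\<forall>k. P (g ` {..<k}) (g k) (fst (dc k)) (snd (dc k))"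
      by (elim exE)
    define d where "d = (\<lambda>k. fst (dc k))"
    define c where "c = (\<lambda>k. snd (dc k))"
    have gP: "P (g ` {..<k}) (g k) (d k) (c k)" for k using dc by (simp add: d_def c_def)
    have gJ: "g k \<in> J" and gnot: "g k \<notin> idl (Suc N) (g ` {..<k})" and gv: "var_deg_le N (g k) (d k) (c k)" for k
      using gP[of k] unfolding P_def by blast+
    have dmin: "d k \<le> d'" if "h' \<in> J" "h' \<notin> idl (Suc N) (g ` {..<k})" "var_deg_le N h' d' c'" for k h' d' c'
      using gP[of k] that unfolding P_def by blast
    \<comment> \<open>Larger ideals leave fewer candidates, so the minimal degrees increase. The
      shift by \<open>d m - d i\<close> below relies on this.\<close>
    have dmono: "d i \<le> d k" if "i \<le> k" for i k
    proof (rule dmin[OF gJ _ gv])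
      have "g ` {..<i} \<subseteq> g ` {..<k}" using that by auto
      then show "g k \<notin> idl (Suc N) (g ` {..<i})" using gnot[of k] idl_mono by blast
    qed
    have "poly_fun N (c k (d k))" for k using gv[of k] by (simp add: var_deg_le_def)
    from Suc.IH[of "\<lambda>k. c k (d k)", OF this] obtain m where m: "c m (d m) \<in> idl N ((\<lambda>k. c k (d k)) ` {..<m})" by blast
    \<comment> \<open>Every combination of earlier leading coefficients is the coefficient at
      \<open>d m\<close> of a combination of the \<open>g i\<close>, once \<open>g i\<close> is
      multiplied by the missing power of the last variable.\<close>
    have lift: "\<exists>h e. h \<in> idl (Suc N) (g ` {..<m}) \<and> var_deg_le N h (d m) e \<and> e (d m) = u"
      if "u \<in> idl N ((\<lambda>k. c k (d k)) ` {..<m})" for u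
      using that
    proof (induction rule: idl.induct)
      case idl_zero
      show ?case
        by (intro exI[of _ "\<lambda>x. 0"] exI[of _ "\<lambda>l x. 0"])
          (auto simp: var_deg_le_def intro: idl.idl_zero)
    next
      case (idl_step w a u)
      then obtain h e where he: "h \<in> idl (Suc N) (g ` {..<m})" "var_deg_le N h (d m) e" "e (d m) = u"
        by blast
      obtain i where i: "i < m" "w = c i (d i)" using idl_step by auto
      define s where "s = d m - d i"
      have dm: "d m = s + d i" using dmono[of i m] i(1) by (simp add: s_def)
      define e' where "e' = (\<lambda>l x. (if l \<ge> s then a x * c i (l - s) x else 0) + e l x)"
      define h' where "h' = (\<lambda>x. (a x * x N ^ s) * g i x + h x)"
      have a': "poly_fun (Suc N) a"
        using idl_step(2) poly_fun_iff[of N a] pd_subset[of "{..<N}" _ a "{..<Suc N}"] poly_fun_pd by auto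
      have "h' \<in> idl (Suc N) (g ` {..<m})"
        unfolding h'_def using i a' he(1)
        by (intro idl.idl_step pf_mult poly_fun_power pf_var) auto
      moreover have "var_deg_le N h' (d m) e'"
        unfolding var_deg_le_def
      proof (intro conjI allI ext)
        show "poly_fun N (e' l)" for l
        proof -
          have "poly_fun N (\<lambda>x. a x * c i (l - s) x)" "poly_fun N (e l)"
            using idl_step(2) gv[of i] he(2) by (auto simp: var_deg_le_def intro: pf_mult)
          then show ?thesis unfolding e'_def by (cases "l \<ge> s") (auto intro: pf_add)
        qed
        fix x
        have "(\<Sum>l\<le>d m. (if l \<ge> s then a x * c i (l - s) x else 0) * x N ^ l) =
            (\<Sum>l\<in>{s..d m}. a x * c i (l - s) x * x N ^ l)"
          by (intro sum.mono_neutral_cong_right) auto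
        also have "\<dots> = (\<Sum>l\<le>d i. a x * c i l x * x N ^ (s + l))"
          by (rule sum.reindex_bij_witness[of _ "\<lambda>l. l + s" "\<lambda>l. l - s"]) (auto simp: dm)
        also have "\<dots> = (a x * x N ^ s) * (\<Sum>l\<le>d i. c i l x * x N ^ l)"
          by (simp add: sum_distrib_left power_add mult_ac)
        also have "(\<Sum>l\<le>d i. c i l x * x N ^ l) = g i x" using gv[of i] by (simp add: var_deg_le_def)
        finally have "(\<Sum>l\<le>d m. (if l \<ge> s then a x * c i (l - s) x else 0) * x N ^ l) = (a x * x N ^ s) * g i x" .
        moreover have "h x = (\<Sum>l\<le>d m. e l x * x N ^ l)" using he(2) by (simp add: var_deg_le_def)
        ultimately show "h' x = (\<Sum>l\<le>d m. e' l x * x N ^ l)"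
          by (simp add: h'_def e'_def distrib_right sum.distrib)
      qed
      moreover have "e' (d m) = (\<lambda>x. a x * w x + u x)"
        using dm i(2) he(3) by (auto simp: e'_def)
      ultimately show ?case by blast
    qed
    from lift[OF m] obtain h e where h: "h \<in> idl (Suc N) (g ` {..<m})" "var_deg_le N h (d m) e"
        "e (d m) = c m (d m)" by blast
    \<comment> \<open>The terms at \<open>d m\<close> cancel, so \<open>k\<close> contradicts the
      minimality of \<open>d m\<close>.\<close>
    define k where "k = (\<lambda>x. g m x - h x)"
    have "g ` {..<m} \<subseteq> J" using gJ by auto
    then have "h \<in> J" using h(1) idl_subset unfolding J_def by blast
    then have kJ: "k \<in> J" using gJ[of m] unfolding k_def J_def by (intro idl_diff)
    have knot: "k \<notin> idl (Suc N) (g ` {..<m})"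
    proof
      assume "k \<in> idl (Suc N) (g ` {..<m})"
      from idl_add[OF this h(1)] show False using gnot[of m] by (simp add: k_def)
    qed
    have keq: "k x = (\<Sum>l<d m. (c m l x - e l x) * x N ^ l)" for x
    proof -
      have "k x = (\<Sum>l\<le>d m. (c m l x - e l x) * x N ^ l)"
        using gv[of m] h(2) by (simp add: k_def var_deg_le_def left_diff_distrib sum_subtractf)
      also have "\<dots> = (\<Sum>l<d m. (c m l x - e l x) * x N ^ l)"
        using h(3) by (simp add: lessThan_Suc_atMost[symmetric])
      finally show ?thesis .
    qed
    have "d m \<noteq> 0"
    proof
      assume "d m = 0"
      then have "k = (\<lambda>x. 0)" using keq by auto
      then show False using knot idl_zero by auto
    qed
    then obtain d' where d': "d m = Suc d'" using not0_implies_Suc by blast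
    have "var_deg_le N k d' (\<lambda>l x. c m l x - e l x)"
      unfolding var_deg_le_def
    proof (intro conjI allI ext)
      fix x l
      show "poly_fun N (\<lambda>x. c m l x - e l x)"
        using gv[of m] h(2) by (intro poly_fun_diff) (auto simp: var_deg_le_def)
      show "k x = (\<Sum>l\<le>d'. (c m l x - e l x) * x N ^ l)"
        using keq[of x] by (simp add: d' lessThan_Suc_atMost)
    qed
    from dmin[OF kJ knot this] show False using d' by simp
  qed
qed

text \<open>\<open>gp i\<close> pairs a function vanishing on \<open>X (Suc i)\<close> with a point
  of \<open>X i\<close> where it does not vanish. A function in the ideal of its predecessors would
  vanish at its own point, which lies in every earlier \<open>X (Suc i)\<close>.\<close>

lemma alg_set_dcc:
  assumes "\<And>i::nat. alg_set N (X i)" "\<And>i. X (Suc i) \<subset> X i"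
  shows False
proof -
  have ex: "\<forall>i. \<exists>gp. poly_fun N (fst gp) \<and> (\<forall>x\<in>X (Suc i). fst gp x = 0) \<and> snd gp \<in> X i \<and> fst gp (snd gp) \<noteq> 0"
  proof
    fix i
    obtain p where p: "p \<in> X i" "p \<notin> X (Suc i)" using assms(2)[of i] by blast
    have "p \<in> aff_space N" using p(1) alg_set_subset_aff[OF assms(1)] by blast
    from alg_set_separate[OF assms(1) this p(2)]
    obtain g where "poly_fun N g" "\<forall>x\<in>X (Suc i). g x = 0" "g p \<noteq> 0" by (elim exE conjE)
    then show "\<exists>gp. poly_fun N (fst gp) \<and> (\<forall>x\<in>X (Suc i). fst gp x = 0) \<and> snd gp \<in> X i \<and> fst gp (snd gp) \<noteq> 0"
      using p by (intro exI[of _ "(g, p)"]) auto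
  qed
  from choice[OF ex] obtain gp where gp0: "\<forall>i. poly_fun N (fst (gp i)) \<and>
    (\<forall>x\<in>X (Suc i). fst (gp i) x = 0) \<and> snd (gp i) \<in> X i \<and> fst (gp i) (snd (gp i)) \<noteq> 0"
    by (elim exE)
  have gp: "poly_fun N (fst (gp i))" "x \<in> X (Suc i) \<Longrightarrow> fst (gp i) x = 0" "snd (gp i) \<in> X i"
    "fst (gp i) (snd (gp i)) \<noteq> 0" for i x
    using gp0[rule_format, of i] by auto
  obtain m where m: "fst (gp m) \<in> idl N ((\<lambda>i. fst (gp i)) ` {..<m})"
    using hilbert_basis[of N "\<lambda>i. fst (gp i)"] gp(1) by blast
  have dec: "X k \<subseteq> X j" if "j \<le> k" for j k
    using that assms(2) by (induction rule: dec_induct) blast+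
  have "fst (gp m) (snd (gp m)) = 0"
  proof (rule idl_zero_at[OF m])
    fix f assume "f \<in> (\<lambda>i. fst (gp i)) ` {..<m}"
    then obtain i where i: "i < m" "f = fst (gp i)" by auto
    then have "snd (gp m) \<in> X (Suc i)" using gp(3)[of m] dec[of "Suc i" m] by auto
    then show "f (snd (gp m)) = 0" using gp(2) i by blast
  qed
  then show False using gp(4) by blast
qed

lemma alg_set_induct [consumes 1, case_names less]:
  assumes "alg_set N X"
    "\<And>X. alg_set N X \<Longrightarrow> (\<And>Y. alg_set N Y \<Longrightarrow> Y \<subset> X \<Longrightarrow> P Y) \<Longrightarrow> P X"
  shows "P X"
proof -
  have "wf {(Y, X). alg_set N X \<and> alg_set N Y \<and> Y \<subset> X}"
    unfolding wf_iff_no_infinite_down_chain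
  proof (rule notI, elim exE)
    fix X :: "nat \<Rightarrow> (nat \<Rightarrow> complex) set"
    assume "\<forall>i. (X (Suc i), X i) \<in> {(Y, X). alg_set N X \<and> alg_set N Y \<and> Y \<subset> X}"
    then have "alg_set N (X i)" "X (Suc i) \<subset> X i" for i by auto
    then show False by (rule alg_set_dcc)
  qed
  then show ?thesis using assms(1)
    by (induction X rule: wf_induct_rule) (use assms(2) in auto)
qed

lemma alg_set_decomp:
  assumes "alg_set N X"
  shows "\<exists>F. finite F \<and> (\<forall>V\<in>F. irred_alg_set N V) \<and> X = \<Union>F"
  using assms
proof (induction rule: alg_set_induct)
  case (less X)
  show ?case
  proof (cases "X = {} \<or> irred_alg_set N X")
    case True
    then show ?thesis
    proof
      assume "X = {}"
      then show ?thesis by (intro exI[of _ "{}"]) auto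
    next
      assume "irred_alg_set N X"
      then show ?thesis by (intro exI[of _ "{X}"]) auto
    qed
  next
    case False
    then obtain Y Z where YZ: "alg_set N Y" "alg_set N Z" "X = Y \<union> Z" "X \<noteq> Y" "X \<noteq> Z"
      using less(1) unfolding irred_alg_set_def by blast
    then have "Y \<subset> X" "Z \<subset> X" by auto
    obtain F where F: "finite F" "\<forall>V\<in>F. irred_alg_set N V" "Y = \<Union>F"
      using less(2)[OF YZ(1) \<open>Y \<subset> X\<close>] by blast
    obtain G where G: "finite G" "\<forall>V\<in>G. irred_alg_set N V" "Z = \<Union>G"
      using less(2)[OF YZ(2) \<open>Z \<subset> X\<close>] by blast
    show ?thesis using F G YZ(3) by (intro exI[of _ "F \<union> G"]) auto
  qed
qed

text \<open>An irreducible subset lies in a single member of a finite irreducible decomposition, so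
  the components are the maximal members of any such decomposition.\<close>

lemma irred_components:
  assumes "alg_set N X"
  shows "finite (irred_components N X)" "X = \<Union>(irred_components N X)"
proof -
  obtain F where F: "finite F" "\<forall>V\<in>F. irred_alg_set N V" "X = \<Union>F"
    using alg_set_decomp[OF assms] by blast
  have in_F: "\<exists>W\<in>F. V \<subseteq> W" if "irred_alg_set N V" "V \<subseteq> X" for V
    using that F by (intro irred_subset_Union[of N V F]) (auto simp: irred_alg_set_def)
  have "irred_components N X \<subseteq> F"
  proof
    fix V assume "V \<in> irred_components N X"
    then have V: "irred_alg_set N V" "V \<subseteq> X" "\<And>W. irred_alg_set N W \<Longrightarrow> V \<subseteq> W \<Longrightarrow> W \<subseteq> X \<Longrightarrow> W = V"
      unfolding irred_components_def by auto
    obtain W where "W \<in> F" "V \<subseteq> W" using in_F[OF V(1,2)] by blast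
    then show "V \<in> F" using V(3)[of W] F by auto
  qed
  then show "finite (irred_components N X)" using F(1) finite_subset by blast
  show "X = \<Union>(irred_components N X)"
  proof
    show "\<Union>(irred_components N X) \<subseteq> X" unfolding irred_components_def by auto
    show "X \<subseteq> \<Union>(irred_components N X)"
    proof
      fix x assume "x \<in> X"
      then obtain W where W: "W \<in> F" "x \<in> W" using F by auto
      obtain M where M: "M \<in> F" "W \<subseteq> M" "\<And>M'. M' \<in> F \<Longrightarrow> M \<subseteq> M' \<Longrightarrow> M' = M"
        using finite_has_maximal2[OF F(1) W(1)] by metis
      have "M \<in> irred_components N X" unfolding irred_components_def
      proof (intro CollectI conjI allI impI, goal_cases)
        case (3 V)
        then obtain M' where "M' \<in> F" "V \<subseteq> M'" using in_F by blast
        then show ?case using M(3)[of M'] 3 by auto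
      qed (use M F in auto)
      then show "x \<in> \<Union>(irred_components N X)" using W M by auto
    qed
  qed
qed

section \<open>Noether normalisation and dimension\<close>

text \<open>\<open>I\<close> only labels the linear forms \<open>L i\<close>, which need not be
  coordinates. Outside \<open>I\<close>, where polynomials in \<open>I\<close> do not look, the
  value is 0.\<close>

definition linmap :: "nat set \<Rightarrow> nat \<Rightarrow> (nat \<Rightarrow> nat \<Rightarrow> complex) \<Rightarrow> (nat \<Rightarrow> complex) \<Rightarrow> nat \<Rightarrow> complex" where
  "linmap I N L x = (\<lambda>i. if i \<in> I then \<Sum>k<N. L i k * x k else 0)"

lemma pd_linmap: "pd {..<N} 1 (\<lambda>x. linmap I N L x i)"
proof (cases "i \<in> I")
  case True
  have "pd {..<N} 1 (\<lambda>x. \<Sum>k<N. L i k * x k)"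
    by (intro pd_sum pd_cmult pd_var) auto
  then show ?thesis using True by (simp add: linmap_def)
qed (simp add: linmap_def)

lemma pd_comp_linmap:
  assumes "pd I e q"
  shows "pd {..<N} e (\<lambda>x. q (linmap I N L x))"
  using pd_subst1[OF assms, of "{..<N}" "\<lambda>i x. linmap I N L x i"] pd_linmap by simp

text \<open>Algebraic independence of the forms on \<open>V\<close>; geometrically, \<open>V\<close>
  projects onto a dense subset of \<open>I\<close>-space.\<close>

definition algind :: "nat \<Rightarrow> (nat \<Rightarrow> complex) set \<Rightarrow> nat set \<Rightarrow> (nat \<Rightarrow> nat \<Rightarrow> complex) \<Rightarrow> bool" where
  "algind N V I L \<longleftrightarrow> (\<forall>q e. pd I e q \<longrightarrow> (\<forall>x\<in>V. q (linmap I N L x) = 0) \<longrightarrow> (\<forall>y. q y = 0))"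

lemma algindD:
  assumes "algind N V I L" "pd I e q" "\<And>x. x \<in> V \<Longrightarrow> q (linmap I N L x) = 0"
  shows "q y = 0"
  using assms(1)[unfolded algind_def, rule_format, OF assms(2)] assms(3) by blast

text \<open>\<open>V\<close> is finite over the \<open>I\<close>-coordinates: the bound by \<open>K\<close> is properness, and the generators
  \<open>A\<close> come with coefficients whose degree does not exceed that of the represented function.\<close>
definition prenoether ::
  "nat \<Rightarrow> (nat \<Rightarrow> complex) set \<Rightarrow> nat set \<Rightarrow> (nat \<Rightarrow> nat \<Rightarrow> complex) \<Rightarrow>
    ((nat \<Rightarrow> complex) \<Rightarrow> complex) set \<Rightarrow> real \<Rightarrow> bool" where
  "prenoether N V I L A K \<longleftrightarrow> I \<subseteq> {..<N} \<and> finite A \<and> 0 \<le> K \<and>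
    (\<forall>x\<in>V. \<forall>k<N. cmod (x k) \<le> K * (1 + (\<Sum>i\<in>I. cmod (linmap I N L x i)))) \<and>
    (\<forall>t f. pd {..<N} t f \<longrightarrow> (\<exists>q. (\<forall>\<alpha>\<in>A. pd I t (q \<alpha>)) \<and>
      (\<forall>x\<in>V. f x = (\<Sum>\<alpha>\<in>A. q \<alpha> (linmap I N L x) * \<alpha> x))))"

text \<open>A relation, since the normalisation is a choice; that \<open>r\<close> does not depend
  on it follows from \<open>has_dim_mono\<close>.\<close>

definition has_dim :: "nat \<Rightarrow> (nat \<Rightarrow> complex) set \<Rightarrow> nat \<Rightarrow> bool" where
  "has_dim N V r \<longleftrightarrow> (\<exists>I L A K. prenoether N V I L A K \<and> algind N V I L \<and> card I = r)"

text \<open>\<open>H\<close> is the homogeneous part of degree \<open>e\<close>, zero if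
  \<open>e\<close> exceeds the true degree. The case \<open>e = 0\<close> is separate because
  \<open>e - 1\<close> is then no smaller.\<close>

lemma pd_top:
  assumes "pd I e f"
  shows "\<exists>H. (\<forall>t v. H (\<lambda>i. t * v i) = t ^ e * H v) \<and> pd I e H \<and>
    (e > 0 \<longrightarrow> pd I (e - 1) (\<lambda>x. f x - H x)) \<and> (e = 0 \<longrightarrow> (\<forall>x. f x = H x))"
  using assms
proof (induction rule: pd.induct)
  case (pd_const0 c)
  show ?case by (intro exI[of _ "\<lambda>x. c"]) auto
next
  case (pd_var1 i)
  then show ?case by (intro exI[of _ "\<lambda>x. x i"]) (auto intro: pd_var)
next
  case (pd_add e f g)
  then obtain H G where H: "\<forall>t v. H (\<lambda>i. t * v i) = t ^ e * H v" "pd I e H"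
      "e > 0 \<longrightarrow> pd I (e - 1) (\<lambda>x. f x - H x)" "e = 0 \<longrightarrow> (\<forall>x. f x = H x)"
    and G: "\<forall>t v. G (\<lambda>i. t * v i) = t ^ e * G v" "pd I e G"
      "e > 0 \<longrightarrow> pd I (e - 1) (\<lambda>x. g x - G x)" "e = 0 \<longrightarrow> (\<forall>x. g x = G x)"
    by (elim exE conjE)
  have eq: "(\<lambda>x. f x + g x - (H x + G x)) = (\<lambda>x. (f x - H x) + (g x - G x))" by auto
  have "pd I (e - 1) (\<lambda>x. f x + g x - (H x + G x))" if "e > 0"
    unfolding eq using H(3) G(3) that by (intro pd.pd_add) auto
  then show ?case using H G
    by (intro exI[of _ "\<lambda>x. H x + G x"]) (auto simp: distrib_left intro!: pd.pd_add)
next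
  case (pd_mult a f b g)
  then obtain H G where H: "\<forall>t v. H (\<lambda>i. t * v i) = t ^ a * H v" "pd I a H"
      "a > 0 \<longrightarrow> pd I (a - 1) (\<lambda>x. f x - H x)" "a = 0 \<longrightarrow> (\<forall>x. f x = H x)"
    and G: "\<forall>t v. G (\<lambda>i. t * v i) = t ^ b * G v" "pd I b G"
      "b > 0 \<longrightarrow> pd I (b - 1) (\<lambda>x. g x - G x)" "b = 0 \<longrightarrow> (\<forall>x. g x = G x)"
    by (elim exE conjE)
  have eq: "(\<lambda>x. f x * g x - H x * G x) = (\<lambda>x. (f x - H x) * g x + H x * (g x - G x))"
    by (auto simp: algebra_simps)
  have "pd I (a + b - 1) (\<lambda>x. (f x - H x) * g x)" if "a + b > 0"
  proof (cases "a = 0")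
    case True
    then have "(\<lambda>x. (f x - H x) * g x) = (\<lambda>x. 0)" using H(4) by auto
    then show ?thesis by (simp only: pd_const)
  next
    case False
    then have "pd I (a - 1) (\<lambda>x. f x - H x)" using H(3) by simp
    from pd_mult_le[OF this pd_mult.hyps(2), of "a + b - 1"] False show ?thesis by simp
  qed
  moreover have "pd I (a + b - 1) (\<lambda>x. H x * (g x - G x))" if "a + b > 0"
  proof (cases "b = 0")
    case True
    then have "(\<lambda>x. H x * (g x - G x)) = (\<lambda>x. 0)" using G(4) by auto
    then show ?thesis by (simp only: pd_const)
  next
    case False
    then have "pd I (b - 1) (\<lambda>x. g x - G x)" using G(3) by simp
    from pd_mult_le[OF H(2) this, of "a + b - 1"] False show ?thesis by simp
  qed
  ultimately have "pd I (a + b - 1) (\<lambda>x. f x * g x - H x * G x)" if "a + b > 0"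
    unfolding eq using that by (intro pd.pd_add) auto
  moreover have "pd I (a + b) (\<lambda>x. H x * G x)" using H(2) G(2) by (rule pd.pd_mult)
  moreover have "H (\<lambda>i. t * v i) * G (\<lambda>i. t * v i) = t ^ (a + b) * (H v * G v)" for t v
    using H(1) G(1) by (simp add: power_add)
  moreover have "a + b = 0 \<longrightarrow> (\<forall>x. f x * g x = H x * G x)" using H(4) G(4) by simp
  ultimately show ?case by (intro exI[of _ "\<lambda>x. H x * G x"]) simp
next
  case (pd_mono a f b)
  show ?case
  proof (cases "a = b")
    case True
    then show ?thesis using pd_mono by simp
  next
    case False
    then have "a \<le> b - 1" "b > 0" using pd_mono by auto
    then show ?thesis using pd.pd_mono[OF pd_mono.hyps(1) \<open>a \<le> b - 1\<close>]
      by (intro exI[of _ "\<lambda>x. 0"]) auto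
  qed
qed

text \<open>Cauchy's root bound with weights: coefficient \<open>l\<close> may grow like
  \<open>B ^ (e - l)\<close>, as in an integral equation with coefficients of degree
  \<open>e - l\<close>. If \<open>cmod \<tau>\<close> exceeded \<open>k * B\<close>, the lower terms
  would sum to less than \<open>cmod \<tau> ^ e\<close>.\<close>

lemma monic_root_bound:
  fixes \<tau> :: complex
  assumes "e > 0" "\<tau> ^ e = (\<Sum>l<e. d l * \<tau> ^ l)" "\<And>l. l < e \<Longrightarrow> cmod (d l) \<le> C * B ^ (e - l)"
    "B \<ge> 1" "C \<ge> 0"
  shows "cmod \<tau> \<le> (1 + real e * C) * B"
proof (rule ccontr)
  define k where "k = 1 + real e * C"
  assume "\<not> ?thesis"
  then have gt: "cmod \<tau> > k * B" by (simp add: k_def)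
  have k: "k \<ge> 1" using assms(5) by (simp add: k_def)
  have tpos: "cmod \<tau> > 0" using gt k assms(4) by (meson le_less_trans less_eq_real_def mult_nonneg_nonneg not_one_le_zero order_trans zero_le_one)
  have Bk: "B \<le> cmod \<tau> / k" using gt k by (simp add: field_simps)
  have term_le: "cmod (d l * \<tau> ^ l) \<le> C / k * cmod \<tau> ^ e" if "l < e" for l
  proof -
    have "B ^ (e - l) \<le> (cmod \<tau> / k) ^ (e - l)"
      using Bk assms(4) by (intro power_mono) auto
    also have "\<dots> = cmod \<tau> ^ (e - l) / k ^ (e - l)" by (simp add: power_divide)
    also have "\<dots> \<le> cmod \<tau> ^ (e - l) / k"
    proof (intro divide_left_mono)
      show "k \<le> k ^ (e - l)" using k that self_le_power[of k "e - l"] by simp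
    qed (use k in auto)
    finally have B: "B ^ (e - l) \<le> cmod \<tau> ^ (e - l) / k" .
    have "cmod (d l * \<tau> ^ l) \<le> (C * B ^ (e - l)) * cmod \<tau> ^ l"
      unfolding norm_mult norm_power using assms(3)[OF that] by (intro mult_right_mono) auto
    also have "\<dots> \<le> (C * (cmod \<tau> ^ (e - l) / k)) * cmod \<tau> ^ l"
      using B assms(5) by (intro mult_right_mono mult_left_mono) auto
    also have "\<dots> = C / k * (cmod \<tau> ^ (e - l) * cmod \<tau> ^ l)" by simp
    also have "cmod \<tau> ^ (e - l) * cmod \<tau> ^ l = cmod \<tau> ^ e"
      using that by (simp add: power_add[symmetric])
    finally show ?thesis .
  qed
  have "cmod \<tau> ^ e = cmod (\<Sum>l<e. d l * \<tau> ^ l)" using assms(2) by (simp add: norm_power[symmetric])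
  also have "\<dots> \<le> (\<Sum>l<e. cmod (d l * \<tau> ^ l))" by (rule norm_sum)
  also have "\<dots> \<le> (\<Sum>l<e. C / k * cmod \<tau> ^ e)" using term_le by (intro sum_mono) auto
  also have "\<dots> = (real e * C / k) * cmod \<tau> ^ e" by simp
  also have "\<dots> < 1 * cmod \<tau> ^ e"
    using k tpos by (intro mult_strict_right_mono) (auto simp: k_def)
  finally show False by simp
qed

text \<open>The highest power is rewritten by the integral equation until all exponents are below
  \<open>e\<close>. The weights \<open>t - l\<close> and \<open>e - l\<close> add up, so degree
  \<open>t\<close> is never exceeded; this preserves the degree clause of
  \<open>prenoether\<close>.\<close>

lemma reduce_powers:
  assumes "e > 0" "\<And>x. x \<in> V \<Longrightarrow> \<tau> x ^ e = (\<Sum>l<e. d l (z x) * \<tau> x ^ l)"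
    "\<And>l. l < e \<Longrightarrow> pd J (e - l) (d l)"
    "\<And>l. l \<le> m \<Longrightarrow> pd J (t - l) (c l)" "m \<le> t"
  shows "\<exists>r. (\<forall>i<e. pd J t (r i)) \<and>
    (\<forall>x\<in>V. (\<Sum>l\<le>m. c l (z x) * \<tau> x ^ l) = (\<Sum>i<e. r i (z x) * (\<tau> x :: complex) ^ i))"
  using assms(4,5)
proof (induction m arbitrary: c rule: less_induct)
  case (less m)
  show ?case
  proof (cases "m < e")
    case True
    define r where "r = (\<lambda>i. if i \<le> m then c i else (\<lambda>x. 0))"
    have "pd J t (r i)" for i
      using less.prems pd_mono[of J "t - i" "c i" t] by (auto simp: r_def)
    moreover have "(\<Sum>l\<le>m. c l (z x) * \<tau> x ^ l) = (\<Sum>i<e. r i (z x) * \<tau> x ^ i)" for x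
      using True by (intro sum.mono_neutral_cong_left) (auto simp: r_def)
    ultimately show ?thesis by (intro exI[of _ r]) simp
  next
    case False
    define s where "s = m - e"
    have ms: "m = s + e" using False by (simp add: s_def)
    define c' where "c' = (\<lambda>i x. c i x + (if i \<ge> s then c m x * d (i - s) x else 0))"
    have pd': "pd J (t - i) (c' i)" if "i \<le> m - 1" for i
    proof (cases "i \<ge> s")
      case True
      have i: "i - s < e" using that True assms(1) ms by auto
      have "pd J (t - m) (c m)" "pd J (t - i) (c i)" using less.prems that by auto
      moreover have "pd J (t - i) (\<lambda>x. c m x * d (i - s) x)"
        using less.prems(2) True ms i
        by (intro pd_mult_le[OF \<open>pd J (t - m) (c m)\<close> assms(3)[OF i]]) auto
      ultimately show ?thesis using True unfolding c'_def by (simp add: pd_add)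
    next
      case False
      then show ?thesis using less.prems(1)[of i] that unfolding c'_def by simp
    qed
    have lt: "m - 1 < m" using assms(1) ms by simp
    have "\<exists>r. (\<forall>i<e. pd J t (r i)) \<and>
      (\<forall>x\<in>V. (\<Sum>l\<le>m - 1. c' l (z x) * \<tau> x ^ l) = (\<Sum>i<e. r i (z x) * \<tau> x ^ i))"
      by (rule less.IH[OF lt]) (use pd' less.prems(2) in auto)
    then obtain r where r: "\<forall>i<e. pd J t (r i)"
      "\<forall>x\<in>V. (\<Sum>l\<le>m - 1. c' l (z x) * \<tau> x ^ l) = (\<Sum>i<e. r i (z x) * \<tau> x ^ i)"
      by (elim exE conjE)
    have "(\<Sum>l\<le>m. c l (z x) * \<tau> x ^ l) = (\<Sum>l\<le>m - 1. c' l (z x) * \<tau> x ^ l)" if "x \<in> V" for x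
    proof -
      have mm: "{..m} = insert m {..m - 1}" using lt by auto
      have "(\<Sum>l\<le>m - 1. c' l (z x) * \<tau> x ^ l) = (\<Sum>l\<le>m - 1. c l (z x) * \<tau> x ^ l) +
          (\<Sum>l\<le>m - 1. (if l \<ge> s then c m (z x) * d (l - s) (z x) else 0) * \<tau> x ^ l)"
        by (simp add: c'_def distrib_right sum.distrib)
      also have "(\<Sum>l\<le>m - 1. (if l \<ge> s then c m (z x) * d (l - s) (z x) else 0) * \<tau> x ^ l) =
          (\<Sum>l\<in>{s..<m}. c m (z x) * d (l - s) (z x) * \<tau> x ^ l)"
        using lt by (intro sum.mono_neutral_cong_right) auto
      also have "\<dots> = (\<Sum>l<e. c m (z x) * d l (z x) * \<tau> x ^ (s + l))"
        by (rule sum.reindex_bij_witness[of _ "\<lambda>l. l + s" "\<lambda>l. l - s"]) (auto simp: ms)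
      also have "\<dots> = c m (z x) * \<tau> x ^ s * (\<Sum>l<e. d l (z x) * \<tau> x ^ l)"
        by (simp add: sum_distrib_left power_add mult_ac)
      also have "\<dots> = c m (z x) * \<tau> x ^ m"
        using assms(2)[OF that] by (simp add: ms power_add)
      finally show ?thesis using lt by (simp add: mm)
    qed
    then show ?thesis using r by (intro exI[of _ r]) simp
  qed
qed

text \<open>Noether's step with a linear change of coordinates: for a relation \<open>q\<close> of
  least degree, choose a direction \<open>v\<close> in which its leading form is nonzero. Along
  \<open>v\<close> the relation is monic up to a constant, so \<open>V\<close> stays finite over the
  projection along \<open>v\<close>.\<close>

lemma prenoether_step:
  assumes pre: "prenoether N V I L A K" and ne: "V \<noteq> {}" and dep: "\<not> algind N V I L"
  shows "\<exists>j\<in>I. \<exists>L' A' K'. prenoether N V (I - {j}) L' A' K'"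
proof -
  have I: "I \<subseteq> {..<N}" "finite A" "0 \<le> K" and finI: "finite I"
    using pre finite_subset unfolding prenoether_def by auto
  define R where "R = (\<lambda>e. \<exists>q y. pd I e q \<and> (\<forall>x\<in>V. q (linmap I N L x) = 0) \<and> q y \<noteq> 0)"
  have "\<exists>e. R e" using dep unfolding algind_def R_def by blast
  \<comment> \<open>Minimality guarantees a nonzero leading form; otherwise \<open>q\<close> itself
    would be a relation of degree \<open>e - 1\<close>.\<close>
  define e where "e = (LEAST e. R e)"
  have "R e" unfolding e_def using \<open>\<exists>e. R e\<close> by (rule LeastI_ex)
  have least: "\<not> R e'" if "e' < e" for e' using that not_less_Least unfolding e_def by blast
  from \<open>R e\<close>[unfolded R_def] obtain q y0 where q: "pd I e q" "\<forall>x\<in>V. q (linmap I N L x) = 0" "q y0 \<noteq> 0"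
    by (elim exE conjE)
  from pd_top[OF q(1)] obtain H where H: "\<forall>t v. H (\<lambda>i. t * v i) = t ^ e * H v" "pd I e H"
    "e > 0 \<longrightarrow> pd I (e - 1) (\<lambda>x. q x - H x)" "e = 0 \<longrightarrow> (\<forall>x. q x = H x)"
    by (elim exE conjE)
  have epos: "e > 0"
  proof (rule ccontr)
    assume "\<not> e > 0"
    then have q0: "pd I 0 q" using q(1) by simp
    obtain x where x: "x \<in> V" using ne by blast
    from pd_line[OF q0, of "linmap I N L x" "\<lambda>i. y0 i - linmap I N L x i"] obtain p
      where p: "degree p \<le> 0" "\<forall>t. q (\<lambda>i. linmap I N L x i + t * (y0 i - linmap I N L x i)) = poly p t"
      by (elim exE conjE)
    from p(1) obtain a where "p = [:a:]" by (auto elim: degree_eq_zeroE)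
    then show False using p(2)[rule_format, of 0] p(2)[rule_format, of 1] q(2,3) x by simp
  qed
  have "\<exists>v. H v \<noteq> 0"
  proof (rule ccontr)
    assume "\<not> ?thesis"
    then have "(\<lambda>x. q x - H x) = q" by auto
    then have "pd I (e - 1) q" using H(3) epos by simp
    then have "R (e - 1)" unfolding R_def using q(2,3) by (intro exI[of _ q] exI[of _ y0]) simp
    then show False using least[of "e - 1"] epos by simp
  qed
  then obtain v0 where v0: "H v0 \<noteq> 0" by blast
  define v where "v = (\<lambda>i. if i \<in> I then v0 i else 0)"
  have "H v = H v0" by (rule pd_cong[OF H(2)]) (simp add: v_def)
  then have Hv: "H v \<noteq> 0" using v0 by simp
  have "\<exists>j\<in>I. v j \<noteq> 0"
  proof (rule ccontr)
    assume "\<not> ?thesis"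
    then have "v = (\<lambda>i. 0 * v i)" by (auto simp: v_def)
    then have "H v = H (\<lambda>i. 0 * v i)" by simp
    also have "\<dots> = 0" using H(1)[rule_format, of 0 v] epos by simp
    finally show False using Hv by simp
  qed
  then obtain j where j: "j \<in> I" "v j \<noteq> 0" by blast
  define J where "J = I - {j}"
  \<comment> \<open>The projection along \<open>v\<close>: coordinate \<open>j\<close> of
    \<open>z x\<close> is 0, and the original forms are recovered as
    \<open>z x + \<tau> x * v\<close>.\<close>
  define L' where "L' = (\<lambda>i k. L i k - v i / v j * L j k)"
  define \<tau> where "\<tau> = (\<lambda>x. linmap I N L x j / v j)"
  define z where "z = linmap J N L'"
  have zeq: "z x i = linmap I N L x i - \<tau> x * v i" for x i
  proof -
    consider "i \<in> J" | "i = j" | "i \<notin> I" using j by (auto simp: J_def)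
    then show ?thesis
    proof cases
      case 1
      have "(\<Sum>k<N. L' i k * x k) = (\<Sum>k<N. L i k * x k - v i / v j * (L j k * x k))"
        by (intro sum.cong) (auto simp: L'_def left_diff_distrib)
      also have "\<dots> = (\<Sum>k<N. L i k * x k) - v i / v j * (\<Sum>k<N. L j k * x k)"
        by (simp add: sum_subtractf sum_distrib_left)
      finally show ?thesis using 1 j by (simp add: z_def linmap_def \<tau>_def J_def)
    next
      case 2
      then show ?thesis using j by (simp add: z_def linmap_def \<tau>_def J_def)
    next
      case 3
      then show ?thesis by (simp add: z_def linmap_def J_def v_def)
    qed
  qed
  then have lin: "linmap I N L x = (\<lambda>i. z x i + \<tau> x * v i)" for x by (auto simp: fun_eq_iff)
  have zj: "z x j = 0" for x by (simp add: z_def linmap_def J_def)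
  then have zupd: "(z x)(j := 0) = z x" for x by (simp add: fun_upd_idem)
  have pdJ: "pd J a (\<lambda>y. f (y(j := 0)))" if "pd I a f" for f a
    unfolding J_def by (rule pd_fun_upd[OF that])
  from pd_expand[OF q(1), of v] obtain c where c: "\<forall>l. pd I (e - l) (c l)"
    "\<forall>x t. q (\<lambda>i. x i + t * v i) = (\<Sum>l\<le>e. c l x * t ^ l)" by (elim exE conjE)
  \<comment> \<open>The top coefficient is constant: the part of \<open>q\<close> of lower degree
    does not reach \<open>t ^ e\<close>, and the coefficient of \<open>H\<close> there has degree 0,
    hence can be computed at the origin.\<close>
  have ce: "c e y = H v" for y
  proof -
    have "pd I (e - 1) (\<lambda>x. q x - H x)" using H(3) epos by simp
    from pd_line[OF this, of y v] obtain p' where p': "degree p' \<le> e - 1"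
      "\<forall>t. q (\<lambda>i. y i + t * v i) - H (\<lambda>i. y i + t * v i) = poly p' t" by (elim exE conjE)
    from pd_expand[OF H(2), of v] obtain h where h: "\<forall>l. pd I (e - l) (h l)"
      "\<forall>x t. H (\<lambda>i. x i + t * v i) = (\<Sum>l\<le>e. h l x * t ^ l)" by (elim exE conjE)
    have const: "h e x = h e x'" for x x'
    proof -
      have "pd I 0 (h e)" using h(1)[rule_format, of e] by simp
      from pd_line[OF this, of x "\<lambda>i. x' i - x i"] obtain p where p: "degree p \<le> 0"
        "\<forall>t. h e (\<lambda>i. x i + t * (x' i - x i)) = poly p t" by (elim exE conjE)
      from p(1) obtain a where "p = [:a:]" by (auto elim: degree_eq_zeroE)
      then show ?thesis using p(2)[rule_format, of 0] p(2)[rule_format, of 1] by simp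
    qed
    have "poly (\<Sum>l\<le>e. monom (h l (\<lambda>i. 0)) l) t = poly (monom (H v) e) t" for t
      using h(2)[rule_format, of "\<lambda>i. 0" t] H(1)[rule_format, of t v]
      by (simp add: poly_sum_monom poly_monom mult.commute)
    then have "(\<Sum>l\<le>e. monom (h l (\<lambda>i. 0)) l) = monom (H v) e" by (intro poly_eq_poly_eq_iff[THEN iffD1]) auto
    then have "coeff (\<Sum>l\<le>e. monom (h l (\<lambda>i. 0)) l) e = H v" by simp
    then have he: "h e y = H v" using const[of y "\<lambda>i. 0"] by (simp add: coeff_sum)
    have "poly (\<Sum>l\<le>e. monom (c l y) l) t = poly ((\<Sum>l\<le>e. monom (h l y) l) + p') t" for t
      using c(2)[rule_format, of y t] h(2)[rule_format, of y t] p'(2)[rule_format, of t]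
      by (simp add: poly_sum_monom algebra_simps)
    then have "(\<Sum>l\<le>e. monom (c l y) l) = (\<Sum>l\<le>e. monom (h l y) l) + p'"
      by (intro poly_eq_poly_eq_iff[THEN iffD1]) auto
    then have "coeff (\<Sum>l\<le>e. monom (c l y) l) e = coeff ((\<Sum>l\<le>e. monom (h l y) l) + p') e" by simp
    moreover have "coeff p' e = 0" using p'(1) epos by (intro coeff_eq_0) auto
    ultimately show ?thesis using he by (simp add: coeff_sum)
  qed
  define d where "d = (\<lambda>l y. - inverse (H v) * c l (y(j := 0)))"
  have d: "pd J (e - l) (d l)" for l
    unfolding d_def by (rule pd_cmult, rule pdJ) (use c(1) in blast)
  have rel: "\<tau> x ^ e = (\<Sum>l<e. d l (z x) * \<tau> x ^ l)" if "x \<in> V" for x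
  proof -
    have "0 = q (\<lambda>i. z x i + \<tau> x * v i)" using q(2) that lin by simp
    also have "\<dots> = (\<Sum>l\<le>e. c l (z x) * \<tau> x ^ l)" using c(2) by blast
    also have "\<dots> = H v * \<tau> x ^ e + (\<Sum>l<e. c l (z x) * \<tau> x ^ l)"
      using ce by (simp add: lessThan_Suc_atMost[symmetric])
    finally have "\<tau> x ^ e = - inverse (H v) * (\<Sum>l<e. c l (z x) * \<tau> x ^ l)"
      using Hv by (simp add: field_simps eq_neg_iff_add_eq_0)
    then show ?thesis by (simp add: d_def zupd sum_distrib_left mult_ac sum_negf)
  qed
  have "\<exists>C\<ge>0. \<forall>x\<in>V. cmod (\<tau> x) \<le> C * (1 + (\<Sum>i\<in>J. cmod (z x i)))"
  proof -
    have "finite J" using finI by (simp add: J_def)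
    then have exC: "\<forall>l. \<exists>C\<ge>0. (\<forall>y. cmod (d l y) \<le> C * (1 + (\<Sum>i\<in>J. cmod (y i))) ^ (e - l))"
      by (intro allI pd_growth d)
    from choice[OF this] obtain C where C: "\<forall>l. C l \<ge> (0::real) \<and>
      (\<forall>y. cmod (d l y) \<le> C l * (1 + (\<Sum>i\<in>J. cmod (y i))) ^ (e - l))" by (elim exE)
    define D where "D = (\<Sum>l<e. C l)"
    have D: "D \<ge> 0" "l < e \<Longrightarrow> C l \<le> D" for l
      using C unfolding D_def by (auto intro!: sum_nonneg member_le_sum)
    have "cmod (\<tau> x) \<le> (1 + real e * D) * (1 + (\<Sum>i\<in>J. cmod (z x i)))" if "x \<in> V" for x
    proof (rule monic_root_bound[OF epos rel[OF that]])
      fix l assume l: "l < e"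
      have "C l * (1 + (\<Sum>i\<in>J. cmod (z x i))) ^ (e - l) \<le> D * (1 + (\<Sum>i\<in>J. cmod (z x i))) ^ (e - l)"
        using D(2)[OF l] by (intro mult_right_mono zero_le_power) (simp_all add: add_nonneg_nonneg sum_nonneg)
      moreover have "cmod (d l (z x)) \<le> C l * (1 + (\<Sum>i\<in>J. cmod (z x i))) ^ (e - l)"
        using C by simp
      ultimately show "cmod (d l (z x)) \<le> D * (1 + (\<Sum>i\<in>J. cmod (z x i))) ^ (e - l)"
        by linarith
    qed (use D(1) in \<open>auto intro: sum_nonneg\<close>)
    then show ?thesis using D(1) by (intro exI[of _ "1 + real e * D"]) auto
  qed
  then obtain C where C: "C \<ge> 0" "\<forall>x\<in>V. cmod (\<tau> x) \<le> C * (1 + (\<Sum>i\<in>J. cmod (z x i)))" by blast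
  define K' where "K' = K * (1 + C * (\<Sum>i\<in>I. cmod (v i)))"
  have vpos: "0 \<le> (\<Sum>i\<in>I. cmod (v i))" by (intro sum_nonneg) auto
  have growth: "cmod (x k) \<le> K' * (1 + (\<Sum>i\<in>J. cmod (z x i)))" if x: "x \<in> V" "k < N" for x k
  proof -
    have "(\<Sum>i\<in>I. cmod (linmap I N L x i)) \<le> (\<Sum>i\<in>I. cmod (z x i) + cmod (\<tau> x) * cmod (v i))"
      unfolding lin by (intro sum_mono order_trans[OF norm_triangle_ineq]) (simp add: norm_mult)
    also have "\<dots> = (\<Sum>i\<in>I. cmod (z x i)) + cmod (\<tau> x) * (\<Sum>i\<in>I. cmod (v i))"
      by (simp add: sum.distrib sum_distrib_left)
    also have "(\<Sum>i\<in>I. cmod (z x i)) = (\<Sum>i\<in>J. cmod (z x i))"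
      using finI j zj by (simp add: J_def sum.remove[of I j])
    also have "cmod (\<tau> x) * (\<Sum>i\<in>I. cmod (v i)) \<le>
        (C * (1 + (\<Sum>i\<in>J. cmod (z x i)))) * (\<Sum>i\<in>I. cmod (v i))"
      using C(2) x vpos by (intro mult_right_mono) auto
    finally have "1 + (\<Sum>i\<in>I. cmod (linmap I N L x i)) \<le>
        (1 + C * (\<Sum>i\<in>I. cmod (v i))) * (1 + (\<Sum>i\<in>J. cmod (z x i)))"
      by (simp add: algebra_simps)
    then have "K * (1 + (\<Sum>i\<in>I. cmod (linmap I N L x i))) \<le> K' * (1 + (\<Sum>i\<in>J. cmod (z x i)))"
      unfolding K'_def mult.assoc using I(3) by (rule mult_left_mono)
    moreover have "cmod (x k) \<le> K * (1 + (\<Sum>i\<in>I. cmod (linmap I N L x i)))"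
      using pre x unfolding prenoether_def by blast
    ultimately show ?thesis by linarith
  qed
  define A' where "A' = (\<lambda>(\<alpha>, i) x. \<tau> x ^ i * \<alpha> x) ` (A \<times> {..<e})"
  have repr: "\<exists>q. (\<forall>\<beta>\<in>A'. pd J t (q \<beta>)) \<and> (\<forall>x\<in>V. f x = (\<Sum>\<beta>\<in>A'. q \<beta> (z x) * \<beta> x))"
    if f: "pd {..<N} t f" for t f
  proof -
    from pre f obtain q where q: "\<forall>\<alpha>\<in>A. pd I t (q \<alpha>)"
      "\<forall>x\<in>V. f x = (\<Sum>\<alpha>\<in>A. q \<alpha> (linmap I N L x) * \<alpha> x)"
      unfolding prenoether_def by blast
    have "\<exists>r. (\<forall>i<e. pd J t (r i)) \<and>
      (\<forall>x\<in>V. q \<alpha> (linmap I N L x) = (\<Sum>i<e. r i (z x) * \<tau> x ^ i))" if \<alpha>: "\<alpha> \<in> A" for \<alpha>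
    proof -
      from q(1) \<alpha> have "pd I t (q \<alpha>)" by blast
      from pd_expand[OF this, of v] obtain c where c: "\<forall>l. pd I (t - l) (c l)"
        "\<forall>x s. q \<alpha> (\<lambda>i. x i + s * v i) = (\<Sum>l\<le>t. c l x * s ^ l)" by (elim exE conjE)
      have "\<exists>r. (\<forall>i<e. pd J t (r i)) \<and>
        (\<forall>x\<in>V. (\<Sum>l\<le>t. (\<lambda>y. c l (y(j := 0))) (z x) * \<tau> x ^ l) = (\<Sum>i<e. r i (z x) * \<tau> x ^ i))"
      proof (rule reduce_powers[where e = e and V = V and \<tau> = \<tau> and d = d and z = z and J = J
            and m = t and t = t and c = "\<lambda>l y. c l (y(j := 0))", OF epos])
        show "\<tau> x ^ e = (\<Sum>l<e. d l (z x) * \<tau> x ^ l)" if "x \<in> V" for x by (rule rel[OF that])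
        show "pd J (t - l) (\<lambda>y. c l (y(j := 0)))" for l by (rule pdJ) (use c(1) in blast)
        show "pd J (e - l) (d l)" for l by (rule d)
      qed simp
      then show ?thesis by (simp add: zupd lin c(2)[rule_format])
    qed
    then have "\<forall>\<alpha>. \<exists>r. \<alpha> \<in> A \<longrightarrow> (\<forall>i<e. pd J t (r i)) \<and>
      (\<forall>x\<in>V. q \<alpha> (linmap I N L x) = (\<Sum>i<e. r i (z x) * \<tau> x ^ i))" by blast
    from choice[OF this] obtain r where r: "\<forall>\<alpha>. \<alpha> \<in> A \<longrightarrow> (\<forall>i<e. pd J t (r \<alpha> i)) \<and>
      (\<forall>x\<in>V. q \<alpha> (linmap I N L x) = (\<Sum>i<e. r \<alpha> i (z x) * \<tau> x ^ i))" by (elim exE)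
    define g where "g = (\<lambda>(\<alpha>, i) x. \<tau> x ^ i * (\<alpha> x :: complex))"
    \<comment> \<open>Different pairs may give the same generator as a function; their coefficients
      are added.\<close>
    define q' where "q' = (\<lambda>\<beta> y. \<Sum>p\<in>{p \<in> A \<times> {..<e}. g p = \<beta>}. r (fst p) (snd p) y)"
    have "pd J t (q' \<beta>)" for \<beta>
      unfolding q'_def using r by (intro pd_sum) auto
    moreover have "f x = (\<Sum>\<beta>\<in>A'. q' \<beta> (z x) * \<beta> x)" if "x \<in> V" for x
    proof -
      have "f x = (\<Sum>\<alpha>\<in>A. (\<Sum>i<e. r \<alpha> i (z x) * \<tau> x ^ i) * \<alpha> x)"
        using q(2) r that by (auto intro!: sum.cong)
      also have "\<dots> = (\<Sum>\<alpha>\<in>A. \<Sum>i<e. r \<alpha> i (z x) * g (\<alpha>, i) x)"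
        unfolding sum_distrib_right by (intro sum.cong refl) (simp add: g_def mult_ac)
      also have "\<dots> = (\<Sum>p\<in>A \<times> {..<e}. r (fst p) (snd p) (z x) * g p x)"
        by (simp add: sum.cartesian_product case_prod_beta)
      also have "\<dots> = (\<Sum>\<beta>\<in>A'. \<Sum>p\<in>{p \<in> A \<times> {..<e}. g p = \<beta>}. r (fst p) (snd p) (z x) * g p x)"
        unfolding A'_def g_def[symmetric] using I(2) by (intro sum.image_gen) auto
      also have "\<dots> = (\<Sum>\<beta>\<in>A'. q' \<beta> (z x) * \<beta> x)"
        unfolding q'_def by (intro sum.cong refl) (auto simp: sum_distrib_right)
      finally show ?thesis .
    qed
    ultimately show ?thesis by (intro exI[of _ q']) simp
  qed
  have "prenoether N V J L' A' K'"
    unfolding prenoether_def z_def[symmetric]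
  proof (intro conjI ballI allI impI)
    show "J \<subseteq> {..<N}" using I by (auto simp: J_def)
    show "finite A'" using I by (simp add: A'_def)
    show "0 \<le> K'" using I(3) C(1) vpos by (simp add: K'_def)
    show "cmod (x k) \<le> K' * (1 + (\<Sum>i\<in>J. cmod (z x i)))" if "x \<in> V" "k < N" for x k
      by (rule growth[OF that])
    show "\<exists>q. (\<forall>\<beta>\<in>A'. pd J t (q \<beta>)) \<and> (\<forall>x\<in>V. f x = (\<Sum>\<beta>\<in>A'. q \<beta> (z x) * \<beta> x))"
      if "pd {..<N} t f" for t f
      by (rule repr[OF that])
  qed
  then have "\<exists>L' A' K'. prenoether N V (I - {j}) L' A' K'" unfolding J_def by (intro exI)
  then show ?thesis using j(1) by (rule bexI)
qed

lemma prenoether_init: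
  "prenoether N V {..<N} (\<lambda>i k. if i = k then 1 else 0) {\<lambda>x. 1} 1"
proof -
  define L :: "nat \<Rightarrow> nat \<Rightarrow> complex" where "L = (\<lambda>i k. if i = k then 1 else 0)"
  have lin: "linmap {..<N} N L x i = x i" if "i < N" for x i
  proof -
    have "linmap {..<N} N L x i = (\<Sum>k<N. if i = k then x k else 0)"
      using that by (simp add: linmap_def L_def if_distrib[of "\<lambda>a. a * _"] cong: if_cong)
    then show ?thesis using that by simp
  qed
  have "cmod (x k) \<le> 1 * (1 + (\<Sum>i<N. cmod (linmap {..<N} N L x i)))" if "k < N" for x k
    using member_le_sum[of k "{..<N}" "\<lambda>i. cmod (x i)"] that by (simp add: lin)
  moreover have "\<exists>q. (\<forall>\<alpha>\<in>{\<lambda>x. 1}. pd {..<N} t (q \<alpha>)) \<and>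
      (\<forall>x\<in>V. f x = (\<Sum>\<alpha>\<in>{\<lambda>x. 1}. q \<alpha> (linmap {..<N} N L x) * \<alpha> x))" if "pd {..<N} t f" for t f
  proof -
    have "f x = f (linmap {..<N} N L x)" for x by (rule pd_cong[OF that]) (simp add: lin)
    then show ?thesis using that by (intro exI[of _ "\<lambda>\<alpha>. f"]) simp
  qed
  ultimately show ?thesis unfolding prenoether_def L_def[symmetric] by simp
qed

lemma prenoether_algind_exists:
  assumes "prenoether N V I L A K" "V \<noteq> {}"
  shows "\<exists>I L A K. prenoether N V I L A K \<and> algind N V I L"
proof -
  have "finite I" using assms(1) finite_subset unfolding prenoether_def by blast
  then show ?thesis using assms(1)
  proof (induction "card I" arbitrary: I L A K rule: less_induct)
    case less
    show ?case
    proof (cases "algind N V I L")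
      case True
      with less.prems(2) have "prenoether N V I L A K \<and> algind N V I L" by simp
      then show ?thesis by (intro exI)
    next
      case False
      from prenoether_step[OF less.prems(2) assms(2) False] obtain j L' A' K'
        where j: "j \<in> I" "prenoether N V (I - {j}) L' A' K'" by blast
      have "card (I - {j}) < card I" by (rule card_Diff1_less[OF less.prems(1) j(1)])
      from less.hyps[OF this _ j(2)] less.prems(1) show ?thesis by simp
    qed
  qed
qed

lemma has_dim_exists: "V \<noteq> {} \<Longrightarrow> \<exists>r. has_dim N V r"
  using prenoether_algind_exists[OF prenoether_init[of N V]] unfolding has_dim_def by blast

section \<open>Growth of function spaces and comparison of dimensions\<close>

definition indep_on :: "(nat \<Rightarrow> complex) set \<Rightarrow> 'a set \<Rightarrow> ('a \<Rightarrow> (nat \<Rightarrow> complex) \<Rightarrow> complex) \<Rightarrow> bool" where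
  "indep_on V S F \<longleftrightarrow> (\<forall>c. (\<forall>x\<in>V. (\<Sum>s\<in>S. c s * F s x) = 0) \<longrightarrow> (\<forall>s\<in>S. c s = 0))"

lemma indep_onD:
  "indep_on V S F \<Longrightarrow> (\<And>x. x \<in> V \<Longrightarrow> (\<Sum>s\<in>S. c s * F s x) = 0) \<Longrightarrow> s \<in> S \<Longrightarrow> c s = 0"
  unfolding indep_on_def by blast

text \<open>An upper bound for the Hilbert function: a function of degree \<open>t\<close> on
  \<open>V\<close> is given by \<open>card A\<close> polynomials in the forms, and each of these by
  its values on a grid of \<open>(t + 1) ^ card I\<close> points.\<close>

lemma indep_card_le:
  assumes pre: "prenoether N V I L A K" and S: "finite S" "\<And>s. s \<in> S \<Longrightarrow> pd {..<N} t (F s)"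
    and ind: "indep_on V S F"
  shows "card S \<le> card A * (t + 1) ^ card I"
proof (rule ccontr)
  assume "\<not> ?thesis"
  then have gt: "card A * (t + 1) ^ card I < card S" by simp
  have I: "finite A" "finite I" using pre finite_subset unfolding prenoether_def by auto
  have "\<forall>s. \<exists>q. s \<in> S \<longrightarrow> (\<forall>\<alpha>\<in>A. pd I t (q \<alpha>)) \<and>
      (\<forall>x\<in>V. F s x = (\<Sum>\<alpha>\<in>A. q \<alpha> (linmap I N L x) * \<alpha> x))"
    using pre S(2) unfolding prenoether_def by blast
  from choice[OF this] obtain q where q: "\<forall>s. s \<in> S \<longrightarrow> (\<forall>\<alpha>\<in>A. pd I t (q s \<alpha>)) \<and>
      (\<forall>x\<in>V. F s x = (\<Sum>\<alpha>\<in>A. q s \<alpha> (linmap I N L x) * \<alpha> x))" by (elim exE)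
  define T where "T = A \<times> PiE I (\<lambda>_. {..t})"
  have "finite T" "card T < card S"
    using I gt by (auto simp: T_def finite_PiE card_cartesian_product card_PiE_const)
  from lin_dep[OF this(1) S(1) this(2), of "\<lambda>s (\<alpha>, p). q s \<alpha> (\<lambda>i. of_nat (p i))"]
  obtain c where c: "\<exists>s\<in>S. c s \<noteq> 0"
    "\<forall>j\<in>T. (\<Sum>s\<in>S. c s * (case j of (\<alpha>, p) \<Rightarrow> q s \<alpha> (\<lambda>i. of_nat (p i)))) = 0"
    by (elim exE conjE)
  have zero: "(\<Sum>s\<in>S. c s * q s \<alpha> y) = 0" if \<alpha>: "\<alpha> \<in> A" for \<alpha> y
  proof (rule pd_grid_zero[OF I(2), where S = "\<lambda>_. of_nat ` {..t}" and e = t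
        and f = "\<lambda>y. \<Sum>s\<in>S. c s * q s \<alpha> y"])
    show "pd I t (\<lambda>y. \<Sum>s\<in>S. c s * q s \<alpha> y)"
      using q \<alpha> by (intro pd_sum pd_cmult) auto
    show "t < card ((of_nat ` {..t}) :: complex set)" by (simp add: card_image inj_on_def)
    fix y :: "nat \<Rightarrow> complex" assume y: "\<And>i. i \<in> I \<Longrightarrow> y i \<in> of_nat ` {..t}"
    then have "\<forall>i. \<exists>m. i \<in> I \<longrightarrow> m \<le> t \<and> y i = of_nat m" by fastforce
    from choice[OF this] obtain m where m: "\<forall>i. i \<in> I \<longrightarrow> m i \<le> t \<and> y i = of_nat (m i)" by (elim exE)
    define p where "p = restrict m I"
    have "(\<alpha>, p) \<in> T" using m \<alpha> by (auto simp: T_def p_def)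
    then have "(\<Sum>s\<in>S. c s * q s \<alpha> (\<lambda>i. of_nat (p i))) = 0" using c(2) by fastforce
    moreover have "q s \<alpha> (\<lambda>i. of_nat (p i)) = q s \<alpha> y" if "s \<in> S" for s
    proof -
      have "pd I t (q s \<alpha>)" using q that \<alpha> by blast
      then show ?thesis by (rule pd_cong) (use m in \<open>simp add: p_def\<close>)
    qed
    ultimately show "(\<Sum>s\<in>S. c s * q s \<alpha> y) = 0" by simp
  qed
  have "(\<Sum>s\<in>S. c s * F s x) = 0" if "x \<in> V" for x
  proof -
    have "(\<Sum>s\<in>S. c s * F s x) = (\<Sum>s\<in>S. c s * (\<Sum>\<alpha>\<in>A. q s \<alpha> (linmap I N L x) * \<alpha> x))"
      using q that by (auto intro!: sum.cong)
    also have "\<dots> = (\<Sum>\<alpha>\<in>A. (\<Sum>s\<in>S. c s * q s \<alpha> (linmap I N L x)) * \<alpha> x)"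
      by (simp add: sum_distrib_left sum_distrib_right mult.assoc sum.swap[of _ A S])
    also have "\<dots> = 0" using zero by simp
    finally show ?thesis .
  qed
  then have "\<forall>s\<in>S. c s = 0" using ind unfolding indep_on_def by blast
  then show False using c(1) by blast
qed

text \<open>Only the exponents matter. The chosen \<open>t\<close> equals the constant
  \<open>M * (a + b + 1) ^ r'\<close>, which is too small against one extra factor
  \<open>t + 1\<close>.\<close>

lemma power_growth_le:
  fixes M a b r r' :: nat
  assumes "\<And>t. (t + 1) ^ r \<le> M * (a * t + b + 1) ^ r'"
  shows "r \<le> r'"
proof (rule ccontr)
  assume "\<not> ?thesis"
  then have r: "r \<ge> r' + 1" by simp
  define t where "t = M * (a + b + 1) ^ r'"
  have "(t + 1) ^ (r' + 1) \<le> (t + 1) ^ r" using r by (intro power_increasing) auto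
  also have "\<dots> \<le> M * (a * t + b + 1) ^ r'" by (rule assms)
  also have "\<dots> \<le> M * ((a + b + 1) * (t + 1)) ^ r'"
    by (intro mult_left_mono power_mono) (auto simp: algebra_simps)
  also have "\<dots> = M * (a + b + 1) ^ r' * (t + 1) ^ r'" by (simp only: power_mult_distrib mult.assoc)
  also have "\<dots> = t * (t + 1) ^ r'" by (simp only: t_def)
  finally show False by simp
qed

text \<open>Dimensions are compared through this growth estimate instead of transcendence
  degrees.\<close>

lemma dim_ge_of_indep:
  assumes "prenoether N V I L A K" "\<And>t. finite (S t)" "\<And>t. (t + 1) ^ r \<le> card (S t)"
    "\<And>t s. s \<in> S t \<Longrightarrow> pd {..<N} (a * t + b) (F t s)" "\<And>t. indep_on V (S t) (F t)"
  shows "r \<le> card I"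
proof (rule power_growth_le)
  fix t
  have "card (S t) \<le> card A * (a * t + b + 1) ^ card I"
    by (rule indep_card_le[OF assms(1), where S = "S t" and F = "F t"]) (use assms in simp_all)
  then show "(t + 1) ^ r \<le> card A * (a * t + b + 1) ^ card I"
    using assms(3)[of t] by linarith
qed

lemma lagr_indep:
  assumes "algind N V I L" "finite I"
  shows "indep_on V (PiE I (\<lambda>_. {..t})) (\<lambda>p x. lagr I t p (linmap I N L x))"
  unfolding indep_on_def
proof (intro allI impI ballI)
  fix c p assume c: "\<forall>x\<in>V. (\<Sum>p\<in>PiE I (\<lambda>_. {..t}). c p * lagr I t p (linmap I N L x)) = 0"
    and p: "p \<in> PiE I (\<lambda>_. {..t})"
  have pd: "pd I (card I * t) (\<lambda>y. \<Sum>p\<in>PiE I (\<lambda>_. {..t}). c p * lagr I t p y)"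
    by (intro pd_sum pd_cmult pd_lagr assms(2))
  have "(\<Sum>p'\<in>PiE I (\<lambda>_. {..t}). c p' * lagr I t p' (\<lambda>i. of_nat (p i))) = 0"
    by (rule algindD[OF assms(1) pd]) (use c in blast)
  moreover have "(\<Sum>p'\<in>PiE I (\<lambda>_. {..t}). c p' * lagr I t p' (\<lambda>i. of_nat (p i))) =
      (\<Sum>p'\<in>PiE I (\<lambda>_. {..t}). if p' = p then c p' else 0)"
    using p assms(2) by (intro sum.cong) (auto simp: lagr_eval)
  ultimately show "c p = 0" using p assms(2) by (simp add: finite_PiE)
qed

lemma pd_lagr_linmap:
  "finite I \<Longrightarrow> p \<in> PiE I (\<lambda>_. {..t}) \<Longrightarrow> pd {..<N} (card I * t) (\<lambda>x. lagr I t p (linmap I N L x))"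
  by (rule pd_comp_linmap[OF pd_lagr])

lemma algind_card_le:
  assumes "prenoether N V I L A K" "algind N V J L'" "finite J"
  shows "card J \<le> card I"
proof (rule dim_ge_of_indep[OF assms(1), where S = "\<lambda>t. PiE J (\<lambda>_. {..t})" and a = "card J" and b = 0
      and F = "\<lambda>t p x. lagr J t p (linmap J N L' x)"])
  fix t :: nat
  show "finite (PiE J (\<lambda>_. {..t}))" using assms(3) by (simp add: finite_PiE)
  show "(t + 1) ^ card J \<le> card (PiE J (\<lambda>_. {..t}))" using assms(3) by (simp add: card_PiE_const)
  show "indep_on V (PiE J (\<lambda>_. {..t})) (\<lambda>p x. lagr J t p (linmap J N L' x))"
    by (rule lagr_indep[OF assms(2,3)])
  show "pd {..<N} (card J * t + 0) (\<lambda>x. lagr J t p (linmap J N L' x))"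
    if "p \<in> PiE J (\<lambda>_. {..t})" for p
    using pd_lagr_linmap[OF assms(3) that] by simp
qed

lemma algind_le_dim:
  assumes "has_dim N V r" "algind N V J L'" "finite J"
  shows "card J \<le> r"
  using assms algind_card_le unfolding has_dim_def by blast

lemma algind_superset: "algind N V I L \<Longrightarrow> V \<subseteq> W \<Longrightarrow> algind N W I L"
  unfolding algind_def by blast

lemma has_dim_mono:
  assumes "has_dim N V r" "has_dim N W r'" "V \<subseteq> W"
  shows "r \<le> r'"
proof -
  obtain I L A K where "prenoether N V I L A K" "algind N V I L" "card I = r"
    using assms(1) unfolding has_dim_def by blast
  then show ?thesis
    using algind_le_dim[OF assms(2) algind_superset[OF _ assms(3)], of I L] finite_subset
    unfolding prenoether_def by blast
qed

lemma has_dim_le: "has_dim N V r \<Longrightarrow> r \<le> N"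
  unfolding has_dim_def prenoether_def
  by (metis card_lessThan card_mono finite_lessThan)

text \<open>A function \<open>g\<close> that vanishes on \<open>V\<close> but not on all of
  \<open>W\<close> supplies one more free parameter: its powers are independent over the Lagrange
  functions of \<open>V\<close>.\<close>

lemma has_dim_strict:
  assumes V: "alg_set N V" and W: "irred_alg_set N W" and sub: "V \<subset> W"
    and dV: "has_dim N V r" and dW: "has_dim N W r'"
  shows "r < r'"
proof -
  obtain I L A K where I: "prenoether N V I L A K" "algind N V I L" "card I = r"
    using dV unfolding has_dim_def by blast
  have finI: "finite I" using I(1) finite_subset unfolding prenoether_def by blast
  obtain I' L' A' K' where I': "prenoether N W I' L' A' K'" "card I' = r'"
    using dW unfolding has_dim_def by blast
  obtain p where p: "p \<in> W" "p \<notin> V" using sub by blast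
  have "p \<in> aff_space N" using p(1) irred_alg_set_aff[OF W] by blast
  from alg_set_separate[OF V this p(2)] obtain g where
    g: "poly_fun N g" "\<forall>x\<in>V. g x = 0" "g p \<noteq> 0" by (elim exE conjE)
  obtain e where e: "pd {..<N} e g" using g(1) poly_fun_iff by blast
  define E where "E = (\<lambda>(t::nat) c (j::nat) x. \<Sum>p\<in>PiE I (\<lambda>_. {..t}). c (j, p) * lagr I t p (linmap I N L x))"
  have "r + 1 \<le> card I'"
  proof (rule dim_ge_of_indep[OF I'(1), where S = "\<lambda>t. {..t} \<times> PiE I (\<lambda>_. {..t})"
        and a = "e + r" and b = 0 and F = "\<lambda>t (j, p) x. g x ^ j * lagr I t p (linmap I N L x)"])
    fix t :: nat
    show "finite ({..t} \<times> PiE I (\<lambda>_. {..t}))" using finI by (simp add: finite_PiE)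
    show "(t + 1) ^ (r + 1) \<le> card ({..t} \<times> PiE I (\<lambda>_. {..t}))"
      using finI I(3) by (simp add: card_cartesian_product card_PiE_const)
    show "pd {..<N} ((e + r) * t + 0) ((\<lambda>(j, p) x. g x ^ j * lagr I t p (linmap I N L x)) s)"
      if "s \<in> {..t} \<times> PiE I (\<lambda>_. {..t})" for s
    proof -
      obtain j p where s: "s = (j, p)" by (cases s)
      have "pd {..<N} (j * e) (\<lambda>x. g x ^ j)" by (rule pd_power[OF e])
      moreover have "pd {..<N} (r * t) (\<lambda>x. lagr I t p (linmap I N L x))"
        using pd_lagr_linmap[OF finI, of p t N L] that s I(3) by simp
      moreover have "j * e + r * t \<le> (e + r) * t"
        using that s by (simp add: algebra_simps)
      ultimately show ?thesis using s by (simp add: pd_mult_le)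
    qed
    show "indep_on W ({..t} \<times> PiE I (\<lambda>_. {..t})) (\<lambda>(j, p) x. g x ^ j * lagr I t p (linmap I N L x))"
      unfolding indep_on_def
    proof (intro allI impI)
      fix c assume c0: "\<forall>x\<in>W. (\<Sum>s\<in>{..t} \<times> PiE I (\<lambda>_. {..t}). c s *
        (case s of (j, p) \<Rightarrow> \<lambda>x. g x ^ j * lagr I t p (linmap I N L x)) x) = 0"
      have c: "(\<Sum>j\<le>t. g x ^ j * E t c j x) = 0" if "x \<in> W" for x
      proof -
        have "(\<Sum>j\<le>t. g x ^ j * E t c j x) =
            (\<Sum>j\<le>t. \<Sum>p\<in>PiE I (\<lambda>_. {..t}). c (j, p) * (g x ^ j * lagr I t p (linmap I N L x)))"
          unfolding E_def sum_distrib_left by (intro sum.cong refl) (simp add: mult_ac)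
        also have "\<dots> = (\<Sum>s\<in>{..t} \<times> PiE I (\<lambda>_. {..t}). c s *
            (case s of (j, p) \<Rightarrow> \<lambda>x. g x ^ j * lagr I t p (linmap I N L x)) x)"
          unfolding sum.cartesian_product by (intro sum.cong refl) auto
        finally show ?thesis using c0 that by simp
      qed
      have polyE: "poly_fun N (E t c j)" for j
        unfolding E_def
        by (rule poly_fun_sum, rule pf_mult, rule pf_const, rule poly_fun_pd, rule pd_lagr_linmap[OF finI])
      \<comment> \<open>The coefficients are killed in the order of the powers of \<open>g\<close>:
        on the irreducible \<open>W\<close> the common factor \<open>g ^ n\<close> can be cancelled,
        and restricting to \<open>V\<close> then leaves only the term \<open>j = n\<close>.\<close>
      have "\<forall>j<n. \<forall>p\<in>PiE I (\<lambda>_. {..t}). c (j, p) = 0" if "n \<le> t + 1" for n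
        using that
      proof (induction n)
        case (Suc n)
        then have IH: "\<forall>j<n. \<forall>p\<in>PiE I (\<lambda>_. {..t}). c (j, p) = 0" and n: "n \<le> t" by auto
        define R where "R = (\<lambda>x. \<Sum>j\<in>{n..t}. g x ^ (j - n) * E t c j x)"
        have polyR: "poly_fun N R" unfolding R_def
          by (intro poly_fun_sum pf_mult poly_fun_power g(1) polyE)
        have "g x ^ n * R x = 0" if "x \<in> W" for x
        proof -
          have "(\<Sum>j\<le>t. g x ^ j * E t c j x) = (\<Sum>j\<in>{n..t}. g x ^ j * E t c j x)"
            using IH by (intro sum.mono_neutral_right) (auto simp: E_def not_le)
          also have "\<dots> = (\<Sum>j\<in>{n..t}. g x ^ n * (g x ^ (j - n) * E t c j x))"
            by (intro sum.cong refl) (simp add: mult.assoc[symmetric] power_add[symmetric])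
          finally show ?thesis using c[OF that] by (simp add: R_def sum_distrib_left)
        qed
        from irred_mult_zero[OF W poly_fun_power[OF g(1)] polyR this]
        have "\<forall>x\<in>W. R x = 0" using p(1) g(3) by auto
        moreover have "R x = E t c n x" if "x \<in> V" for x
        proof -
          have "R x = (\<Sum>j\<in>{n..t}. if j = n then E t c n x else 0)"
            unfolding R_def using g(2) that by (intro sum.cong) auto
          then show ?thesis using n by simp
        qed
        ultimately have "E t c n x = 0" if "x \<in> V" for x
          using that psubsetD[OF sub that] by metis
        then have zero: "(\<Sum>p\<in>PiE I (\<lambda>_. {..t}). c (n, p) * lagr I t p (linmap I N L x)) = 0"
          if "x \<in> V" for x
          using that unfolding E_def by blast
        have "c (n, p) = 0" if "p \<in> PiE I (\<lambda>_. {..t})" for p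
          using indep_onD[OF lagr_indep[OF I(2) finI, of t], of "\<lambda>p. c (n, p)" p, OF zero that] .
        then show ?case using IH by (auto simp: less_Suc_eq)
      qed simp
      from this[of "t + 1"] show "\<forall>s\<in>{..t} \<times> PiE I (\<lambda>_. {..t}). c s = 0" by auto
    qed
  qed
  then show ?thesis using I'(2) by simp
qed

section \<open>Division, limits and interpolation\<close>

definition rp :: "nat set \<Rightarrow> ((nat \<Rightarrow> complex) \<Rightarrow> complex) \<Rightarrow> bool" where
  "rp I q \<longleftrightarrow> (\<exists>e. pd I e q)"

lemma rpE:
  assumes "rp I q"
  obtains e where "pd I e q"
  using assms unfolding rp_def by (elim exE)

lemma rpI: "pd I e q \<Longrightarrow> rp I q"
  unfolding rp_def by (rule exI)

lemma rp_const [simp, intro]: "rp I (\<lambda>y. c)"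
  by (rule rpI[OF pd_const])

lemma rp_var: "i \<in> I \<Longrightarrow> rp I (\<lambda>y. y i)"
  by (rule rpI[OF pd_var1])

lemma rp_add:
  assumes "rp I p" "rp I q"
  shows "rp I (\<lambda>y. p y + q y)"
proof -
  obtain a where a: "pd I a p" using assms(1) by (rule rpE)
  obtain b where b: "pd I b q" using assms(2) by (rule rpE)
  have "pd I (max a b) p" "pd I (max a b) q" by (rule pd_mono[OF a], simp, rule pd_mono[OF b], simp)
  then show ?thesis by (rule rpI[OF pd_add])
qed

lemma rp_mult:
  assumes "rp I p" "rp I q"
  shows "rp I (\<lambda>y. p y * q y)"
proof -
  obtain a where a: "pd I a p" using assms(1) by (rule rpE)
  obtain b where b: "pd I b q" using assms(2) by (rule rpE)
  show ?thesis by (rule rpI[OF pd_mult[OF a b]])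
qed

lemma rp_uminus: "rp I p \<Longrightarrow> rp I (\<lambda>y. - p y)"
  using rp_mult[OF rp_const[of I "-1"], of p] by simp

lemma rp_diff: "rp I p \<Longrightarrow> rp I q \<Longrightarrow> rp I (\<lambda>y. p y - q y)"
  using rp_add[OF _ rp_uminus, of I p q] by simp

lemma rp_sum: "(\<And>s. s \<in> S \<Longrightarrow> rp I (f s)) \<Longrightarrow> rp I (\<lambda>y. \<Sum>s\<in>S. f s y)"
proof (induction S rule: infinite_finite_induct)
  case (insert s S)
  then have "rp I (\<lambda>y. f s y + (\<Sum>s\<in>S. f s y))" by (intro rp_add) auto
  then show ?case using insert.hyps by simp
qed auto

lemma rp_prod: "(\<And>s. s \<in> S \<Longrightarrow> rp I (f s)) \<Longrightarrow> rp I (\<lambda>y. \<Prod>s\<in>S. f s y)"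
proof (induction S rule: infinite_finite_induct)
  case (insert s S)
  then have "rp I (\<lambda>y. f s y * (\<Prod>s\<in>S. f s y))" by (intro rp_mult) auto
  then show ?case using insert.hyps by simp
qed auto

lemma rp_power: "rp I f \<Longrightarrow> rp I (\<lambda>y. f y ^ n)"
  using rp_prod[of "{..<n}" I "\<lambda>_. f"] by simp

lemma rp_subset: "rp I f \<Longrightarrow> I \<subseteq> J \<Longrightarrow> rp J f"
  by (erule rpE, rule rpI, rule pd_subset)

lemma rp_cong: "rp I f \<Longrightarrow> (\<And>i. i \<in> I \<Longrightarrow> x i = y i) \<Longrightarrow> f x = f y"
  by (erule rpE, rule pd_cong)

lemma rp_fun_upd: "rp I f \<Longrightarrow> rp (I - {i}) (\<lambda>y. f (y(i := c)))"
  by (erule rpE, rule rpI, rule pd_fun_upd)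

lemma rp_prod_nonzero:
  assumes "finite S" "\<And>s. s \<in> S \<Longrightarrow> rp I (f s)" "\<And>s. s \<in> S \<Longrightarrow> \<exists>x. f s x \<noteq> 0"
  shows "\<exists>x. \<forall>s\<in>S. f s x \<noteq> 0"
proof -
  have "\<forall>s. \<exists>e. s \<in> S \<longrightarrow> pd I e (f s)" using assms(2) unfolding rp_def by auto
  from choice[OF this] obtain e where "\<forall>s. s \<in> S \<longrightarrow> pd I (e s) (f s)" by (elim exE)
  then show ?thesis using assms by (intro pd_prod_nonzero[where e = e]) auto
qed

lemma rp_mult_nonzero:
  assumes "rp I f" "rp I g" "f x \<noteq> 0" "g y \<noteq> 0"
  shows "\<exists>z. f z * g z \<noteq> 0"
proof -
  obtain a where a: "pd I a f" using assms(1) by (rule rpE)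
  obtain b where b: "pd I b g" using assms(2) by (rule rpE)
  from pd_mult_nonzero[OF a b assms(3,4)] show ?thesis by auto
qed

lemma rp_line_zeros_finite:
  assumes "rp I f" "f (\<lambda>i. x i + s * v i) \<noteq> 0"
  shows "finite {t. f (\<lambda>i. x i + t * v i) = 0}"
proof -
  obtain e where e: "pd I e f" using assms(1) by (rule rpE)
  show ?thesis by (rule pd_line_zeros_finite[where f = f and x = x and s = s and v = v, OF e assms(2)])
qed

lemma rp_upd_zeros_finite:
  assumes "rp I f" "f y \<noteq> 0"
  shows "finite {t. f (y(i := t)) = 0}"
proof -
  obtain e where "pd I e f" using assms(1) by (rule rpE)
  from pd_line_upd[OF this, of y i] obtain p where p: "\<forall>t. f (y(i := t)) = poly p t" by (elim exE conjE)
  have "poly p (y i) \<noteq> 0" using p[rule_format, of "y i"] assms(2) by simp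
  then have "p \<noteq> 0" by auto
  then show ?thesis using poly_roots_finite[of p] p by simp
qed

lemma rp_line_poly: "rp I f \<Longrightarrow> \<exists>p. \<forall>t. f (y(i := t)) = poly p t"
  by (erule rpE, drule pd_line_upd[of _ _ _ y i], elim exE conjE, rule exI)

lemma eventually_notin_finite: "finite S \<Longrightarrow> eventually (\<lambda>t. t \<notin> S) (at (a :: complex))"
proof -
  assume "finite S"
  then have "open (- (S - {a}))" by (intro open_Compl finite_imp_closed) auto
  then show ?thesis unfolding eventually_at_topological by (intro exI[of _ "- (S - {a})"]) auto
qed

text \<open>On the line from \<open>y\<close> towards \<open>y1\<close> the function
  \<open>h\<close> has finitely many zeros, so the estimate passes to \<open>y\<close> in the
  limit.\<close>

lemma rp_bound_extend:
  assumes P: "rp I P" and Q: "rp I Q" and h: "rp I h" "h y1 \<noteq> 0" and I: "finite I"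
    and bd: "\<And>y. h y \<noteq> 0 \<Longrightarrow> cmod (P y) \<le> C * cmod (Q y) * (1 + (\<Sum>i\<in>I. cmod (y i))) ^ m"
  shows "cmod (P y) \<le> C * cmod (Q y) * (1 + (\<Sum>i\<in>I. cmod (y i))) ^ m"
proof -
  define l where "l = (\<lambda>t i. y i + t * (y1 i - y i))"
  have "finite {t. h (l t) = 0}" unfolding l_def
    by (rule rp_line_zeros_finite[where f = h and x = y and s = 1 and v = "\<lambda>i. y1 i - y i", OF h(1)])
      (use h(2) in simp)
  from eventually_notin_finite[OF this, of 0]
  have ev: "eventually (\<lambda>t. cmod (P (l t)) \<le> C * cmod (Q (l t)) * (1 + (\<Sum>i\<in>I. cmod (l t i))) ^ m) (at 0)"
    by (rule eventually_mono) (use bd in simp)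
  have lim: "((\<lambda>t. l t i) \<longlongrightarrow> y i) (at 0)" for i
  proof -
    have "((\<lambda>t. y i + t * (y1 i - y i)) \<longlongrightarrow> y i + 0 * (y1 i - y i)) (at 0)"
      by (intro tendsto_intros)
    then show ?thesis by (simp add: l_def)
  qed
  obtain a where a: "pd I a P" using P by (rule rpE)
  obtain b where b: "pd I b Q" using Q by (rule rpE)
  have "((\<lambda>t. cmod (P (l t))) \<longlongrightarrow> cmod (P y)) (at 0)"
    by (intro tendsto_norm pd_tendsto[OF a] lim)
  moreover have "((\<lambda>t. C * cmod (Q (l t)) * (1 + (\<Sum>i\<in>I. cmod (l t i))) ^ m) \<longlongrightarrow>
      C * cmod (Q y) * (1 + (\<Sum>i\<in>I. cmod (y i))) ^ m) (at 0)"
    by (intro tendsto_mult tendsto_const tendsto_norm pd_tendsto[OF b] lim tendsto_power tendsto_add tendsto_sum)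
  ultimately show ?thesis using ev by (intro tendsto_le[OF _ _ _ ev]) auto
qed

lemma poly_root_factor:
  fixes p :: "'a :: comm_ring_1 poly"
  assumes "poly p z = 0"
  shows "\<exists>u. p = [:-z, 1:] * u"
proof -
  have "[:-z, 1:] dvd p" using assms by (simp only: poly_eq_0_iff_dvd)
  then show ?thesis unfolding dvd_def .
qed

lemma poly_linear_mult: "poly ([:-z, 1:] * p) t = (t - z) * poly p t"
  for z :: "'a :: comm_ring_1"
  by (simp add: algebra_simps)

text \<open>Linear factors of \<open>Q\<close> are removed one at a time: a root of \<open>Q\<close>
  is a root of \<open>P\<close>, and continuity of \<open>g\<close> restores the estimate at the
  cancelled point.\<close>

lemma poly_dvd_of_bound:
  fixes P Q :: "complex poly"
  assumes "Q \<noteq> 0" "\<And>t. cmod (poly P t) \<le> cmod (poly Q t) * g t" "continuous_on UNIV g"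
  shows "Q dvd P"
  using assms
proof (induction "degree Q" arbitrary: P Q rule: less_induct)
  case less
  show ?case
  proof (cases "degree Q = 0")
    case True
    then obtain c where "Q = [:c:]" by (auto elim: degree_eq_zeroE)
    then show ?thesis using less.prems(1) by (simp add: const_poly_dvd_iff dvd_field_iff)
  next
    case False
    then have "\<not> constant (poly Q)" by (simp add: constant_degree)
    then obtain z where z: "poly Q z = 0" using fundamental_theorem_of_algebra by blast
    from poly_root_factor[OF z] obtain Q1 where Q1: "Q = [:-z, 1:] * Q1" by (elim exE)
    have "poly P z = 0" using less.prems(2)[of z] z by simp
    from poly_root_factor[OF this] obtain P1 where P1: "P = [:-z, 1:] * P1" by (elim exE)
    have "Q1 \<noteq> 0" using Q1 less.prems(1) by auto
    then have deg: "degree Q = Suc (degree Q1)" unfolding Q1 by (subst degree_mult_eq) auto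
    have bd: "cmod (poly P1 t) \<le> cmod (poly Q1 t) * g t" if "t \<noteq> z" for t
    proof -
      have "cmod (t - z) * cmod (poly P1 t) \<le> cmod (t - z) * (cmod (poly Q1 t) * g t)"
        using less.prems(2)[of t] unfolding P1 Q1 poly_linear_mult norm_mult by (simp add: mult.assoc)
      then show ?thesis using that by (simp add: mult_le_cancel_left)
    qed
    have bdz: "cmod (poly P1 z) \<le> cmod (poly Q1 z) * g z"
    proof (rule tendsto_le)
      show "((\<lambda>t. cmod (poly P1 t)) \<longlongrightarrow> cmod (poly P1 z)) (at z)"
        by (intro tendsto_norm tendsto_poly tendsto_ident_at)
      have "(g \<longlongrightarrow> g z) (at z)" using less.prems(3) by (simp add: continuous_on_def)
      then show "((\<lambda>t. cmod (poly Q1 t) * g t) \<longlongrightarrow> cmod (poly Q1 z) * g z) (at z)"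
        by (intro tendsto_mult tendsto_norm tendsto_poly tendsto_ident_at)
      show "eventually (\<lambda>t. cmod (poly P1 t) \<le> cmod (poly Q1 t) * g t) (at z)"
        using bd by (auto simp: eventually_at_filter)
    qed simp
    have "Q1 dvd P1"
      using less.hyps[of Q1 P1] deg \<open>Q1 \<noteq> 0\<close> bd bdz less.prems(3) by (metis lessI)
    then show ?thesis unfolding P1 Q1 by (rule mult_dvd_mono[OF dvd_refl])
  qed
qed

text \<open>Reflection moves infinity to 0, where the bound forces the leading coefficient to vanish
  if the degree exceeds \<open>m\<close>.\<close>

lemma poly_degree_of_bound:
  fixes p :: "complex poly"
  assumes "\<And>t. cmod (poly p t) \<le> C * (1 + cmod t) ^ m"
  shows "degree p \<le> m"
proof (rule ccontr)
  assume "\<not> ?thesis"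
  then have n: "degree p > m" by simp
  define n where "n = degree p"
  have bd: "cmod (poly (reflect_poly p) x) \<le> C * (cmod x ^ (n - m) * (1 + cmod x) ^ m)" if "x \<noteq> 0" for x
  proof -
    have "cmod (poly (reflect_poly p) x) = cmod x ^ n * cmod (poly p (inverse x))"
      using poly_reflect_poly_nz[OF that, of p] by (simp add: n_def norm_mult norm_power)
    also have "\<dots> \<le> cmod x ^ n * (C * (1 + cmod (inverse x)) ^ m)"
      by (intro mult_left_mono assms) auto
    also have "cmod x ^ n = cmod x ^ (n - m) * cmod x ^ m"
      using n by (simp add: n_def power_add[symmetric])
    also have "cmod x ^ (n - m) * cmod x ^ m * (C * (1 + cmod (inverse x)) ^ m) =
        C * (cmod x ^ (n - m) * (cmod x * (1 + cmod (inverse x))) ^ m)"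
      by (simp add: power_mult_distrib)
    also have "cmod x * (1 + cmod (inverse x)) = 1 + cmod x"
      using that by (simp add: norm_inverse distrib_left)
    finally show ?thesis .
  qed
  have "cmod (poly (reflect_poly p) 0) \<le> C * (cmod 0 ^ (n - m) * (1 + cmod 0) ^ m)"
  proof (rule tendsto_le)
    show "((\<lambda>x. cmod (poly (reflect_poly p) x)) \<longlongrightarrow> cmod (poly (reflect_poly p) 0)) (at 0)"
      by (intro tendsto_norm tendsto_poly tendsto_ident_at)
    show "((\<lambda>x. C * (cmod x ^ (n - m) * (1 + cmod x) ^ m)) \<longlongrightarrow>
        C * (cmod 0 ^ (n - m) * (1 + cmod (0::complex)) ^ m)) (at 0)"
      by (intro tendsto_intros)
    show "eventually (\<lambda>x. cmod (poly (reflect_poly p) x) \<le> C * (cmod x ^ (n - m) * (1 + cmod x) ^ m)) (at 0)"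
      using bd by (auto simp: eventually_at_filter)
  qed simp
  moreover have "(0::real) ^ (n - m) = 0" using n by (simp add: n_def)
  ultimately have "cmod (lead_coeff p) \<le> 0" by simp
  then have "p = 0" by simp
  then show False using n by simp
qed

lemma poly_interpolation:
  fixes \<alpha> :: "complex poly"
  assumes "finite B" "degree \<alpha> < card B"
  shows "poly \<alpha> t = (\<Sum>b\<in>B. poly \<alpha> b * (\<Prod>c\<in>B - {b}. (t - c) / (b - c)))"
proof -
  define l where "l = (\<lambda>b. \<Prod>c\<in>B - {b}. smult (inverse (b - c)) [:-c, 1:])"
  have l: "poly (l b) t = (\<Prod>c\<in>B - {b}. (t - c) / (b - c))" for b t
    unfolding l_def poly_prod by (intro prod.cong refl) (simp add: divide_inverse algebra_simps)
  define \<beta> where "\<beta> = \<alpha> - (\<Sum>b\<in>B. smult (poly \<alpha> b) (l b))"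
  have dl: "degree (l b) \<le> card B - 1" if "b \<in> B" for b
  proof -
    have "degree (l b) \<le> sum (degree \<circ> (\<lambda>c. smult (inverse (b - c)) [:-c, 1:])) (B - {b})"
      unfolding l_def by (rule degree_prod_sum_le) (use assms(1) in auto)
    also have "\<dots> \<le> sum (\<lambda>_. 1) (B - {b})"
      by (intro sum_mono) simp
    finally show ?thesis using assms(1) that by simp
  qed
  have Bpos: "card B > 0" using assms(2) by simp
  have "degree \<beta> \<le> card B - 1" unfolding \<beta>_def
  proof (intro degree_diff_le degree_sum_le assms(1))
    show "degree \<alpha> \<le> card B - 1" using assms(2) by simp
    fix b assume "b \<in> B"
    then show "degree (smult (poly \<alpha> b) (l b)) \<le> card B - 1"
      using dl[of b] degree_smult_le[of "poly \<alpha> b" "l b"] by linarith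
  qed
  moreover have root: "poly \<beta> b = 0" if "b \<in> B" for b
  proof -
    have "poly (l b') b = (if b' = b then 1 else 0)" if "b' \<in> B" for b'
      using that \<open>b \<in> B\<close> assms(1) by (auto simp: l intro!: prod.neutral prod_zero)
    then have "(\<Sum>b'\<in>B. poly \<alpha> b' * poly (l b') b) = (\<Sum>b'\<in>B. if b' = b then poly \<alpha> b' else 0)"
      by (intro sum.cong) auto
    then show ?thesis using that assms(1) by (simp add: \<beta>_def poly_sum)
  qed
  ultimately have dg: "degree \<beta> \<le> card B - 1" and root: "\<And>b. b \<in> B \<Longrightarrow> poly \<beta> b = 0" by simp_all
  have "\<beta> = 0"
  proof (rule ccontr)
    assume "\<beta> \<noteq> 0"
    then have "card B \<le> card {t. poly \<beta> t = 0}"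
      using root by (intro card_mono poly_roots_finite) auto
    also have "\<dots> \<le> degree \<beta>" by (rule card_poly_roots_bound[OF \<open>\<beta> \<noteq> 0\<close>])
    finally show False using dg Bpos by simp
  qed
  then have "poly \<alpha> t = poly (\<Sum>b\<in>B. smult (poly \<alpha> b) (l b)) t" by (simp add: \<beta>_def)
  then show ?thesis by (simp add: poly_sum l)
qed

text \<open>A quotient of polynomials of at most polynomial growth is a polynomial: it is so on every
  line, and interpolation on \<open>deg P + 1\<close> parallel hyperplanes recovers it.\<close>
lemma rp_div_of_bound:
  assumes "finite I" "rp I P" "rp I Q" "Q y0 \<noteq> 0"
    "\<And>y. cmod (P y) \<le> C * cmod (Q y) * (1 + (\<Sum>i\<in>I. cmod (y i))) ^ m"
  shows "\<exists>a. rp I a \<and> (\<forall>y. P y = Q y * a y)"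
  using assms
proof (induction I arbitrary: P Q y0 C rule: finite_induct)
  case empty
  have "P y = Q y * (P y0 / Q y0)" for y
    using rp_cong[OF empty.prems(1), of y y0] rp_cong[OF empty.prems(2), of y y0] empty.prems(3) by simp
  then show ?case by (intro exI[of _ "\<lambda>y. P y0 / Q y0"] conjI allI rp_const)
next
  case (insert i I)
  obtain e where e: "pd (insert i I) e P" using insert.prems(1) by (rule rpE)
  have II: "insert i I - {i} = I" using insert.hyps by auto
  have "infinite (UNIV - {t. Q (y0(i := t)) = 0})"
    by (rule Diff_infinite_finite[OF rp_upd_zeros_finite[OF insert.prems(2,3)] infinite_UNIV_char_0])
  \<comment> \<open>\<open>Suc e\<close> hyperplanes on which \<open>Q\<close> is not identically
    zero: along direction \<open>i\<close> the quotient has degree at most \<open>e\<close>, so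
    these values determine it.\<close>
  from infinite_arbitrarily_large[OF this, of "Suc e"] obtain B
    where B: "finite B" "card B = Suc e" "B \<subseteq> UNIV - {t. Q (y0(i := t)) = 0}" by blast
  have "\<exists>a. rp I a \<and> (\<forall>y. P (y(i := b)) = Q (y(i := b)) * a y)" if b: "b \<in> B" for b
  proof (rule insert.IH[where C = "\<bar>C\<bar> * (1 + cmod b) ^ m"])
    show "rp I (\<lambda>y. P (y(i := b)))" "rp I (\<lambda>y. Q (y(i := b)))"
      by (rule rp_fun_upd[OF insert.prems(1), of i b, unfolded II],
        rule rp_fun_upd[OF insert.prems(2), of i b, unfolded II])
    show "Q (y0(i := b)) \<noteq> 0" using b B(3) by auto
    fix y
    have s: "0 \<le> (\<Sum>j\<in>I. cmod (y j))" by (intro sum_nonneg) auto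
    have "(\<Sum>j\<in>insert i I. cmod ((y(i := b)) j)) = cmod b + (\<Sum>j\<in>I. cmod (y j))"
    proof -
      have "(\<Sum>j\<in>I. cmod ((y(i := b)) j)) = (\<Sum>j\<in>I. cmod (y j))"
        using insert.hyps(2) by (intro sum.cong) auto
      then show ?thesis using insert.hyps by simp
    qed
    then have "cmod (P (y(i := b))) \<le> C * cmod (Q (y(i := b))) * (1 + (cmod b + (\<Sum>j\<in>I. cmod (y j)))) ^ m"
      using insert.prems(4)[of "y(i := b)"] by (simp only:)
    also have "\<dots> \<le> \<bar>C\<bar> * cmod (Q (y(i := b))) * ((1 + cmod b) * (1 + (\<Sum>j\<in>I. cmod (y j)))) ^ m"
    proof (intro mult_mono power_mono)
      show "1 + (cmod b + (\<Sum>j\<in>I. cmod (y j))) \<le> (1 + cmod b) * (1 + (\<Sum>j\<in>I. cmod (y j)))"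
        using s by (simp add: algebra_simps)
    qed (use s in auto)
    finally show "cmod (P (y(i := b))) \<le> \<bar>C\<bar> * (1 + cmod b) ^ m * cmod (Q (y(i := b))) * (1 + (\<Sum>j\<in>I. cmod (y j))) ^ m"
      by (simp add: power_mult_distrib mult_ac)
  qed
  then have "\<forall>b. \<exists>a. b \<in> B \<longrightarrow> rp I a \<and> (\<forall>y. P (y(i := b)) = Q (y(i := b)) * a y)" by blast
  from choice[OF this] obtain a where a: "\<forall>b. b \<in> B \<longrightarrow> rp I (a b) \<and>
    (\<forall>y. P (y(i := b)) = Q (y(i := b)) * a b y)" by (elim exE)
  define A where "A = (\<lambda>y. \<Sum>b\<in>B. a b y * (\<Prod>c\<in>B - {b}. (y i - c) / (b - c)))"
  have rpA: "rp (insert i I) A" unfolding A_def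
  proof (intro rp_sum rp_mult rp_prod)
    fix b assume "b \<in> B"
    then show "rp (insert i I) (a b)" using a rp_subset[of I "a b" "insert i I"] by auto
    fix c
    show "rp (insert i I) (\<lambda>y. (y i - c) / (b - c))"
      unfolding divide_inverse by (intro rp_mult rp_diff rp_var rp_const) simp
  qed
  have eq: "P y = Q y * A y" if nz: "\<forall>b\<in>B. Q (y(i := b)) \<noteq> 0" for y
  proof -
    from pd_line_upd[OF e, of y i] obtain p where p: "degree p \<le> e" "\<forall>t. P (y(i := t)) = poly p t"
      by (elim exE conjE)
    from rp_line_poly[OF insert.prems(2), of y i] obtain q where q: "\<forall>t. Q (y(i := t)) = poly q t"
      by (elim exE)
    obtain b0 where "b0 \<in> B" using B(2) by fastforce
    then have "poly q b0 \<noteq> 0" using nz q by auto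
    then have "q \<noteq> 0" by auto
    define g where "g = (\<lambda>t. C * (1 + (cmod t + (\<Sum>j\<in>I. cmod (y j)))) ^ m)"
    have "q dvd p"
    proof (rule poly_dvd_of_bound[OF \<open>q \<noteq> 0\<close>, where g = g])
      fix t
      have "(\<Sum>j\<in>I. cmod ((y(i := t)) j)) = (\<Sum>j\<in>I. cmod (y j))"
        using insert.hyps(2) by (intro sum.cong) auto
      then have "(\<Sum>j\<in>insert i I. cmod ((y(i := t)) j)) = cmod t + (\<Sum>j\<in>I. cmod (y j))"
        using insert.hyps by simp
      then show "cmod (poly p t) \<le> cmod (poly q t) * g t"
        using insert.prems(4)[of "y(i := t)"] unfolding p(2)[rule_format] q[rule_format] g_def
        by (simp add: mult_ac)
      show "continuous_on UNIV g" unfolding g_def by (intro continuous_intros)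
    qed
    then obtain \<alpha> where \<alpha>: "p = q * \<alpha>" by (auto simp: dvd_def)
    have "degree \<alpha> < card B"
    proof (cases "\<alpha> = 0")
      case False
      then have "degree p = degree q + degree \<alpha>" using \<open>q \<noteq> 0\<close> \<alpha> by (simp add: degree_mult_eq)
      then show ?thesis using p(1) B(2) by simp
    qed (use B(2) in simp)
    from poly_interpolation[OF B(1) this, of "y i"]
    have "poly \<alpha> (y i) = (\<Sum>b\<in>B. poly \<alpha> b * (\<Prod>c\<in>B - {b}. (y i - c) / (b - c)))" .
    also have "\<dots> = A y" unfolding A_def
    proof (intro sum.cong refl arg_cong2[where f = "(*)"])
      fix b assume b: "b \<in> B"
      have "poly q b * poly \<alpha> b = poly q b * a b y"
        using a b p(2)[rule_format, of b] q[rule_format, of b] \<alpha> by auto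
      moreover have "poly q b \<noteq> 0" using nz b q by auto
      ultimately show "poly \<alpha> b = a b y" by simp
    qed
    finally have "poly \<alpha> (y i) = A y" .
    then show ?thesis using p(2)[rule_format, of "y i"] q[rule_format, of "y i"] \<alpha> by simp
  qed
  \<comment> \<open>So far the identity holds where no \<open>Q (y(i := b))\<close> vanishes. The
    difference of both sides times the product of these values is zero everywhere, hence so is the
    difference.\<close>
  have "P y = Q y * A y" for y
  proof (rule ccontr)
    assume ne: "P y \<noteq> Q y * A y"
    have r1: "rp (insert i I) (\<lambda>y. P y - Q y * A y)"
      by (intro rp_diff rp_mult insert.prems rpA)
    have r2: "rp (insert i I) (\<lambda>y. \<Prod>b\<in>B. Q (y(i := b)))"
    proof (rule rp_prod)
      fix b
      have "rp I (\<lambda>y. Q (y(i := b)))" by (rule rp_fun_upd[OF insert.prems(2), of i b, unfolded II])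
      then show "rp (insert i I) (\<lambda>y. Q (y(i := b)))" by (rule rp_subset) auto
    qed
    have "(\<Prod>b\<in>B. Q (y0(i := b))) \<noteq> 0" using B by auto
    moreover have "P y - Q y * A y \<noteq> 0" using ne by simp
    ultimately obtain z where "(P z - Q z * A z) * (\<Prod>b\<in>B. Q (z(i := b))) \<noteq> 0"
      using rp_mult_nonzero[OF r1 r2] by blast
    then show False using eq[of z] B(1) by auto
  qed
  then show ?case using rpA by (intro exI[of _ A]) simp
qed

text \<open>Vieta's formulas, by splitting off one root at a time; \<open>2 ^ degree g\<close>
  absorbs the binomial coefficients.\<close>

lemma poly_coeff_root_bound:
  fixes g :: "complex poly"
  assumes "\<And>z. poly g z = 0 \<Longrightarrow> cmod z \<le> R" "R \<ge> 0" "l \<le> degree g"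
  shows "cmod (coeff g l) \<le> cmod (lead_coeff g) * (2 ^ degree g * R ^ (degree g - l))"
  using assms
proof (induction "degree g" arbitrary: g l)
  case 0
  then show ?case by simp
next
  case (Suc n)
  have "\<not> constant (poly g)" using Suc.hyps(2) by (simp add: constant_degree)
  then obtain z where z: "poly g z = 0" using fundamental_theorem_of_algebra by blast
  from poly_root_factor[OF z] obtain u where u: "g = [:-z, 1:] * u" by (elim exE)
  have "u \<noteq> 0" using u Suc.hyps(2) by auto
  then have deg: "degree g = Suc (degree u)" unfolding u by (subst degree_mult_eq) auto
  then have n: "n = degree u" using Suc.hyps(2) by simp
  have lc: "lead_coeff g = lead_coeff u" unfolding u by (simp add: lead_coeff_mult del: mult_pCons_left)
  define c where "c = cmod (lead_coeff u)"
  have IH: "cmod (coeff u l) \<le> c * (2 ^ n * R ^ (n - l))" if "l \<le> n" for l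
    unfolding c_def n using Suc.prems(1,2) that n u by (intro Suc.hyps(1)[OF n]) auto
  have zR: "cmod z \<le> R" using Suc.prems(1) z by blast
  have c0: "0 \<le> c" by (simp add: c_def)
  have a: "cmod (z * coeff u l) \<le> c * (2 ^ n * R ^ (Suc n - l))"
  proof (cases "l \<le> n")
    case True
    have "cmod (z * coeff u l) \<le> R * (c * (2 ^ n * R ^ (n - l)))"
      unfolding norm_mult by (intro mult_mono zR IH True) (use Suc.prems(2) in auto)
    then show ?thesis using True by (simp add: Suc_diff_le mult_ac)
  next
    case False
    then have "coeff u l = 0" using n by (intro coeff_eq_0) auto
    then show ?thesis using Suc.prems(2) c0 by simp
  qed
  have b: "cmod (case l of 0 \<Rightarrow> 0 | Suc k \<Rightarrow> coeff u k) \<le> c * (2 ^ n * R ^ (Suc n - l))"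
  proof (cases l)
    case 0
    then show ?thesis using Suc.prems(2) c0 by simp
  next
    case (Suc k)
    then have "k \<le> n" using Suc.prems(3) Suc.hyps(2) by simp
    then show ?thesis using IH[of k] Suc by simp
  qed
  have "coeff g l = (case l of 0 \<Rightarrow> 0 | Suc k \<Rightarrow> coeff u k) - z * coeff u l"
    unfolding u by (simp add: coeff_pCons split: nat.split)
  then have "cmod (coeff g l) \<le> cmod (case l of 0 \<Rightarrow> 0 | Suc k \<Rightarrow> coeff u k) + cmod (z * coeff u l)"
    by (metis norm_triangle_ineq4)
  also have "\<dots> \<le> c * (2 ^ Suc n * R ^ (Suc n - l))" using a b by simp
  finally show ?case using Suc.hyps(2) lc by (simp add: c_def)
qed

text \<open>For a monic \<open>g\<close>, \<open>cmod (poly g t)\<close> is the product of the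
  distances from \<open>t\<close> to the roots, so the nearest root will do.\<close>

lemma poly_root_near:
  fixes g :: "complex poly"
  assumes "lead_coeff g = 1" "degree g > 0"
  shows "\<exists>z. poly g z = 0 \<and> cmod (t - z) ^ degree g \<le> cmod (poly g t)"
proof -
  have prodbd: "r ^ degree g * cmod (lead_coeff g) \<le> cmod (poly g t)"
    if "\<And>z. poly g z = 0 \<Longrightarrow> r \<le> cmod (t - z)" "r \<ge> 0" for r and g :: "complex poly"
    using that
  proof (induction "degree g" arbitrary: g)
    case 0
    then obtain c where "g = [:c:]" using degree_eq_zeroE by metis
    then show ?case by simp
  next
    case (Suc n)
    have "\<not> constant (poly g)" using Suc.hyps(2) by (simp add: constant_degree)
    then obtain z where z: "poly g z = 0" using fundamental_theorem_of_algebra by blast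
    from poly_root_factor[OF z] obtain u where u: "g = [:-z, 1:] * u" by (elim exE)
    have "u \<noteq> 0" using u Suc.hyps(2) by auto
    then have deg: "degree g = Suc (degree u)" unfolding u by (subst degree_mult_eq) auto
    have lc: "lead_coeff g = lead_coeff u" unfolding u by (simp add: lead_coeff_mult del: mult_pCons_left)
    have "r ^ degree u * cmod (lead_coeff u) \<le> cmod (poly u t)"
      using Suc.prems Suc.hyps(2) deg u by (intro Suc.hyps(1)) auto
    then have "r * (r ^ degree u * cmod (lead_coeff u)) \<le> cmod (t - z) * cmod (poly u t)"
      using Suc.prems(1)[OF z] Suc.prems(2) by (intro mult_mono) auto
    also have "\<dots> = cmod (poly g t)" unfolding u poly_linear_mult norm_mult ..
    finally have "r * (r ^ degree u * cmod (lead_coeff u)) \<le> cmod (poly g t)" .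
    then show ?case by (simp only: lc) (simp only: deg power_Suc mult.assoc)
  qed
  have "g \<noteq> 0" using assms(2) by auto
  have fin: "finite {z. poly g z = 0}" using poly_roots_finite[OF \<open>g \<noteq> 0\<close>] .
  have "\<not> constant (poly g)" using assms(2) by (simp add: constant_degree)
  then have ne: "{z. poly g z = 0} \<noteq> {}" using fundamental_theorem_of_algebra by blast
  define z where "z = arg_min_on (\<lambda>z. cmod (t - z)) {z. poly g z = 0}"
  have z: "z \<in> {z. poly g z = 0}" "\<And>w. poly g w = 0 \<Longrightarrow> cmod (t - z) \<le> cmod (t - w)"
    unfolding z_def using arg_min_if_finite[OF fin ne] arg_min_least[OF fin ne] by auto
  have "cmod (t - z) ^ degree g * cmod (lead_coeff g) \<le> cmod (poly g t)"
    using z(2) by (intro prodbd) auto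
  then show ?thesis using z(1) assms(1) by (intro exI[of _ z]) auto
qed

lemma bounded_coords_subseq:
  fixes X :: "nat \<Rightarrow> nat \<Rightarrow> complex"
  assumes "\<And>j k. k < N \<Longrightarrow> cmod (X j k) \<le> B"
  shows "\<exists>s x. strict_mono (s :: nat \<Rightarrow> nat) \<and> (\<forall>k<N. (\<lambda>j. X (s j) k) \<longlonglongrightarrow> x k)"
  using assms
proof (induction N)
  case 0
  then show ?case by (intro exI[of _ id]) (auto simp: strict_mono_def)
next
  case (Suc N)
  then have "\<exists>s x. strict_mono (s :: nat \<Rightarrow> nat) \<and> (\<forall>k<N. (\<lambda>j. X (s j) k) \<longlonglongrightarrow> x k)" by simp
  then obtain s :: "nat \<Rightarrow> nat" and x where s: "strict_mono s" "\<forall>k<N. (\<lambda>j. X (s j) k) \<longlonglongrightarrow> x k" by blast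
  have "bounded (range (\<lambda>j. X (s j) N))"
    unfolding bounded_iff using Suc.prems[of N] by auto
  from bounded_imp_convergent_subsequence[OF this] obtain l r
    where r: "strict_mono r" "((\<lambda>j. X (s j) N) \<circ> r) \<longlonglongrightarrow> l" by blast
  have conv: "(\<lambda>j. X ((s \<circ> r) j) k) \<longlonglongrightarrow> (x(N := l)) k" if "k < Suc N" for k
  proof (cases "k = N")
    case True
    then show ?thesis using r(2) by (simp add: o_def)
  next
    case False
    then have "(\<lambda>j. X (s j) k) \<longlonglongrightarrow> x k" using that s(2) by simp
    from LIMSEQ_subseq_LIMSEQ[OF this r(1)] show ?thesis using False by (simp add: o_def)
  qed
  have "strict_mono (s \<circ> r)" using s(1) r(1) by (rule strict_mono_o)
  then show ?case using conv by (intro exI[of _ "s \<circ> r"] exI[of _ "x(N := l)"] conjI allI impI)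
qed

text \<open>The property of the set of \<open>y\<close> whose fibre is annihilated by
  \<open>f\<close> that the grid argument uses. It mentions no \<open>f\<close>, so one grid serves
  all functions of degree at most \<open>s\<close>.\<close>

definition line_closed ::
  "nat \<Rightarrow> nat set \<Rightarrow> ((nat \<Rightarrow> complex) \<Rightarrow> complex) \<Rightarrow> (nat \<Rightarrow> complex) set \<Rightarrow> bool" where
  "line_closed s I h Z \<longleftrightarrow>
    (\<forall>y i B. i \<in> I \<longrightarrow> card B = s + 1 \<longrightarrow> (\<forall>b\<in>B. h (y(i := b)) \<noteq> 0 \<and> y(i := b) \<in> Z) \<longrightarrow>
      (\<forall>t. y(i := t) \<in> Z)) \<and>
    (\<forall>y y'. y \<in> Z \<longrightarrow> (\<forall>i\<in>I. y i = y' i) \<longrightarrow> y' \<in> Z)"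

text \<open>Spreading along a line needs points with \<open>h\<close> nonzero, so the conclusion
  reaches only the complement of some hypersurface.\<close>

definition test_grid ::
  "nat \<Rightarrow> nat set \<Rightarrow> ((nat \<Rightarrow> complex) \<Rightarrow> complex) \<Rightarrow> (nat \<Rightarrow> complex) set \<Rightarrow> bool" where
  "test_grid s I h G \<longleftrightarrow> finite G \<and> card G \<le> (s + 1) ^ card I \<and> (\<forall>y\<in>G. h y \<noteq> 0) \<and>
    (\<forall>Z. line_closed s I h Z \<longrightarrow> G \<subseteq> Z \<longrightarrow>
      (\<exists>h' z. rp I h' \<and> h' z \<noteq> 0 \<and> (\<forall>y. h' y \<noteq> 0 \<longrightarrow> y \<in> Z)))"

text \<open>Take \<open>s + 1\<close> slices in coordinate \<open>i\<close> and a recursively chosen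
  grid in each. The grids may differ between slices, as each has to avoid the zeros of
  \<open>h\<close> in its own slice.\<close>

lemma test_grid_exists:
  assumes "finite I" "rp I h" "h y0 \<noteq> 0"
  shows "\<exists>G. test_grid s I h G"
  using assms
proof (induction I arbitrary: h y0 rule: finite_induct)
  case empty
  have nz: "h y \<noteq> 0" for y using rp_cong[OF empty(1), of y y0] empty(2) by simp
  show ?case unfolding test_grid_def
  proof (intro exI[of _ "{\<lambda>_. 0}"] conjI allI impI ballI)
    fix Z :: "(nat \<Rightarrow> complex) set" assume Z: "line_closed s {} h Z" "{\<lambda>_. 0} \<subseteq> Z"
    have "y \<in> Z" for y using Z unfolding line_closed_def by blast
    then show "\<exists>h' z. rp {} h' \<and> h' z \<noteq> 0 \<and> (\<forall>y. h' y \<noteq> 0 \<longrightarrow> y \<in> Z)"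
      by (intro exI[of _ "\<lambda>_. 1"]) auto
  qed (use nz in auto)
next
  case (insert i I)
  have II: "insert i I - {i} = I" using insert.hyps by auto
  have "infinite (UNIV - {t. h (y0(i := t)) = 0})"
    by (rule Diff_infinite_finite[OF rp_upd_zeros_finite[OF insert.prems] infinite_UNIV_char_0])
  from infinite_arbitrarily_large[OF this, of "s + 1"] obtain B
    where B: "finite B" "card B = s + 1" "B \<subseteq> UNIV - {t. h (y0(i := t)) = 0}" by blast
  define hb where "hb = (\<lambda>b y. h (y(i := b)))"
  have hb: "rp I (hb b)" for b
    unfolding hb_def by (rule rp_fun_upd[OF insert.prems(1), of i b, unfolded II])
  have "\<forall>b. \<exists>G. b \<in> B \<longrightarrow> test_grid s I (hb b) G"
  proof
    fix b
    show "\<exists>G. b \<in> B \<longrightarrow> test_grid s I (hb b) G"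
    proof (cases "b \<in> B")
      case True
      then have "hb b y0 \<noteq> 0" using B(3) by (auto simp: hb_def)
      from insert.IH[OF hb this] show ?thesis by blast
    qed blast
  qed
  from choice[OF this] obtain G where G: "\<forall>b. b \<in> B \<longrightarrow> test_grid s I (hb b) (G b)" by (elim exE)
  define G' where "G' = (\<Union>b\<in>B. (\<lambda>y. y(i := b)) ` G b)"
  have Gfin: "finite (G b)" "card (G b) \<le> (s + 1) ^ card I" "\<forall>y\<in>G b. hb b y \<noteq> 0" if "b \<in> B" for b
    using G that unfolding test_grid_def by blast+
  have "finite G'" using B(1) Gfin by (auto simp: G'_def)
  moreover have "card G' \<le> (s + 1) ^ card (insert i I)"
  proof -
    have "card G' \<le> (\<Sum>b\<in>B. card ((\<lambda>y. y(i := b)) ` G b))"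
      unfolding G'_def by (rule card_UN_le[OF B(1)])
    also have "\<dots> \<le> (\<Sum>b\<in>B. (s + 1) ^ card I)"
      using Gfin card_image_le order_trans by (intro sum_mono) blast
    also have "\<dots> = (s + 1) ^ card (insert i I)" using B(2) insert.hyps by simp
    finally show ?thesis .
  qed
  moreover have "\<forall>y\<in>G'. h y \<noteq> 0" using Gfin(3) by (auto simp: G'_def hb_def)
  moreover have "\<exists>h' z. rp (insert i I) h' \<and> h' z \<noteq> 0 \<and> (\<forall>y. h' y \<noteq> 0 \<longrightarrow> y \<in> Z)"
    if LZ: "line_closed s (insert i I) h Z" and GZ: "G' \<subseteq> Z" for Z
  proof -
    have Z: "y(j := t) \<in> Z" if "j \<in> insert i I" "card B = s + 1"
        "\<forall>b\<in>B. h (y(j := b)) \<noteq> 0 \<and> y(j := b) \<in> Z" for y j B t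
      using LZ that unfolding line_closed_def by blast
    have Zc: "y' \<in> Z" if "y \<in> Z" "\<forall>j\<in>insert i I. y j = y' j" for y y'
      using LZ that unfolding line_closed_def by blast
    have "\<exists>h' z. rp I h' \<and> h' z \<noteq> (0::complex) \<and> (\<forall>y. h' y \<noteq> 0 \<longrightarrow> y(i := b) \<in> Z)" if b: "b \<in> B" for b
    proof -
      define Zb where "Zb = {y. y(i := b) \<in> Z}"
      have "line_closed s I (hb b) Zb"
        unfolding line_closed_def
      proof (intro conjI allI impI)
        fix y j B t assume j: "j \<in> I" "card B = s + 1" "\<forall>b'\<in>B. hb b (y(j := b')) \<noteq> 0 \<and> y(j := b') \<in> Zb"
        have tw: "(y(j := u))(i := b) = (y(i := b))(j := u)" for u
          using j(1) insert.hyps(2) by (intro fun_upd_twist) auto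
        have "\<forall>b'\<in>B. h ((y(i := b))(j := b')) \<noteq> 0 \<and> (y(i := b))(j := b') \<in> Z"
          using j(3) unfolding hb_def Zb_def mem_Collect_eq tw .
        then have "(y(i := b))(j := t) \<in> Z" using j(1,2) by (intro Z[of j B]) simp_all
        then show "y(j := t) \<in> Zb" unfolding Zb_def mem_Collect_eq tw .
      next
        fix y y' assume y: "y \<in> Zb" "\<forall>j\<in>I. y j = y' j"
        have "\<forall>j\<in>insert i I. (y(i := b)) j = (y'(i := b)) j" using y(2) by simp
        with y(1) show "y' \<in> Zb" unfolding Zb_def mem_Collect_eq by (rule Zc)
      qed
      moreover have "G b \<subseteq> Zb" using GZ b by (auto simp: G'_def Zb_def)
      moreover have "test_grid s I (hb b) (G b)" using G b by blast
      ultimately have "\<exists>h' z. rp I h' \<and> h' z \<noteq> (0::complex) \<and> (\<forall>y. h' y \<noteq> 0 \<longrightarrow> y \<in> Zb)"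
        unfolding test_grid_def by simp
      then show ?thesis unfolding Zb_def by simp
    qed
    then have "\<forall>b. \<exists>h'. b \<in> B \<longrightarrow> rp I h' \<and> (\<exists>z. h' z \<noteq> (0::complex)) \<and> (\<forall>y. h' y \<noteq> 0 \<longrightarrow> y(i := b) \<in> Z)"
      by blast
    from choice[OF this] obtain h' where h': "\<forall>b. b \<in> B \<longrightarrow> rp I (h' b) \<and> (\<exists>z. h' b z \<noteq> (0::complex)) \<and>
      (\<forall>y. h' b y \<noteq> 0 \<longrightarrow> y(i := b) \<in> Z)" by (elim exE)
    \<comment> \<open>Where \<open>H\<close> is nonzero, all \<open>s + 1\<close> slice points on
      the line through \<open>y\<close> in direction \<open>i\<close> lie in \<open>Z\<close> and
      have \<open>h\<close> nonzero, so the line is contained in \<open>Z\<close>.\<close>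
    define H where "H = (\<lambda>y. \<Prod>b\<in>B. h' b y * hb b y)"
    have "rp I H" unfolding H_def using h' hb by (intro rp_prod rp_mult) auto
    then have rH: "rp (insert i I) H" by (rule rp_subset) auto
    have "\<exists>z. \<forall>b\<in>B. h' b z * hb b z \<noteq> 0"
    proof (rule rp_prod_nonzero[OF B(1), where I = I])
      fix b assume b: "b \<in> B"
      show "rp I (\<lambda>y. h' b y * hb b y)" using h' hb b by (intro rp_mult) auto
      obtain z where "h' b z \<noteq> 0" using h' b by blast
      moreover have "hb b y0 \<noteq> 0" using B(3) b by (auto simp: hb_def)
      ultimately show "\<exists>x. h' b x * hb b x \<noteq> 0" using h' hb b by (intro rp_mult_nonzero) auto
    qed
    then obtain z where "H z \<noteq> 0" using B(1) by (auto simp: H_def)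
    moreover have "y \<in> Z" if "H y \<noteq> 0" for y
    proof -
      have "\<forall>b\<in>B. h (y(i := b)) \<noteq> 0 \<and> y(i := b) \<in> Z"
        using that h' B(1) by (auto simp: H_def hb_def)
      then have "y(i := y i) \<in> Z" using B(2) by (intro Z[of i B]) simp_all
      then show ?thesis by simp
    qed
    ultimately show ?thesis using rH by (intro exI[of _ H] exI[of _ z]) simp
  qed
  ultimately have "test_grid s (insert i I) h G'" unfolding test_grid_def by simp
  then show ?case by (rule exI)
qed

section \<open>Generic fibres of a Noether normalisation\<close>

definition nz :: "((nat \<Rightarrow> complex) \<Rightarrow> complex) \<Rightarrow> bool" where
  "nz q \<longleftrightarrow> (\<exists>y. q y \<noteq> 0)"

lemma nz_mult: "rp I p \<Longrightarrow> rp I q \<Longrightarrow> nz p \<Longrightarrow> nz q \<Longrightarrow> nz (\<lambda>y. p y * q y)"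
  unfolding nz_def by (elim exE) (rule rp_mult_nonzero)

locale noether_var =
  fixes N :: nat and V :: "(nat \<Rightarrow> complex) set" and I :: "nat set"
    and L :: "nat \<Rightarrow> nat \<Rightarrow> complex" and A :: "((nat \<Rightarrow> complex) \<Rightarrow> complex) set" and K :: real
  assumes irr: "irred_alg_set N V" and pre: "prenoether N V I L A K" and ind: "algind N V I L"
begin

abbreviation Y :: "(nat \<Rightarrow> complex) \<Rightarrow> nat \<Rightarrow> complex" where
  "Y \<equiv> linmap I N L"

definition fiber :: "(nat \<Rightarrow> complex) \<Rightarrow> (nat \<Rightarrow> complex) set" where
  "fiber y = {x \<in> V. \<forall>i\<in>I. Y x i = y i}"

lemma finI: "finite I" and finA: "finite A" and I_sub: "I \<subseteq> {..<N}" and K0: "0 \<le> K"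
  using pre finite_subset unfolding prenoether_def by auto

lemma V_alg: "alg_set N V" and V_ne: "V \<noteq> {}"
  using irr by (auto simp: irred_alg_set_def)

lemma V_aff: "V \<subseteq> aff_space N"
  by (rule irred_alg_set_aff[OF irr])

lemma rp_zero:
  assumes "rp I q" "\<And>x. x \<in> V \<Longrightarrow> q (Y x) = 0"
  shows "q y = 0"
proof -
  obtain e where "pd I e q" using assms(1) by (rule rpE)
  then show ?thesis by (rule algindD[OF ind]) (rule assms(2))
qed

lemma poly_fun_rp: "rp I q \<Longrightarrow> poly_fun N (\<lambda>x. q (Y x))"
  by (erule rpE, rule poly_fun_pd, rule pd_comp_linmap)

lemma rp_fiber: "rp I q \<Longrightarrow> x \<in> fiber y \<Longrightarrow> q (Y x) = q y"
  by (rule rp_cong) (auto simp: fiber_def)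

lemma mult_zero:
  "poly_fun N f \<Longrightarrow> poly_fun N g \<Longrightarrow> (\<And>x. x \<in> V \<Longrightarrow> f x * g x = 0) \<Longrightarrow>
    (\<forall>x\<in>V. f x = 0) \<or> (\<forall>x\<in>V. g x = 0)"
  by (rule irred_mult_zero[OF irr])

text \<open>A nonzero polynomial in the independent forms is not identically zero on
  \<open>V\<close>, hence no zero divisor on the irreducible \<open>V\<close>.\<close>

lemma rp_cancel:
  assumes "rp I q" "q y0 \<noteq> 0" "poly_fun N f" "\<And>x. x \<in> V \<Longrightarrow> q (Y x) * f x = 0" "x \<in> V"
  shows "f x = 0"
proof -
  have "\<not> (\<forall>x\<in>V. q (Y x) = 0)" using rp_zero[OF assms(1), of y0] assms(2) by blast
  then show ?thesis using mult_zero[OF poly_fun_rp[OF assms(1)] assms(3,4)] assms(5) by blast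
qed

text \<open>Linear independence over the field of rational functions in the forms \<open>Y\<close>,
  with denominators cleared.\<close>

definition rind :: "nat \<Rightarrow> (nat \<Rightarrow> (nat \<Rightarrow> complex) \<Rightarrow> complex) \<Rightarrow> bool" where
  "rind d b \<longleftrightarrow> (\<forall>q. (\<forall>j<d. rp I (q j)) \<longrightarrow> (\<forall>x\<in>V. (\<Sum>j<d. q j (Y x) * b j x) = 0) \<longrightarrow>
    (\<forall>j<d. \<forall>y. q j y = 0))"

lemma rindD:
  assumes "rind d b" "\<And>j. j < d \<Longrightarrow> rp I (q j)" "\<And>x. x \<in> V \<Longrightarrow> (\<Sum>j<d. q j (Y x) * b j x) = 0" "j < d"
  shows "q j y = 0"
  using assms(1)[unfolded rind_def, rule_format, of q] assms(2-4) by blast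

text \<open>The function field is finite over the rational functions in \<open>Y\<close>: products
  of \<open>d\<close> independent functions with Lagrange functions are independent and of bounded
  degree, so there cannot be too many. A single \<open>t\<close> that is at least every degree of
  the \<open>b j\<close> suffices.\<close>

lemma rind_bound:
  assumes "rind d b" "\<And>j. j < d \<Longrightarrow> poly_fun N (b j)"
  shows "d \<le> card A * (card I + 1) ^ card I"
proof -
  have "\<forall>j. \<exists>e. j < d \<longrightarrow> pd {..<N} e (b j)" using assms(2) poly_fun_iff by blast
  from choice[OF this] obtain e where e: "\<forall>j. j < d \<longrightarrow> pd {..<N} (e j) (b j)" by (elim exE)
  define t where "t = (\<Sum>j<d. e j)"
  have bt: "pd {..<N} t (b j)" if "j < d" for j
  proof (rule pd_mono)
    show "pd {..<N} (e j) (b j)" using e that by blast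
    show "e j \<le> t" unfolding t_def using that by (intro member_le_sum) auto
  qed
  define r where "r = card I"
  define S where "S = {..<d} \<times> PiE I (\<lambda>_. {..t})"
  define F where "F = (\<lambda>(j, p) x. lagr I t p (Y x) * b j x)"
  have "finite S" using finI by (auto simp: S_def finite_PiE)
  have "card S \<le> card A * ((r + 1) * t + 1) ^ card I"
  proof (rule indep_card_le[OF pre \<open>finite S\<close>, where F = F])
    fix s assume s: "s \<in> S"
    then obtain j p where jp: "s = (j, p)" "j < d" "p \<in> PiE I (\<lambda>_. {..t})" by (auto simp: S_def)
    have "pd {..<N} ((r + 1) * t) (\<lambda>x. lagr I t p (Y x) * b j x)"
      by (rule pd_mult_le[OF pd_lagr_linmap[OF finI jp(3)] bt[OF jp(2)]]) (simp add: r_def)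
    then show "pd {..<N} ((r + 1) * t) (F s)" by (simp add: F_def jp(1))
  next
    show "indep_on V S F" unfolding indep_on_def
    proof (intro allI impI ballI)
      fix c s assume c: "\<forall>x\<in>V. (\<Sum>s\<in>S. c s * F s x) = 0" and s: "s \<in> S"
      obtain j p where jp: "s = (j, p)" "j < d" "p \<in> PiE I (\<lambda>_. {..t})" using s by (auto simp: S_def)
      define q where "q = (\<lambda>j y. \<Sum>p\<in>PiE I (\<lambda>_. {..t}). c (j, p) * lagr I t p y)"
      have "q j (\<lambda>i. of_nat (p i)) = 0"
      proof (rule rindD[OF assms(1) _ _ jp(2), where q = q])
        show "rp I (q j)" for j
          unfolding q_def by (rule rp_sum, rule rp_mult, rule rp_const, rule rpI, rule pd_lagr[OF finI])
        fix x assume "x \<in> V"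
        have "(\<Sum>j<d. q j (Y x) * b j x) =
            (\<Sum>j<d. \<Sum>p\<in>PiE I (\<lambda>_. {..t}). c (j, p) * F (j, p) x)"
          unfolding q_def sum_distrib_right F_def by (intro sum.cong refl) simp
        also have "\<dots> = (\<Sum>s\<in>S. c s * F s x)"
          unfolding S_def sum.cartesian_product by (intro sum.cong refl) auto
        finally show "(\<Sum>j<d. q j (Y x) * b j x) = 0" using c \<open>x \<in> V\<close> by simp
      qed
      moreover have "q j (\<lambda>i. of_nat (p i)) = (\<Sum>p'\<in>PiE I (\<lambda>_. {..t}). if p' = p then c (j, p') else 0)"
        unfolding q_def using jp(3) finI by (intro sum.cong) (auto simp: lagr_eval)
      ultimately show "c s = 0" using jp finI by (simp add: finite_PiE)
    qed
  qed
  moreover have "card S = d * (t + 1) ^ r"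
    using finI by (simp add: S_def card_cartesian_product card_PiE_const r_def)
  ultimately have "d * (t + 1) ^ r \<le> card A * ((r + 1) * t + 1) ^ r" by (simp add: r_def)
  also have "\<dots> \<le> card A * ((r + 1) * (t + 1)) ^ r"
    by (intro mult_left_mono power_mono) auto
  also have "\<dots> = card A * (r + 1) ^ r * (t + 1) ^ r" by (simp only: power_mult_distrib mult.assoc)
  finally show ?thesis unfolding mult_le_cancel2 r_def by simp
qed

lemma not_rind_SucE:
  assumes "rind d b" "\<not> rind (Suc d) b"
  shows "\<exists>q. (\<forall>j\<le>d. rp I (q j)) \<and> nz (q d) \<and> (\<forall>x\<in>V. (\<Sum>j\<le>d. q j (Y x) * b j x) = 0)"
proof -
  from assms(2) obtain q j y where q: "\<forall>j<Suc d. rp I (q j)"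
    "\<forall>x\<in>V. (\<Sum>j<Suc d. q j (Y x) * b j x) = 0" "j < Suc d" "q j y \<noteq> 0"
    unfolding rind_def by blast
  have "nz (q d)"
  proof (rule ccontr)
    assume "\<not> nz (q d)"
    then have neg: "\<And>y. q d y = 0" unfolding nz_def by blast
    have "(\<Sum>j<d. q j (Y x) * b j x) = 0" if "x \<in> V" for x using q(2) that neg by simp
    then have "j < d \<Longrightarrow> q j y = 0" using q(1) by (intro rindD[OF assms(1), of q]) auto
    then show False using q(3,4) neg by (cases "j = d") auto
  qed
  then show ?thesis using q(1,2) by (intro exI[of _ q]) (simp add: less_Suc_eq_le lessThan_Suc_atMost)
qed

text \<open>The minimal polynomial of \<open>f\<close> over the rational functions in
  \<open>Y\<close>, denominators cleared; \<open>rind n\<close> expresses minimality.\<close>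

definition minrel :: "((nat \<Rightarrow> complex) \<Rightarrow> complex) \<Rightarrow> nat \<Rightarrow> (nat \<Rightarrow> (nat \<Rightarrow> complex) \<Rightarrow> complex) \<Rightarrow> bool" where
  "minrel f n q \<longleftrightarrow> n > 0 \<and> rind n (\<lambda>l x. f x ^ l) \<and> (\<forall>l\<le>n. rp I (q l)) \<and> nz (q n) \<and>
    (\<forall>x\<in>V. (\<Sum>l\<le>n. q l (Y x) * f x ^ l) = 0)"

lemma minrel_exists:
  assumes "poly_fun N f"
  shows "\<exists>n q. minrel f n q"
proof -
  let ?b = "\<lambda>l x. f x ^ l"
  define B where "B = card A * (card I + 1) ^ card I"
  have "\<not> rind (Suc B) ?b"
  proof
    assume "rind (Suc B) ?b"
    from rind_bound[OF this poly_fun_power[OF assms]] show False by (simp add: B_def)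
  qed
  then have ex: "\<exists>n. \<not> rind (Suc n) ?b" by blast
  define n where "n = (LEAST n. \<not> rind (Suc n) ?b)"
  have n1: "\<not> rind (Suc n) ?b" unfolding n_def by (rule LeastI_ex[OF ex])
  have r0: "rind 0 ?b" by (simp add: rind_def)
  have n2: "rind n ?b"
  proof (cases n)
    case 0
    then show ?thesis using r0 by simp
  next
    case (Suc m)
    then show ?thesis using not_less_Least[of m "\<lambda>n. \<not> rind (Suc n) ?b"] n_def by auto
  qed
  from not_rind_SucE[OF n2 n1] obtain q where q: "\<forall>j\<le>n. rp I (q j)" "nz (q n)"
    "\<forall>x\<in>V. (\<Sum>j\<le>n. q j (Y x) * f x ^ j) = 0" by (elim exE conjE)
  have "n > 0"
  proof (rule ccontr)
    assume "\<not> n > 0"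
    then have "\<forall>x\<in>V. q 0 (Y x) = 0" "rp I (q 0)" using q by auto
    then have "q 0 y = 0" for y using rp_zero by blast
    then show False using q(2) \<open>\<not> n > 0\<close> by (simp add: nz_def)
  qed
  then have "minrel f n q" unfolding minrel_def using n2 q by simp
  then show ?thesis by (intro exI)
qed

text \<open>With \<open>q 0\<close> zero, \<open>f\<close> could be cancelled from the relation,
  contradicting the independence of the lower powers.\<close>

lemma minrel_const_nonzero:
  assumes mr: "minrel f n q" and f: "poly_fun N f" and nz: "x0 \<in> V" "f x0 \<noteq> 0"
  shows "nz (q 0)"
proof (rule ccontr)
  assume "\<not> nz (q 0)"
  then have z: "\<And>y. q 0 y = 0" unfolding nz_def by blast
  have m: "n > 0" "rind n (\<lambda>l x. f x ^ l)" "\<forall>l\<le>n. rp I (q l)" "nz (q n)"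
    "\<forall>x\<in>V. (\<Sum>l\<le>n. q l (Y x) * f x ^ l) = 0" using mr unfolding minrel_def by auto
  obtain k where k: "n = Suc k" using m(1) not0_implies_Suc by blast
  define R where "R = (\<lambda>x. \<Sum>l<n. q (Suc l) (Y x) * f x ^ l)"
  have polyR: "poly_fun N R" unfolding R_def
    by (rule poly_fun_sum, rule pf_mult, rule poly_fun_rp) (use m(3) poly_fun_power[OF f] in auto)
  have "f x * R x = 0" if "x \<in> V" for x
  proof -
    have "(\<Sum>l\<le>n. q l (Y x) * f x ^ l) = q 0 (Y x) + (\<Sum>l<n. q (Suc l) (Y x) * f x ^ Suc l)"
      unfolding k lessThan_Suc_atMost by (subst sum.atMost_Suc_shift) simp
    also have "(\<Sum>l<n. q (Suc l) (Y x) * f x ^ Suc l) = f x * R x"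
      unfolding R_def sum_distrib_left by (intro sum.cong refl) (simp add: mult_ac)
    finally show ?thesis using m(5) that z by simp
  qed
  from mult_zero[OF f polyR this] have "\<forall>x\<in>V. R x = 0" using nz by blast
  then have R0: "(\<Sum>l<n. q (Suc l) (Y x) * f x ^ l) = 0" if "x \<in> V" for x
    using that unfolding R_def by blast
  have "q (Suc k) y = 0" for y
  proof (rule rindD[OF m(2), where q = "\<lambda>l. q (Suc l)" and j = k])
    show "rp I (q (Suc l))" if "l < n" for l using m(3) that by auto
    show "(\<Sum>l<n. q (Suc l) (Y x) * f x ^ l) = 0" if "x \<in> V" for x by (rule R0[OF that])
  qed (use k in simp)
  then show False using m(4) k by (simp add: nz_def)
qed

text \<open>Solving the minimal relation for its constant term exhibits that term as a multiple of
  \<open>f\<close>; where it is nonzero this inverts \<open>f\<close>.\<close>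

lemma divides_rp:
  assumes f: "poly_fun N f" and nz: "x0 \<in> V" "f x0 \<noteq> 0"
  shows "\<exists>a \<rho>. poly_fun N a \<and> rp I \<rho> \<and> nz \<rho> \<and> (\<forall>x\<in>V. f x * a x = \<rho> (Y x))"
proof -
  from minrel_exists[OF f] obtain n q where mr: "minrel f n q" by (elim exE)
  have m: "n > 0" "\<forall>l\<le>n. rp I (q l)" "\<forall>x\<in>V. (\<Sum>l\<le>n. q l (Y x) * f x ^ l) = 0"
    using mr unfolding minrel_def by auto
  obtain k where k: "n = Suc k" using m(1) not0_implies_Suc by blast
  define a where "a = (\<lambda>x. - (\<Sum>l<n. q (Suc l) (Y x) * f x ^ l))"
  have "poly_fun N a" unfolding a_def
    by (rule poly_fun_uminus, rule poly_fun_sum, rule pf_mult, rule poly_fun_rp)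
      (use m(2) poly_fun_power[OF f] in auto)
  moreover have "f x * a x = q 0 (Y x)" if "x \<in> V" for x
  proof -
    have "(\<Sum>l\<le>n. q l (Y x) * f x ^ l) = q 0 (Y x) + (\<Sum>l<n. q (Suc l) (Y x) * f x ^ Suc l)"
      unfolding k lessThan_Suc_atMost by (subst sum.atMost_Suc_shift) simp
    also have "(\<Sum>l<n. q (Suc l) (Y x) * f x ^ Suc l) = - (f x * a x)"
      unfolding a_def mult_minus_right minus_minus sum_distrib_left
      by (intro sum.cong refl) (simp add: mult_ac)
    finally show ?thesis using m(3) that by simp
  qed
  ultimately show ?thesis using m(2) minrel_const_nonzero[OF mr f nz]
    by (intro exI[of _ a] exI[of _ "q 0"]) simp
qed

end

text \<open>\<open>b\<close> is a basis of the function field over the rational functions in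
  \<open>Y\<close>, and \<open>\<delta>\<close> a common denominator for the coordinates of 1 and
  for multiplication by the \<open>x k\<close>. This describes the algebra of \<open>V\<close> after
  inverting \<open>\<delta>\<close>.\<close>

locale noether_basis = noether_var +
  fixes d :: nat and b :: "nat \<Rightarrow> (nat \<Rightarrow> complex) \<Rightarrow> complex" and \<delta> :: "(nat \<Rightarrow> complex) \<Rightarrow> complex"
  assumes b_poly: "\<And>j. j < d \<Longrightarrow> poly_fun N (b j)" and b_rind: "rind d b"
    and \<delta>_rp: "rp I \<delta>" and \<delta>_nz: "nz \<delta>"
    and rep_one: "\<exists>m. (\<forall>i<d. rp I (m i)) \<and> (\<forall>x\<in>V. \<delta> (Y x) = (\<Sum>i<d. m i (Y x) * b i x))"
    and rep_var: "\<And>k j. k < N \<Longrightarrow> j < d \<Longrightarrow>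
      \<exists>m. (\<forall>i<d. rp I (m i)) \<and> (\<forall>x\<in>V. \<delta> (Y x) * (x k * b j x) = (\<Sum>i<d. m i (Y x) * b i x))"

context noether_var
begin

text \<open>A maximal independent family exists by \<open>rind_bound\<close>. Prescribing its first
  members allows the powers of a given \<open>f\<close> to be put in the basis.\<close>

lemma basis_exists:
  assumes "rind n b0" "\<And>j. j < n \<Longrightarrow> poly_fun N (b0 j)"
  shows "\<exists>d b \<delta>. noether_basis N V I L A K d b \<delta> \<and> n \<le> d \<and> (\<forall>j<n. b j = b0 j)"
proof -
  define P where "P = (\<lambda>d. \<exists>b. rind d b \<and> (\<forall>j<d. poly_fun N (b j)) \<and> n \<le> d \<and> (\<forall>j<n. b j = b0 j))"
  have "P n" unfolding P_def using assms by (intro exI[of _ b0]) simp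
  moreover have "\<forall>d. P d \<longrightarrow> d < Suc (card A * (card I + 1) ^ card I)"
    unfolding P_def using rind_bound by (auto simp: less_Suc_eq_le)
  ultimately obtain d where d: "P d" "\<forall>d'. P d' \<longrightarrow> d' \<le> d"
    using ex_has_greatest_nat[of P n "\<lambda>d. d"] by blast
  from d(1)[unfolded P_def] obtain b where b: "rind d b" "\<forall>j<d. poly_fun N (b j)" "n \<le> d" "\<forall>j<n. b j = b0 j"
    by (elim exE conjE)
  \<comment> \<open>Maximality: adjoining \<open>g\<close> creates a relation in which the
    coefficient of \<open>g\<close> is nonzero.\<close>
  have single: "\<exists>\<delta> m. rp I \<delta> \<and> nz \<delta> \<and> (\<forall>i<d. rp I (m i)) \<and>
      (\<forall>x\<in>V. \<delta> (Y x) * g x = (\<Sum>i<d. m i (Y x) * b i x))" if g: "poly_fun N g" for g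
  proof -
    define b' where "b' = b(d := g)"
    have eq: "(\<Sum>j<d. q j (Y x) * b' j x) = (\<Sum>j<d. q j (Y x) * b j x)" for q x
      by (intro sum.cong) (auto simp: b'_def)
    have r: "rind d b'" using b(1) unfolding rind_def eq .
    have "\<not> P (Suc d)" using d(2) by auto
    have nr: "\<not> rind (Suc d) b'"
    proof
      assume "rind (Suc d) b'"
      then have "P (Suc d)" unfolding P_def using b g
        by (intro exI[of _ b']) (auto simp: b'_def less_Suc_eq)
      then show False using \<open>\<not> P (Suc d)\<close> by simp
    qed
    from not_rind_SucE[OF r nr] obtain q where q: "\<forall>j\<le>d. rp I (q j)" "nz (q d)"
      "\<forall>x\<in>V. (\<Sum>j\<le>d. q j (Y x) * b' j x) = 0" by (elim exE conjE)
    have "q d (Y x) * g x = (\<Sum>i<d. - q i (Y x) * b i x)" if "x \<in> V" for x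
    proof -
      have "(\<Sum>j\<le>d. q j (Y x) * b' j x) = (\<Sum>j<d. q j (Y x) * b j x) + q d (Y x) * g x"
        unfolding lessThan_Suc_atMost[symmetric] sum.lessThan_Suc eq by (simp add: b'_def)
      then show ?thesis using q(3) that by (simp add: sum_negf eq_neg_iff_add_eq_0 add.commute)
    qed
    then show ?thesis using q(1,2)
      by (intro exI[of _ "q d"] exI[of _ "\<lambda>i y. - q i y"]) (simp add: rp_uminus)
  qed
  have common: "\<exists>\<delta>. rp I \<delta> \<and> nz \<delta> \<and> (\<forall>g\<in>G. \<exists>m. (\<forall>i<d. rp I (m i)) \<and>
      (\<forall>x\<in>V. \<delta> (Y x) * g x = (\<Sum>i<d. m i (Y x) * b i x)))"
    if "finite G" "\<And>g. g \<in> G \<Longrightarrow> poly_fun N g" for G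
    using that
  proof (induction G rule: finite_induct)
    case empty
    show ?case by (intro exI[of _ "\<lambda>y. 1"]) (auto simp: nz_def)
  next
    case (insert g G)
    have "\<exists>\<delta>. rp I \<delta> \<and> nz \<delta> \<and> (\<forall>g\<in>G. \<exists>m. (\<forall>i<d. rp I (m i)) \<and>
      (\<forall>x\<in>V. \<delta> (Y x) * g x = (\<Sum>i<d. m i (Y x) * b i x)))" using insert by simp
    then obtain \<delta> where \<delta>: "rp I \<delta>" "nz \<delta>" "\<forall>g\<in>G. \<exists>m. (\<forall>i<d. rp I (m i)) \<and>
      (\<forall>x\<in>V. \<delta> (Y x) * g x = (\<Sum>i<d. m i (Y x) * b i x))" by (elim exE conjE)
    have "poly_fun N g" using insert.prems by simp
    from single[OF this] obtain \<epsilon> m0 where \<epsilon>: "rp I \<epsilon>" "nz \<epsilon>" "\<forall>i<d. rp I (m0 i)"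
      "\<forall>x\<in>V. \<epsilon> (Y x) * g x = (\<Sum>i<d. m0 i (Y x) * b i x)" by (elim exE conjE)
    have nz\<delta>\<epsilon>: "nz (\<lambda>y. \<delta> y * \<epsilon> y)" by (rule nz_mult[OF \<delta>(1) \<epsilon>(1) \<delta>(2) \<epsilon>(2)])
    have "\<exists>m. (\<forall>i<d. rp I (m i)) \<and> (\<forall>x\<in>V. \<delta> (Y x) * \<epsilon> (Y x) * h x = (\<Sum>i<d. m i (Y x) * b i x))"
      if h: "h \<in> insert g G" for h
    proof (cases "h = g")
      case True
      have "\<delta> (Y x) * \<epsilon> (Y x) * h x = (\<Sum>i<d. (\<delta> (Y x) * m0 i (Y x)) * b i x)" if "x \<in> V" for x
        using \<epsilon>(4) that True by (simp add: mult.assoc sum_distrib_left[symmetric])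
      then show ?thesis using \<delta>(1) \<epsilon>(3)
        by (intro exI[of _ "\<lambda>i y. \<delta> y * m0 i y"]) (simp add: rp_mult)
    next
      case False
      then have "h \<in> G" using h by simp
      with \<delta>(3) obtain m where m: "\<forall>i<d. rp I (m i)"
        "\<forall>x\<in>V. \<delta> (Y x) * h x = (\<Sum>i<d. m i (Y x) * b i x)" by blast
      have "\<delta> (Y x) * \<epsilon> (Y x) * h x = (\<Sum>i<d. (\<epsilon> (Y x) * m i (Y x)) * b i x)" if "x \<in> V" for x
      proof -
        have "\<delta> (Y x) * \<epsilon> (Y x) * h x = \<epsilon> (Y x) * (\<delta> (Y x) * h x)" by simp
        then show ?thesis using m(2) that by (simp add: mult.assoc sum_distrib_left)
      qed
      then show ?thesis using \<epsilon>(1) m(1)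
        by (intro exI[of _ "\<lambda>i y. \<epsilon> y * m i y"]) (simp add: rp_mult)
    qed
    then show ?case using nz\<delta>\<epsilon> rp_mult[OF \<delta>(1) \<epsilon>(1)] by (intro exI[of _ "\<lambda>y. \<delta> y * \<epsilon> y"] conjI ballI)
  qed
  define G where "G = insert (\<lambda>x. 1) ((\<lambda>(k, j) x. x k * b j x) ` ({..<N} \<times> {..<d}))"
  have "finite G" by (simp add: G_def)
  moreover have "poly_fun N g" if "g \<in> G" for g
    using that b(2) unfolding G_def by (auto intro!: pf_mult pf_var)
  ultimately have "\<exists>\<delta>. rp I \<delta> \<and> nz \<delta> \<and> (\<forall>g\<in>G. \<exists>m. (\<forall>i<d. rp I (m i)) \<and>
      (\<forall>x\<in>V. \<delta> (Y x) * g x = (\<Sum>i<d. m i (Y x) * b i x)))" by (rule common)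
  then obtain \<delta> where \<delta>: "rp I \<delta>" "nz \<delta>" "\<forall>g\<in>G. \<exists>m. (\<forall>i<d. rp I (m i)) \<and>
      (\<forall>x\<in>V. \<delta> (Y x) * g x = (\<Sum>i<d. m i (Y x) * b i x))" by (elim exE conjE)
  have "noether_basis N V I L A K d b \<delta>"
  proof (unfold_locales)
    show "poly_fun N (b j)" if "j < d" for j using b(2) that by blast
    show "rind d b" by (rule b(1))
    show "rp I \<delta>" "nz \<delta>" by (rule \<delta>(1), rule \<delta>(2))
    have "(\<lambda>x. 1) \<in> G" by (simp add: G_def)
    from \<delta>(3)[rule_format, OF this]
    show "\<exists>m. (\<forall>i<d. rp I (m i)) \<and> (\<forall>x\<in>V. \<delta> (Y x) = (\<Sum>i<d. m i (Y x) * b i x))" by simp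
    show "\<exists>m. (\<forall>i<d. rp I (m i)) \<and> (\<forall>x\<in>V. \<delta> (Y x) * (x k * b j x) = (\<Sum>i<d. m i (Y x) * b i x))"
      if "k < N" "j < d" for k j
    proof -
      have "(\<lambda>x. x k * b j x) \<in> G" using that by (auto simp: G_def)
      from \<delta>(3)[rule_format, OF this] show ?thesis .
    qed
  qed
  then show ?thesis using b(3,4) by (intro exI[of _ d] exI[of _ b] exI[of _ \<delta>] conjI)
qed

end

context noether_basis
begin

text \<open>The matrix of multiplication by \<open>f\<close> is built from those of the coordinates;
  the exponent \<open>k\<close> counts the denominators \<open>\<delta>\<close> collected on the
  way.\<close>

lemma rep_mult:
  assumes "poly_fun N f"
  shows "\<exists>k \<theta>. (\<forall>i<d. \<forall>j<d. rp I (\<theta> i j)) \<and>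
    (\<forall>j<d. \<forall>x\<in>V. \<delta> (Y x) ^ k * (f x * b j x) = (\<Sum>i<d. \<theta> i j (Y x) * b i x))"
  using assms
proof (induction rule: poly_fun.induct)
  case (pf_const c)
  have "c * b j x = (\<Sum>i<d. (if i = j then c else 0) * b i x)" if "j < d" for j x
  proof -
    have "(\<Sum>i<d. (if i = j then c else 0) * b i x) = (\<Sum>i<d. if i = j then c * b i x else 0)"
      by (intro sum.cong) auto
    then show ?thesis using that by simp
  qed
  then show ?case by (intro exI[of _ 0] exI[of _ "\<lambda>i j y. if i = j then c else 0"]) simp
next
  case (pf_var k)
  have "\<forall>j. \<exists>m. j < d \<longrightarrow> (\<forall>i<d. rp I (m i)) \<and> (\<forall>x\<in>V. \<delta> (Y x) * (x k * b j x) = (\<Sum>i<d. m i (Y x) * b i x))"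
    using rep_var[OF pf_var] by blast
  from choice[OF this] obtain m where m: "\<forall>j. j < d \<longrightarrow> (\<forall>i<d. rp I (m j i)) \<and>
    (\<forall>x\<in>V. \<delta> (Y x) * (x k * b j x) = (\<Sum>i<d. m j i (Y x) * b i x))" by (elim exE)
  then show ?case by (intro exI[of _ 1] exI[of _ "\<lambda>i j. m j i"]) simp
next
  case (pf_add f g)
  then obtain k \<theta> l \<eta> where
    f: "\<forall>i<d. \<forall>j<d. rp I (\<theta> i j)" "\<forall>j<d. \<forall>x\<in>V. \<delta> (Y x) ^ k * (f x * b j x) = (\<Sum>i<d. \<theta> i j (Y x) * b i x)" and
    g: "\<forall>i<d. \<forall>j<d. rp I (\<eta> i j)" "\<forall>j<d. \<forall>x\<in>V. \<delta> (Y x) ^ l * (g x * b j x) = (\<Sum>i<d. \<eta> i j (Y x) * b i x)"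
    by (elim exE conjE)
  have "\<delta> (Y x) ^ (k + l) * ((f x + g x) * b j x) =
      (\<Sum>i<d. (\<delta> (Y x) ^ l * \<theta> i j (Y x) + \<delta> (Y x) ^ k * \<eta> i j (Y x)) * b i x)" if "j < d" "x \<in> V" for j x
  proof -
    have "\<delta> (Y x) ^ (k + l) * ((f x + g x) * b j x) =
        \<delta> (Y x) ^ l * (\<delta> (Y x) ^ k * (f x * b j x)) + \<delta> (Y x) ^ k * (\<delta> (Y x) ^ l * (g x * b j x))"
      by (simp add: power_add algebra_simps)
    also have "\<dots> = \<delta> (Y x) ^ l * (\<Sum>i<d. \<theta> i j (Y x) * b i x) + \<delta> (Y x) ^ k * (\<Sum>i<d. \<eta> i j (Y x) * b i x)"
      using f(2) g(2) that by simp
    finally show ?thesis by (simp add: sum_distrib_left sum.distrib[symmetric] algebra_simps)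
  qed
  moreover have "rp I (\<lambda>y. \<delta> y ^ l * \<theta> i j y + \<delta> y ^ k * \<eta> i j y)" if "i < d" "j < d" for i j
    using f(1) g(1) that by (intro rp_add rp_mult rp_power \<delta>_rp) auto
  ultimately show ?case
    by (intro exI[of _ "k + l"] exI[of _ "\<lambda>i j y. \<delta> y ^ l * \<theta> i j y + \<delta> y ^ k * \<eta> i j y"]) simp
next
  case (pf_mult f g)
  then obtain k \<theta> l \<eta> where
    f: "\<forall>i<d. \<forall>j<d. rp I (\<theta> i j)" "\<forall>j<d. \<forall>x\<in>V. \<delta> (Y x) ^ k * (f x * b j x) = (\<Sum>i<d. \<theta> i j (Y x) * b i x)" and
    g: "\<forall>i<d. \<forall>j<d. rp I (\<eta> i j)" "\<forall>j<d. \<forall>x\<in>V. \<delta> (Y x) ^ l * (g x * b j x) = (\<Sum>i<d. \<eta> i j (Y x) * b i x)"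
    by (elim exE conjE)
  have "\<delta> (Y x) ^ (k + l) * ((f x * g x) * b j x) =
      (\<Sum>i<d. (\<Sum>h<d. \<theta> i h (Y x) * \<eta> h j (Y x)) * b i x)" if "j < d" "x \<in> V" for j x
  proof -
    have "\<delta> (Y x) ^ (k + l) * ((f x * g x) * b j x) =
        \<delta> (Y x) ^ k * f x * (\<delta> (Y x) ^ l * (g x * b j x))"
      by (simp add: power_add mult_ac)
    also have "\<dots> = \<delta> (Y x) ^ k * f x * (\<Sum>h<d. \<eta> h j (Y x) * b h x)"
      using g(2) that by simp
    also have "\<dots> = (\<Sum>h<d. \<eta> h j (Y x) * (\<delta> (Y x) ^ k * (f x * b h x)))"
      unfolding sum_distrib_left by (intro sum.cong refl) (simp add: mult_ac)
    also have "\<dots> = (\<Sum>h<d. \<eta> h j (Y x) * (\<Sum>i<d. \<theta> i h (Y x) * b i x))"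
      using f(2) that by (intro sum.cong) auto
    also have "\<dots> = (\<Sum>h<d. \<Sum>i<d. \<theta> i h (Y x) * \<eta> h j (Y x) * b i x)"
      unfolding sum_distrib_left by (intro sum.cong refl) (simp add: mult_ac)
    also have "\<dots> = (\<Sum>i<d. \<Sum>h<d. \<theta> i h (Y x) * \<eta> h j (Y x) * b i x)" by (rule sum.swap)
    finally show ?thesis by (simp add: sum_distrib_right)
  qed
  moreover have "rp I (\<lambda>y. \<Sum>h<d. \<theta> i h y * \<eta> h j y)" if "i < d" "j < d" for i j
    using f(1) g(1) that by (intro rp_sum rp_mult) auto
  ultimately show ?case
    by (intro exI[of _ "k + l"] exI[of _ "\<lambda>i j y. \<Sum>h<d. \<theta> i h y * \<eta> h j y"]) simp
qed

text \<open>\<open>J y0\<close> is the ideal of the fibre over \<open>y0\<close> in the localisation at \<open>\<delta>\<close>: the functions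
  whose coordinates with respect to the basis \<open>b\<close> vanish at \<open>y0\<close>.\<close>
definition J :: "(nat \<Rightarrow> complex) \<Rightarrow> ((nat \<Rightarrow> complex) \<Rightarrow> complex) set" where
  "J y0 = {f. \<exists>k \<theta>. (\<forall>j<d. rp I (\<theta> j) \<and> \<theta> j y0 = 0) \<and>
    (\<forall>x\<in>V. \<delta> (Y x) ^ k * f x = (\<Sum>j<d. \<theta> j (Y x) * b j x))}"

lemma J_I:
  "(\<And>j. j < d \<Longrightarrow> rp I (\<theta> j)) \<Longrightarrow> (\<And>j. j < d \<Longrightarrow> \<theta> j y0 = 0) \<Longrightarrow>
    (\<And>x. x \<in> V \<Longrightarrow> \<delta> (Y x) ^ k * f x = (\<Sum>j<d. \<theta> j (Y x) * b j x)) \<Longrightarrow> f \<in> J y0"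
  unfolding J_def by (intro CollectI exI[of _ k] exI[of _ \<theta>]) simp

lemma J_E:
  assumes "f \<in> J y0"
  obtains k \<theta> where "\<forall>j<d. rp I (\<theta> j)" "\<forall>j<d. \<theta> j y0 = 0"
    "\<forall>x\<in>V. \<delta> (Y x) ^ k * f x = (\<Sum>j<d. \<theta> j (Y x) * b j x)"
proof -
  from assms[unfolded J_def mem_Collect_eq] obtain k \<theta> where "\<forall>j<d. rp I (\<theta> j) \<and> \<theta> j y0 = 0"
    "\<forall>x\<in>V. \<delta> (Y x) ^ k * f x = (\<Sum>j<d. \<theta> j (Y x) * b j x)" by (elim exE conjE)
  then show ?thesis by (intro that[of \<theta> k]) auto
qed

lemma J_cong: "f \<in> J y0 \<Longrightarrow> (\<And>x. x \<in> V \<Longrightarrow> f x = g x) \<Longrightarrow> g \<in> J y0"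
proof (erule J_E)
  fix k \<theta>
  assume "\<And>x. x \<in> V \<Longrightarrow> f x = g x" "\<forall>j<d. rp I (\<theta> j)" "\<forall>j<d. \<theta> j y0 = 0"
    "\<forall>x\<in>V. \<delta> (Y x) ^ k * f x = (\<Sum>j<d. \<theta> j (Y x) * b j x)"
  then show "g \<in> J y0" by (intro J_I[of \<theta> y0 k]) auto
qed

lemma J_zero: "(\<And>x. x \<in> V \<Longrightarrow> f x = 0) \<Longrightarrow> f \<in> J y0"
  by (rule J_I[of "\<lambda>j y. 0" _ 0]) auto

lemma J_add:
  assumes "f \<in> J y0" "g \<in> J y0"
  shows "(\<lambda>x. f x + g x) \<in> J y0"
proof -
  obtain k \<theta> where f: "\<forall>j<d. rp I (\<theta> j)" "\<forall>j<d. \<theta> j y0 = 0"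
    "\<forall>x\<in>V. \<delta> (Y x) ^ k * f x = (\<Sum>j<d. \<theta> j (Y x) * b j x)" by (rule J_E[OF assms(1)])
  obtain l \<eta> where g: "\<forall>j<d. rp I (\<eta> j)" "\<forall>j<d. \<eta> j y0 = 0"
    "\<forall>x\<in>V. \<delta> (Y x) ^ l * g x = (\<Sum>j<d. \<eta> j (Y x) * b j x)" by (rule J_E[OF assms(2)])
  show ?thesis
  proof (rule J_I[of "\<lambda>j y. \<delta> y ^ l * \<theta> j y + \<delta> y ^ k * \<eta> j y" _ "k + l"])
    show "rp I (\<lambda>y. \<delta> y ^ l * \<theta> j y + \<delta> y ^ k * \<eta> j y)" if "j < d" for j
      using f(1) g(1) that by (intro rp_add rp_mult rp_power \<delta>_rp) auto
    fix x assume x: "x \<in> V"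
    have "\<delta> (Y x) ^ (k + l) * (f x + g x) =
        \<delta> (Y x) ^ l * (\<delta> (Y x) ^ k * f x) + \<delta> (Y x) ^ k * (\<delta> (Y x) ^ l * g x)"
      by (simp add: power_add algebra_simps)
    also have "\<dots> = \<delta> (Y x) ^ l * (\<Sum>j<d. \<theta> j (Y x) * b j x) + \<delta> (Y x) ^ k * (\<Sum>j<d. \<eta> j (Y x) * b j x)"
      using f(3) g(3) x by simp
    finally show "\<delta> (Y x) ^ (k + l) * (f x + g x) =
        (\<Sum>j<d. (\<delta> (Y x) ^ l * \<theta> j (Y x) + \<delta> (Y x) ^ k * \<eta> j (Y x)) * b j x)"
      by (simp add: sum_distrib_left sum.distrib[symmetric] algebra_simps)
  qed (use f(2) g(2) in auto)
qed

lemma J_mult: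
  assumes "f \<in> J y0" "poly_fun N g"
  shows "(\<lambda>x. g x * f x) \<in> J y0"
proof -
  obtain k \<theta> where f: "\<forall>j<d. rp I (\<theta> j)" "\<forall>j<d. \<theta> j y0 = 0"
    "\<forall>x\<in>V. \<delta> (Y x) ^ k * f x = (\<Sum>j<d. \<theta> j (Y x) * b j x)" by (rule J_E[OF assms(1)])
  from rep_mult[OF assms(2)] obtain l \<eta> where g: "\<forall>i<d. \<forall>j<d. rp I (\<eta> i j)"
    "\<forall>j<d. \<forall>x\<in>V. \<delta> (Y x) ^ l * (g x * b j x) = (\<Sum>i<d. \<eta> i j (Y x) * b i x)" by (elim exE conjE)
  show ?thesis
  proof (rule J_I[of "\<lambda>i y. \<Sum>j<d. \<theta> j y * \<eta> i j y" _ "k + l"])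
    show "rp I (\<lambda>y. \<Sum>j<d. \<theta> j y * \<eta> i j y)" if "i < d" for i
      using f(1) g(1) that by (intro rp_sum rp_mult) auto
    show "(\<Sum>j<d. \<theta> j y0 * \<eta> i j y0) = 0" for i using f(2) by simp
    fix x assume x: "x \<in> V"
    have "\<delta> (Y x) ^ (k + l) * (g x * f x) = \<delta> (Y x) ^ l * g x * (\<delta> (Y x) ^ k * f x)"
      by (simp add: power_add mult_ac)
    also have "\<dots> = \<delta> (Y x) ^ l * g x * (\<Sum>j<d. \<theta> j (Y x) * b j x)" using f(3) x by simp
    also have "\<dots> = (\<Sum>j<d. \<theta> j (Y x) * (\<delta> (Y x) ^ l * (g x * b j x)))"
      unfolding sum_distrib_left by (intro sum.cong refl) (simp add: mult_ac)
    also have "\<dots> = (\<Sum>j<d. \<theta> j (Y x) * (\<Sum>i<d. \<eta> i j (Y x) * b i x))"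
      using g(2) x by (intro sum.cong) auto
    also have "\<dots> = (\<Sum>j<d. \<Sum>i<d. \<theta> j (Y x) * \<eta> i j (Y x) * b i x)"
      unfolding sum_distrib_left by (intro sum.cong refl) (simp add: mult_ac)
    also have "\<dots> = (\<Sum>i<d. \<Sum>j<d. \<theta> j (Y x) * \<eta> i j (Y x) * b i x)" by (rule sum.swap)
    finally show "\<delta> (Y x) ^ (k + l) * (g x * f x) = (\<Sum>i<d. (\<Sum>j<d. \<theta> j (Y x) * \<eta> i j (Y x)) * b i x)"
      by (simp add: sum_distrib_right)
  qed
qed

lemma J_cmult: "f \<in> J y0 \<Longrightarrow> (\<lambda>x. c * f x) \<in> J y0"
  by (rule J_mult) auto

lemma J_diff: "f \<in> J y0 \<Longrightarrow> g \<in> J y0 \<Longrightarrow> (\<lambda>x. f x - g x) \<in> J y0"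
  using J_add[OF _ J_cmult[of g y0 "-1"], of f] by simp

lemma J_sum: "(\<And>s. s \<in> S \<Longrightarrow> f s \<in> J y0) \<Longrightarrow> (\<lambda>x. \<Sum>s\<in>S. f s x) \<in> J y0"
proof (induction S rule: infinite_finite_induct)
  case (insert s S)
  then have "(\<lambda>x. f s x + (\<Sum>s\<in>S. f s x)) \<in> J y0" by (intro J_add) auto
  then show ?case using insert.hyps by simp
qed (auto intro: J_zero)

lemma J_rp:
  assumes "rp I p" "p y0 = 0"
  shows "(\<lambda>x. p (Y x)) \<in> J y0"
proof -
  from rep_one obtain m where m: "\<forall>i<d. rp I (m i)" "\<forall>x\<in>V. \<delta> (Y x) = (\<Sum>i<d. m i (Y x) * b i x)"
    by (elim exE conjE)
  show ?thesis
  proof (rule J_I[of "\<lambda>i y. p y * m i y" _ 1])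
    show "rp I (\<lambda>y. p y * m i y)" if "i < d" for i using m(1) assms(1) that by (intro rp_mult) auto
    fix x assume "x \<in> V"
    then have "\<delta> (Y x) ^ 1 * p (Y x) = p (Y x) * (\<Sum>i<d. m i (Y x) * b i x)" using m(2) by simp
    then show "\<delta> (Y x) ^ 1 * p (Y x) = (\<Sum>i<d. p (Y x) * m i (Y x) * b i x)"
      by (simp add: sum_distrib_left mult.assoc)
  qed (use assms(2) in simp)
qed

text \<open>Comparing coefficients gives \<open>\<delta> ^ k * c j = \<theta> j\<close> as
  polynomials; evaluate at \<open>y0\<close>, where the right side vanishes.\<close>

lemma J_basis:
  assumes "\<delta> y0 \<noteq> 0" "(\<lambda>x. \<Sum>j<d. c j * b j x) \<in> J y0" "j < d"
  shows "c j = 0"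
proof -
  obtain k \<theta> where f: "\<forall>j<d. rp I (\<theta> j)" "\<forall>j<d. \<theta> j y0 = 0"
    "\<forall>x\<in>V. \<delta> (Y x) ^ k * (\<Sum>j<d. c j * b j x) = (\<Sum>j<d. \<theta> j (Y x) * b j x)" by (rule J_E[OF assms(2)])
  have "\<delta> y0 ^ k * c j - \<theta> j y0 = 0"
  proof (rule rindD[OF b_rind _ _ assms(3), where q = "\<lambda>j y. \<delta> y ^ k * c j - \<theta> j y"])
    show "rp I (\<lambda>y. \<delta> y ^ k * c j - \<theta> j y)" if "j < d" for j
      using f(1) that by (intro rp_diff rp_mult rp_power \<delta>_rp rp_const) auto
    fix x assume "x \<in> V"
    have "(\<Sum>j<d. (\<delta> (Y x) ^ k * c j - \<theta> j (Y x)) * b j x) =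
        \<delta> (Y x) ^ k * (\<Sum>j<d. c j * b j x) - (\<Sum>j<d. \<theta> j (Y x) * b j x)"
      by (simp add: left_diff_distrib sum_subtractf sum_distrib_left mult.assoc)
    then show "(\<Sum>j<d. (\<delta> (Y x) ^ k * c j - \<theta> j (Y x)) * b j x) = 0" using f(3) \<open>x \<in> V\<close> by simp
  qed
  then show ?thesis using f(2) assms(1,3) by simp
qed

end

section \<open>Radicality of the generic fibre ideal and the size of good fibres\<close>

lemma poly_fun_poly:
  assumes "poly_fun N f"
  shows "poly_fun N (\<lambda>x. poly p (f x))"
  unfolding poly_altdef by (rule poly_fun_sum, rule pf_mult, rule pf_const, rule poly_fun_power[OF assms])

lemma pderiv_sum: "pderiv (\<Sum>s\<in>S. f s) = (\<Sum>s\<in>S. pderiv (f s))"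
  by (induction S rule: infinite_finite_induct) (auto simp: pderiv_add)

lemma order_card_le_degree:
  fixes p :: "complex poly"
  assumes "finite B" "p \<noteq> 0" "\<And>b. b \<in> B \<Longrightarrow> m \<le> order b p"
  shows "card B * m \<le> degree p"
  using assms
proof (induction B arbitrary: p rule: finite_induct)
  case (insert b B)
  have "[:-b, 1:] ^ m dvd p" using insert.prems by (simp add: order_divides)
  then obtain u where u: "p = [:-b, 1:] ^ m * u" by (auto elim: dvdE)
  have u0: "u \<noteq> 0" using u insert.prems(1) by auto
  have "degree p = degree ([:-b, 1:] ^ m) + degree u"
    unfolding u by (rule degree_mult_eq) (use u0 in auto)
  then have deg: "degree p = m + degree u" by (simp add: degree_linear_power)
  have "card B * m \<le> degree u"
  proof (rule insert.IH[OF u0])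
    fix c assume c: "c \<in> B"
    then have "c \<noteq> b" using insert.hyps by auto
    then have "poly ([:-b, 1:] ^ m) c \<noteq> 0" by (simp add: poly_power)
    then have "order c ([:-b, 1:] ^ m) = 0" by (rule order_0I)
    moreover have "order c p = order c ([:-b, 1:] ^ m) + order c u"
      unfolding u by (rule order_mult) (use u insert.prems(1) in auto)
    ultimately show "m \<le> order c u" using insert.prems(2)[of c] c by simp
  qed
  then show ?case using insert.hyps deg by simp
qed simp

context noether_basis
begin

text \<open>Away from a hypersurface, \<open>J y0\<close> contains a squarefree polynomial in each coordinate,
  because the derivative of the minimal relation divides a polynomial in the \<open>Y\<close>-coordinates.\<close>
lemma squarefree_in_J:
  assumes k: "k < N"
  shows "\<exists>\<rho>. rp I \<rho> \<and> nz \<rho> \<and> (\<forall>y0. \<rho> y0 \<noteq> 0 \<longrightarrow>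
    (\<exists>p. p \<noteq> 0 \<and> rsquarefree p \<and> (\<lambda>x. poly p (x k)) \<in> J y0))"
proof -
  have xk: "poly_fun N (\<lambda>x. x k)" using k by (rule pf_var)
  from minrel_exists[OF xk] obtain n q where mr: "minrel (\<lambda>x. x k) n q" by (elim exE)
  have m: "n > 0" "rind n (\<lambda>l x. x k ^ l)" "\<forall>l\<le>n. rp I (q l)" "nz (q n)"
    "\<forall>x\<in>V. (\<Sum>l\<le>n. q l (Y x) * x k ^ l) = 0" using mr unfolding minrel_def by auto
  obtain n' where n': "n = Suc n'" using m(1) not0_implies_Suc by blast
  define dq where "dq = (\<lambda>l y. of_nat (Suc l) * q (Suc l) y)"
  define g' where "g' = (\<lambda>x. \<Sum>l<n. dq l (Y x) * x k ^ l)"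
  have rp_dq: "rp I (dq l)" if "l < n" for l
    unfolding dq_def using m(3) that by (intro rp_mult rp_const) auto
  have poly_g': "poly_fun N g'" unfolding g'_def
    by (rule poly_fun_sum, rule pf_mult, rule poly_fun_rp, rule rp_dq, simp, rule poly_fun_power[OF xk])
  \<comment> \<open>\<open>g'\<close> is the derivative of the minimal relation at
    \<open>x k\<close>. Its top coefficient is \<open>n\<close> times \<open>q n\<close>, nonzero in
    characteristic 0, so independence of the lower powers prevents \<open>g'\<close> from vanishing
    on \<open>V\<close>.\<close>
  have "\<exists>x0\<in>V. g' x0 \<noteq> 0"
  proof (rule ccontr)
    assume "\<not> ?thesis"
    then have z: "(\<Sum>l<n. dq l (Y x) * x k ^ l) = 0" if "x \<in> V" for x
      using that unfolding g'_def by blast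
    have "dq n' y = 0" for y
      by (rule rindD[OF m(2), where q = dq]) (use rp_dq z n' in auto)
    then have "q n y = 0" for y by (simp add: dq_def n' del: of_nat_Suc)
    then show False using m(4) by (simp add: nz_def)
  qed
  then obtain x0 where x0: "x0 \<in> V" "g' x0 \<noteq> 0" by blast
  from divides_rp[OF poly_g' x0] obtain a \<rho> where a: "poly_fun N a" "rp I \<rho>" "nz \<rho>"
    "\<forall>x\<in>V. g' x * a x = \<rho> (Y x)" by (elim exE conjE)
  have main: "\<exists>p. p \<noteq> 0 \<and> rsquarefree p \<and> (\<lambda>x. poly p (x k)) \<in> J y0" if y0: "\<rho> y0 \<noteq> 0" for y0
  proof -
    define G where "G = (\<Sum>l\<le>n. monom (q l y0) l)"
    have Gp: "poly G t = (\<Sum>l\<le>n. q l y0 * t ^ l)" for t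
      unfolding G_def by (rule poly_sum_monom)
    have dG: "poly (pderiv G) t = (\<Sum>l<n. dq l y0 * t ^ l)" for t
    proof -
      have "poly (pderiv G) t = (\<Sum>l\<le>n. of_nat l * q l y0 * t ^ (l - 1))"
        by (simp add: G_def pderiv_sum pderiv_monom poly_sum poly_monom)
      also have "\<dots> = (\<Sum>l<n. of_nat (Suc l) * q (Suc l) y0 * t ^ l)"
        unfolding n' lessThan_Suc_atMost by (subst sum.atMost_Suc_shift) simp
      finally show ?thesis by (simp add: dq_def)
    qed
    have coefJ: "(\<lambda>x. x k ^ l * (r (Y x) - r y0)) \<in> J y0" if "rp I r" for r l
    proof (rule J_mult[OF _ poly_fun_power[OF xk]])
      show "(\<lambda>x. r (Y x) - r y0) \<in> J y0"
        using J_rp[of "\<lambda>y. r y - r y0" y0] that by (simp add: rp_diff)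
    qed
    have GJ: "(\<lambda>x. poly G (x k)) \<in> J y0"
    proof (rule J_cong)
      show "(\<lambda>x. - 1 * (\<Sum>l\<le>n. x k ^ l * (q l (Y x) - q l y0))) \<in> J y0"
        by (rule J_cmult, rule J_sum, rule coefJ) (use m(3) in auto)
      fix x assume "x \<in> V"
      have "(\<Sum>l\<le>n. x k ^ l * (q l (Y x) - q l y0)) =
          (\<Sum>l\<le>n. q l (Y x) * x k ^ l) - (\<Sum>l\<le>n. q l y0 * x k ^ l)"
        by (simp add: right_diff_distrib sum_subtractf mult.commute)
      then show "- 1 * (\<Sum>l\<le>n. x k ^ l * (q l (Y x) - q l y0)) = poly G (x k)"
        using m(5) \<open>x \<in> V\<close> by (simp add: Gp)
    qed
    have dGJ: "(\<lambda>x. poly (pderiv G) (x k) * a x - \<rho> y0) \<in> J y0"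
    proof (rule J_cong)
      have 1: "(\<lambda>x. \<Sum>l<n. x k ^ l * (dq l (Y x) - dq l y0)) \<in> J y0"
        by (rule J_sum, rule coefJ) (use rp_dq in auto)
      have 2: "(\<lambda>x. \<rho> (Y x) - \<rho> y0) \<in> J y0"
        using J_rp[of "\<lambda>y. \<rho> y - \<rho> y0" y0] a(2) by (simp add: rp_diff)
      show "(\<lambda>x. (\<rho> (Y x) - \<rho> y0) - a x * (\<Sum>l<n. x k ^ l * (dq l (Y x) - dq l y0))) \<in> J y0"
        by (rule J_diff[OF 2 J_mult[OF 1 a(1)]])
      fix x assume "x \<in> V"
      have "(\<Sum>l<n. x k ^ l * (dq l (Y x) - dq l y0)) = g' x - poly (pderiv G) (x k)"
        by (simp add: g'_def dG right_diff_distrib sum_subtractf mult.commute)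
      moreover have "\<rho> (Y x) = g' x * a x" using a(4) \<open>x \<in> V\<close> by simp
      ultimately show "\<rho> (Y x) - \<rho> y0 - a x * (\<Sum>l<n. x k ^ l * (dq l (Y x) - dq l y0)) =
          poly (pderiv G) (x k) * a x - \<rho> y0"
        by (simp only:) (simp add: algebra_simps)
    qed
    \<comment> \<open>Modulo \<open>J y0\<close> the function \<open>poly (pderiv G) (x k)\<close>
      is invertible, with inverse \<open>a x / \<rho> y0\<close>.\<close>
    have cancel: "f \<in> J y0" if f: "poly_fun N f" and fJ: "(\<lambda>x. poly (pderiv G) (x k) * f x) \<in> J y0" for f
    proof (rule J_cong)
      show "(\<lambda>x. inverse (\<rho> y0) * (a x * (poly (pderiv G) (x k) * f x) -
          f x * (poly (pderiv G) (x k) * a x - \<rho> y0))) \<in> J y0"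
        by (rule J_cmult, rule J_diff, rule J_mult[OF fJ a(1)], rule J_mult[OF dGJ f])
      show "inverse (\<rho> y0) * (a x * (poly (pderiv G) (x k) * f x) -
          f x * (poly (pderiv G) (x k) * a x - \<rho> y0)) = f x" for x
        using y0 by (simp add: algebra_simps)
    qed
    define Q where "Q = (\<lambda>p. p \<noteq> 0 \<and> (\<lambda>x. poly p (x k)) \<in> J y0)"
    \<comment> \<open>\<open>G\<close> may be the zero polynomial. Then its derivative is zero as
      well, and being invertible it puts 1 into \<open>J y0\<close>.\<close>
    have exQ: "\<exists>p. Q p"
    proof (cases "G = 0")
      case True
      have "(\<lambda>x. 1) \<in> J y0"
        by (rule cancel) (use True in \<open>auto intro: J_zero\<close>)
      then show ?thesis unfolding Q_def by (intro exI[of _ 1]) simp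
    next
      case False
      then show ?thesis unfolding Q_def using GJ by (intro exI[of _ G]) simp
    qed
    then obtain p where p: "Q p" "\<And>p'. Q p' \<Longrightarrow> degree p \<le> degree p'"
      using ex_has_least_nat[of Q _ degree] by blast
    have p0: "p \<noteq> 0" and pJ: "(\<lambda>x. poly p (x k)) \<in> J y0" using p(1) unfolding Q_def by auto
    have "p dvd G"
    proof -
      have "(\<lambda>x. poly (G mod p) (x k)) \<in> J y0"
      proof (rule J_cong)
        show "(\<lambda>x. poly G (x k) - poly (G div p) (x k) * poly p (x k)) \<in> J y0"
          by (rule J_diff[OF GJ J_mult[OF pJ poly_fun_poly[OF xk]]])
        show "poly G (x k) - poly (G div p) (x k) * poly p (x k) = poly (G mod p) (x k)" for x
          unfolding poly_mult[symmetric] poly_diff[symmetric] by (simp add: minus_div_mult_eq_mod)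
      qed
      then have "G mod p = 0 \<or> degree p \<le> degree (G mod p)" using p(2)[of "G mod p"] unfolding Q_def by blast
      then show ?thesis using degree_mod_less[OF p0, of G] by auto
    qed
    then obtain w where w: "G = p * w" by (auto elim: dvdE)
    \<comment> \<open>For a double root \<open>z\<close>, removing one factor gives \<open>u\<close>
      with \<open>pderiv G * u\<close> divisible by \<open>p\<close>. Cancelling the derivative puts
      \<open>u\<close> into \<open>J y0\<close>, below the minimal degree.\<close>
    have "rsquarefree p" unfolding rsquarefree_roots
    proof (intro allI notI, elim conjE)
      fix z assume z: "poly p z = 0" "poly (pderiv p) z = 0"
      define s where "s = [:-z, 1:]"
      have s1: "pderiv s = 1" by (simp add: s_def pderiv_pCons)
      have sz: "poly s z = 0" by (simp add: s_def)
      from poly_root_factor[OF z(1)] obtain u where u: "p = s * u" unfolding s_def by (elim exE)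
      have "poly u z = 0" using z(2) unfolding u by (simp add: pderiv_mult s1 sz)
      from poly_root_factor[OF this] obtain v where v: "u = s * v" unfolding s_def by (elim exE)
      define X where "X = v * w"
      have "pderiv G * u = p * (s * pderiv X + 2 * X)"
      proof -
        have "G = s * (s * X)" by (simp add: w u v X_def mult_ac)
        then have "pderiv G = s * (s * pderiv X + X) + s * X"
          by (simp add: pderiv_mult s1)
        then show ?thesis by (simp add: u v algebra_simps)
      qed
      then have eq: "poly (pderiv G) t * poly u t = poly (s * pderiv X + 2 * X) t * poly p t" for t
        unfolding poly_mult[symmetric] by (simp add: mult.commute)
      have "(\<lambda>x. poly u (x k)) \<in> J y0"
      proof (rule cancel[OF poly_fun_poly[OF xk]])
        show "(\<lambda>x. poly (pderiv G) (x k) * poly u (x k)) \<in> J y0"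
          unfolding eq by (rule J_mult[OF pJ poly_fun_poly[OF xk]])
      qed
      moreover have "u \<noteq> 0" using u p0 by auto
      ultimately have "degree p \<le> degree u" using p(2)[of u] unfolding Q_def by blast
      moreover have "degree p = Suc (degree u)"
        unfolding u using \<open>u \<noteq> 0\<close> by (subst degree_mult_eq) (auto simp: s_def)
      ultimately show False by simp
    qed
    then show ?thesis using p0 pJ by (intro exI[of _ p]) simp
  qed
  then show ?thesis using a(2,3) by (intro exI[of _ \<rho>]) simp
qed

text \<open>A radical zero-dimensional ideal contains every function vanishing on its zero set: split
  \<open>1\<close> into the Lagrange idempotents of the coordinates.\<close>
lemma vanish_in_J:
  assumes sep: "\<And>k. k < N \<Longrightarrow> \<exists>p. p \<noteq> 0 \<and> rsquarefree p \<and> (\<lambda>x. poly p (x k)) \<in> J y0"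
    and f: "poly_fun N f" "\<And>x. x \<in> fiber y0 \<Longrightarrow> f x = 0"
  shows "f \<in> J y0"
proof (rule ccontr)
  assume fJ: "f \<notin> J y0"
  have "\<forall>k. \<exists>\<Lambda>. k < N \<longrightarrow> finite \<Lambda> \<and> (\<lambda>x. \<Prod>\<mu>\<in>\<Lambda>. (x k - \<mu>)) \<in> J y0"
  proof
    fix k
    show "\<exists>\<Lambda>. k < N \<longrightarrow> finite \<Lambda> \<and> (\<lambda>x. \<Prod>\<mu>\<in>\<Lambda>. (x k - \<mu>)) \<in> J y0"
    proof (cases "k < N")
      case True
      from sep[OF True] obtain p where p: "p \<noteq> 0" "rsquarefree p" "(\<lambda>x. poly p (x k)) \<in> J y0"
        by (elim exE conjE)
      define \<Lambda> where "\<Lambda> = {z. poly p z = 0}"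
      have fin: "finite \<Lambda>" unfolding \<Lambda>_def by (rule poly_roots_finite[OF p(1)])
      have "poly p t = lead_coeff p * (\<Prod>\<mu>\<in>\<Lambda>. (t - \<mu>))" for t
      proof -
        have "poly p t = poly (smult (lead_coeff p) (\<Prod>z|poly p z = 0. [:-z, 1:])) t"
          using complex_poly_decompose_rsquarefree[OF p(2)] by simp
        then show ?thesis by (simp add: \<Lambda>_def poly_prod)
      qed
      then have "(\<Prod>\<mu>\<in>\<Lambda>. (t - \<mu>)) = inverse (lead_coeff p) * poly p t" for t
        using p(1) by simp
      then have "(\<lambda>x. \<Prod>\<mu>\<in>\<Lambda>. (x k - \<mu>)) \<in> J y0" using J_cmult[OF p(3)] by simp
      then show ?thesis using fin by blast
    qed blast
  qed
  from choice[OF this] obtain \<Lambda> where \<Lambda>0: "\<forall>k. k < N \<longrightarrow> finite (\<Lambda> k) \<and> (\<lambda>x. \<Prod>\<mu>\<in>\<Lambda> k. (x k - \<mu>)) \<in> J y0"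
    by (elim exE)
  have \<Lambda>: "finite (\<Lambda> k)" "(\<lambda>x. \<Prod>\<mu>\<in>\<Lambda> k. (x k - \<mu>)) \<in> J y0" if "k < N" for k
    using \<Lambda>0 that by auto
  define \<Phi> where "\<Phi> = (\<lambda>k v x. \<Prod>\<mu>\<in>\<Lambda> k - {v}. (x k - \<mu>) :: complex)"
  have poly_l: "poly_fun N (\<Phi> k v)" if "k < N" for k v
    unfolding \<Phi>_def using that by (intro poly_fun_prod poly_fun_diff pf_var pf_const)
  have poly_P: "poly_fun N (\<lambda>x. \<Prod>k<n. \<Phi> k (v k) x)" if "n \<le> N" for n v
    using that by (intro poly_fun_prod poly_l) auto
  \<comment> \<open>One root per coordinate is chosen so that \<open>f\<close> times the Lagrange
    factors stays outside \<open>J y0\<close>. Suitable multiples of the factors of one coordinate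
    sum to 1, so not every choice can fall into \<open>J y0\<close>.\<close>
  have "\<exists>v. (\<forall>k<n. v k \<in> \<Lambda> k) \<and> (\<lambda>x. f x * (\<Prod>k<n. \<Phi> k (v k) x)) \<notin> J y0" if "n \<le> N" for n
    using that
  proof (induction n)
    case 0
    then show ?case using fJ by simp
  next
    case (Suc n)
    then obtain v where v: "\<forall>k<n. v k \<in> \<Lambda> k" "(\<lambda>x. f x * (\<Prod>k<n. \<Phi> k (v k) x)) \<notin> J y0" by auto
    define g where "g = (\<lambda>x. f x * (\<Prod>k<n. \<Phi> k (v k) x))"
    have g: "poly_fun N g" "g \<notin> J y0"
      unfolding g_def using v(2) Suc.prems by (auto intro!: pf_mult f(1) poly_P)
    have n: "n < N" using Suc.prems by simp
    have "\<exists>w\<in>\<Lambda> n. (\<lambda>x. \<Phi> n w x * g x) \<notin> J y0"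
    proof (rule ccontr)
      assume "\<not> ?thesis"
      then have all: "(\<lambda>x. \<Phi> n w x * g x) \<in> J y0" if "w \<in> \<Lambda> n" for w using that by blast
      have "g \<in> J y0"
      proof (cases "\<Lambda> n = {}")
        case True
        then have "(\<lambda>x. 1) \<in> J y0" using \<Lambda>(2)[OF n] by simp
        from J_mult[OF this g(1)] show ?thesis by simp
      next
        case False
        show ?thesis
        proof (rule J_cong)
          show "(\<lambda>x. \<Sum>w\<in>\<Lambda> n. inverse (\<Prod>c\<in>\<Lambda> n - {w}. (w - c)) * (\<Phi> n w x * g x)) \<in> J y0"
            by (rule J_sum, rule J_cmult, rule all)
          fix x
          have "degree (1 :: complex poly) < card (\<Lambda> n)" using False \<Lambda>(1)[OF n] by (simp add: card_gt_0_iff)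
          from poly_interpolation[OF \<Lambda>(1)[OF n] this, of "x n"]
          have "1 = (\<Sum>w\<in>\<Lambda> n. \<Prod>c\<in>\<Lambda> n - {w}. (x n - c) / (w - c))" by simp
          also have "\<dots> = (\<Sum>w\<in>\<Lambda> n. inverse (\<Prod>c\<in>\<Lambda> n - {w}. (w - c)) * \<Phi> n w x)"
            unfolding \<Phi>_def prod_dividef by (simp add: divide_inverse mult.commute)
          finally have "g x = (\<Sum>w\<in>\<Lambda> n. inverse (\<Prod>c\<in>\<Lambda> n - {w}. (w - c)) * \<Phi> n w x) * g x" by simp
          then show "(\<Sum>w\<in>\<Lambda> n. inverse (\<Prod>c\<in>\<Lambda> n - {w}. (w - c)) * (\<Phi> n w x * g x)) = g x"
            by (simp add: sum_distrib_right mult.assoc)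
        qed
      qed
      then show False using g(2) by simp
    qed
    then obtain w where w: "w \<in> \<Lambda> n" "(\<lambda>x. \<Phi> n w x * g x) \<notin> J y0" by blast
    have "(\<lambda>x. f x * (\<Prod>k<Suc n. \<Phi> k ((v(n := w)) k) x)) = (\<lambda>x. \<Phi> n w x * g x)"
    proof
      fix x
      have "(\<Prod>k<n. \<Phi> k ((v(n := w)) k) x) = (\<Prod>k<n. \<Phi> k (v k) x)" by (intro prod.cong) auto
      then show "f x * (\<Prod>k<Suc n. \<Phi> k ((v(n := w)) k) x) = \<Phi> n w x * g x" by (simp add: g_def mult_ac)
    qed
    then show ?case using v(1) w by (intro exI[of _ "v(n := w)"]) (auto simp: less_Suc_eq)
  qed
  from this[of N] obtain v where v: "\<forall>k<N. v k \<in> \<Lambda> k" "(\<lambda>x. f x * (\<Prod>k<N. \<Phi> k (v k) x)) \<notin> J y0" by auto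
  \<comment> \<open>Up to a scalar, \<open>e\<close> is the Lagrange idempotent of the point
    \<open>p\<close>: modulo \<open>J y0\<close> every \<open>g\<close> acts on it as
    \<open>g p\<close>. As \<open>e\<close> is not in \<open>J y0\<close>, polynomials in
    \<open>J y0\<close> vanish at \<open>p\<close>, which places \<open>p\<close> on the
    fibre.\<close>
  define e where "e = (\<lambda>x. \<Prod>k<N. \<Phi> k (v k) x)"
  define p where "p = (\<lambda>k. if k < N then v k else 0)"
  have poly_e: "poly_fun N e" unfolding e_def by (rule poly_P) simp
  have fe: "(\<lambda>x. f x * e x) \<notin> J y0" using v(2) by (simp add: e_def)
  have e: "e \<notin> J y0" using fe J_mult[OF _ f(1)] by blast
  have coord: "(\<lambda>x. (x k - p k) * e x) \<in> J y0" if k: "k < N" for k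
  proof (rule J_cong)
    show "(\<lambda>x. (\<Prod>j\<in>{..<N} - {k}. \<Phi> j (v j) x) * (\<Prod>\<mu>\<in>\<Lambda> k. (x k - \<mu>))) \<in> J y0"
      by (rule J_mult[OF \<Lambda>(2)[OF k]]) (intro poly_fun_prod poly_l, auto)
    fix x
    have "(\<Prod>\<mu>\<in>\<Lambda> k. (x k - \<mu>)) = (x k - v k) * \<Phi> k (v k) x"
      unfolding \<Phi>_def using v(1) k \<Lambda>(1)[OF k] by (intro prod.remove) auto
    moreover have "e x = \<Phi> k (v k) x * (\<Prod>j\<in>{..<N} - {k}. \<Phi> j (v j) x)"
      unfolding e_def using k by (intro prod.remove) auto
    ultimately show "(\<Prod>j\<in>{..<N} - {k}. \<Phi> j (v j) x) * (\<Prod>\<mu>\<in>\<Lambda> k. (x k - \<mu>)) = (x k - p k) * e x"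
      using k by (simp add: p_def mult_ac)
  qed
  have ev: "(\<lambda>x. (g x - g p) * e x) \<in> J y0" if "poly_fun N g" for g
    using that
  proof (induction rule: poly_fun.induct)
    case (pf_const c)
    show ?case by (rule J_zero) simp
  next
    case (pf_var k)
    then show ?case by (rule coord)
  next
    case (pf_add g h)
    from J_add[OF pf_add.IH] show ?case by (simp add: algebra_simps)
  next
    case (pf_mult g h)
    have "(\<lambda>x. h x * ((g x - g p) * e x) + g p * ((h x - h p) * e x)) \<in> J y0"
      by (rule J_add[OF J_mult[OF pf_mult.IH(1) pf_mult.hyps(2)] J_cmult[OF pf_mult.IH(2)]])
    then show ?case by (simp add: algebra_simps)
  qed
  have zero_at: "g p = 0" if g: "poly_fun N g" "(\<lambda>x. g x * e x) \<in> J y0" for g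
  proof (rule ccontr)
    assume nz: "g p \<noteq> 0"
    have "(\<lambda>x. inverse (g p) * (g x * e x - (g x - g p) * e x)) \<in> J y0"
      by (rule J_cmult[OF J_diff[OF g(2) ev[OF g(1)]]])
    moreover have "inverse (g p) * (g x * e x - (g x - g p) * e x) = e x" for x
      using nz by (simp add: algebra_simps)
    ultimately show False using e by simp
  qed
  have "p \<in> V"
  proof (rule alg_set_memI[OF V_alg])
    show "p \<in> aff_space N" by (simp add: p_def aff_space_def)
    show "g p = 0" if "poly_fun N g" "\<forall>x\<in>V. g x = 0" for g
      by (rule zero_at[OF that(1)], rule J_zero) (use that(2) in simp)
  qed
  moreover have "Y p i = y0 i" if i: "i \<in> I" for i
  proof -
    have "(\<lambda>x. e x * (Y x i - y0 i)) \<in> J y0"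
      using J_mult[OF J_rp[of "\<lambda>y. y i - y0 i" y0] poly_e] i by (simp add: rp_diff rp_var)
    moreover have "poly_fun N (\<lambda>x. Y x i - y0 i)"
      using poly_fun_pd[OF pd_linmap] by (intro poly_fun_diff) auto
    ultimately have "Y p i - y0 i = 0" by (intro zero_at[where g = "\<lambda>x. Y x i - y0 i"]) (simp_all add: mult.commute)
    then show ?thesis by simp
  qed
  ultimately have "p \<in> fiber y0" by (simp add: fiber_def)
  then have "f p = 0" by (rule f(2))
  then show False using ev[OF f(1)] fe by simp
qed

text \<open>Fibres on which the basis stays independent; these have exactly \<open>d\<close>
  points.\<close>

definition good :: "(nat \<Rightarrow> complex) \<Rightarrow> bool" where
  "good y \<longleftrightarrow> \<delta> y \<noteq> 0 \<and> (\<forall>c. (\<forall>x\<in>fiber y. (\<Sum>j<d. c j * b j x) = 0) \<longrightarrow> (\<forall>j<d. c j = 0))"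

text \<open>A combination of the \<open>b j\<close> vanishing on the fibre lies in
  \<open>J y\<close> by radicality, and \<open>J_basis\<close> makes it trivial. \<open>h\<close>
  collects \<open>\<delta>\<close> and the exceptional polynomial of each coordinate.\<close>

lemma generic_good: "\<exists>h. rp I h \<and> nz h \<and> (\<forall>y. h y \<noteq> 0 \<longrightarrow> good y)"
proof -
  have "\<forall>k. \<exists>\<rho>. k < N \<longrightarrow> rp I \<rho> \<and> nz \<rho> \<and> (\<forall>y0. \<rho> y0 \<noteq> 0 \<longrightarrow>
    (\<exists>p. p \<noteq> 0 \<and> rsquarefree p \<and> (\<lambda>x. poly p (x k)) \<in> J y0))"
    using squarefree_in_J by blast
  from choice[OF this] obtain \<rho> where \<rho>: "\<forall>k. k < N \<longrightarrow> rp I (\<rho> k) \<and> nz (\<rho> k) \<and> (\<forall>y0. \<rho> k y0 \<noteq> 0 \<longrightarrow>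
    (\<exists>p. p \<noteq> 0 \<and> rsquarefree p \<and> (\<lambda>x. poly p (x k)) \<in> J y0))" by (elim exE)
  define h where "h = (\<lambda>y. \<delta> y * (\<Prod>k<N. \<rho> k y))"
  have r1: "rp I (\<lambda>y. \<Prod>k<N. \<rho> k y)" using \<rho> by (intro rp_prod) auto
  have "\<exists>x. \<forall>k\<in>{..<N}. \<rho> k x \<noteq> 0"
    by (rule rp_prod_nonzero[where I = I]) (use \<rho> in \<open>auto simp: nz_def\<close>)
  then have n1: "nz (\<lambda>y. \<Prod>k<N. \<rho> k y)" by (auto simp: nz_def)
  have "rp I h" unfolding h_def by (rule rp_mult[OF \<delta>_rp r1])
  moreover have "nz h" unfolding h_def by (rule nz_mult[OF \<delta>_rp r1 \<delta>_nz n1])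
  moreover have "good y" if hy: "h y \<noteq> 0" for y
    unfolding good_def
  proof (intro conjI allI impI)
    show \<delta>y: "\<delta> y \<noteq> 0" using hy by (auto simp: h_def)
    have sep: "\<exists>p. p \<noteq> 0 \<and> rsquarefree p \<and> (\<lambda>x. poly p (x k)) \<in> J y" if "k < N" for k
    proof -
      have "\<rho> k y \<noteq> 0" using hy that by (auto simp: h_def)
      then show ?thesis using \<rho> that by blast
    qed
    fix c j assume c: "\<forall>x\<in>fiber y. (\<Sum>j<d. c j * b j x) = 0" and j: "j < d"
    have "(\<lambda>x. \<Sum>j<d. c j * b j x) \<in> J y"
    proof (rule vanish_in_J[OF sep])
      show "poly_fun N (\<lambda>x. \<Sum>j<d. c j * b j x)"
        by (rule poly_fun_sum, rule pf_mult, rule pf_const, rule b_poly) simp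
    qed (use c in auto)
    from J_basis[OF \<delta>y this j] show "c j = 0" .
  qed
  ultimately show ?thesis by (intro exI[of _ h]) simp
qed

text \<open>Write \<open>\<delta>\<close> as a combination of the \<open>b j\<close>, multiply by
  \<open>f\<close> and express each \<open>f * b j\<close> in the basis; on a fibre all coefficients
  are constants.\<close>

lemma fiber_span:
  assumes "\<delta> y \<noteq> 0" "poly_fun N f"
  shows "\<exists>c. \<forall>x\<in>fiber y. f x = (\<Sum>j<d. c j * b j x)"
proof -
  from rep_one obtain m where m: "\<forall>i<d. rp I (m i)" "\<forall>x\<in>V. \<delta> (Y x) = (\<Sum>i<d. m i (Y x) * b i x)"
    by (elim exE conjE)
  from rep_mult[OF assms(2)] obtain k \<theta> where \<theta>: "\<forall>i<d. \<forall>j<d. rp I (\<theta> i j)"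
    "\<forall>j<d. \<forall>x\<in>V. \<delta> (Y x) ^ k * (f x * b j x) = (\<Sum>i<d. \<theta> i j (Y x) * b i x)" by (elim exE conjE)
  have "f x = (\<Sum>i<d. (inverse (\<delta> y ^ Suc k) * (\<Sum>j<d. m j y * \<theta> i j y)) * b i x)" if x: "x \<in> fiber y" for x
  proof -
    have xV: "x \<in> V" using x by (simp add: fiber_def)
    have \<delta>x: "\<delta> (Y x) = \<delta> y" by (rule rp_fiber[OF \<delta>_rp x])
    have mx: "m j (Y x) = m j y" if "j < d" for j using rp_fiber[OF _ x] m(1) that by blast
    have \<theta>x: "\<theta> i j (Y x) = \<theta> i j y" if "i < d" "j < d" for i j using rp_fiber[OF _ x] \<theta>(1) that by blast
    have "\<delta> y ^ Suc k * f x = \<delta> y ^ k * f x * \<delta> (Y x)" by (simp add: \<delta>x)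
    also have "\<dots> = \<delta> y ^ k * f x * (\<Sum>j<d. m j y * b j x)" using m(2) xV mx by simp
    also have "\<dots> = (\<Sum>j<d. m j y * (\<delta> (Y x) ^ k * (f x * b j x)))"
      unfolding sum_distrib_left by (intro sum.cong refl) (simp add: \<delta>x mult_ac)
    also have "\<dots> = (\<Sum>j<d. m j y * (\<Sum>i<d. \<theta> i j y * b i x))"
      using \<theta>(2) xV \<theta>x by (intro sum.cong) auto
    also have "\<dots> = (\<Sum>j<d. \<Sum>i<d. m j y * \<theta> i j y * b i x)"
      unfolding sum_distrib_left by (intro sum.cong refl) (simp add: mult_ac)
    also have "\<dots> = (\<Sum>i<d. \<Sum>j<d. m j y * \<theta> i j y * b i x)" by (rule sum.swap)
    finally have "\<delta> y ^ Suc k * f x = (\<Sum>i<d. (\<Sum>j<d. m j y * \<theta> i j y) * b i x)"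
      by (simp add: sum_distrib_right)
    then have "f x = inverse (\<delta> y ^ Suc k) * (\<Sum>i<d. (\<Sum>j<d. m j y * \<theta> i j y) * b i x)"
      using assms(1) by (simp add: field_simps)
    also have "\<dots> = (\<Sum>i<d. inverse (\<delta> y ^ Suc k) * ((\<Sum>j<d. m j y * \<theta> i j y) * b i x))"
      by (rule sum_distrib_left)
    finally show ?thesis by (simp only: mult.assoc)
  qed
  then show ?thesis by (intro exI[of _ "\<lambda>i. inverse (\<delta> y ^ Suc k) * (\<Sum>j<d. m j y * \<theta> i j y)"] ballI)
qed

text \<open>Indicator functions of more than \<open>d\<close> points would be dependent, being
  combinations of \<open>d\<close> functions on the fibre.\<close>

lemma fiber_card_le:
  assumes "\<delta> y \<noteq> 0" "finite Z" "Z \<subseteq> fiber y"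
  shows "card Z \<le> d"
proof (rule ccontr)
  assume "\<not> ?thesis"
  then have gt: "card {..<d} < card Z" by simp
  have "Z \<subseteq> aff_space N" using assms(3) V_aff by (auto simp: fiber_def)
  from separating_polys[OF assms(2) this] obtain q e where e: "\<And>z. z \<in> Z \<Longrightarrow> pd {..<N} q (e z)"
    "\<And>z z'. z \<in> Z \<Longrightarrow> z' \<in> Z \<Longrightarrow> e z z' = (if z = z' then 1 else 0)" by metis
  have "\<forall>z. \<exists>c. z \<in> Z \<longrightarrow> (\<forall>x\<in>fiber y. e z x = (\<Sum>j<d. c j * b j x))"
    using fiber_span[OF assms(1) poly_fun_pd[OF e(1)]] by blast
  from choice[OF this] obtain c where c: "\<forall>z. z \<in> Z \<longrightarrow> (\<forall>x\<in>fiber y. e z x = (\<Sum>j<d. c z j * b j x))"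
    by (elim exE)
  from lin_dep[OF _ assms(2) gt, of c] obtain a where a: "\<exists>z\<in>Z. a z \<noteq> 0" "\<forall>j\<in>{..<d}. (\<Sum>z\<in>Z. a z * c z j) = 0"
    by auto
  have "(\<Sum>z\<in>Z. a z * e z x) = 0" if "x \<in> fiber y" for x
  proof -
    have "(\<Sum>z\<in>Z. a z * e z x) = (\<Sum>z\<in>Z. \<Sum>j<d. a z * c z j * b j x)"
      using c that by (intro sum.cong) (auto simp: sum_distrib_left mult.assoc)
    also have "\<dots> = (\<Sum>j<d. (\<Sum>z\<in>Z. a z * c z j) * b j x)"
      by (subst sum.swap) (simp add: sum_distrib_right)
    finally show ?thesis using a(2) by simp
  qed
  moreover have "(\<Sum>z\<in>Z. a z * e z x) = a x" if "x \<in> Z" for x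
  proof -
    have "(\<Sum>z\<in>Z. a z * e z x) = (\<Sum>z\<in>Z. if z = x then a z else 0)"
      using e(2) that by (intro sum.cong) auto
    then show ?thesis using assms(2) that by simp
  qed
  ultimately show False using a(1) assms(3) by (metis subsetD)
qed

lemma good_fiber:
  assumes "good y"
  shows "finite (fiber y)" "card (fiber y) = d"
proof -
  have \<delta>y: "\<delta> y \<noteq> 0" using assms by (simp add: good_def)
  show fin: "finite (fiber y)"
  proof (rule ccontr)
    assume "infinite (fiber y)"
    then obtain Z where "Z \<subseteq> fiber y" "finite Z" "card Z = Suc d"
      using infinite_arbitrarily_large by blast
    then show False using fiber_card_le[OF \<delta>y, of Z] by simp
  qed
  have "\<not> card (fiber y) < d"
  proof
    assume "card (fiber y) < d"
    then have "card (fiber y) < card {..<d}" by simp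
    from lin_dep[OF fin _ this, of b] obtain c where c: "\<exists>j\<in>{..<d}. c j \<noteq> 0"
      "\<forall>x\<in>fiber y. (\<Sum>j<d. c j * b j x) = 0" by auto
    then show False using assms unfolding good_def by blast
  qed
  then show "card (fiber y) = d" using fiber_card_le[OF \<delta>y fin] by simp
qed

end

section \<open>Monic relations and lifting of their roots\<close>

context noether_var
begin

lemma fiber_sub: "x \<in> fiber y \<Longrightarrow> x \<in> V"
  by (simp add: fiber_def)

text \<open>With the powers of \<open>f\<close> below \<open>n\<close> in the basis, no nonzero
  polynomial of degree below \<open>n\<close> kills \<open>f\<close> on a good fibre. So the
  polynomial whose roots are the values of \<open>f\<close> there leaves remainder 0 modulo the
  relation, and every root of the relation is such a value.\<close>

lemma roots_generic:
  assumes f: "poly_fun N f" and mr: "minrel f n q"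
  shows "\<exists>h. rp I h \<and> nz h \<and> (\<forall>y. h y \<noteq> 0 \<longrightarrow> q n y \<noteq> 0 \<and>
    (\<forall>t. (\<Sum>l\<le>n. q l y * t ^ l) = 0 \<longrightarrow> (\<exists>x\<in>fiber y. f x = t)))"
proof -
  have m: "n > 0" "rind n (\<lambda>l x. f x ^ l)" "\<forall>l\<le>n. rp I (q l)" "nz (q n)"
    "\<forall>x\<in>V. (\<Sum>l\<le>n. q l (Y x) * f x ^ l) = 0" using mr unfolding minrel_def by auto
  from basis_exists[OF m(2) poly_fun_power[OF f]] obtain d b \<delta>
    where nb: "noether_basis N V I L A K d b \<delta>" and nd: "n \<le> d" and bl: "\<forall>j<n. b j = (\<lambda>x. f x ^ j)"
    by (elim exE conjE)
  interpret B: noether_basis N V I L A K d b \<delta> by (rule nb)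
  from B.generic_good obtain h where h: "rp I h" "nz h" "\<forall>y. h y \<noteq> 0 \<longrightarrow> B.good y"
    by (elim exE conjE)
  have rq: "rp I (q n)" using m(3) by simp
  have "q n y \<noteq> 0 \<and> (\<forall>t. (\<Sum>l\<le>n. q l y * t ^ l) = 0 \<longrightarrow> (\<exists>x\<in>fiber y. f x = t))"
    if hy: "h y * q n y \<noteq> 0" for y
  proof (intro conjI allI impI)
    show qn: "q n y \<noteq> 0" using hy by simp
    fix t assume t: "(\<Sum>l\<le>n. q l y * t ^ l) = 0"
    have good: "B.good y" using h(3) hy by simp
    define g where "g = (\<Sum>l\<le>n. monom (q l y) l)"
    have gp: "poly g u = (\<Sum>l\<le>n. q l y * u ^ l)" for u unfolding g_def by (rule poly_sum_monom)
    have "coeff g n = q n y" by (simp add: g_def coeff_sum)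
    then have g0: "g \<noteq> 0" using qn by auto
    have dg: "degree g \<le> n" unfolding g_def
      by (intro degree_sum_le finite_atMost) (metis atMost_iff degree_monom_le le_trans)
    define S where "S = f ` fiber y"
    have finS: "finite S" unfolding S_def using B.good_fiber(1)[OF good] by simp
    define Qp where "Qp = (\<Prod>v\<in>S. [:-v, 1:])"
    have Qp: "poly Qp u = (\<Prod>v\<in>S. (u - v))" for u by (simp add: Qp_def poly_prod)
    define r where "r = Qp mod g"
    have rdeg: "r = 0 \<or> degree r < n"
      using degree_mod_less[OF g0, of Qp] dg unfolding r_def by linarith
    have rx: "poly r (f x) = 0" if x: "x \<in> fiber y" for x
    proof -
      have "poly Qp (f x) = 0" using x finS by (auto simp: Qp S_def)
      moreover have "poly g (f x) = 0"
      proof -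
        have "(\<Sum>l\<le>n. q l (Y x) * f x ^ l) = (\<Sum>l\<le>n. q l y * f x ^ l)"
          using m(3) rp_fiber[OF _ x] by (intro sum.cong) auto
        then show ?thesis using m(5) fiber_sub[OF x] by (simp add: gp)
      qed
      moreover have "Qp = Qp div g * g + r" unfolding r_def by simp
      then have "poly Qp (f x) = poly (Qp div g) (f x) * poly g (f x) + poly r (f x)"
        by (metis poly_add poly_mult)
      ultimately show ?thesis by simp
    qed
    have "r = 0"
    proof (rule ccontr)
      assume "r \<noteq> 0"
      then have rn: "degree r < n" using rdeg by simp
      define c where "c = (\<lambda>j. if j < n then coeff r j else 0)"
      have "(\<Sum>j<d. c j * b j x) = 0" if x: "x \<in> fiber y" for x
      proof -
        have "(\<Sum>j<d. c j * b j x) = (\<Sum>j<n. coeff r j * f x ^ j)"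
          using nd bl by (intro sum.mono_neutral_cong_right) (auto simp: c_def)
        also have "\<dots> = (\<Sum>j\<le>degree r. coeff r j * f x ^ j)"
          using rn by (intro sum.mono_neutral_right) (auto simp: coeff_eq_0)
        finally show ?thesis using rx[OF x] by (simp add: poly_altdef)
      qed
      then have "\<forall>j<d. c j = 0" using good unfolding B.good_def by blast
      then have "c (degree r) = 0" using rn nd by simp
      then show False using rn \<open>r \<noteq> 0\<close> by (simp add: c_def)
    qed
    then have "g dvd Qp" by (simp add: r_def mod_eq_0_iff_dvd)
    then obtain w where "Qp = g * w" by (auto elim: dvdE)
    then have "poly Qp t = 0" using t by (simp add: gp)
    then show "\<exists>x\<in>fiber y. f x = t" using finS by (auto simp: Qp S_def)
  qed
  then show ?thesis using rp_mult[OF h(1) rq] nz_mult[OF h(1) rq h(2) m(4)]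
    by (intro exI[of _ "\<lambda>y. h y * q n y"]) simp
qed

abbreviation nrm :: "(nat \<Rightarrow> complex) \<Rightarrow> real" where
  "nrm y \<equiv> 1 + (\<Sum>i\<in>I. cmod (y i))"

lemma nrm_ge1: "1 \<le> nrm y"
  by (simp add: sum_nonneg)

lemma nrm_fiber: "x \<in> fiber y \<Longrightarrow> nrm (Y x) = nrm y"
  by (auto simp: fiber_def intro!: sum.cong)

lemma coord_bound: "x \<in> V \<Longrightarrow> k < N \<Longrightarrow> cmod (x k) \<le> K * nrm (Y x)"
  using pre unfolding prenoether_def by blast

lemma poly_bound_on_V:
  assumes "pd {..<N} s f"
  shows "\<exists>C\<ge>0. \<forall>x\<in>V. cmod (f x) \<le> C * nrm (Y x) ^ s"
proof -
  from pd_growth[OF assms finite_lessThan] obtain C where C: "C \<ge> 0"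
    "\<forall>x. cmod (f x) \<le> C * (1 + (\<Sum>k<N. cmod (x k))) ^ s" by blast
  have "cmod (f x) \<le> C * (1 + real N * K) ^ s * nrm (Y x) ^ s" if x: "x \<in> V" for x
  proof -
    have "(\<Sum>k<N. cmod (x k)) \<le> (\<Sum>k<N. K * nrm (Y x))"
      by (intro sum_mono coord_bound x) auto
    then have "1 + (\<Sum>k<N. cmod (x k)) \<le> nrm (Y x) + real N * (K * nrm (Y x))"
      using nrm_ge1[of "Y x"] by simp
    also have "\<dots> = (1 + real N * K) * nrm (Y x)" by (simp add: algebra_simps)
    finally have "(1 + (\<Sum>k<N. cmod (x k))) ^ s \<le> ((1 + real N * K) * nrm (Y x)) ^ s"
      by (intro power_mono) (simp_all add: add_nonneg_nonneg sum_nonneg)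
    then have "C * (1 + (\<Sum>k<N. cmod (x k))) ^ s \<le> C * ((1 + real N * K) * nrm (Y x)) ^ s"
      using C(1) by (rule mult_left_mono)
    then show ?thesis using C(2)[rule_format, of x] by (simp only: power_mult_distrib mult.assoc)
  qed
  moreover have "0 \<le> C * (1 + real N * K) ^ s" using C(1) K0 by simp
  ultimately show ?thesis by blast
qed

text \<open>The minimal relation can be made monic: its coefficients are symmetric functions of the
  values of \<open>f\<close> on a fibre, hence of polynomial growth.\<close>
definition monicrel :: "((nat \<Rightarrow> complex) \<Rightarrow> complex) \<Rightarrow> nat \<Rightarrow> nat \<Rightarrow> (nat \<Rightarrow> (nat \<Rightarrow> complex) \<Rightarrow> complex) \<Rightarrow> real \<Rightarrow> bool" where
  "monicrel f s n a C \<longleftrightarrow> n > 0 \<and> rind n (\<lambda>l x. f x ^ l) \<and> (\<forall>l<n. rp I (a l)) \<and>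
    (\<forall>x\<in>V. f x ^ n = (\<Sum>l<n. a l (Y x) * f x ^ l)) \<and>
    (\<forall>l<n. \<forall>y. cmod (a l y) \<le> C * nrm y ^ (s * (n - l))) \<and>
    (\<forall>y t. t ^ n = (\<Sum>l<n. a l y * t ^ l) \<longrightarrow> (\<exists>x\<in>fiber y. f x = t))"

text \<open>Approach \<open>y\<close> through generic points; over each take a root near
  \<open>t\<close> and a fibre point realising it. The growth clause of \<open>prenoether\<close>
  keeps these points bounded, and a limit point lies over \<open>y\<close> with value
  \<open>t\<close>. This is properness of the projection.\<close>

lemma lifting:
  assumes f: "poly_fun N f" and n: "n > 0" and a: "\<And>l. l < n \<Longrightarrow> rp I (a l)"
    and h: "rp I h" "h y1 \<noteq> 0"
    and gen: "\<And>y t. h y \<noteq> 0 \<Longrightarrow> t ^ n = (\<Sum>l<n. a l y * t ^ l) \<Longrightarrow> \<exists>x\<in>fiber y. f x = t"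
    and t: "t ^ n = (\<Sum>l<n. a l y * t ^ l)"
  shows "\<exists>x\<in>fiber y. f x = t"
proof -
  define l where "l = (\<lambda>e i. y i + e * (y1 i - y i))"
  have fz: "finite {e. h (l e) = 0}" unfolding l_def
    by (rule rp_line_zeros_finite[where f = h and x = y and s = 1 and v = "\<lambda>i. y1 i - y i", OF h(1)])
      (use h(2) in simp)
  define e0 where "e0 = (\<lambda>j. complex_of_real (inverse (real (Suc j))))"
  have inj: "inj e0" unfolding e0_def by (intro injI) simp
  have "finite (e0 -` {e. h (l e) = 0})" by (rule finite_vimageI[OF fz inj])
  then have "\<exists>m. \<forall>j\<in>e0 -` {e. h (l e) = 0}. j < m"
    by (simp only: finite_nat_set_iff_bounded)
  then obtain m where m: "\<forall>j\<in>e0 -` {e. h (l e) = 0}. j < m" by (elim exE)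
  \<comment> \<open>The shift skips the finitely many parameters at which \<open>h\<close>
    vanishes.\<close>
  define e where "e = (\<lambda>j. e0 (j + m))"
  have eh: "h (l (e j)) \<noteq> 0" for j
  proof
    assume "h (l (e j)) = 0"
    then have "j + m \<in> e0 -` {e. h (l e) = 0}" by (simp add: e_def)
    from bspec[OF m this] show False by simp
  qed
  have e0lim: "e0 \<longlonglongrightarrow> complex_of_real 0"
    unfolding e0_def by (intro tendsto_of_real LIMSEQ_inverse_real_of_nat)
  have elim: "e \<longlonglongrightarrow> 0" using LIMSEQ_ignore_initial_segment[OF e0lim, of m] by (simp add: e_def)
  have e1: "cmod (e j) \<le> 1" for j
    unfolding e_def e0_def norm_of_real by (simp add: inverse_eq_divide)
  have llim: "(\<lambda>j. l (e j) i) \<longlonglongrightarrow> y i" for i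
  proof -
    have "(\<lambda>j. y i + e j * (y1 i - y i)) \<longlonglongrightarrow> y i + 0 * (y1 i - y i)" by (intro tendsto_intros elim)
    then show ?thesis by (simp add: l_def)
  qed
  have alim: "(\<lambda>j. a k (l (e j))) \<longlonglongrightarrow> a k y" if k: "k < n" for k
  proof -
    obtain c where "pd I c (a k)" using a[OF k] by (rule rpE)
    then show ?thesis by (rule pd_tendsto) (rule llim)
  qed
  \<comment> \<open>These polynomials are monic and their values at \<open>t\<close> tend to 0, so
    their roots nearest to \<open>t\<close> converge to \<open>t\<close>.\<close>
  define g where "g = (\<lambda>j. monom 1 n - (\<Sum>k<n. monom (a k (l (e j))) k))"
  have gp: "poly (g j) u = u ^ n - (\<Sum>k<n. a k (l (e j)) * u ^ k)" for j u
    by (simp add: g_def poly_sum poly_monom)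
  have gdeg: "degree (g j) = n" and glc: "lead_coeff (g j) = 1" for j
  proof -
    have "degree (\<Sum>k<n. monom (a k (l (e j))) k) < n"
      using n by (intro degree_sum_less) (auto intro: le_less_trans[OF degree_monom_le])
    then have lt: "degree (\<Sum>k<n. monom (a k (l (e j))) k) < degree (monom (1::complex) n)"
      by (simp add: degree_monom_eq)
    then have "degree (- (\<Sum>k<n. monom (a k (l (e j))) k)) < degree (monom (1::complex) n)"
      by (simp only: degree_minus)
    from degree_add_eq_left[OF this] show d: "degree (g j) = n" unfolding g_def
      by (simp add: degree_monom_eq)
    have "coeff (\<Sum>k<n. monom (a k (l (e j))) k) n = 0" by (simp add: coeff_sum)
    then show "lead_coeff (g j) = 1" unfolding d by (simp add: g_def)
  qed
  have "\<exists>z x. cmod (t - z) ^ n \<le> cmod (poly (g j) t) \<and> x \<in> fiber (l (e j)) \<and> f x = z" for j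
  proof -
    from poly_root_near[OF glc, of j t] obtain z where z: "poly (g j) z = 0" "cmod (t - z) ^ n \<le> cmod (poly (g j) t)"
      using n gdeg by auto
    have "\<exists>x\<in>fiber (l (e j)). f x = z" by (rule gen[OF eh]) (use z(1) in \<open>simp add: gp\<close>)
    then show ?thesis using z(2) by blast
  qed
  then have "\<forall>j. \<exists>x. cmod (t - f x) ^ n \<le> cmod (poly (g j) t) \<and> x \<in> fiber (l (e j))" by blast
  from choice[OF this] obtain X where X: "\<forall>j. cmod (t - f (X j)) ^ n \<le> cmod (poly (g j) t) \<and> X j \<in> fiber (l (e j))"
    by (elim exE)
  have XV: "X j \<in> V" for j using X fiber_sub by blast
  have YX: "Y (X j) i = l (e j) i" if "i \<in> I" for i j using X that by (auto simp: fiber_def)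
  define B where "B = K * (1 + (\<Sum>i\<in>I. cmod (y i) + cmod (y1 i - y i)))"
  have XB: "cmod (X j k) \<le> B" if k: "k < N" for j k
  proof -
    have "nrm (Y (X j)) \<le> 1 + (\<Sum>i\<in>I. cmod (y i) + cmod (y1 i - y i))"
    proof (intro add_left_mono sum_mono)
      fix i assume i: "i \<in> I"
      have "cmod (Y (X j) i) \<le> cmod (y i) + cmod (e j * (y1 i - y i))"
        unfolding YX[OF i] l_def by (rule norm_triangle_ineq)
      also have "cmod (e j * (y1 i - y i)) \<le> 1 * cmod (y1 i - y i)"
        unfolding norm_mult using e1 by (intro mult_right_mono) auto
      finally show "cmod (Y (X j) i) \<le> cmod (y i) + cmod (y1 i - y i)" by simp
    qed
    then have "K * nrm (Y (X j)) \<le> B" unfolding B_def using K0 by (rule mult_left_mono)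
    then show ?thesis using coord_bound[OF XV k, of j] by linarith
  qed
  have "\<exists>s x. strict_mono (s :: nat \<Rightarrow> nat) \<and> (\<forall>k<N. (\<lambda>j. X (s j) k) \<longlonglongrightarrow> x k)"
    by (rule bounded_coords_subseq) (rule XB)
  then obtain \<sigma> x0
    where \<sigma>: "strict_mono (\<sigma> :: nat \<Rightarrow> nat)" "\<forall>k<N. (\<lambda>j. X (\<sigma> j) k) \<longlonglongrightarrow> x0 k" by (elim exE conjE)
  define x where "x = (\<lambda>k. if k < N then x0 k else 0)"
  have xlim: "(\<lambda>j. X (\<sigma> j) k) \<longlonglongrightarrow> x k" if "k \<in> {..<N}" for k
    using \<sigma>(2) that by (simp add: x_def)
  have flim: "(\<lambda>j. p (X (\<sigma> j))) \<longlonglongrightarrow> p x" if p: "poly_fun N p" for p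
  proof -
    obtain c where "pd {..<N} c p" using p poly_fun_iff by blast
    then show ?thesis by (rule pd_tendsto) (rule xlim)
  qed
  have "x \<in> V"
  proof (rule alg_set_memI[OF V_alg])
    show "x \<in> aff_space N" by (simp add: x_def aff_space_def)
    fix p assume p: "poly_fun N p" "\<forall>x\<in>V. p x = 0"
    have "(\<lambda>j. p (X (\<sigma> j))) \<longlonglongrightarrow> 0" using p(2) XV by simp
    then show "p x = 0" using flim[OF p(1)] LIMSEQ_unique by blast
  qed
  moreover have "Y x i = y i" if i: "i \<in> I" for i
  proof -
    have "(\<lambda>j. Y (X (\<sigma> j)) i) \<longlonglongrightarrow> Y x i"
      using flim[of "\<lambda>x. Y x i"] poly_fun_pd[OF pd_linmap] by blast
    moreover have "(\<lambda>j. Y (X (\<sigma> j)) i) \<longlonglongrightarrow> y i"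
      using LIMSEQ_subseq_LIMSEQ[OF llim[of i] \<sigma>(1)] by (simp add: YX[OF i] o_def)
    ultimately show ?thesis by (rule LIMSEQ_unique)
  qed
  moreover have "f x = t"
  proof -
    have "(\<lambda>j. poly (g j) t) \<longlonglongrightarrow> t ^ n - (\<Sum>k<n. a k y * t ^ k)"
      unfolding gp by (intro tendsto_diff tendsto_const tendsto_sum tendsto_mult alim) auto
    then have "(\<lambda>j. cmod (poly (g j) t)) \<longlonglongrightarrow> 0" using t by (simp add: tendsto_norm_zero)
    then have "(\<lambda>j. root n (cmod (poly (g j) t))) \<longlonglongrightarrow> root n 0" by (rule tendsto_real_root)
    then have r0: "(\<lambda>j. root n (cmod (poly (g j) t))) \<longlonglongrightarrow> 0" using n by simp
    have "cmod (t - f (X j)) \<le> root n (cmod (poly (g j) t))" for j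
    proof -
      have "cmod (t - f (X j)) = root n (cmod (t - f (X j)) ^ n)" using n by (simp add: real_root_power_cancel)
      also have "\<dots> \<le> root n (cmod (poly (g j) t))" using X n by (intro real_root_le_mono) auto
      finally show ?thesis .
    qed
    then have "(\<lambda>j. t - f (X j)) \<longlonglongrightarrow> 0"
      by (intro Lim_null_comparison[OF _ r0] always_eventually allI)
    then have "(\<lambda>j. t - (t - f (X j))) \<longlonglongrightarrow> t - 0" by (intro tendsto_diff tendsto_const)
    then have "(\<lambda>j. f (X j)) \<longlonglongrightarrow> t" by simp
    from LIMSEQ_subseq_LIMSEQ[OF this \<sigma>(1)] have "(\<lambda>j. f (X (\<sigma> j))) \<longlonglongrightarrow> t" by (simp add: o_def)
    then show ?thesis using flim[OF f] LIMSEQ_unique by blast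
  qed
  ultimately show ?thesis by (intro bexI[of _ x]) (auto simp: fiber_def)
qed

text \<open>On the generic locus the roots of the minimal relation are values of \<open>f\<close>,
  which bounds \<open>q l\<close> by \<open>q n\<close> times a power of \<open>nrm\<close>;
  \<open>rp_div_of_bound\<close> turns the quotient into a polynomial. \<open>lifting\<close>
  extends the root property to the remaining fibres.\<close>

lemma monicrel_exists:
  assumes f: "pd {..<N} s f"
  shows "\<exists>n a C. monicrel f s n a C"
proof -
  have pf: "poly_fun N f" by (rule poly_fun_pd[OF f])
  from minrel_exists[OF pf] obtain n q where mr: "minrel f n q" by (elim exE)
  have m: "n > 0" "rind n (\<lambda>l x. f x ^ l)" "\<forall>l\<le>n. rp I (q l)" "nz (q n)"
    "\<forall>x\<in>V. (\<Sum>l\<le>n. q l (Y x) * f x ^ l) = 0" using mr unfolding minrel_def by auto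
  have rq: "rp I (q n)" using m(3) by simp
  from m(4) obtain yq where yq: "q n yq \<noteq> 0" unfolding nz_def by blast
  from roots_generic[OF pf mr] obtain h where h: "rp I h" "nz h" "\<forall>y. h y \<noteq> 0 \<longrightarrow> q n y \<noteq> 0 \<and>
    (\<forall>t. (\<Sum>l\<le>n. q l y * t ^ l) = 0 \<longrightarrow> (\<exists>x\<in>fiber y. f x = t))" by (elim exE conjE)
  from h(2) obtain y1 where y1: "h y1 \<noteq> 0" unfolding nz_def by blast
  from poly_bound_on_V[OF f] obtain C where C: "C \<ge> 0" "\<forall>x\<in>V. cmod (f x) \<le> C * nrm (Y x) ^ s" by blast
  \<comment> \<open>\<open>2 ^ n\<close> comes from \<open>poly_coeff_root_bound\<close>;
    \<open>(1 + C) ^ n\<close> dominates \<open>C ^ (n - l)\<close> for every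
    \<open>l\<close>.\<close>
  define D where "D = 2 ^ n * (1 + C) ^ n"
  have bd0: "cmod (q l y) \<le> D * cmod (q n y) * nrm y ^ (s * (n - l))" if l: "l < n" and hy: "h y \<noteq> 0" for l y
  proof -
    define g where "g = (\<Sum>l\<le>n. monom (q l y) l)"
    have gp: "poly g u = (\<Sum>l\<le>n. q l y * u ^ l)" for u unfolding g_def by (rule poly_sum_monom)
    have cg: "coeff g j = q j y" if "j \<le> n" for j using that by (simp add: g_def coeff_sum)
    have qn: "q n y \<noteq> 0" using h(3) hy by blast
    have "degree g \<le> n" unfolding g_def
      by (intro degree_sum_le finite_atMost) (metis atMost_iff degree_monom_le le_trans)
    moreover have "n \<le> degree g" by (rule le_degree) (use cg qn in simp)
    ultimately have dg: "degree g = n" by simp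
    have "cmod (coeff g l) \<le> cmod (lead_coeff g) * (2 ^ degree g * (C * nrm y ^ s) ^ (degree g - l))"
    proof (rule poly_coeff_root_bound)
      fix z assume "poly g z = 0"
      then obtain x where x: "x \<in> fiber y" "f x = z" using h(3) hy unfolding gp by blast
      then show "cmod z \<le> C * nrm y ^ s" using C(2) fiber_sub[OF x(1)] nrm_fiber[OF x(1)] by metis
    next
      show "0 \<le> C * nrm y ^ s" using C(1) nrm_ge1[of y] by simp
    qed (use l dg in simp)
    then have "cmod (q l y) \<le> cmod (q n y) * (2 ^ n * (C ^ (n - l) * nrm y ^ (s * (n - l))))"
      using l by (simp add: dg cg power_mult_distrib power_mult)
    also have "\<dots> \<le> cmod (q n y) * (2 ^ n * ((1 + C) ^ n * nrm y ^ (s * (n - l))))"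
    proof (intro mult_left_mono mult_right_mono)
      have "C ^ (n - l) \<le> (1 + C) ^ (n - l)" using C(1) by (intro power_mono) auto
      also have "\<dots> \<le> (1 + C) ^ n" using C(1) by (intro power_increasing) auto
      finally show "C ^ (n - l) \<le> (1 + C) ^ n" .
    qed (use nrm_ge1[of y] in auto)
    finally show ?thesis by (simp add: D_def mult_ac)
  qed
  have bd: "cmod (q l y) \<le> D * cmod (q n y) * nrm y ^ (s * (n - l))" if l: "l < n" for l y
    by (rule rp_bound_extend[OF _ rq h(1) y1 finI]) (use m(3) l bd0 in auto)
  have "\<forall>l. \<exists>a. l < n \<longrightarrow> rp I a \<and> (\<forall>y. q l y = q n y * a y)"
  proof
    fix l
    show "\<exists>a. l < n \<longrightarrow> rp I a \<and> (\<forall>y. q l y = q n y * a y)"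
    proof (cases "l < n")
      case True
      have "rp I (q l)" using m(3) True by simp
      from rp_div_of_bound[OF finI this rq yq bd[OF True]] show ?thesis by blast
    qed blast
  qed
  from choice[OF this] obtain a0 where a0: "\<forall>l. l < n \<longrightarrow> rp I (a0 l) \<and> (\<forall>y. q l y = q n y * a0 l y)"
    by (elim exE)
  define a where "a = (\<lambda>l y. - a0 l y)"
  have a: "rp I (a l)" "q l y = - (q n y * a l y)" if "l < n" for l y
    using a0 that by (auto simp: a_def intro: rp_uminus)
  have ga: "cmod (a l y) \<le> D * nrm y ^ (s * (n - l))" if l: "l < n" for l y
  proof -
    have "cmod (a l y) \<le> D * cmod (1::complex) * nrm y ^ (s * (n - l))"
    proof (rule rp_bound_extend[where Q = "\<lambda>_. 1" and h = "q n" and ?y1.0 = yq, OF a(1)[OF l] rp_const rq yq finI])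
      fix y assume qy: "q n y \<noteq> 0"
      have "cmod (q n y) * cmod (a l y) \<le> cmod (q n y) * (D * nrm y ^ (s * (n - l)))"
        using bd[OF l, of y] a(2)[OF l, of y] by (simp add: norm_mult mult_ac)
      then show "cmod (a l y) \<le> D * cmod (1::complex) * nrm y ^ (s * (n - l))"
        using qy by (simp add: mult_le_cancel_left)
    qed
    then show ?thesis by simp
  qed
  have sumq: "(\<Sum>l\<le>n. q l y * t ^ l) = q n y * (t ^ n - (\<Sum>l<n. a l y * t ^ l))" for y t
  proof -
    have "(\<Sum>l<n. q l y * t ^ l) = - (q n y * (\<Sum>l<n. a l y * t ^ l))"
      unfolding sum_distrib_left sum_negf[symmetric] by (intro sum.cong refl) (simp add: a(2))
    then show ?thesis by (simp add: lessThan_Suc_atMost[symmetric] right_diff_distrib)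
  qed
  have polyd: "poly_fun N (\<lambda>x. f x ^ n - (\<Sum>l<n. a l (Y x) * f x ^ l))"
    by (rule poly_fun_diff, rule poly_fun_power[OF pf], rule poly_fun_sum, rule pf_mult,
      rule poly_fun_rp, rule a(1), simp, rule poly_fun_power[OF pf])
  have rel: "f x ^ n - (\<Sum>l<n. a l (Y x) * f x ^ l) = 0" if "x \<in> V" for x
    by (rule rp_cancel[where q = "q n" and f = "\<lambda>x. f x ^ n - (\<Sum>l<n. a l (Y x) * f x ^ l)", OF rq yq polyd _ that])
      (use m(5) sumq in simp)
  have "\<exists>x\<in>fiber y. f x = t" if "t ^ n = (\<Sum>l<n. a l y * t ^ l)" for y t
  proof (rule lifting[OF pf m(1) a(1) h(1) y1 _ that])
    fix y t assume "h y \<noteq> 0" "t ^ n = (\<Sum>l<n. a l y * t ^ l)"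
    then show "\<exists>x\<in>fiber y. f x = t" using h(3) sumq[of y t] by simp
  qed
  then have "monicrel f s n a D"
    unfolding monicrel_def using m(1,2) a(1) ga rel by simp
  then show ?thesis by (intro exI)
qed

end

section \<open>Spreading zeros along a coordinate line\<close>

context noether_basis
begin

text \<open>Near a good point \<open>c\<close> of the line, a function vanishing on the fibre over \<open>c\<close> is
  \<open>O(|\<tau> - c|)\<close> on the fibre over \<open>\<tau>\<close>, so the coefficient \<open>a l\<close> of its monic relation has
  a zero of order \<open>n - l\<close> at \<open>c\<close>; with \<open>s + 1\<close> such points it has too many zeros.\<close>
lemma line_vanish:
  assumes f: "pd {..<N} s f" and i: "i \<in> I" and B: "card B = s + 1"
    and good: "\<And>c. c \<in> B \<Longrightarrow> good (y(i := c))"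
    and van: "\<And>c x. c \<in> B \<Longrightarrow> x \<in> fiber (y(i := c)) \<Longrightarrow> f x = 0"
    and x: "x \<in> fiber (y(i := \<tau>))"
  shows "f x = 0"
proof -
  have pf: "poly_fun N f" by (rule poly_fun_pd[OF f])
  have finB: "finite B" using B by (intro card_ge_0_finite) simp
  from monicrel_exists[OF f] obtain n a C where mr: "monicrel f s n a C" by (elim exE)
  have m: "n > 0" "\<forall>l<n. rp I (a l)" "\<forall>x\<in>V. f x ^ n = (\<Sum>l<n. a l (Y x) * f x ^ l)"
    "\<forall>l<n. \<forall>y. cmod (a l y) \<le> C * nrm y ^ (s * (n - l))"
    "\<forall>y t. t ^ n = (\<Sum>l<n. a l y * t ^ l) \<longrightarrow> (\<exists>x\<in>fiber y. f x = t)"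
    using mr unfolding monicrel_def by auto
  from rep_mult[OF pf] obtain k \<theta> where \<theta>: "\<forall>i<d. \<forall>j<d. rp I (\<theta> i j)"
    "\<forall>j<d. \<forall>x\<in>V. \<delta> (Y x) ^ k * (f x * b j x) = (\<Sum>i<d. \<theta> i j (Y x) * b i x)" by (elim exE conjE)
  from rp_line_poly[OF \<delta>_rp, of y i] obtain D where D: "\<forall>t. \<delta> (y(i := t)) = poly D t" by (elim exE)
  have "\<forall>g. \<exists>p. rp I g \<longrightarrow> (\<forall>t. g (y(i := t)) = poly p t)" using rp_line_poly by blast
  from choice[OF this] obtain lp where lp: "\<forall>g. rp I g \<longrightarrow> (\<forall>t. g (y(i := t)) = poly (lp g) t)" by (elim exE)
  define \<Theta> where "\<Theta> = (\<lambda>g h. lp (\<theta> g h))"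
  have \<Theta>: "\<theta> g h (y(i := t)) = poly (\<Theta> g h) t" if "g < d" "h < d" for g h t
    using lp \<theta>(1) that by (simp add: \<Theta>_def)
  define \<alpha> where "\<alpha> = (\<lambda>l. lp (a l))"
  have \<alpha>: "a l (y(i := t)) = poly (\<alpha> l) t" if "l < n" for l t
    using lp m(2) that by (simp add: \<alpha>_def)
  have finI: "finite I" by (rule finI)
  have nrm_line: "nrm (y(i := t)) \<le> nrm y * (1 + cmod t)" for t
  proof -
    have "(\<Sum>j\<in>I. cmod ((y(i := t)) j)) = cmod t + (\<Sum>j\<in>I - {i}. cmod ((y(i := t)) j))"
      using i finI by (subst sum.remove[of I i]) auto
    also have "(\<Sum>j\<in>I - {i}. cmod ((y(i := t)) j)) = (\<Sum>j\<in>I - {i}. cmod (y j))"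
      by (intro sum.cong) auto
    also have "\<dots> \<le> (\<Sum>j\<in>I. cmod (y j))" using finI by (intro sum_mono2) auto
    finally have "nrm (y(i := t)) \<le> 1 + cmod t + (\<Sum>j\<in>I. cmod (y j))" by simp
    moreover have "0 \<le> (\<Sum>j\<in>I. cmod (y j)) * cmod t" by (intro mult_nonneg_nonneg sum_nonneg) auto
    ultimately show ?thesis by (simp add: algebra_simps)
  qed
  have \<alpha>_deg: "degree (\<alpha> l) \<le> s * (n - l)" if l: "l < n" for l
  proof (rule poly_degree_of_bound)
    fix t
    have "cmod (poly (\<alpha> l) t) \<le> C * nrm (y(i := t)) ^ (s * (n - l))"
      using m(4) l \<alpha>[OF l, of t] by metis
    also have "\<dots> \<le> \<bar>C\<bar> * (nrm y * (1 + cmod t)) ^ (s * (n - l))"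
      using nrm_line[of t] nrm_ge1[of "y(i := t)"] by (intro mult_mono power_mono) auto
    finally show "cmod (poly (\<alpha> l) t) \<le> \<bar>C\<bar> * nrm y ^ (s * (n - l)) * (1 + cmod t) ^ (s * (n - l))"
      by (simp add: power_mult_distrib mult.assoc)
  qed
  have zero_order: "n - l \<le> order c (\<alpha> l)" if c: "c \<in> B" and l: "l < n" and nz: "\<alpha> l \<noteq> 0" for c l
  proof -
    have Dc: "poly D c \<noteq> 0" using good[OF c] D by (simp add: good_def)
    then have D0: "D \<noteq> 0" by auto
    \<comment> \<open>\<open>f\<close> vanishes on the fibre over \<open>c\<close>, so each column
      of its multiplication matrix is a combination of the basis vanishing there; goodness of the
      fibre makes the matrix zero at \<open>c\<close>.\<close>
    have "poly (\<Theta> g h) c = 0" if gh: "g < d" "h < d" for g h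
    proof -
      have "(\<Sum>g<d. \<theta> g h (y(i := c)) * b g x) = 0" if x: "x \<in> fiber (y(i := c))" for x
      proof -
        have "(\<Sum>g<d. \<theta> g h (y(i := c)) * b g x) = (\<Sum>g<d. \<theta> g h (Y x) * b g x)"
        proof (intro sum.cong refl arg_cong2[where f = "(*)"])
          fix g assume "g \<in> {..<d}"
          then have "rp I (\<theta> g h)" using \<theta>(1) gh(2) by simp
          from rp_fiber[OF this x] show "\<theta> g h (y(i := c)) = \<theta> g h (Y x)" by simp
        qed
        also have "\<dots> = \<delta> (Y x) ^ k * (f x * b h x)" using \<theta>(2) gh(2) fiber_sub[OF x] by simp
        finally show ?thesis using van[OF c x] by simp
      qed
      then have "\<theta> g h (y(i := c)) = 0"
        using good[OF c] gh(1) unfolding good_def by (elim conjE allE[of _ "\<lambda>g. \<theta> g h (y(i := c))"]) simp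
      then show ?thesis using \<Theta>[OF gh] by simp
    qed
    then have "\<forall>g h. \<exists>u. g < d \<and> h < d \<longrightarrow> \<Theta> g h = [:-c, 1:] * u" using poly_root_factor by blast
    then have "\<forall>gh. \<exists>u. fst gh < d \<and> snd gh < d \<longrightarrow> \<Theta> (fst gh) (snd gh) = [:-c, 1:] * u" by blast
    from choice[OF this] obtain \<Psi> where \<Psi>: "\<forall>gh. fst gh < d \<and> snd gh < d \<longrightarrow>
      \<Theta> (fst gh) (snd gh) = [:-c, 1:] * \<Psi> gh" by (elim exE)
    define S where "S = (\<lambda>t. \<Sum>g<d. \<Sum>h<d. cmod (poly (\<Psi> (g, h)) t))"
    have S0: "0 \<le> S t" for t unfolding S_def by (intro sum_nonneg) auto
    have val: "cmod (f x) * cmod (poly D t) ^ k \<le> cmod (t - c) * S t"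
      if x: "x \<in> fiber (y(i := t))" and Dt: "poly D t \<noteq> 0" for x t
    proof -
      have xV: "x \<in> V" by (rule fiber_sub[OF x])
      have \<delta>x: "\<delta> (Y x) = poly D t" using rp_fiber[OF \<delta>_rp x] D by simp
      have "\<exists>h<d. b h x \<noteq> 0"
      proof (rule ccontr)
        assume neg: "\<not> ?thesis"
        from rep_one obtain m where "\<forall>x\<in>V. \<delta> (Y x) = (\<Sum>i<d. m i (Y x) * b i x)" by (elim exE conjE)
        then show False using xV neg \<delta>x Dt by simp
      qed
      then obtain h1 where h1: "h1 < d" "b h1 x \<noteq> 0" by blast
      \<comment> \<open>Choosing \<open>h\<close> with \<open>cmod (b h x)\<close> largest bounds
        \<open>f x\<close>, an eigenvalue of the multiplication matrix up to the denominator, by the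
        entries of one column, all divisible by \<open>t - c\<close>.\<close>
      define M where "M = Max ((\<lambda>h. cmod (b h x)) ` {..<d})"
      have "M \<in> (\<lambda>h. cmod (b h x)) ` {..<d}" unfolding M_def using h1(1) by (intro Max_in) auto
      then obtain h where hM: "h \<in> {..<d}" "M = cmod (b h x)" by (elim imageE)
      have h: "cmod (b g x) \<le> cmod (b h x)" if "g < d" for g
        unfolding hM(2)[symmetric] M_def using that by (intro Max_ge) auto
      have bh: "0 < cmod (b h x)" using h[OF h1(1)] h1(2) by (smt (verit) zero_less_norm_iff)
      have "poly D t ^ k * (f x * b h x) = (\<Sum>g<d. \<theta> g h (Y x) * b g x)"
        using \<theta>(2)[rule_format, of h x] hM(1) xV \<delta>x by simp
      also have "\<dots> = (\<Sum>g<d. (t - c) * poly (\<Psi> (g, h)) t * b g x)"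
      proof (intro sum.cong refl arg_cong2[where f = "(*)"])
        fix g assume g: "g \<in> {..<d}"
        have "\<theta> g h (Y x) = \<theta> g h (y(i := t))" using rp_fiber[OF \<theta>(1)[rule_format, of g h] x] g hM(1) by simp
        also have "\<dots> = poly ([:-c, 1:] * \<Psi> (g, h)) t" using \<Theta>[of g h t] \<Psi>[rule_format, of "(g, h)"] g hM(1) by simp
        finally show "\<theta> g h (Y x) = (t - c) * poly (\<Psi> (g, h)) t" unfolding poly_linear_mult .
      qed
      finally have "cmod (poly D t ^ k * (f x * b h x)) \<le> (\<Sum>g<d. cmod ((t - c) * poly (\<Psi> (g, h)) t * b g x))"
        by (simp only: norm_sum)
      also have "\<dots> \<le> (\<Sum>g<d. cmod (t - c) * cmod (poly (\<Psi> (g, h)) t) * cmod (b h x))"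
        unfolding norm_mult using h by (intro sum_mono mult_left_mono) auto
      also have "\<dots> = cmod (t - c) * (\<Sum>g<d. cmod (poly (\<Psi> (g, h)) t)) * cmod (b h x)"
        by (simp add: sum_distrib_left sum_distrib_right)
      also have "\<dots> \<le> cmod (t - c) * S t * cmod (b h x)"
      proof (intro mult_right_mono mult_left_mono)
        show "(\<Sum>g<d. cmod (poly (\<Psi> (g, h)) t)) \<le> S t" unfolding S_def
        proof (intro sum_mono)
          fix g
          show "cmod (poly (\<Psi> (g, h)) t) \<le> (\<Sum>h<d. cmod (poly (\<Psi> (g, h)) t))"
            by (rule member_le_sum[where f = "\<lambda>h. cmod (poly (\<Psi> (g, h)) t)", OF hM(1)]) auto
        qed
      qed auto
      finally have "cmod (poly D t) ^ k * cmod (f x) * cmod (b h x) \<le> cmod (t - c) * S t * cmod (b h x)"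
        by (simp add: norm_mult norm_power mult.assoc)
      then show ?thesis using bh by (simp add: mult.commute)
    qed
    define e where "e = n - l"
    have e: "e > 0" using l by (simp add: e_def)
    \<comment> \<open>The exponent uses \<open>Suc k\<close> rather than \<open>k\<close>, so that a
      factor \<open>D\<close> remains even for \<open>k = 0\<close> and the estimate also holds at
      zeros of \<open>D\<close>.\<close>
    have "[:-c, 1:] ^ e dvd \<alpha> l * D ^ (Suc k * e)"
    proof (rule poly_dvd_of_bound[where g = "\<lambda>t. 2 ^ n * (S t * cmod (poly D t)) ^ e"])
      show "[:-c, 1:] ^ e \<noteq> 0" by simp
      show "continuous_on UNIV (\<lambda>t. 2 ^ n * (S t * cmod (poly D t)) ^ e)"
        unfolding S_def by (intro continuous_intros)
      fix t
      have pl: "poly ([:-c, 1:] ^ e) t = (t - c) ^ e" by (simp add: poly_power)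
      show "cmod (poly (\<alpha> l * D ^ (Suc k * e)) t) \<le>
          cmod (poly ([:-c, 1:] ^ e) t) * (2 ^ n * (S t * cmod (poly D t)) ^ e)"
      proof (cases "poly D t = 0")
        case True
        then show ?thesis using e by (simp add: poly_power zero_power)
      next
        case Dt: False
        define R where "R = cmod (t - c) * S t / cmod (poly D t) ^ k"
        have R0: "0 \<le> R" using S0 by (simp add: R_def)
        define g where "g = monom 1 n - (\<Sum>j<n. monom (a j (y(i := t))) j)"
        have gp: "poly g u = u ^ n - (\<Sum>j<n. a j (y(i := t)) * u ^ j)" for u
          by (simp add: g_def poly_sum poly_monom)
        have "degree (\<Sum>j<n. monom (a j (y(i := t))) j) < n"
          using m(1) by (intro degree_sum_less) (auto intro: le_less_trans[OF degree_monom_le])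
        then have "degree (- (\<Sum>j<n. monom (a j (y(i := t))) j)) < degree (monom (1::complex) n)"
          by (simp only: degree_minus degree_monom_eq[OF one_neq_zero])
        from degree_add_eq_left[OF this] have dg: "degree g = n" unfolding g_def
          by (simp add: degree_monom_eq)
        have lc: "lead_coeff g = 1" unfolding dg by (simp add: g_def coeff_sum)
        have cl: "coeff g l = - poly (\<alpha> l) t" using l \<alpha>[OF l, of t] by (simp add: g_def coeff_sum)
        have "cmod (coeff g l) \<le> cmod (lead_coeff g) * (2 ^ degree g * R ^ (degree g - l))"
        proof (rule poly_coeff_root_bound[OF _ R0])
          fix z assume "poly g z = 0"
          then have "z ^ n = (\<Sum>j<n. a j (y(i := t)) * z ^ j)" by (simp add: gp)
          then obtain x where x: "x \<in> fiber (y(i := t))" "f x = z" using m(5) by blast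
          have "cmod z * cmod (poly D t) ^ k \<le> cmod (t - c) * S t" using val[OF x(1) Dt] x(2) by simp
          then show "cmod z \<le> R" unfolding R_def using Dt by (simp add: pos_le_divide_eq)
        qed (use l dg in simp)
        then have "cmod (poly (\<alpha> l) t) \<le> 2 ^ n * R ^ e"
          unfolding lc cl e_def by (simp only: dg norm_minus_cancel norm_one mult_1)
        then have "cmod (poly (\<alpha> l) t) * cmod (poly D t) ^ (Suc k * e) \<le>
            2 ^ n * R ^ e * cmod (poly D t) ^ (Suc k * e)" by (rule mult_right_mono) simp
        also have "\<dots> = 2 ^ n * (R * cmod (poly D t) ^ Suc k) ^ e"
          by (simp only: power_mult_distrib power_mult mult.assoc)
        also have "R * cmod (poly D t) ^ Suc k = cmod (t - c) * (S t * cmod (poly D t))"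
          using Dt by (simp add: R_def)
        also have "2 ^ n * (cmod (t - c) * (S t * cmod (poly D t))) ^ e =
            cmod (poly ([:-c, 1:] ^ e) t) * (2 ^ n * (S t * cmod (poly D t)) ^ e)"
          unfolding pl norm_power power_mult_distrib[of "cmod (t - c)"] by simp
        finally show ?thesis by (simp only: poly_mult poly_power norm_mult norm_power)
      qed
    qed
    moreover have nzp: "\<alpha> l * D ^ (Suc k * e) \<noteq> 0" using nz D0 by simp
    ultimately have "e \<le> order c (\<alpha> l * D ^ (Suc k * e))" unfolding order_divides by (elim disjE) auto
    also have "\<dots> = order c (\<alpha> l) + order c (D ^ (Suc k * e))" by (rule order_mult[OF nzp])
    also have "order c (D ^ (Suc k * e)) = 0" by (rule order_0I) (simp add: poly_power Dc)
    finally show ?thesis by (simp add: e_def)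
  qed
  have \<alpha>0: "\<alpha> l = 0" if l: "l < n" for l
  proof (rule ccontr)
    assume "\<alpha> l \<noteq> 0"
    from order_card_le_degree[OF finB this zero_order[OF _ l this]]
    have "(s + 1) * (n - l) \<le> s * (n - l)" using \<alpha>_deg[OF l] B by simp
    then show False using l by simp
  qed
  have "f x ^ n = (\<Sum>l<n. a l (Y x) * f x ^ l)" using m(3) fiber_sub[OF x] by blast
  also have "\<dots> = 0"
  proof (intro sum.neutral ballI)
    fix l assume "l \<in> {..<n}"
    then have "a l (Y x) = poly (\<alpha> l) \<tau>" using rp_fiber[OF m(2)[rule_format, of l] x] \<alpha>[of l \<tau>] by simp
    then show "a l (Y x) * f x ^ l = 0" using \<alpha>0 \<open>l \<in> {..<n}\<close> by simp
  qed
  finally show ?thesis using m(1) by simp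
qed

end

context noether_var
begin

text \<open>By \<open>line_vanish\<close> the \<open>y\<close> whose fibre is killed by
  \<open>f\<close> form a line-closed set, so the fibres over a test grid force \<open>f\<close> to
  vanish over a dense set of \<open>y\<close>; the polynomial defining its complement is then
  cancelled. \<open>d\<close> does not depend on \<open>s\<close>, and the fibre over
  \<open>y0\<close> is recorded for comparison with the degree.\<close>

lemma test_set_exists:
  "\<exists>d y0. finite (fiber y0) \<and> card (fiber y0) = d \<and> (\<forall>s. \<exists>P. finite P \<and> P \<subseteq> V \<and>
    card P \<le> d * (s + 1) ^ card I \<and> (\<forall>f. pd {..<N} s f \<longrightarrow> (\<forall>x\<in>P. f x = 0) \<longrightarrow> (\<forall>x\<in>V. f x = 0)))"
proof -
  have r0: "rind 0 (\<lambda>j x. 0)" by (simp add: rind_def)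
  from basis_exists[OF r0] obtain d b \<delta> where nb: "noether_basis N V I L A K d b \<delta>" by auto
  interpret B: noether_basis N V I L A K d b \<delta> by (rule nb)
  from B.generic_good obtain h where h: "rp I h" "nz h" "\<forall>y. h y \<noteq> 0 \<longrightarrow> B.good y"
    by (elim exE conjE)
  from h(2) obtain y0 where y0: "h y0 \<noteq> 0" unfolding nz_def by blast
  have fib: "finite (fiber y)" "card (fiber y) = d" if "h y \<noteq> 0" for y
    using B.good_fiber h(3) that by auto
  have "\<exists>P. finite P \<and> P \<subseteq> V \<and> card P \<le> d * (s + 1) ^ card I \<and>
    (\<forall>f. pd {..<N} s f \<longrightarrow> (\<forall>x\<in>P. f x = 0) \<longrightarrow> (\<forall>x\<in>V. f x = 0))" for s
  proof -
    from test_grid_exists[OF finI h(1) y0, of s] obtain G where G: "test_grid s I h G" by (elim exE)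
    have G1: "finite G" "card G \<le> (s + 1) ^ card I" "\<forall>y\<in>G. h y \<noteq> 0"
      using G unfolding test_grid_def by auto
    define P where "P = (\<Union>y\<in>G. fiber y)"
    have "finite P" unfolding P_def using G1 fib by auto
    moreover have "P \<subseteq> V" unfolding P_def fiber_def by auto
    moreover have "card P \<le> d * (s + 1) ^ card I"
    proof -
      have "card P \<le> (\<Sum>y\<in>G. card (fiber y))" unfolding P_def by (rule card_UN_le[OF G1(1)])
      also have "\<dots> = card G * d" using G1(3) fib(2) by simp
      finally show ?thesis using G1(2) by (metis mult.commute mult_le_mono1 order_trans)
    qed
    moreover have "f x = 0" if f: "pd {..<N} s f" and fP: "\<forall>x\<in>P. f x = 0" and x: "x \<in> V" for f x
    proof -
      define Z where "Z = {y. \<forall>x\<in>fiber y. f x = 0}"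
      have "line_closed s I h Z" unfolding line_closed_def
      proof (intro conjI allI impI)
        fix y i B t assume a: "i \<in> I" "card B = s + 1" "\<forall>b\<in>B. h (y(i := b)) \<noteq> 0 \<and> y(i := b) \<in> Z"
        have "f x = 0" if xt: "x \<in> fiber (y(i := t))" for x
        proof (rule B.line_vanish[OF f a(1,2) _ _ xt])
          fix c assume "c \<in> B"
          then have c: "h (y(i := c)) \<noteq> 0" "y(i := c) \<in> Z" using a(3) by simp_all
          show "B.good (y(i := c))" using h(3)[rule_format, OF c(1)] .
          fix x' assume "x' \<in> fiber (y(i := c))"
          then show "f x' = 0" using c(2) unfolding Z_def by simp
        qed
        then show "y(i := t) \<in> Z" unfolding Z_def by simp
      next
        fix y y' assume "y \<in> Z" "\<forall>i\<in>I. y i = y' i"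
        moreover have "fiber y = fiber y'" using calculation(2) unfolding fiber_def by auto
        ultimately show "y' \<in> Z" unfolding Z_def by simp
      qed
      moreover have "G \<subseteq> Z" using fP unfolding Z_def P_def by auto
      ultimately have "\<exists>h' z. rp I h' \<and> h' z \<noteq> 0 \<and> (\<forall>y. h' y \<noteq> 0 \<longrightarrow> y \<in> Z)"
        using G unfolding test_grid_def by (elim conjE allE[of _ Z]) simp
      then obtain h' z where h': "rp I h'" "h' z \<noteq> 0" "\<forall>y. h' y \<noteq> 0 \<longrightarrow> y \<in> Z" by (elim exE conjE)
      have "h' (Y x) * f x = 0" if "x \<in> V" for x
      proof (cases "h' (Y x) = 0")
        case False
        then have "Y x \<in> Z" using h'(3) by simp
        moreover have "x \<in> fiber (Y x)" using that by (simp add: fiber_def)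
        ultimately show ?thesis unfolding Z_def by simp
      qed simp
      from rp_cancel[OF h'(1,2) poly_fun_pd[OF f] this x] show ?thesis .
    qed
    ultimately show ?thesis by (intro exI[of _ P] conjI allI impI ballI)
  qed
  then show ?thesis using fib[OF y0] by (intro exI[of _ d] exI[of _ y0]) simp
qed

end

section \<open>Hypersurface sections\<close>

lemma has_dim_noether_var:
  assumes "irred_alg_set N V" "has_dim N V r"
  shows "\<exists>I L A K. noether_var N V I L A K \<and> card I = r"
proof -
  from assms(2)[unfolded has_dim_def] obtain I L A K
    where "prenoether N V I L A K" "algind N V I L" "card I = r" by (elim exE conjE)
  then have "noether_var N V I L A K \<and> card I = r" using assms(1) by (simp add: noether_var.intro)
  then show ?thesis by (intro exI)
qed

lemma rp_upd_invariant:
  assumes "finite I" "rp I p" "\<And>i u t. i \<in> I \<Longrightarrow> p (u(i := t)) = p u"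
  shows "p x = p y"
proof -
  have "p (\<lambda>k. if k \<in> J then y k else x k) = p x" if "J \<subseteq> I" for J
    using finite_subset[OF that assms(1)] that
  proof (induction J rule: finite_induct)
    case (insert i J)
    have "(\<lambda>k. if k \<in> insert i J then y k else x k) = (\<lambda>k. if k \<in> J then y k else x k)(i := y i)"
      by auto
    then show ?case using insert assms(3)[of i "\<lambda>k. if k \<in> J then y k else x k" "y i"] by auto
  qed simp
  from this[of I] have "p (\<lambda>k. if k \<in> I then y k else x k) = p x" by simp
  moreover have "p (\<lambda>k. if k \<in> I then y k else x k) = p y" by (rule rp_cong[OF assms(2)]) simp
  ultimately show ?thesis by simp
qed

text \<open>The image of \<open>V \<inter> Z(f)\<close> in the normalisation is the hypersurface where the constant
  coefficient \<open>a 0\<close> of the monic relation of \<open>f\<close> vanishes.\<close>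
lemma hypersurface_component:
  assumes V: "irred_alg_set N V" and dim: "has_dim N V r" and f: "poly_fun N f"
    and z: "z \<in> V" "f z = 0" and x1: "x1 \<in> V" "f x1 \<noteq> 0"
  shows "\<exists>W r'. irred_alg_set N W \<and> W \<subseteq> {x \<in> V. f x = 0} \<and> has_dim N W r' \<and> r \<le> r' + 1"
proof -
  from has_dim_noether_var[OF V dim] obtain I L A K
    where nv: "noether_var N V I L A K" and r: "card I = r" by (elim exE conjE)
  interpret noether_var N V I L A K by (rule nv)
  obtain e where e: "pd {..<N} e f" using f poly_fun_iff by blast
  from monicrel_exists[OF e] obtain n a C where mr: "monicrel f e n a C" by (elim exE)
  have m: "n > 0" "rind n (\<lambda>l x. f x ^ l)" "\<forall>l<n. rp I (a l)" "\<forall>x\<in>V. f x ^ n = (\<Sum>l<n. a l (Y x) * f x ^ l)"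
    "\<forall>y t. t ^ n = (\<Sum>l<n. a l y * t ^ l) \<longrightarrow> (\<exists>x\<in>fiber y. f x = t)"
    using mr unfolding monicrel_def by auto
  \<comment> \<open>Rewritten as a minimal relation, so that \<open>minrel_const_nonzero\<close>
    shows that \<open>a 0\<close> is not the zero polynomial.\<close>
  define q where "q = (\<lambda>l y. if l < n then - a l y else 1)"
  have "minrel f n q" unfolding minrel_def
  proof (intro conjI m(1,2) allI impI ballI)
    show "rp I (q l)" for l using m(3) by (cases "l < n") (auto simp: q_def intro: rp_uminus)
    show "nz (q n)" by (simp add: q_def nz_def)
    fix x assume "x \<in> V"
    have "(\<Sum>l<n. q l (Y x) * f x ^ l) = - (\<Sum>l<n. a l (Y x) * f x ^ l)"
      unfolding sum_negf[symmetric] by (intro sum.cong) (auto simp: q_def)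
    then show "(\<Sum>l\<le>n. q l (Y x) * f x ^ l) = 0"
      using m(4) \<open>x \<in> V\<close> by (simp add: lessThan_Suc_atMost[symmetric] q_def)
  qed
  from minrel_const_nonzero[OF this f x1] have "nz (q 0)" .
  then obtain y1 where y1: "a 0 y1 \<noteq> 0" using m(1) by (auto simp: nz_def q_def)
  have sum0: "(\<Sum>l<n. a l y * 0 ^ l) = a 0 y" for y
  proof -
    have "(\<Sum>l<n. a l y * 0 ^ l) = (\<Sum>l<n. if l = 0 then a l y else 0)"
      by (intro sum.cong) auto
    then show ?thesis using m(1) by simp
  qed
  have "a 0 (Y z) = 0"
    using m(4)[rule_format, OF z(1)] m(1) unfolding z(2) sum0 by (simp add: zero_power)
  have rp0: "rp I (a 0)" using m(1,3) by blast
  \<comment> \<open>\<open>a 0\<close> vanishes at \<open>Y z\<close> but not at \<open>y1\<close>,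
    hence really depends on some coordinate \<open>i\<close>.\<close>
  have "\<exists>i\<in>I. \<exists>u t. a 0 (u(i := t)) \<noteq> a 0 u"
    using rp_upd_invariant[OF finI rp0, of "Y z" y1] \<open>a 0 (Y z) = 0\<close> y1 by metis
  then obtain i u t where i: "i \<in> I" "a 0 (u(i := t)) \<noteq> a 0 u" by blast
  obtain e0 where e0: "pd I e0 (a 0)" using rp0 by (rule rpE)
  from pd_expand_var[OF e0, of i] obtain c where c: "\<forall>l. pd (I - {i}) (e0 - l) (c l)"
    "\<forall>y. a 0 y = (\<Sum>l\<le>e0. c l y * y i ^ l)" by (elim exE conjE)
  have cupd: "c l (y(i := s)) = c l y" for l y s
    by (rule pd_cong[OF c(1)[rule_format]]) auto
  define T where "T = {l. l \<le> e0 \<and> l \<ge> 1 \<and> nz (c l)}"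
  have "T \<noteq> {}"
  proof
    assume "T = {}"
    then have z: "c l y = 0" if "l \<le> e0" "l \<ge> 1" for l y using that unfolding T_def nz_def by blast
    have "a 0 y = c 0 y" for y
    proof -
      have "a 0 y = (\<Sum>l\<le>e0. if l = 0 then c 0 y else 0)"
        unfolding c(2)[rule_format] using z by (intro sum.cong) (auto simp: Suc_le_eq)
      then show ?thesis by simp
    qed
    then show False using i(2) cupd by simp
  qed
  define l0 where "l0 = Max T"
  have "finite T" unfolding T_def by (rule finite_subset[of _ "{..e0}"]) auto
  then have l0: "l0 \<in> T" "\<And>l. l \<in> T \<Longrightarrow> l \<le> l0" using \<open>T \<noteq> {}\<close> unfolding l0_def by auto
  have l0': "l0 \<le> e0" "l0 \<ge> 1" "nz (c l0)" using l0(1) unfolding T_def by auto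
  have cz: "c l y = 0" if "l \<le> e0" "l > l0" for l y
    using l0(2)[of l] that l0' unfolding T_def nz_def by force
  \<comment> \<open>For generic values of the other coordinates \<open>a 0\<close> has positive
    degree in coordinate \<open>i\<close>, hence a root. There the monic relation has root 0, which
    is realised by a zero of \<open>f\<close>; so the zeros of \<open>f\<close> on \<open>V\<close>
    dominate the space of the other coordinates.\<close>
  have cover: "\<exists>s. \<exists>x\<in>fiber (y(i := s)). f x = 0" if y: "c l0 y \<noteq> 0" for y
  proof -
    define p where "p = (\<Sum>l\<le>e0. monom (c l y) l)"
    have pp: "poly p s = (\<Sum>l\<le>e0. c l y * s ^ l)" for s unfolding p_def by (rule poly_sum_monom)
    have "coeff p l0 = c l0 y" using l0'(1) by (simp add: p_def coeff_sum)
    then have "l0 \<le> degree p" using y by (intro le_degree) simp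
    then have "\<not> constant (poly p)" using l0'(2) by (simp add: constant_degree)
    then obtain s where "poly p s = 0" using fundamental_theorem_of_algebra by blast
    then have "a 0 (y(i := s)) = 0" unfolding c(2)[rule_format] by (simp add: cupd pp)
    then have "0 ^ n = (\<Sum>l<n. a l (y(i := s)) * 0 ^ l)" unfolding sum0 using m(1) by simp
    then show ?thesis using m(5) by blast
  qed
  define X where "X = {x \<in> V. f x = 0}"
  define I' where "I' = I - {i}"
  have finI': "finite I'" using finI by (simp add: I'_def)
  have alg_X: "alg_set N X" unfolding X_def by (rule alg_set_Int_zero[OF V_alg f])
  have indX: "algind N X I' L" unfolding algind_def
  proof (intro allI impI)
    fix q e y assume q: "pd I' e q" "\<forall>x\<in>X. q (linmap I' N L x) = 0"
    have "q y * c l0 y = 0" for y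
    proof (cases "c l0 y = 0")
      case False
      from cover[OF this] obtain s x where x: "x \<in> fiber (y(i := s))" "f x = 0" by blast
      have "x \<in> X" using x fiber_sub unfolding X_def by blast
      moreover have "q (linmap I' N L x) = q y"
      proof (rule pd_cong[OF q(1)])
        fix j assume j: "j \<in> I'"
        then have "Y x j = (y(i := s)) j" using x(1) unfolding fiber_def I'_def by blast
        then show "linmap I' N L x j = y j" using j by (auto simp: linmap_def I'_def)
      qed
      ultimately show ?thesis using q(2) by simp
    qed simp
    moreover have "rp I' q" by (rule rpI[OF q(1)])
    moreover have "rp I' (c l0)" unfolding I'_def by (rule rpI[OF c(1)[rule_format]])
    moreover obtain y' where "c l0 y' \<noteq> 0" using l0'(3) unfolding nz_def by blast
    ultimately show "q y = 0" using rp_mult_nonzero[of I' q "c l0" y y'] by blast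
  qed
  from alg_set_decomp[OF alg_X] obtain F where F: "finite F" "\<forall>W\<in>F. irred_alg_set N W" "X = \<Union>F"
    by (elim exE conjE)
  \<comment> \<open>If each component had its own relation, their product would be a relation on
    \<open>X\<close>.\<close>
  have "\<exists>W\<in>F. algind N W I' L"
  proof (rule ccontr)
    assume "\<not> ?thesis"
    then have "\<forall>W. \<exists>q. W \<in> F \<longrightarrow> rp I' q \<and> nz q \<and> (\<forall>x\<in>W. q (linmap I' N L x) = 0)"
      unfolding algind_def rp_def nz_def by blast
    from choice[OF this] obtain q where q: "\<forall>W. W \<in> F \<longrightarrow> rp I' (q W) \<and> nz (q W) \<and>
      (\<forall>x\<in>W. q W (linmap I' N L x) = 0)" by (elim exE)
    have "rp I' (\<lambda>y. \<Prod>W\<in>F. q W y)" using q by (intro rp_prod) auto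
    then obtain e where e: "pd I' e (\<lambda>y. \<Prod>W\<in>F. q W y)" by (rule rpE)
    have "\<exists>y. \<forall>W\<in>F. q W y \<noteq> 0"
      by (rule rp_prod_nonzero[OF F(1), where I = I']) (use q in \<open>auto simp: nz_def\<close>)
    then obtain y where "(\<Prod>W\<in>F. q W y) \<noteq> 0" using F(1) by auto
    moreover have "(\<Prod>W\<in>F. q W y) = 0"
    proof (rule algindD[OF indX e])
      fix x assume "x \<in> X"
      then obtain W where "W \<in> F" "x \<in> W" using F(3) by blast
      then show "(\<Prod>W\<in>F. q W (linmap I' N L x)) = 0" using q F(1) by (intro prod_zero) auto
    qed
    ultimately show False by simp
  qed
  then obtain W where W: "W \<in> F" "algind N W I' L" by blast
  have irrW: "irred_alg_set N W" using F(2) W(1) by blast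
  then have "W \<noteq> {}" by (simp add: irred_alg_set_def)
  from has_dim_exists[OF this] obtain r' where r': "has_dim N W r'" by blast
  have "card I' \<le> r'" by (rule algind_le_dim[OF r' W(2) finI'])
  then have "r \<le> r' + 1" using r i(1) finI by (simp add: I'_def card_Diff_singleton)
  moreover have "W \<subseteq> {x \<in> V. f x = 0}" using W(1) F(3) unfolding X_def by blast
  ultimately show ?thesis using irrW r' by blast
qed

text \<open>\<open>{x \<in> V. g x \<noteq> 0}\<close>, made closed by adjoining the inverse of \<open>g\<close> as coordinate \<open>N\<close>.\<close>
definition principal_open :: "nat \<Rightarrow> (nat \<Rightarrow> complex) set \<Rightarrow> ((nat \<Rightarrow> complex) \<Rightarrow> complex) \<Rightarrow> (nat \<Rightarrow> complex) set" where
  "principal_open N V g = {x \<in> aff_space (Suc N). x(N := 0) \<in> V \<and> x N * g x = 1}"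

lemma poly_fun_Suc: "poly_fun N f \<Longrightarrow> poly_fun (Suc N) f"
  by (induction rule: poly_fun.induct) (auto intro: poly_fun.intros)

lemma poly_fun_upd_last: "poly_fun N f \<Longrightarrow> f (x(N := t)) = f x"
  by (rule poly_fun_cong) auto

lemma aff_upd_last: "x \<in> aff_space (Suc N) \<Longrightarrow> x(N := 0) \<in> aff_space N"
  by (auto simp: aff_space_def Suc_le_eq)

lemma alg_set_cylinder:
  assumes "alg_set N W"
  shows "alg_set (Suc N) {x \<in> aff_space (Suc N). x(N := 0) \<in> W}"
proof -
  from assms[unfolded alg_set_def] obtain G where G: "\<forall>g\<in>G. poly_fun N g"
    "W = {x \<in> aff_space N. \<forall>g\<in>G. g x = 0}" by (elim exE conjE)
  show ?thesis
  proof (rule alg_setI[of G])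
    show "poly_fun (Suc N) g" if "g \<in> G" for g using G(1) that poly_fun_Suc by blast
    have "x(N := 0) \<in> W \<longleftrightarrow> (\<forall>g\<in>G. g x = 0)" if x: "x \<in> aff_space (Suc N)" for x
    proof -
      have eq: "g (x(N := 0)) = g x" if "g \<in> G" for g by (rule poly_fun_upd_last) (use G(1) that in simp)
      have "(\<forall>g\<in>G. g (x(N := 0)) = 0) \<longleftrightarrow> (\<forall>g\<in>G. g x = 0)"
        by (intro ball_cong refl) (simp only: eq)
      then show ?thesis using aff_upd_last[OF x] unfolding G(2) by simp
    qed
    then show "{x \<in> aff_space (Suc N). x(N := 0) \<in> W} = {x \<in> aff_space (Suc N). \<forall>g\<in>G. g x = 0}" by blast
  qed
qed

text \<open>Where \<open>x N * g x = 1\<close> the last coordinate is the inverse of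
  \<open>g\<close>, and multiplying by \<open>g ^ t\<close> removes it. Each unit of degree costs at
  most \<open>e + 1\<close>.\<close>

lemma flatten:
  assumes "pd {..<Suc N} t F" and g: "pd {..<N} e g"
  shows "\<exists>F'. pd {..<N} (t * (e + 1)) F' \<and> (\<forall>x. x N * g x = 1 \<longrightarrow> g x ^ t * F x = F' x)"
  using assms(1)
proof (induction rule: pd.induct)
  case (pd_const0 c)
  show ?case by (intro exI[of _ "\<lambda>x. c"]) auto
next
  case (pd_var1 i)
  show ?case
  proof (cases "i = N")
    case True
    then show ?thesis by (intro exI[of _ "\<lambda>x. 1"]) (auto simp: mult.commute)
  next
    case False
    then have "i \<in> {..<N}" using pd_var1 by auto
    from pd.pd_mult[OF g pd.pd_var1[OF this]] show ?thesis by (intro exI[of _ "\<lambda>x. g x * x i"]) simp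
  qed
next
  case (pd_add a F G)
  then obtain F' G' where F': "pd {..<N} (a * (e + 1)) F'" "\<forall>x. x N * g x = 1 \<longrightarrow> g x ^ a * F x = F' x"
    and G': "pd {..<N} (a * (e + 1)) G'" "\<forall>x. x N * g x = 1 \<longrightarrow> g x ^ a * G x = G' x"
    by (elim exE conjE)
  then show ?case by (intro exI[of _ "\<lambda>x. F' x + G' x"]) (auto intro: pd.pd_add simp: distrib_left)
next
  case (pd_mult a F b G)
  then obtain F' G' where F': "pd {..<N} (a * (e + 1)) F'" "\<forall>x. x N * g x = 1 \<longrightarrow> g x ^ a * F x = F' x"
    and G': "pd {..<N} (b * (e + 1)) G'" "\<forall>x. x N * g x = 1 \<longrightarrow> g x ^ b * G x = G' x"
    by (elim exE conjE)
  have "pd {..<N} ((a + b) * (e + 1)) (\<lambda>x. F' x * G' x)"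
    using pd.pd_mult[OF F'(1) G'(1)] by (simp add: algebra_simps)
  moreover have "g x ^ (a + b) * (F x * G x) = F' x * G' x" if "x N * g x = 1" for x
  proof -
    have "g x ^ (a + b) * (F x * G x) = (g x ^ a * F x) * (g x ^ b * G x)" by (simp add: power_add mult_ac)
    then show ?thesis using F'(2) G'(2) that by simp
  qed
  ultimately show ?case by (intro exI[of _ "\<lambda>x. F' x * G' x"]) simp
next
  case (pd_mono a F b)
  then obtain F' where F': "pd {..<N} (a * (e + 1)) F'" "\<forall>x. x N * g x = 1 \<longrightarrow> g x ^ a * F x = F' x"
    by (elim exE conjE)
  have "(b - a) * e + a * (e + 1) \<le> b * (e + 1)"
  proof -
    have "(b - a) * e + a * (e + 1) = b * e + a"
      using pd_mono(2) by (simp add: diff_mult_distrib algebra_simps)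
    then show ?thesis using pd_mono(2) by simp
  qed
  from pd_mult_le[OF pd_power[OF g, of "b - a"] F'(1) this]
  have "pd {..<N} (b * (e + 1)) (\<lambda>x. g x ^ (b - a) * F' x)" .
  moreover have "g x ^ b * F x = g x ^ (b - a) * F' x" if "x N * g x = 1" for x
  proof -
    have "g x ^ b = g x ^ (b - a) * g x ^ a" using pd_mono(2) by (simp add: power_add[symmetric])
    then show ?thesis using F'(2) that by (simp add: mult.assoc)
  qed
  ultimately show ?case by (intro exI[of _ "\<lambda>x. g x ^ (b - a) * F' x"]) simp
qed

text \<open>Clearing the inverse of \<open>g\<close> turns an identity on the open set into one on
  \<open>V\<close>, where irreducibility allows \<open>g\<close> to be cancelled again.\<close>

lemma
  assumes V: "irred_alg_set N V" and g: "poly_fun N g" and z: "z \<in> V" "g z \<noteq> 0"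
  shows irred_principal_open: "irred_alg_set (Suc N) (principal_open N V g)"
    and principal_open_lift: "\<And>x. x \<in> V \<Longrightarrow> g x \<noteq> 0 \<Longrightarrow> x(N := inverse (g x)) \<in> principal_open N V g"
    and principal_open_zero: "\<And>F. poly_fun N F \<Longrightarrow> (\<And>x. x \<in> principal_open N V g \<Longrightarrow> F x = 0) \<Longrightarrow>
      (\<forall>x\<in>V. F x = 0)"
proof -
  have alg_V: "alg_set N V" using V by (simp add: irred_alg_set_def)
  have V_aff: "V \<subseteq> aff_space N" by (rule irred_alg_set_aff[OF V])
  show lift: "x(N := inverse (g x)) \<in> principal_open N V g" if x: "x \<in> V" "g x \<noteq> 0" for x
  proof -
    have xa: "x \<in> aff_space N" using x(1) V_aff by blast
    then have "x(N := inverse (g x)) \<in> aff_space (Suc N)" by (auto simp: aff_space_def)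
    moreover have "x(N := 0) = x" using xa by (auto simp: aff_space_def)
    ultimately show ?thesis using x poly_fun_upd_last[OF g] by (simp add: principal_open_def)
  qed
  have alg: "alg_set (Suc N) (principal_open N V g)"
  proof -
    have "poly_fun (Suc N) (\<lambda>x. x N * g x - 1)"
      by (rule poly_fun_diff, rule pf_mult, rule pf_var, simp, rule poly_fun_Suc[OF g], rule pf_const)
    from alg_set_Int_zero[OF alg_set_cylinder[OF alg_V] this] show ?thesis
      unfolding principal_open_def by (simp add: conj_assoc)
  qed
  show zero: "\<forall>x\<in>V. F x = 0" if F: "poly_fun N F" and F0: "\<And>x. x \<in> principal_open N V g \<Longrightarrow> F x = 0" for F
  proof -
    have "g x * F x = 0" if x: "x \<in> V" for x
    proof (cases "g x = 0")
      case False
      from F0[OF lift[OF x False]] show ?thesis using poly_fun_upd_last[OF F] by simp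
    qed simp
    from irred_mult_zero[OF V g F this] show ?thesis using z by blast
  qed
  obtain e where e: "pd {..<N} e g" using g poly_fun_iff by blast
  show "irred_alg_set (Suc N) (principal_open N V g)"
  proof (rule irredI_domain[OF alg])
    show "principal_open N V g \<noteq> {}" using lift[OF z] by blast
    fix F G assume FG: "poly_fun (Suc N) F" "poly_fun (Suc N) G"
      "\<And>x. x \<in> principal_open N V g \<Longrightarrow> F x * G x = 0"
    obtain a where a: "pd {..<Suc N} a F" using FG(1) poly_fun_iff by blast
    obtain b where b: "pd {..<Suc N} b G" using FG(2) poly_fun_iff by blast
    from flatten[OF a e] obtain F' where F': "pd {..<N} (a * (e + 1)) F'"
      "\<forall>x. x N * g x = 1 \<longrightarrow> g x ^ a * F x = F' x" by (elim exE conjE)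
    from flatten[OF b e] obtain G' where G': "pd {..<N} (b * (e + 1)) G'"
      "\<forall>x. x N * g x = 1 \<longrightarrow> g x ^ b * G x = G' x" by (elim exE conjE)
    have pF': "poly_fun N F'" and pG': "poly_fun N G'" using F'(1) G'(1) poly_fun_pd by auto
    have prod0: "F' x * G' x = 0" if "x \<in> principal_open N V g" for x
    proof -
      have x: "x N * g x = 1" using that by (simp add: principal_open_def)
      have "F' x * G' x = (g x ^ a * g x ^ b) * (F x * G x)" using F'(2) G'(2) x by (metis mult.commute mult.left_commute)
      then show ?thesis using FG(3)[OF that] by simp
    qed
    have "\<forall>x\<in>V. F' x * G' x = 0"
      by (rule zero[OF pf_mult[OF pF' pG'] prod0])
    then have "(\<forall>x\<in>V. F' x = 0) \<or> (\<forall>x\<in>V. G' x = 0)" by (intro irred_mult_zero[OF V pF' pG']) simp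
    moreover have "H x = 0" if H: "\<forall>x\<in>V. H' x = 0" "\<forall>x. x N * g x = 1 \<longrightarrow> g x ^ c * H x = H' x" "poly_fun N H'"
      and x: "x \<in> principal_open N V g" for H H' c x
    proof -
      have x': "x N * g x = 1" "x(N := 0) \<in> V" using x by (auto simp: principal_open_def)
      then have "H' x = 0" using H(1) poly_fun_upd_last[OF H(3), of x 0] by metis
      then show ?thesis using H(2) x'(1) by (metis mult_eq_0_iff mult_zero_right power_not_zero zero_neq_one)
    qed
    ultimately show "(\<forall>x\<in>principal_open N V g. F x = 0) \<or> (\<forall>x\<in>principal_open N V g. G x = 0)"
      using F'(2) G'(2) pF' pG' by metis
  qed
qed

text \<open>The same linear forms remain independent, because a polynomial vanishing where
  \<open>g\<close> is nonzero vanishes on all of \<open>V\<close>.\<close>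

lemma principal_open_dim:
  assumes V: "irred_alg_set N V" and g: "poly_fun N g" and z: "z \<in> V" "g z \<noteq> 0"
    and dV: "has_dim N V r" and dO: "has_dim (Suc N) (principal_open N V g) r'"
  shows "r \<le> r'"
proof -
  from dV[unfolded has_dim_def] obtain I L A K
    where I: "prenoether N V I L A K" "algind N V I L" "card I = r" by (elim exE conjE)
  have finI: "finite I" using I(1) finite_subset unfolding prenoether_def by auto
  define L' where "L' = (\<lambda>i k. if k < N then L i k else 0)"
  have lin: "linmap I (Suc N) L' x = linmap I N L x" for x
    by (auto simp: linmap_def L'_def fun_eq_iff)
  have "algind (Suc N) (principal_open N V g) I L'" unfolding algind_def lin
  proof (intro allI impI)
    fix q e y assume q: "pd I e q" "\<forall>x\<in>principal_open N V g. q (linmap I N L x) = 0"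
    have "\<forall>x\<in>V. q (linmap I N L x) = 0"
      by (rule principal_open_zero[OF V g z poly_fun_pd[OF pd_comp_linmap[OF q(1)]]]) (use q(2) in blast)
    then show "q y = 0" using algindD[OF I(2) q(1)] by blast
  qed
  from algind_le_dim[OF dO this finI] I(3) show ?thesis by simp
qed

text \<open>With the inverse of \<open>g\<close> cleared, the Lagrange functions on
  \<open>W'\<close> become functions on \<open>W\<close> whose degree is still linear in
  \<open>t\<close>; they stay independent since \<open>g\<close> has no zero on
  \<open>W'\<close>.\<close>

lemma sub_principal_open_dim:
  assumes W': "W' \<subseteq> principal_open N V g" and g: "poly_fun N g"
    and sub: "\<And>x. x \<in> W' \<Longrightarrow> x(N := 0) \<in> W"
    and d': "has_dim (Suc N) W' r'" and d: "has_dim N W r"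
  shows "r' \<le> r"
proof -
  from d'[unfolded has_dim_def] obtain I' L' A' K'
    where I': "prenoether (Suc N) W' I' L' A' K'" "algind (Suc N) W' I' L'" "card I' = r'" by (elim exE conjE)
  have fin: "finite I'" using I'(1) finite_subset unfolding prenoether_def by auto
  from d[unfolded has_dim_def] obtain I L A K
    where I: "prenoether N W I L A K" "card I = r" by (elim exE conjE)
  obtain e where e: "pd {..<N} e g" using g poly_fun_iff by blast
  define F where "F = (\<lambda>t p x. lagr I' t p (linmap I' (Suc N) L' x))"
  have "\<forall>tp. \<exists>F'. snd tp \<in> PiE I' (\<lambda>_. {..fst tp}) \<longrightarrow> pd {..<N} (card I' * fst tp * (e + 1)) F' \<and>
    (\<forall>x. x N * g x = 1 \<longrightarrow> g x ^ (card I' * fst tp) * F (fst tp) (snd tp) x = F' x)"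
  proof
    fix tp :: "nat \<times> (nat \<Rightarrow> nat)"
    show "\<exists>F'. snd tp \<in> PiE I' (\<lambda>_. {..fst tp}) \<longrightarrow> pd {..<N} (card I' * fst tp * (e + 1)) F' \<and>
      (\<forall>x. x N * g x = 1 \<longrightarrow> g x ^ (card I' * fst tp) * F (fst tp) (snd tp) x = F' x)"
    proof (cases "snd tp \<in> PiE I' (\<lambda>_. {..fst tp})")
      case True
      have "pd {..<Suc N} (card I' * fst tp) (F (fst tp) (snd tp))"
        unfolding F_def by (rule pd_lagr_linmap[OF fin True])
      from flatten[OF this e] show ?thesis by blast
    qed blast
  qed
  from choice[OF this] obtain F' where F': "\<forall>tp. snd tp \<in> PiE I' (\<lambda>_. {..fst tp}) \<longrightarrow>
    pd {..<N} (card I' * fst tp * (e + 1)) (F' tp) \<and>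
    (\<forall>x. x N * g x = 1 \<longrightarrow> g x ^ (card I' * fst tp) * F (fst tp) (snd tp) x = F' tp x)" by (elim exE)
  have "r' \<le> card I"
  proof (rule dim_ge_of_indep[OF I(1), where S = "\<lambda>t. PiE I' (\<lambda>_. {..t})" and a = "card I' * (e + 1)" and b = 0
        and F = "\<lambda>t p. F' (t, p)"])
    fix t :: nat
    show "finite (PiE I' (\<lambda>_. {..t}))" using fin by (simp add: finite_PiE)
    show "(t + 1) ^ r' \<le> card (PiE I' (\<lambda>_. {..t}))" using fin I'(3) by (simp add: card_PiE_const)
    show "pd {..<N} (card I' * (e + 1) * t + 0) (F' (t, p))" if "p \<in> PiE I' (\<lambda>_. {..t})" for p
      using F'[rule_format, of "(t, p)"] that by (simp add: mult_ac)
    show "indep_on W (PiE I' (\<lambda>_. {..t})) (\<lambda>p. F' (t, p))"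
      unfolding indep_on_def
    proof (intro allI impI)
      fix c assume c: "\<forall>x\<in>W. (\<Sum>p\<in>PiE I' (\<lambda>_. {..t}). c p * F' (t, p) x) = 0"
      have zero: "(\<Sum>p\<in>PiE I' (\<lambda>_. {..t}). c p * lagr I' t p (linmap I' (Suc N) L' x)) = 0" if x: "x \<in> W'" for x
      proof -
        have xN: "x N * g x = 1" using x W' by (auto simp: principal_open_def)
        have "(\<Sum>p\<in>PiE I' (\<lambda>_. {..t}). c p * F' (t, p) x) =
            (\<Sum>p\<in>PiE I' (\<lambda>_. {..t}). c p * F' (t, p) (x(N := 0)))"
          using F' by (intro sum.cong refl arg_cong2[where f = "(*)"] poly_fun_upd_last[symmetric] poly_fun_pd) auto
        also have "\<dots> = 0" using c sub[OF x] by blast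
        finally have "0 = (\<Sum>p\<in>PiE I' (\<lambda>_. {..t}). c p * (g x ^ (card I' * t) * F t p x))"
          using F' xN by (simp cong: sum.cong)
        also have "\<dots> = g x ^ (card I' * t) * (\<Sum>p\<in>PiE I' (\<lambda>_. {..t}). c p * F t p x)"
          unfolding sum_distrib_left by (intro sum.cong refl) (simp add: mult_ac)
        finally show ?thesis using xN unfolding F_def by auto
      qed
      show "\<forall>p\<in>PiE I' (\<lambda>_. {..t}). c p = 0"
        using indep_onD[OF lagr_indep[OF I'(2) fin, of t], of c, OF zero] by blast
    qed
  qed
  then show ?thesis using I(2) by simp
qed

text \<open>Krull's principal ideal theorem: localise at a function that is nonzero at \<open>z\<close> and
  vanishes on the components of \<open>V \<inter> Z(f)\<close> that miss \<open>z\<close>.\<close>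
lemma hypersurface_component_at:
  assumes V: "irred_alg_set N V" and dim: "has_dim N V r" and f: "poly_fun N f"
    and z: "z \<in> V" "f z = 0"
  shows "\<exists>W r'. irred_alg_set N W \<and> z \<in> W \<and> W \<subseteq> {x \<in> V. f x = 0} \<and> has_dim N W r' \<and> r \<le> r' + 1"
proof (cases "\<forall>x\<in>V. f x = 0")
  case True
  then have "irred_alg_set N V \<and> z \<in> V \<and> V \<subseteq> {x \<in> V. f x = 0} \<and> has_dim N V r \<and> r \<le> r + 1"
    using V z dim by auto
  then show ?thesis by blast
next
  case False
  have alg_V: "alg_set N V" using V by (simp add: irred_alg_set_def)
  define X where "X = {x \<in> V. f x = 0}"
  have alg_X: "alg_set N X" unfolding X_def by (rule alg_set_Int_zero[OF alg_V f])
  from alg_set_decomp[OF alg_X] obtain F where F: "finite F" "\<forall>W\<in>F. irred_alg_set N W" "X = \<Union>F"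
    by (elim exE conjE)
  have alg_F: "alg_set N W" if "W \<in> F" for W using F(2) that by (auto simp: irred_alg_set_def)
  define F' where "F' = {W \<in> F. z \<notin> W}"
  have "alg_set N (\<Union>F')" by (rule alg_set_Union) (use F(1) alg_F in \<open>auto simp: F'_def\<close>)
  moreover have "z \<in> aff_space N" using z(1) irred_alg_set_aff[OF V] by blast
  moreover have "z \<notin> \<Union>F'" by (auto simp: F'_def)
  ultimately have "\<exists>g. poly_fun N g \<and> (\<forall>x\<in>\<Union>F'. g x = 0) \<and> g z \<noteq> 0" by (rule alg_set_separate)
  then obtain g where g: "poly_fun N g" "\<forall>x\<in>\<Union>F'. g x = 0" "g z \<noteq> 0" by (elim exE conjE)
  define U where "U = principal_open N V g"
  have irrU: "irred_alg_set (Suc N) U" unfolding U_def by (rule irred_principal_open[OF V g(1) z(1) g(3)])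
  then have "U \<noteq> {}" by (simp add: irred_alg_set_def)
  from has_dim_exists[OF this] obtain r1 where r1: "has_dim (Suc N) U r1" by blast
  have r_r1: "r \<le> r1" using principal_open_dim[OF V g(1) z(1) g(3) dim] r1 unfolding U_def by blast
  have zU: "z(N := inverse (g z)) \<in> U" unfolding U_def
    by (rule principal_open_lift[OF V g(1) z(1) g(3) z(1) g(3)])
  have fz: "f (z(N := inverse (g z))) = 0" using z(2) poly_fun_upd_last[OF f] by simp
  have "\<exists>x1\<in>U. f x1 \<noteq> 0"
  proof (rule ccontr)
    assume "\<not> ?thesis"
    then have "\<forall>x\<in>V. f x = 0" unfolding U_def by (intro principal_open_zero[OF V g(1) z(1) g(3) f]) blast
    then show False using False by blast
  qed
  then obtain x1 where x1: "x1 \<in> U" "f x1 \<noteq> 0" by blast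
  from hypersurface_component[OF irrU r1 poly_fun_Suc[OF f] zU fz x1] obtain W' r'
    where W': "irred_alg_set (Suc N) W'" "W' \<subseteq> {x \<in> U. f x = 0}" "has_dim (Suc N) W' r'" "r1 \<le> r' + 1"
    by (elim exE conjE)
  define cyl where "cyl = (\<lambda>W. {x \<in> aff_space (Suc N). x(N := 0) \<in> W})"
  \<comment> \<open>\<open>W'\<close> projects into a single component \<open>W\<close>. As
    \<open>g\<close> has no zero on \<open>W'\<close> but vanishes on the components missing
    \<open>z\<close>, this \<open>W\<close> contains \<open>z\<close>.\<close>
  have "\<exists>C\<in>cyl ` F. W' \<subseteq> C"
  proof (rule irred_subset_Union[OF W'(1)])
    show "finite (cyl ` F)" using F(1) by simp
    show "alg_set (Suc N) C" if "C \<in> cyl ` F" for C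
      using that alg_set_cylinder alg_F unfolding cyl_def by blast
    show "W' \<subseteq> \<Union>(cyl ` F)"
    proof
      fix x assume x: "x \<in> W'"
      then have "x \<in> aff_space (Suc N)" "x(N := 0) \<in> V" "f x = 0"
        using W'(2) unfolding U_def principal_open_def by auto
      moreover have "x(N := 0) \<in> X" using calculation poly_fun_upd_last[OF f] by (simp add: X_def)
      ultimately show "x \<in> \<Union>(cyl ` F)" using F(3) unfolding cyl_def by auto
    qed
  qed
  then obtain W where W: "W \<in> F" "W' \<subseteq> cyl W" by blast
  have sub: "x(N := 0) \<in> W" if "x \<in> W'" for x using that W(2) unfolding cyl_def by blast
  have W'U: "W' \<subseteq> principal_open N V g" using W'(2) unfolding U_def by blast
  obtain x where x: "x \<in> W'" using W'(1) by (auto simp: irred_alg_set_def)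
  then have "g x \<noteq> 0" using W'U by (auto simp: principal_open_def)
  then have "g (x(N := 0)) \<noteq> 0" using poly_fun_upd_last[OF g(1)] by simp
  then have "W \<notin> F'" using g(2) sub[OF x] by blast
  then have zW: "z \<in> W" using W(1) by (simp add: F'_def)
  have irrW: "irred_alg_set N W" using F(2) W(1) by blast
  then have "W \<noteq> {}" by (simp add: irred_alg_set_def)
  from has_dim_exists[OF this] obtain r2 where r2: "has_dim N W r2" by blast
  have "r' \<le> r2" by (rule sub_principal_open_dim[OF W'U g(1) sub W'(3) r2])
  then have "r \<le> r2 + 1" using r_r1 W'(4) by simp
  moreover have "W \<subseteq> {x \<in> V. f x = 0}" using W(1) F(3) unfolding X_def by blast
  ultimately show ?thesis using irrW zW r2 by blast
qed

lemma intersection_component_at: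
  assumes "finite S" "irred_alg_set N V" "has_dim N V r" "z \<in> V"
    "\<And>f. f \<in> S \<Longrightarrow> poly_fun N f" "\<And>f. f \<in> S \<Longrightarrow> f z = 0"
  shows "\<exists>W r'. irred_alg_set N W \<and> z \<in> W \<and> W \<subseteq> {x \<in> V. \<forall>f\<in>S. f x = 0} \<and> has_dim N W r' \<and> r \<le> r' + card S"
  using assms
proof (induction S rule: finite_induct)
  case empty
  then have "irred_alg_set N V \<and> z \<in> V \<and> V \<subseteq> {x \<in> V. \<forall>f\<in>{}. f x = 0} \<and> has_dim N V r \<and> r \<le> r + card {}" by simp
  then show ?case by blast
next
  case (insert f S)
  have "\<exists>W r'. irred_alg_set N W \<and> z \<in> W \<and> W \<subseteq> {x \<in> V. \<forall>f\<in>S. f x = 0} \<and> has_dim N W r' \<and> r \<le> r' + card S"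
    using insert.prems by (intro insert.IH) auto
  then obtain W r' where W: "irred_alg_set N W" "z \<in> W" "W \<subseteq> {x \<in> V. \<forall>f\<in>S. f x = 0}" "has_dim N W r'" "r \<le> r' + card S"
    by (elim exE conjE)
  have "poly_fun N f" "f z = 0" using insert.prems by auto
  from hypersurface_component_at[OF W(1,4) this(1) W(2) this(2)] obtain W2 r2
    where W2: "irred_alg_set N W2" "z \<in> W2" "W2 \<subseteq> {x \<in> W. f x = 0}" "has_dim N W2 r2" "r' \<le> r2 + 1"
    by (elim exE conjE)
  have "W2 \<subseteq> {x \<in> V. \<forall>f\<in>insert f S. f x = 0}" using W2(3) W(3) by auto
  moreover have "r \<le> r2 + card (insert f S)" using W(5) W2(5) insert.hyps by simp
  ultimately show ?case using W2(1,2,4) by blast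
qed

section \<open>Dimension and degree\<close>

lemma irred_chain_length:
  assumes "\<And>i. i \<le> k \<Longrightarrow> irred_alg_set N (Z i)" "\<And>i. i < k \<Longrightarrow> Z i \<subset> Z (Suc i)" "has_dim N (Z k) r"
  shows "k \<le> r"
  using assms
proof (induction k arbitrary: r)
  case (Suc k)
  have irr: "irred_alg_set N (Z k)" using Suc.prems(1)[of k] by simp
  then have ne: "Z k \<noteq> {}" and alg: "alg_set N (Z k)" by (simp_all add: irred_alg_set_def)
  from has_dim_exists[OF ne] obtain r' where r': "has_dim N (Z k) r'" by blast
  have "k \<le> r'" by (rule Suc.IH[OF Suc.prems(1) Suc.prems(2) r']) simp_all
  moreover have "r' < r"
    by (rule has_dim_strict[OF alg Suc.prems(1)[OF le_refl] Suc.prems(2)[OF lessI] r' Suc.prems(3)])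
  ultimately show ?case by simp
qed simp

text \<open>Cut with a level set of one normalising form, which is not constant on \<open>V\<close>
  by independence. The dimension drops by at most one there, and by at least one for a proper closed
  subset.\<close>

lemma has_dim_drop:
  assumes V: "irred_alg_set N V" and dim: "has_dim N V (Suc r)"
  shows "\<exists>W. irred_alg_set N W \<and> W \<subset> V \<and> has_dim N W r"
proof -
  from has_dim_noether_var[OF V dim] obtain I L A K
    where nv: "noether_var N V I L A K" and r: "card I = Suc r" by (elim exE conjE)
  interpret noether_var N V I L A K by (rule nv)
  have "I \<noteq> {}" using r by auto
  then obtain i where i: "i \<in> I" by blast
  obtain z where z: "z \<in> V" using V_ne by blast
  define f where "f = (\<lambda>x. Y x i - Y z i)"
  have f: "poly_fun N f" unfolding f_def
    by (rule poly_fun_diff, rule poly_fun_pd[OF pd_linmap], rule pf_const)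
  have "\<exists>x\<in>V. f x \<noteq> 0"
  proof (rule ccontr)
    assume neg: "\<not> ?thesis"
    define q where "q = (\<lambda>y::nat \<Rightarrow> complex. y i - Y z i)"
    have "pd I 1 q" unfolding q_def by (rule pd_diff, rule pd_var[OF i], simp, rule pd_const)
    then have "rp I q" by (rule rpI)
    then have "q (\<lambda>_. Y z i + 1) = 0" by (rule rp_zero) (use neg in \<open>simp add: q_def f_def\<close>)
    then show False by (simp add: q_def)
  qed
  then obtain x1 where x1: "x1 \<in> V" "f x1 \<noteq> 0" by blast
  have fz: "f z = 0" by (simp add: f_def)
  from hypersurface_component[OF V dim f z fz x1] obtain W r' where
    W: "irred_alg_set N W" "W \<subseteq> {x \<in> V. f x = 0}" "has_dim N W r'" "Suc r \<le> r' + 1"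
    by (elim exE conjE)
  have sub: "W \<subset> V" using W(2) x1 by auto
  have "alg_set N W" using W(1) by (simp add: irred_alg_set_def)
  from has_dim_strict[OF this V sub W(3) dim] have "r' = r" using W(4) by simp
  then show ?thesis using W(1,3) sub by blast
qed

lemma irred_chain_exists:
  assumes "irred_alg_set N V" "has_dim N V r"
  shows "\<exists>Z. (\<forall>i\<le>r. irred_alg_set N (Z i) \<and> Z i \<subseteq> V) \<and> (\<forall>i<r. Z i \<subset> Z (Suc i)) \<and> Z r = V"
  using assms
proof (induction r arbitrary: V)
  case 0
  then show ?case by (intro exI[of _ "\<lambda>_. V"]) simp
next
  case (Suc r)
  from has_dim_drop[OF Suc.prems] obtain W where W: "irred_alg_set N W" "W \<subset> V" "has_dim N W r"
    by (elim exE conjE)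
  from Suc.IH[OF W(1,3)] obtain Z where Z: "\<forall>i\<le>r. irred_alg_set N (Z i) \<and> Z i \<subseteq> W"
    "\<forall>i<r. Z i \<subset> Z (Suc i)" "Z r = W" by (elim exE conjE)
  define Z' where "Z' = (\<lambda>i. if i \<le> r then Z i else V)"
  have "irred_alg_set N (Z' i) \<and> Z' i \<subseteq> V" for i
    using Z(1) W(2) Suc.prems(1) by (cases "i \<le> r") (auto simp: Z'_def)
  moreover have "Z' i \<subset> Z' (Suc i)" if "i < Suc r" for i
  proof (cases "i = r")
    case True
    then show ?thesis using Z(3) W(2) by (simp add: Z'_def)
  next
    case False
    then show ?thesis using Z(2) that by (simp add: Z'_def)
  qed
  moreover have "Z' (Suc r) = V" by (simp add: Z'_def)
  ultimately show ?case by (intro exI[of _ Z'] conjI allI impI) auto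
qed

lemma alg_dim_irred:
  assumes V: "irred_alg_set N V" and dim: "has_dim N V r"
  shows "alg_dim N V = r"
  unfolding alg_dim_def
proof (rule cSup_eq_maximum)
  from irred_chain_exists[OF assms] obtain Z where
    "\<forall>i\<le>r. irred_alg_set N (Z i) \<and> Z i \<subseteq> V" "\<forall>i<r. Z i \<subset> Z (Suc i)" by (elim exE conjE)
  then show "r \<in> {k. \<exists>Z. (\<forall>i\<le>k. irred_alg_set N (Z i) \<and> Z i \<subseteq> V) \<and> (\<forall>i<k. Z i \<subset> Z (Suc i))}"
    by (intro CollectI exI[of _ Z] conjI)
  fix k assume "k \<in> {k. \<exists>Z. (\<forall>i\<le>k. irred_alg_set N (Z i) \<and> Z i \<subseteq> V) \<and> (\<forall>i<k. Z i \<subset> Z (Suc i))}"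
  then obtain Z where Z: "\<forall>i\<le>k. irred_alg_set N (Z i) \<and> Z i \<subseteq> V" "\<forall>i<k. Z i \<subset> Z (Suc i)"
    by (elim CollectE exE conjE)
  then have "Z k \<noteq> {}" by (simp add: irred_alg_set_def)
  from has_dim_exists[OF this] obtain r' where r': "has_dim N (Z k) r'" by blast
  have "k \<le> r'" by (rule irred_chain_length[where Z = Z, OF _ _ r']) (simp_all add: Z)
  also have "r' \<le> r" using Z(1) by (intro has_dim_mono[OF r' dim]) simp
  finally show "k \<le> r" .
qed

text \<open>Comparing the suprema requires the chain lengths in \<open>X\<close> to be bounded; a
  chain is no longer than the dimension of its top member, hence than \<open>N\<close>.\<close>

lemma alg_dim_mono:
  assumes V: "irred_alg_set N V" and sub: "V \<subseteq> X"
  shows "alg_dim N V \<le> alg_dim N X"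
  unfolding alg_dim_def
proof (rule cSup_subset_mono)
  let ?C = "\<lambda>X. {k. \<exists>Z. (\<forall>i\<le>k. irred_alg_set N (Z i) \<and> Z i \<subseteq> X) \<and> (\<forall>i<k. Z i \<subset> Z (Suc i))}"
  have "0 \<in> ?C V" using V by (intro CollectI exI[of _ "\<lambda>_. V"]) simp
  then show "?C V \<noteq> {}" by blast
  show "?C V \<subseteq> ?C X"
  proof
    fix k assume "k \<in> ?C V"
    then obtain Z where "\<forall>i\<le>k. irred_alg_set N (Z i) \<and> Z i \<subseteq> V" "\<forall>i<k. Z i \<subset> Z (Suc i)"
      by (elim CollectE exE conjE)
    then show "k \<in> ?C X" by (intro CollectI exI[of _ Z]) (simp add: subset_trans[OF _ sub])
  qed
  show "bdd_above (?C X)"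
  proof (rule bdd_aboveI)
    fix k assume "k \<in> ?C X"
    then obtain Z where Z: "\<forall>i\<le>k. irred_alg_set N (Z i) \<and> Z i \<subseteq> X" "\<forall>i<k. Z i \<subset> Z (Suc i)"
      by (elim CollectE exE conjE)
    then have "Z k \<noteq> {}" by (simp add: irred_alg_set_def)
    from has_dim_exists[OF this] obtain r' where r': "has_dim N (Z k) r'" by blast
    have "k \<le> r'" by (rule irred_chain_length[where Z = Z, OF _ _ r']) (simp_all add: Z)
    also have "r' \<le> N" by (rule has_dim_le[OF r'])
    finally show "k \<le> N" .
  qed
qed

section \<open>Finite linear sections and the degree\<close>

lemma irred_finite_dim:
  assumes W: "irred_alg_set N W" and fin: "finite W" and dim: "has_dim N W r"
  shows "r = 0"
proof (cases r)
  case (Suc r')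
  from has_dim_drop[OF W dim[unfolded Suc]] obtain W' where W': "irred_alg_set N W'" "W' \<subset> W"
    by (elim exE conjE)
  \<comment> \<open>A finite set is the union of its points, so an irreducible one is a single point
    and has no proper irreducible subset.\<close>
  have "\<exists>C\<in>(\<lambda>w. {w}) ` W. W \<subseteq> C"
    by (rule irred_subset_Union[OF W])
      (use fin alg_set_singleton irred_alg_set_aff[OF W] in auto)
  then obtain w where "W \<subseteq> {w}" by auto
  then have "W' = {}" using W'(2) by blast
  then show ?thesis using W'(1) by (simp add: irred_alg_set_def)
qed simp

text \<open>Functions separating the finitely many common zeros of \<open>l 0, \<dots>, l (r - 1)\<close> on \<open>V\<close> are
  independent over the polynomials in the \<open>l i\<close>: pull a relation back to a curve in \<open>V\<close> through
  a zero, on which the \<open>l i\<close> are proportional to a single function \<open>\<tau>\<close>, and cancel \<open>\<tau>\<close>.\<close>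
lemma section_relation_trivial:
  fixes l :: "nat \<Rightarrow> (nat \<Rightarrow> complex) \<Rightarrow> complex"
  assumes V: "irred_alg_set N V" and dim: "has_dim N V r"
    and l: "\<And>i. i < r \<Longrightarrow> poly_fun N (l i)"
    and Z: "Z = {x \<in> V. \<forall>i<r. l i x = 0}" and finZ: "finite Z"
    and e: "\<And>z. z \<in> Z \<Longrightarrow> poly_fun N (e z)"
    and ee: "\<And>z z'. z \<in> Z \<Longrightarrow> z' \<in> Z \<Longrightarrow> e z z' = (if z = z' then 1 else 0)"
    and P: "\<And>z. z \<in> Z \<Longrightarrow> rp {..<r} (P z)"
    and rel: "\<And>x. x \<in> V \<Longrightarrow> (\<Sum>z\<in>Z. P z (\<lambda>i. l i x) * e z x) = 0"
    and z1: "z1 \<in> Z"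
  shows "P z1 y = 0"
proof (rule ccontr)
  assume P1: "P z1 y \<noteq> 0"
  have pick: "(\<Sum>z\<in>Z. g z * e z z') = g z'" if "z' \<in> Z" for g z'
  proof -
    have "(\<Sum>z\<in>Z. g z * e z z') = (\<Sum>z\<in>Z. if z = z' then g z else 0)"
      using ee that by (intro sum.cong) auto
    then show ?thesis using finZ that by simp
  qed
  show False
  proof (cases "r = 0")
    case True
    have "P z1 (\<lambda>i. l i z1) = 0" using rel[of z1] pick[OF z1, of "\<lambda>z. P z (\<lambda>i. l i z1)"] z1 Z by simp
    moreover have "P z1 (\<lambda>i. l i z1) = P z1 y" by (rule rp_cong[OF P[OF z1]]) (simp add: True)
    ultimately show False using P1 by simp
  next
    case False
    then have r: "0 < r" by simp
    \<comment> \<open>The direction \<open>v\<close> is to have both \<open>P z1 v\<close> and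
      \<open>v 0\<close> nonzero, so that \<open>l 0\<close> can parametrise the curve.\<close>
    have "pd {..<r} 1 (\<lambda>y. y 0)" by (rule pd_var) (use r in auto)
    then have "rp {..<r} (\<lambda>y. y 0)" by (rule rpI)
    from rp_mult_nonzero[where f = "P z1" and g = "\<lambda>y. y 0" and x = y and y = "\<lambda>_. 1", OF P[OF z1] this P1]
    obtain v where "P z1 v * v 0 \<noteq> 0" by auto
    then have v: "P z1 v \<noteq> 0" "v 0 \<noteq> 0" by auto
    have "\<exists>p. \<forall>t. P z (\<lambda>i. t * v i) = poly p t" if z: "z \<in> Z" for z
    proof -
      obtain a where "pd {..<r} a (P z)" using P[OF z] by (rule rpE)
      from pd_line[OF this, of "\<lambda>_. 0" v] obtain p where "\<forall>t. P z (\<lambda>i. 0 + t * v i) = poly p t"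
        by (elim exE conjE)
      then show ?thesis by (intro exI[of _ p]) simp
    qed
    then have "\<forall>z. \<exists>p. z \<in> Z \<longrightarrow> (\<forall>t. P z (\<lambda>i. t * v i) = poly p t)" by simp
    from choice[OF this] obtain p where p: "\<forall>z. z \<in> Z \<longrightarrow> (\<forall>t. P z (\<lambda>i. t * v i) = poly (p z) t)"
      by (elim exE)
    have "poly (p z1) 1 \<noteq> 0" using p[rule_format, OF z1, of 1] v(1) by simp
    then have "z1 \<in> Z \<and> p z1 \<noteq> 0" using z1 by auto
    \<comment> \<open>\<open>z0\<close> is the point whose polynomial on the line through
      \<open>v\<close> vanishes to least order at 0: after division of all of them by the power
      \<open>m\<close>, its polynomial is nonzero at 0.\<close>
    from ex_has_least_nat[of "\<lambda>z. z \<in> Z \<and> p z \<noteq> 0", OF this, of "\<lambda>z. order 0 (p z)"]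
    obtain z0 where z0: "z0 \<in> Z" "p z0 \<noteq> 0"
      "\<forall>z. z \<in> Z \<and> p z \<noteq> 0 \<longrightarrow> order 0 (p z0) \<le> order 0 (p z)" by (elim exE conjE)
    define m where "m = order 0 (p z0)"
    have "\<forall>z. \<exists>u. z \<in> Z \<longrightarrow> p z = [:-0, 1:] ^ m * u"
    proof
      fix z
      show "\<exists>u. z \<in> Z \<longrightarrow> p z = [:-0, 1:] ^ m * u"
      proof (cases "z \<in> Z")
        case True
        have "p z = 0 \<or> m \<le> order 0 (p z)" using z0(3) True by (auto simp: m_def)
        then have "[:-0, 1:] ^ m dvd p z" by (simp only: order_divides)
        then show ?thesis unfolding dvd_def by (elim exE) (intro exI impI)
      qed simp
    qed
    from choice[OF this] obtain u where u: "\<forall>z. z \<in> Z \<longrightarrow> p z = [:-0, 1:] ^ m * u z" by (elim exE)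
    have u0: "poly (u z0) 0 \<noteq> 0"
    proof
      assume "poly (u z0) 0 = 0"
      from poly_root_factor[OF this] obtain w where w: "u z0 = [:-0, 1:] * w" by (elim exE)
      have "p z0 = [:-0, 1:] ^ m * ([:-0, 1:] * w)" using u z0(1) w by simp
      then have "p z0 = [:-0, 1:] ^ Suc m * w" by (simp only: power_Suc2 mult.assoc)
      then have "[:-0, 1:] ^ Suc m dvd p z0" by (simp only: dvd_triv_left)
      then have "Suc m \<le> order 0 (p z0)" using z0(2) by (simp only: order_divides) simp
      then show False by (simp add: m_def)
    qed
    \<comment> \<open>At most \<open>r - 1\<close> equations make the \<open>l i\<close>
      proportional to \<open>v\<close>, so a component of dimension at least 1 remains through
      \<open>z0\<close>.\<close>
    define S where "S = (\<lambda>i x. l i x - v i / v 0 * l 0 x) ` {1..<r}"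
    have finS: "finite S" by (simp add: S_def)
    have "card S \<le> card {1..<r}" unfolding S_def by (rule card_image_le) simp
    then have cardS: "card S \<le> r - 1" by simp
    have z0': "z0 \<in> V" "\<And>i. i < r \<Longrightarrow> l i z0 = 0" using z0(1) Z by auto
    have "\<exists>W r'. irred_alg_set N W \<and> z0 \<in> W \<and> W \<subseteq> {x \<in> V. \<forall>f\<in>S. f x = 0} \<and> has_dim N W r' \<and> r \<le> r' + card S"
    proof (rule intersection_component_at[OF finS V dim z0'(1)])
      fix f assume "f \<in> S"
      then obtain i where i: "f = (\<lambda>x. l i x - v i / v 0 * l 0 x)" "i \<in> {1..<r}"
        unfolding S_def by (elim imageE)
      show "f z0 = 0" using z0'(2) i r by simp
      show "poly_fun N f" unfolding i(1)
        by (rule poly_fun_diff, rule l, use i(2) in simp, rule pf_mult, rule pf_const, rule l, rule r)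
    qed
    then obtain W r' where W: "irred_alg_set N W" "z0 \<in> W" "W \<subseteq> {x \<in> V. \<forall>f\<in>S. f x = 0}"
      "has_dim N W r'" "r \<le> r' + card S" by (elim exE conjE)
    have r': "r' \<noteq> 0" using W(5) cardS r by simp
    define \<tau> where "\<tau> = (\<lambda>x. inverse (v 0) * l 0 x)"
    have p\<tau>: "poly_fun N \<tau>" unfolding \<tau>_def by (rule pf_mult, rule pf_const, rule l, rule r)
    have WV: "x \<in> V" if "x \<in> W" for x using W(3) that by auto
    have lW: "l i x = \<tau> x * v i" if "x \<in> W" "i < r" for x i
    proof (cases "i = 0")
      case True
      then show ?thesis using v(2) by (simp add: \<tau>_def)
    next
      case False
      then have "(\<lambda>x. l i x - v i / v 0 * l 0 x) \<in> S" using that(2) unfolding S_def by (intro imageI) simp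
      moreover have "\<forall>f\<in>S. f x = 0" using W(3) that(1) by auto
      ultimately have "l i x - v i / v 0 * l 0 x = 0" by (rule bspec[rotated])
      then show ?thesis by (simp add: \<tau>_def field_simps)
    qed
    define G where "G = (\<lambda>x. \<Sum>z\<in>Z. poly (u z) (\<tau> x) * e z x)"
    have pG: "poly_fun N G" unfolding G_def
      by (rule poly_fun_sum, rule pf_mult, rule poly_fun_poly[OF p\<tau>], rule e)
    have "\<tau> x ^ m * G x = 0" if x: "x \<in> W" for x
    proof -
      have "P z (\<lambda>i. l i x) = \<tau> x ^ m * poly (u z) (\<tau> x)" if z: "z \<in> Z" for z
      proof -
        have "P z (\<lambda>i. l i x) = P z (\<lambda>i. \<tau> x * v i)"
          by (rule rp_cong[OF P[OF z]]) (use lW[OF x] in simp)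
        also have "\<dots> = poly (p z) (\<tau> x)" using p z by simp
        also have "p z = [:-0, 1:] ^ m * u z" using u z by simp
        finally show ?thesis by (simp add: poly_power)
      qed
      then have "(\<Sum>z\<in>Z. P z (\<lambda>i. l i x) * e z x) = \<tau> x ^ m * G x"
        unfolding G_def sum_distrib_left by (intro sum.cong refl) (simp add: mult.assoc)
      then show ?thesis using rel[OF WV[OF x]] by simp
    qed
    then have "(\<forall>x\<in>W. \<tau> x ^ m = 0) \<or> (\<forall>x\<in>W. G x = 0)"
      by (rule irred_mult_zero[OF W(1) poly_fun_power[OF p\<tau>] pG])
    \<comment> \<open>If \<open>\<tau>\<close> vanished on \<open>W\<close>, all \<open>l i\<close>
      would, and \<open>W\<close> would be contained in the finite set \<open>Z\<close>.\<close>
    moreover have "\<exists>x\<in>W. \<tau> x \<noteq> 0"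
    proof (rule ccontr)
      assume neg: "\<not> ?thesis"
      have "W \<subseteq> Z"
      proof
        fix x assume x: "x \<in> W"
        then have "\<tau> x = 0" using neg by simp
        then show "x \<in> Z" unfolding Z using WV[OF x] lW[OF x] by simp
      qed
      then have "finite W" using finZ by (rule finite_subset)
      from irred_finite_dim[OF W(1) this W(4)] show False using r' by simp
    qed
    ultimately have "G z0 = 0" using W(2) by auto
    moreover have "\<tau> z0 = 0" using z0'(2)[OF r] by (simp add: \<tau>_def)
    ultimately have "(\<Sum>z\<in>Z. poly (u z) 0 * e z z0) = 0" by (simp add: G_def)
    then show False using pick[OF z0(1), of "\<lambda>z. poly (u z) 0"] u0 by simp
  qed
qed

text \<open>Serves to bound the set whose supremum is \<open>irred_degree\<close>, so a crude
  constant suffices: \<open>card Z * (q + 1) ^ r\<close> independent functions of degree at most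
  \<open>(r + 1) * q\<close> are compared with the Hilbert function of \<open>V\<close>.\<close>

lemma finite_section_card_le:
  assumes V: "irred_alg_set N V" and pre: "prenoether N V I L A K" and ind: "algind N V I L"
    and r: "card I = r" and E: "affine_subspace_codim N r E" and fin: "finite (V \<inter> E)"
  shows "card (V \<inter> E) \<le> card A * (r + 1) ^ r"
proof -
  have dim: "has_dim N V r" unfolding has_dim_def using pre ind r by (intro exI conjI)
  from E[unfolded affine_subspace_codim_def] obtain M c where
    E: "E = {x \<in> aff_space N. \<forall>i<r. (\<Sum>k<N. M i k * x k) = c i}" by (elim exE conjE)
  define Z where "Z = V \<inter> E"
  have finZ: "finite Z" using fin by (simp add: Z_def)
  have Z_aff: "Z \<subseteq> aff_space N" using irred_alg_set_aff[OF V] by (auto simp: Z_def)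
  have "\<exists>q e. (\<forall>z\<in>Z. pd {..<N} q (e z)) \<and> (\<forall>z\<in>Z. \<forall>z'\<in>Z. e z z' = (if z = z' then 1 else 0))"
  proof (rule separating_polys[OF finZ Z_aff])
    fix q e assume "\<And>z. z \<in> Z \<Longrightarrow> pd {..<N} q (e z)"
      "\<And>z z'. z \<in> Z \<Longrightarrow> z' \<in> Z \<Longrightarrow> e z z' = (if z = z' then 1 else 0)"
    then show ?thesis by (intro exI[of _ q] exI[of _ e]) simp
  qed
  then obtain q e where e: "\<forall>z\<in>Z. pd {..<N} q (e z)"
    "\<forall>z\<in>Z. \<forall>z'\<in>Z. e z z' = (if z = z' then 1 else 0)" by (elim exE conjE)
  define l where "l = (\<lambda>i x. (\<Sum>k<N. M i k * x k) - c i)"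
  have l: "pd {..<N} 1 (l i)" for i unfolding l_def
    by (rule pd_diff, rule pd_sum, rule pd_cmult, rule pd_var, assumption, rule le_refl, rule pd_const)
  have Zl: "Z = {x \<in> V. \<forall>i<r. l i x = 0}"
    using irred_alg_set_aff[OF V] unfolding Z_def E l_def by auto
  define T where "T = PiE {..<r} (\<lambda>_. {..q})"
  have finT: "finite T" unfolding T_def by (intro finite_PiE) auto
  have cardT: "card T = (q + 1) ^ r" unfolding T_def by (simp add: card_PiE_const)
  define F where "F = (\<lambda>(z, p) x. lagr {..<r} q p (\<lambda>i. l i x) * e z x)"
  have "card (Z \<times> T) \<le> card A * ((r + 1) * q + 1) ^ card I"
  proof (rule indep_card_le[OF pre, where F = F])
    show "finite (Z \<times> T)" using finZ finT by simp
    fix s assume "s \<in> Z \<times> T"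
    then obtain z p where s: "s = (z, p)" "z \<in> Z" "p \<in> T" by (elim SigmaE)
    have "pd {..<r} (card {..<r} * q) (lagr {..<r} q p)"
      by (rule pd_lagr) (use s(3) in \<open>simp_all add: T_def\<close>)
    then have "pd {..<N} (card {..<r} * q) (\<lambda>x. lagr {..<r} q p (\<lambda>i. l i x))"
      by (rule pd_subst1) (rule l)
    from pd_mult_le[OF this e(1)[rule_format, OF s(2)], of "(r + 1) * q"]
    show "pd {..<N} ((r + 1) * q) (F s)" by (simp add: F_def s(1))
  next
    show "indep_on V (Z \<times> T) F" unfolding indep_on_def
    proof (intro allI impI ballI)
      fix c s assume c: "\<forall>x\<in>V. (\<Sum>s\<in>Z \<times> T. c s * F s x) = 0" and "s \<in> Z \<times> T"
      then obtain z1 p where s: "s = (z1, p)" "z1 \<in> Z" "p \<in> T" by (elim SigmaE)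
      define P where "P = (\<lambda>z y. \<Sum>p\<in>T. c (z, p) * lagr {..<r} q p y)"
      have "P z1 (\<lambda>i. of_nat (p i)) = 0"
      proof (rule section_relation_trivial[OF V dim _ Zl finZ _ e(2)[rule_format] _ _ s(2), where P = P])
        show "poly_fun N (l i)" for i by (rule poly_fun_pd[OF l])
        show "poly_fun N (e z)" if "z \<in> Z" for z by (rule poly_fun_pd[OF e(1)[rule_format, OF that]])
        show "rp {..<r} (P z)" for z unfolding P_def
          by (rule rp_sum, rule rp_mult, rule rp_const, rule rpI, rule pd_lagr)
            (simp_all add: T_def)
        fix x assume x: "x \<in> V"
        have "(\<Sum>z\<in>Z. P z (\<lambda>i. l i x) * e z x) = (\<Sum>z\<in>Z. \<Sum>p\<in>T. c (z, p) * F (z, p) x)"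
          unfolding P_def sum_distrib_right F_def by (intro sum.cong refl) (simp add: mult.assoc)
        also have "\<dots> = (\<Sum>s\<in>Z \<times> T. c s * F s x)"
          unfolding sum.cartesian_product by (intro sum.cong refl) auto
        finally show "(\<Sum>z\<in>Z. P z (\<lambda>i. l i x) * e z x) = 0" using c x by simp
      qed
      moreover have "P z1 (\<lambda>i. of_nat (p i)) = (\<Sum>p'\<in>T. if p' = p then c (z1, p') else 0)"
        unfolding P_def using s(3) by (intro sum.cong) (auto simp: lagr_eval T_def)
      ultimately show "c s = 0" using s finT by simp
    qed
  qed
  then have "card Z * (q + 1) ^ r \<le> card A * ((r + 1) * q + 1) ^ r"
    by (simp add: card_cartesian_product cardT r)
  also have "\<dots> \<le> card A * ((r + 1) * (q + 1)) ^ r" by (intro mult_le_mono2 power_mono) auto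
  also have "\<dots> = card A * (r + 1) ^ r * (q + 1) ^ r" by (simp only: power_mult_distrib mult.assoc)
  finally show ?thesis by (simp add: Z_def)
qed

text \<open>A fibre is the section by the equations \<open>Y x i = y i\<close>; algebraic
  independence of the forms on \<open>V\<close> contains the linear independence that the
  codimension asks for.\<close>

lemma (in noether_var) fiber_card_le_degree:
  assumes fin: "finite (fiber y)"
  shows "card (fiber y) \<le> irred_degree N V"
proof -
  define r where "r = card I"
  have dim: "has_dim N V r" unfolding has_dim_def r_def
    by (intro exI[of _ I] exI[of _ L] exI[of _ A] exI[of _ K] conjI pre ind refl)
  have adim: "alg_dim N V = r" by (rule alg_dim_irred[OF irr dim])
  obtain \<sigma> where \<sigma>: "bij_betw \<sigma> {0..<r} I" using ex_bij_betw_nat_finite[OF finI] unfolding r_def by blast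
  have \<sigma>I: "\<sigma> i \<in> I" if "i < r" for i using bij_betwE[OF \<sigma>] that by auto
  have \<sigma>eq: "\<sigma> i = \<sigma> j \<longleftrightarrow> i = j" if "i < r" "j < r" for i j
    using bij_betw_imp_inj_on[OF \<sigma>] that by (auto simp: inj_on_def)
  have \<sigma>ex: "\<exists>i<r. j = \<sigma> i" if "j \<in> I" for j
    using bij_betw_imp_surj_on[OF \<sigma>] that by auto
  define E where "E = {x \<in> aff_space N. \<forall>i<r. (\<Sum>k<N. L (\<sigma> i) k * x k) = y (\<sigma> i)}"
  have VE: "V \<inter> E = fiber y"
  proof (intro equalityI subsetI)
    fix x assume x: "x \<in> V \<inter> E"
    have "Y x j = y j" if j: "j \<in> I" for j
    proof -
      obtain i where "i < r" "j = \<sigma> i" using \<sigma>ex[OF j] by blast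
      then show ?thesis using x j by (simp add: E_def linmap_def)
    qed
    then show "x \<in> fiber y" using x by (simp add: fiber_def)
  next
    fix x assume x: "x \<in> fiber y"
    then have xV: "x \<in> V" by (rule fiber_sub)
    have "(\<Sum>k<N. L (\<sigma> i) k * x k) = y (\<sigma> i)" if "i < r" for i
    proof -
      have "Y x (\<sigma> i) = y (\<sigma> i)" using x \<sigma>I[OF that] by (simp add: fiber_def)
      then show ?thesis using \<sigma>I[OF that] by (simp add: linmap_def)
    qed
    then show "x \<in> V \<inter> E" using xV V_aff by (auto simp: E_def)
  qed
  have codim: "affine_subspace_codim N r E" unfolding affine_subspace_codim_def
  proof (intro conjI exI[of _ "\<lambda>i. L (\<sigma> i)"] exI[of _ "\<lambda>i. y (\<sigma> i)"] allI impI)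
    show "r \<le> N" by (rule has_dim_le[OF dim])
    show "E = {x \<in> aff_space N. \<forall>i<r. (\<Sum>k<N. L (\<sigma> i) k * x k) = y (\<sigma> i)}" by (rule E_def)
    fix a j assume a: "\<forall>k<N. (\<Sum>i<r. a i * L (\<sigma> i) k) = 0" and j: "j < r"
    define q where "q = (\<lambda>w::nat \<Rightarrow> complex. \<Sum>i<r. a i * w (\<sigma> i))"
    have "pd I 1 q" unfolding q_def
      by (rule pd_sum, rule pd_cmult, rule pd_var) (simp_all add: \<sigma>I)
    then have "rp I q" by (rule rpI)
    moreover have "q (Y x) = 0" if "x \<in> V" for x
    proof -
      have "q (Y x) = (\<Sum>i<r. \<Sum>k<N. a i * L (\<sigma> i) k * x k)"
        unfolding q_def by (intro sum.cong refl) (simp add: linmap_def \<sigma>I sum_distrib_left mult.assoc)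
      also have "\<dots> = (\<Sum>k<N. (\<Sum>i<r. a i * L (\<sigma> i) k) * x k)"
        unfolding sum_distrib_right by (rule sum.swap)
      also have "\<dots> = 0" using a by simp
      finally show ?thesis .
    qed
    ultimately have "q (\<lambda>k. if k = \<sigma> j then 1 else 0) = 0" by (rule rp_zero)
    moreover have "q (\<lambda>k. if k = \<sigma> j then 1 else 0) = (\<Sum>i<r. if i = j then a i else 0)"
      unfolding q_def using \<sigma>eq[OF _ j] by (intro sum.cong refl) simp
    ultimately show "a j = 0" using j by simp
  qed
  show ?thesis unfolding irred_degree_def adim
  proof (rule cSup_upper)
    show "card (fiber y) \<in> {card (V \<inter> E) | E. affine_subspace_codim N r E \<and> finite (V \<inter> E)}"
      using codim fin by (intro CollectI exI[of _ E]) (simp add: VE)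
    show "bdd_above {card (V \<inter> E) | E. affine_subspace_codim N r E \<and> finite (V \<inter> E)}"
    proof (rule bdd_aboveI)
      fix c assume "c \<in> {card (V \<inter> E) | E. affine_subspace_codim N r E \<and> finite (V \<inter> E)}"
      then obtain E where "c = card (V \<inter> E)" "affine_subspace_codim N r E" "finite (V \<inter> E)"
        by (elim CollectE exE conjE)
      then show "c \<le> card A * (r + 1) ^ r"
        using finite_section_card_le[OF irr pre ind r_def[symmetric]] by simp
    qed
  qed
qed

section \<open>Test sets of algebraic sets\<close>

definition test_set :: "nat \<Rightarrow> nat \<Rightarrow> (nat \<Rightarrow> complex) set \<Rightarrow> (nat \<Rightarrow> complex) set \<Rightarrow> bool" where
  "test_set N s X P \<longleftrightarrow> finite P \<and> P \<subseteq> X \<and>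
    (\<forall>f. pd {..<N} s f \<longrightarrow> (\<forall>x\<in>P. f x = 0) \<longrightarrow> (\<forall>x\<in>X. f x = 0))"

lemma irred_test_set:
  assumes V: "irred_alg_set N V"
  shows "\<exists>P. test_set N s V P \<and> card P \<le> irred_degree N V * (s + 1) ^ alg_dim N V"
proof -
  have "V \<noteq> {}" using V by (simp add: irred_alg_set_def)
  from has_dim_exists[OF this] obtain r where dim: "has_dim N V r" by blast
  from has_dim_noether_var[OF V dim] obtain I L A K
    where nv: "noether_var N V I L A K" and r: "card I = r" by (elim exE conjE)
  interpret noether_var N V I L A K by (rule nv)
  from test_set_exists obtain d y0 where d: "finite (fiber y0)" "card (fiber y0) = d"
    "\<forall>s. \<exists>P. finite P \<and> P \<subseteq> V \<and> card P \<le> d * (s + 1) ^ card I \<and>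
      (\<forall>f. pd {..<N} s f \<longrightarrow> (\<forall>x\<in>P. f x = 0) \<longrightarrow> (\<forall>x\<in>V. f x = 0))" by (elim exE conjE)
  from d(3)[rule_format, of s] obtain P where P: "finite P" "P \<subseteq> V" "card P \<le> d * (s + 1) ^ r"
    "\<forall>f. pd {..<N} s f \<longrightarrow> (\<forall>x\<in>P. f x = 0) \<longrightarrow> (\<forall>x\<in>V. f x = 0)" unfolding r by (elim exE conjE)
  have "d \<le> irred_degree N V" using fiber_card_le_degree[OF d(1)] d(2) by simp
  then have "card P \<le> irred_degree N V * (s + 1) ^ r"
    by (rule order_trans[OF P(3) mult_le_mono1])
  then show ?thesis unfolding test_set_def alg_dim_irred[OF V dim] using P(1,2,4)
    by (intro exI[of _ P] conjI)
qed

text \<open>The test sets of the components are united: degrees add up by the definition of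
  \<open>alg_degree\<close>, and each exponent is raised to the dimension of
  \<open>X\<close>.\<close>

lemma alg_test_set:
  assumes X: "alg_set N X"
  shows "\<exists>P. test_set N s X P \<and> card P \<le> alg_degree N X * (s + 1) ^ alg_dim N X"
proof -
  let ?C = "irred_components N X"
  have irr: "irred_alg_set N V" "V \<subseteq> X" if "V \<in> ?C" for V using that by (auto simp: irred_components_def)
  have "\<forall>V. \<exists>P. V \<in> ?C \<longrightarrow> test_set N s V P \<and> card P \<le> irred_degree N V * (s + 1) ^ alg_dim N V"
    using irred_test_set irr(1) by simp
  from choice[OF this] obtain P where
    P: "\<forall>V. V \<in> ?C \<longrightarrow> test_set N s V (P V) \<and> card (P V) \<le> irred_degree N V * (s + 1) ^ alg_dim N V"
    by (elim exE)
  have fin: "finite ?C" by (rule irred_components(1)[OF X])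
  have "test_set N s X (\<Union>V\<in>?C. P V)" unfolding test_set_def
  proof (intro conjI allI impI ballI)
    show "finite (\<Union>V\<in>?C. P V)" using fin P by (simp add: test_set_def)
    show "(\<Union>V\<in>?C. P V) \<subseteq> X" using P irr(2) unfolding test_set_def by (intro UN_least) (meson subset_trans)
    fix f x assume f: "pd {..<N} s f" "\<forall>x\<in>\<Union>V\<in>?C. P V. f x = 0" and x: "x \<in> X"
    then obtain V where V: "V \<in> ?C" "x \<in> V" using irred_components(2)[OF X] by blast
    have "test_set N s V (P V)" using P V(1) by simp
    then show "f x = 0" unfolding test_set_def using f V by simp
  qed
  moreover have "card (\<Union>V\<in>?C. P V) \<le> alg_degree N X * (s + 1) ^ alg_dim N X"
  proof -
    have "card (\<Union>V\<in>?C. P V) \<le> (\<Sum>V\<in>?C. card (P V))" by (rule card_UN_le[OF fin])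
    also have "\<dots> \<le> (\<Sum>V\<in>?C. irred_degree N V * (s + 1) ^ alg_dim N X)"
    proof (rule sum_mono)
      fix V assume V: "V \<in> ?C"
      have "card (P V) \<le> irred_degree N V * (s + 1) ^ alg_dim N V" using P V by simp
      also have "\<dots> \<le> irred_degree N V * (s + 1) ^ alg_dim N X"
        by (intro mult_le_mono2 power_increasing alg_dim_mono irr[OF V]) simp
      finally show "card (P V) \<le> irred_degree N V * (s + 1) ^ alg_dim N X" .
    qed
    finally show ?thesis by (simp add: alg_degree_def sum_distrib_right)
  qed
  ultimately show ?thesis by (intro exI conjI)
qed

section \<open>Counting products\<close>

lemma mat_list_prod_carrier:
  "set as \<subseteq> carrier_mat d d \<Longrightarrow> mat_list_prod d as \<in> carrier_mat d d"
  by (induction as) (auto simp: mat_list_prod_def)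

lemma mat_list_prod_append:
  assumes "set as \<subseteq> carrier_mat d d" "set bs \<subseteq> carrier_mat d d"
  shows "mat_list_prod d (as @ bs) = mat_list_prod d as * mat_list_prod d bs"
  using assms(1)
proof (induction as)
  case Nil
  then show ?case using mat_list_prod_carrier[OF assms(2)] by (simp add: mat_list_prod_def)
next
  case (Cons A as)
  have A: "A \<in> carrier_mat d d" and as: "mat_list_prod d as \<in> carrier_mat d d"
    using Cons.prems by (auto intro: mat_list_prod_carrier)
  have "mat_list_prod d (A # as @ bs) = A * (mat_list_prod d as * mat_list_prod d bs)"
    using Cons by (simp add: mat_list_prod_def)
  also have "\<dots> = A * mat_list_prod d as * mat_list_prod d bs"
    using assoc_mult_mat[OF A as mat_list_prod_carrier[OF assms(2)]] by simp
  finally show ?case by (simp add: mat_list_prod_def)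
qed

lemma mat_entry_linear:
  assumes "A \<in> carrier_mat d d" "M \<in> carrier_mat d d" "B \<in> carrier_mat d d" "i < d" "j < d"
  shows "(A * (M * B)) $$ (i, j) =
    (\<Sum>k<d. \<Sum>l<d. (A $$ (i, k) * B $$ (l, j)) * mat_coords d M (k * d + l))"
proof -
  have coord: "mat_coords d M (k * d + l) = M $$ (k, l)" if "k < d" "l < d" for k l
  proof -
    have "k * d + l < k * d + d" using that(2) by simp
    also have "\<dots> = Suc k * d" by simp
    also have "\<dots> \<le> d * d" using that(1) by (intro mult_le_mono1) simp
    finally show ?thesis using that by (simp add: mat_coords_def)
  qed
  have "(A * (M * B)) $$ (i, j) = (\<Sum>k<d. A $$ (i, k) * (\<Sum>l<d. M $$ (k, l) * B $$ (l, j)))"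
    using assms by (simp add: scalar_prod_def atLeast0LessThan)
  also have "\<dots> = (\<Sum>k<d. \<Sum>l<d. (A $$ (i, k) * B $$ (l, j)) * mat_coords d M (k * d + l))"
    unfolding sum_distrib_left by (intro sum.cong refl) (simp add: coord)
  finally show ?thesis .
qed

lemma U_oracle_entry:
  assumes "x < 2 ^ n"
  shows "U_oracle n f $$ (2 * x, 2 * x) = (if f x then 0 else 1)"
proof -
  have "2 * x < 2 ^ (n + 1)" using assms by simp
  then show ?thesis by (simp add: U_oracle_def)
qed

definition match :: "nat \<Rightarrow> nat \<Rightarrow> nat set \<Rightarrow> complex mat \<Rightarrow> complex" where
  "match d m S M = (\<Prod>x<m. if x \<in> S then 1 - M $$ (2 * x, 2 * x) else M $$ (2 * x, 2 * x))"

lemma match_U_oracle: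
  assumes "S \<subseteq> {..<2 ^ n}" "S' \<subseteq> {..<2 ^ n}"
  shows "match d (2 ^ n) S (U_oracle n (\<lambda>x. x \<in> S')) = (if S = S' then 1 else 0)"
proof (cases "S = S'")
  case True
  then show ?thesis by (auto simp: match_def U_oracle_entry intro!: prod.neutral)
next
  case False
  then obtain x where "x \<in> S \<longleftrightarrow> x \<notin> S'" by blast
  then have "x < 2 ^ n" and "(if x \<in> S then 1 - U_oracle n (\<lambda>x. x \<in> S') $$ (2 * x, 2 * x)
      else U_oracle n (\<lambda>x. x \<in> S') $$ (2 * x, 2 * x)) = 0"
    using assms by (auto simp: U_oracle_entry)
  then have "match d (2 ^ n) S (U_oracle n (\<lambda>x. x \<in> S')) = 0"
    unfolding match_def by (intro prod_zero bexI[of _ x]) simp_all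
  then show ?thesis using False by simp
qed

lemma match_prod_pd:
  assumes "set as \<subseteq> carrier_mat d d" "set bs \<subseteq> carrier_mat d d" "2 * m \<le> d"
  shows "\<exists>f. pd {..<d * d} m f \<and>
    (\<forall>M\<in>carrier_mat d d. match d m S (mat_list_prod d (as @ M # bs)) = f (mat_coords d M))"
proof -
  define A where "A = mat_list_prod d as"
  define B where "B = mat_list_prod d bs"
  have A: "A \<in> carrier_mat d d" and B: "B \<in> carrier_mat d d"
    unfolding A_def B_def using assms by (auto intro: mat_list_prod_carrier)
  define h where "h = (\<lambda>j x. \<Sum>k<d. \<Sum>l<d. (A $$ (2 * j, k) * B $$ (l, 2 * j)) * x (k * d + l) :: complex)"
  have h: "pd {..<d * d} 1 (h j)" for j unfolding h_def
  proof (rule pd_sum, rule pd_sum, rule pd_cmult, rule pd_var)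
    fix k l assume kl: "k \<in> {..<d}" "l \<in> {..<d}"
    have "k * d + l < k * d + d" using kl(2) by simp
    also have "\<dots> = Suc k * d" by simp
    also have "\<dots> \<le> d * d" using kl(1) by (intro mult_le_mono1) simp
    finally show "k * d + l \<in> {..<d * d}" by simp
  qed simp
  define f where "f = (\<lambda>x. \<Prod>j<m. (if j \<in> S then 1 - h j x else h j x))"
  have "pd {..<d * d} 1 (\<lambda>x. if j \<in> S then 1 - h j x else h j x)" for j
    using h[of j] pd_diff[OF pd_const h[of j], of 1] by (cases "j \<in> S") simp_all
  then have "pd {..<d * d} (\<Sum>j<m. 1) f" unfolding f_def by (intro pd_prod) simp
  moreover have "match d m S (mat_list_prod d (as @ M # bs)) = f (mat_coords d M)"
    if M: "M \<in> carrier_mat d d" for M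
  proof -
    have "mat_list_prod d (as @ M # bs) = A * (M * B)"
      using mat_list_prod_append[of as d "M # bs"] assms(1,2) M
      by (simp add: A_def B_def mat_list_prod_def)
    moreover have "(A * (M * B)) $$ (2 * j, 2 * j) = h j (mat_coords d M)" if "j < m" for j
      unfolding h_def using that assms(3) by (intro mat_entry_linear A B M) auto
    ultimately show ?thesis unfolding match_def f_def by (intro prod.cong refl) simp
  qed
  ultimately show ?thesis by (intro exI[of _ f]) simp
qed

text \<open>The prefix ranges over \<open>X\<close>, the suffix already over \<open>P\<close>. By
  \<open>step\<close> the last factor of the prefix may be restricted to \<open>P\<close> and moved
  to the suffix, until only lists over \<open>P\<close> remain.\<close>

lemma list_vanish:
  assumes step: "\<And>as bs. set as \<subseteq> X \<Longrightarrow> set bs \<subseteq> X \<Longrightarrow> (\<And>M. M \<in> P \<Longrightarrow> g (as @ M # bs) = 0) \<Longrightarrow>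
      (\<And>M. M \<in> X \<Longrightarrow> g (as @ M # bs) = (0::complex))"
    and base: "\<And>as. set as \<subseteq> P \<Longrightarrow> length as = t \<Longrightarrow> g as = 0"
    and P: "P \<subseteq> X"
  shows "set as \<subseteq> X \<Longrightarrow> set bs \<subseteq> P \<Longrightarrow> length as + length bs = t \<Longrightarrow> g (as @ bs) = 0"
proof (induction as arbitrary: bs rule: rev_induct)
  case Nil
  then show ?case using base by simp
next
  case (snoc M as)
  have "g (as @ M # bs) = 0"
  proof (rule step)
    show "g (as @ M' # bs) = 0" if "M' \<in> P" for M'
      using snoc that by (intro snoc.IH) auto
  qed (use snoc.prems P in auto)
  then show ?case by simp
qed

text \<open>The functions \<open>match\<close> separate the oracles, so on a product set of test points, where
  they are determined by too few values, they would be linearly dependent.\<close>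
lemma card_exact_products_le:
  assumes \<Delta>: "\<Delta> \<subseteq> carrier_mat (2 ^ (n + 1)) (2 ^ (n + 1))"
    and P: "test_set (2 ^ (n + 1) * 2 ^ (n + 1)) (2 ^ n) (mat_coords (2 ^ (n + 1)) ` \<Delta>) P"
  shows "card {S \<in> Pow {..<2 ^ n}. \<exists>as. length as = t \<and> set as \<subseteq> \<Delta> \<and>
    mat_list_prod (2 ^ (n + 1)) as = U_oracle n (\<lambda>x. x \<in> S)} \<le> card P ^ t"
proof (rule ccontr)
  define d :: nat where "d = 2 ^ (n + 1)"
  define m :: nat where "m = 2 ^ n"
  define F where "F = {S \<in> Pow {..<m}. \<exists>as. length as = t \<and> set as \<subseteq> \<Delta> \<and>
    mat_list_prod d as = U_oracle n (\<lambda>x. x \<in> S)}"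
  assume "\<not> ?thesis"
  then have lt: "card P ^ t < card F" unfolding F_def d_def m_def by simp
  have finF: "finite F" unfolding F_def by simp
  note P0 = P[folded d_def m_def, unfolded test_set_def]
  have P1: "finite P" "P \<subseteq> mat_coords d ` \<Delta>"
    "\<forall>f. pd {..<d * d} m f \<longrightarrow> (\<forall>x\<in>P. f x = 0) \<longrightarrow> (\<forall>x\<in>mat_coords d ` \<Delta>. f x = 0)"
    by (rule conjunct1[OF P0], rule conjunct1[OF conjunct2[OF P0]], rule conjunct2[OF conjunct2[OF P0]])
  \<comment> \<open>One matrix of \<open>\<Delta>\<close> for each test point, so that
    \<open>card Q = card P\<close>.\<close>
  from P1(2)[unfolded subset_image_inj] obtain Q where
    Q: "Q \<subseteq> \<Delta>" "inj_on (mat_coords d) Q" "P = mat_coords d ` Q" by (elim exE conjE)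
  have finQ: "finite Q" using P1(1) Q(2,3) by (simp add: finite_image_iff)
  have cardQ: "card Q = card P" using Q(2,3) by (simp add: card_image)
  define T where "T = {as. set as \<subseteq> Q \<and> length as = t}"
  have finT: "finite T" unfolding T_def by (rule finite_lists_length_eq[OF finQ])
  have "card T = card P ^ t" unfolding T_def card_lists_length_eq[OF finQ] cardQ ..
  then have "card T < card F" using lt by simp
  from lin_dep[OF finT finF this, of "\<lambda>S as. match d m S (mat_list_prod d as)"] obtain c where
    c: "\<exists>S\<in>F. c S \<noteq> 0" "\<forall>as\<in>T. (\<Sum>S\<in>F. c S * match d m S (mat_list_prod d as)) = 0"
    by (elim exE conjE)
  define G where "G = (\<lambda>as. \<Sum>S\<in>F. c S * match d m S (mat_list_prod d as))"
  have car: "set as \<subseteq> carrier_mat d d" if "set as \<subseteq> \<Delta>" for as :: "complex mat list"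
    using that \<Delta> unfolding d_def by blast
  have G0: "G as = 0" if as: "set as \<subseteq> \<Delta>" "length as = t" for as
  proof -
    have "G (as @ []) = 0"
    proof (rule list_vanish[where g = G and X = \<Delta> and P = Q and t = t])
      fix as bs M assume a: "set as \<subseteq> \<Delta>" "set bs \<subseteq> \<Delta>" and z: "\<And>M. M \<in> Q \<Longrightarrow> G (as @ M # bs) = 0"
        and M: "M \<in> \<Delta>"
      have "2 * m \<le> d" by (simp add: m_def d_def)
      from match_prod_pd[OF car[OF a(1)] car[OF a(2)] this]
      have "\<forall>S. \<exists>f. pd {..<d * d} m f \<and>
        (\<forall>M\<in>carrier_mat d d. match d m S (mat_list_prod d (as @ M # bs)) = f (mat_coords d M))" by (rule allI)
      from choice[OF this] obtain f where f: "\<forall>S. pd {..<d * d} m (f S) \<and>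
        (\<forall>M\<in>carrier_mat d d. match d m S (mat_list_prod d (as @ M # bs)) = f S (mat_coords d M))"
        by (elim exE)
      define H where "H = (\<lambda>x. \<Sum>S\<in>F. c S * f S x)"
      have "pd {..<d * d} m H" unfolding H_def by (rule pd_sum, rule pd_cmult) (use f in simp)
      moreover have GH: "G (as @ M # bs) = H (mat_coords d M)" if "M \<in> \<Delta>" for M
      proof -
        have "M \<in> carrier_mat d d" using that \<Delta> by (auto simp: d_def)
        then show ?thesis unfolding G_def H_def using f by simp
      qed
      moreover have "\<forall>x\<in>P. H x = 0"
      proof
        fix x assume "x \<in> P"
        then obtain M where M: "M \<in> Q" "x = mat_coords d M" unfolding Q(3) by (elim imageE)
        then show "H x = 0" using GH[of M] z[OF M(1)] Q(1) by auto
      qed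
      ultimately have "\<forall>x\<in>mat_coords d ` \<Delta>. H x = 0" using P1(3)[rule_format, of H] by simp
      then show "G (as @ M # bs) = 0" using GH[OF M] M by simp
    next
      fix as assume "set as \<subseteq> Q" "length as = t"
      then show "G as = 0" using c(2) unfolding G_def T_def by simp
    qed (use Q(1) as in simp_all)
    then show ?thesis by simp
  qed
  obtain S where S: "S \<in> F" "c S \<noteq> 0" using c(1) by blast
  then obtain as where as: "length as = t" "set as \<subseteq> \<Delta>" "mat_list_prod d as = U_oracle n (\<lambda>x. x \<in> S)"
    unfolding F_def by blast
  have "G as = (\<Sum>S'\<in>F. if S' = S then c S' else 0)" unfolding G_def as(3) m_def
  proof (rule sum.cong[OF refl])
    fix S' assume "S' \<in> F"
    then have "S' \<subseteq> {..<2 ^ n}" "S \<subseteq> {..<2 ^ n}" using S(1) by (auto simp: F_def m_def)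
    then show "c S' * match d (2 ^ n) S' (U_oracle n (\<lambda>x. x \<in> S)) = (if S' = S then c S' else 0)"
      by (simp add: match_U_oracle)
  qed
  also have "\<dots> = c S" using S(1) finF by simp
  finally show False using G0[OF as(2,1)] S(2) by simp
qed

section \<open>Numerical estimates and the lower bound\<close>

lemma rank_End_less:
  assumes "rank_End m \<Delta> U < enat k"
  shows "\<exists>t<k. \<exists>as. length as = t \<and> set as \<subseteq> \<Delta> \<and> mat_list_prod (2 ^ m) as = U"
  using assms unfolding rank_End_def INF_less_iff by auto

text \<open>There are \<open>T + 1 \<le> 2 ^ T\<close> lengths below the bound and each contributes
  at most \<open>Q ^ T\<close>. The exponent is thus \<open>T * (1 + 2 * \<kappa>)\<close>, at most
  \<open>3 * \<kappa> * T\<close>, whence the factor 3.\<close>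

lemma counting_bound:
  fixes b :: real and q :: nat
  assumes \<kappa>: "1 \<le> \<kappa>" and q: "real q \<le> 2 powr (2 * \<kappa>)" and b: "0 < b" "3 * \<kappa> * b \<le> real m"
  shows "(\<Sum>t<nat \<lceil>b\<rceil>. q ^ t) < 2 ^ m"
proof -
  define T where "T = nat \<lceil>b\<rceil> - 1"
  have T: "nat \<lceil>b\<rceil> = Suc T" using b(1) unfolding T_def by simp
  \<comment> \<open>\<open>T\<close> is the largest integer strictly below \<open>b\<close>, which
    makes the final estimate strict.\<close>
  have Tb: "real T < b" using T b(1) by linarith
  define Q where "Q = 2 powr (2 * \<kappa>)"
  have Q1: "1 \<le> Q" unfolding Q_def using \<kappa> by (intro ge_one_powr_ge_zero) auto
  have "real (\<Sum>t<Suc T. q ^ t) = (\<Sum>t<Suc T. real q ^ t)" by simp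
  also have "\<dots> \<le> (\<Sum>t<Suc T. Q ^ T)"
  proof (rule sum_mono)
    fix t assume "t \<in> {..<Suc T}"
    then have t: "t \<le> T" by simp
    have "real q ^ t \<le> Q ^ t" using q unfolding Q_def by (intro power_mono) simp_all
    also have "\<dots> \<le> Q ^ T" by (rule power_increasing[OF t Q1])
    finally show "real q ^ t \<le> Q ^ T" .
  qed
  also have "\<dots> = real (Suc T) * Q ^ T" by simp
  also have "\<dots> \<le> 2 ^ T * Q ^ T"
  proof (rule mult_right_mono)
    have "Suc T \<le> 2 ^ T" by (simp add: Suc_leI)
    then show "real (Suc T) \<le> 2 ^ T" by (metis of_nat_le_iff of_nat_numeral of_nat_power)
  qed (use Q1 in simp)
  also have "\<dots> = 2 powr (real T + 2 * \<kappa> * real T)"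
  proof -
    have "(2::real) ^ T = 2 powr (real T)" by (rule powr_realpow[symmetric]) simp
    moreover have "Q ^ T = Q powr (real T)" by (rule powr_realpow[symmetric]) (use Q1 in simp)
    moreover have "Q powr (real T) = 2 powr (2 * \<kappa> * real T)" unfolding Q_def by (rule powr_powr)
    ultimately show ?thesis by (simp only: powr_add)
  qed
  also have "\<dots> < 2 powr (real m)"
  proof (rule powr_less_mono)
    have "real T + 2 * \<kappa> * real T \<le> 3 * \<kappa> * real T"
      using mult_right_mono[OF \<kappa>, of "real T"] by simp
    also have "\<dots> < 3 * \<kappa> * b" using Tb \<kappa> by simp
    finally show "real T + 2 * \<kappa> * real T < real m" using b(2) by simp
  qed simp
  also have "\<dots> = real (2 ^ m)" by (simp add: powr_realpow)
  finally show ?thesis unfolding T of_nat_less_iff .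
qed

text \<open>The factor 2 comes from \<open>2 ^ n + 1 \<le> 2 ^ (2 * n)\<close>, which holds for
  \<open>n > 0\<close>. For \<open>D = 0\<close> the hypothesis gives \<open>q = 0\<close>.\<close>

lemma log_card_bound:
  assumes n: "0 < n" and q: "q \<le> D * (2 ^ n + 1) ^ p"
  shows "real q \<le> 2 powr (2 * (real p * real n + log 2 (real D)))"
proof (cases "D = 0")
  case False
  have "(2::nat) ^ n + 1 \<le> 2 ^ (2 * n)"
  proof -
    have "(2::nat) ^ n + 1 \<le> 2 ^ (n + 1)" by simp
    also have "\<dots> \<le> 2 ^ (2 * n)" using n by (intro power_increasing) auto
    finally show ?thesis .
  qed
  then have "D * (2 ^ n + 1) ^ p \<le> D * (2 ^ (2 * n)) ^ p" by (intro mult_le_mono2 power_mono) auto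
  with q have "q \<le> D * (2 ^ (2 * n)) ^ p" by (rule order_trans)
  then have "q \<le> D * 2 ^ (2 * n * p)" by (simp only: power_mult)
  then have "real q \<le> real (D * 2 ^ (2 * n * p))" by (rule of_nat_mono)
  also have "\<dots> = 2 powr (log 2 (real D)) * 2 powr (real (2 * n * p))"
  proof -
    have "2 powr (log 2 (real D)) = real D" using False by simp
    moreover have "2 powr (real (2 * n * p)) = (2::real) ^ (2 * n * p)" by (rule powr_realpow) simp
    ultimately show ?thesis by simp
  qed
  also have "\<dots> = 2 powr (log 2 (real D) + real (2 * n * p))" by (simp only: powr_add)
  also have "\<dots> \<le> 2 powr (2 * (real p * real n + log 2 (real D)))"
  proof (rule powr_mono)
    have "0 \<le> log 2 (real D)" using False by simp
    then show "log 2 (real D) + real (2 * n * p) \<le> 2 * (real p * real n + log 2 (real D))" by simp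
  qed simp
  finally show ?thesis .
qed (use q in simp)

theorem mainTheorem11:
  shows "\<exists>C::real. C > 0 \<and> (\<forall>n::nat. n > 0 \<longrightarrow> (\<forall>(\<Delta>::complex mat set) (p::nat) (D::nat).
     alg_subset_End (n+1) \<Delta> \<and> dim_End (n+1) \<Delta> = p \<and> deg_End (n+1) \<Delta> = D \<longrightarrow>
     (\<exists>f::nat \<Rightarrow> bool.
        ereal (C * 2^n / (real p * real n + log 2 (real D))) \<le> ereal_of_enat (stringent_qc n \<Delta> f))))"
proof (intro exI[of _ "1 / 3"] conjI allI impI)
  fix n :: nat and \<Delta> :: "complex mat set" and p D :: nat
  assume n: "0 < n" and asm: "alg_subset_End (n+1) \<Delta> \<and> dim_End (n+1) \<Delta> = p \<and> deg_End (n+1) \<Delta> = D"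
  define \<kappa> where "\<kappa> = real p * real n + log 2 (real D)"
  define b where "b = 1 / 3 * 2 ^ n / \<kappa>"
  show "\<exists>f. ereal (1 / 3 * 2 ^ n / (real p * real n + log 2 (real D))) \<le> ereal_of_enat (stringent_qc n \<Delta> f)"
    unfolding \<kappa>_def[symmetric] b_def[symmetric]
  proof (cases "b \<le> 0")
    \<comment> \<open>This covers \<open>\<kappa> \<le> 0\<close>, including a zero denominator,
      where the quotient is 0; any function will do.\<close>
    case True
    then have "ereal b \<le> 0" by simp
    also have "0 \<le> ereal_of_enat (stringent_qc n \<Delta> (\<lambda>_. True))" by simp
    finally show "\<exists>f. ereal b \<le> ereal_of_enat (stringent_qc n \<Delta> f)" by (intro exI)
  next
    case False
    then have b: "0 < b" by simp
    have k0: "0 < \<kappa>"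
    proof (rule ccontr)
      assume "\<not> 0 < \<kappa>"
      then have "b \<le> 0" unfolding b_def by (intro divide_nonneg_nonpos) auto
      then show False using b by simp
    qed
    \<comment> \<open>Integrality: a positive \<open>\<kappa>\<close> has
      \<open>p * n \<ge> 1\<close> or \<open>D \<ge> 2\<close>.\<close>
    have \<kappa>: "1 \<le> \<kappa>"
    proof (cases "p = 0")
      case True
      then have pos: "0 < log 2 (real D)" using k0 by (simp add: \<kappa>_def)
      have "D \<noteq> 0"
      proof
        assume "D = 0"
        then show False using pos by (simp add: log_def)
      qed
      moreover have "D \<noteq> 1"
      proof
        assume "D = 1"
        then show False using pos by simp
      qed
      ultimately have "2 \<le> real D" by simp
      then have "log 2 2 \<le> log 2 (real D)" by simp
      then show ?thesis using True by (simp add: \<kappa>_def)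
    next
      case False
      have "1 * 1 \<le> real p * real n" using False n by (intro mult_mono) auto
      moreover have "0 \<le> log 2 (real D)" by (cases "D = 0") (simp_all add: log_def)
      ultimately show ?thesis by (simp add: \<kappa>_def)
    qed
    define N :: nat where "N = 2 ^ (n + 1) * 2 ^ (n + 1)"
    define X where "X = mat_coords (2 ^ (n + 1)) ` \<Delta>"
    have \<Delta>: "\<Delta> \<subseteq> carrier_mat (2 ^ (n + 1)) (2 ^ (n + 1))" "alg_set N X" "alg_dim N X = p" "alg_degree N X = D"
      using asm unfolding alg_subset_End_def dim_End_def deg_End_def N_def X_def by auto
    from alg_test_set[OF \<Delta>(2), of "2 ^ n"] obtain P where
      P: "test_set N (2 ^ n) X P" "card P \<le> D * (2 ^ n + 1) ^ p" unfolding \<Delta>(3,4) by (elim exE conjE)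
    have q: "real (card P) \<le> 2 powr (2 * \<kappa>)" unfolding \<kappa>_def by (rule log_card_bound[OF n P(2)])
    define Fam where "Fam = (\<lambda>t. {S \<in> Pow {..<2 ^ n}. \<exists>as. length as = t \<and> set as \<subseteq> \<Delta> \<and>
      mat_list_prod (2 ^ (n + 1)) as = U_oracle n (\<lambda>x. x \<in> S)})"
    have Fam: "card (Fam t) \<le> card P ^ t" for t
      unfolding Fam_def by (rule card_exact_products_le[OF \<Delta>(1) P(1)[unfolded N_def X_def]])
    have finFam: "finite (Fam t)" for t unfolding Fam_def by simp
    show "\<exists>f. ereal b \<le> ereal_of_enat (stringent_qc n \<Delta> f)"
    proof (rule ccontr)
      assume neg: "\<nexists>f. ereal b \<le> ereal_of_enat (stringent_qc n \<Delta> f)"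
      \<comment> \<open>Boolean functions are represented by their sets of true inputs. A complexity
        below \<open>b\<close> is finite, so each of them is reached by a product of fewer than
        \<open>nat \<lceil>b\<rceil>\<close> factors.\<close>
      have "Pow {..<2 ^ n} \<subseteq> (\<Union>t<nat \<lceil>b\<rceil>. Fam t)"
      proof
        fix S :: "nat set" assume S: "S \<in> Pow {..<2 ^ n}"
        have lt: "ereal_of_enat (stringent_qc n \<Delta> (\<lambda>x. x \<in> S)) < ereal b" using neg by (simp add: not_le)
        then obtain t0 where t0: "stringent_qc n \<Delta> (\<lambda>x. x \<in> S) = enat t0" by (cases "stringent_qc n \<Delta> (\<lambda>x. x \<in> S)") auto
        have "real t0 < b" using lt by (simp add: t0)
        then have "t0 < nat \<lceil>b\<rceil>" by linarith
        then have "rank_End (n + 1) \<Delta> (U_oracle n (\<lambda>x. x \<in> S)) < enat (nat \<lceil>b\<rceil>)"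
          using t0 unfolding stringent_qc_def by simp
        from rank_End_less[OF this] obtain t where "t < nat \<lceil>b\<rceil>" "S \<in> Fam t"
          using S unfolding Fam_def by blast
        then show "S \<in> (\<Union>t<nat \<lceil>b\<rceil>. Fam t)" by blast
      qed
      then have "card (Pow {..<2 ^ n :: nat}) \<le> card (\<Union>t<nat \<lceil>b\<rceil>. Fam t)"
        by (rule card_mono[rotated]) (simp add: finFam)
      also have "\<dots> \<le> (\<Sum>t<nat \<lceil>b\<rceil>. card (Fam t))" by (rule card_UN_le) simp
      also have "\<dots> \<le> (\<Sum>t<nat \<lceil>b\<rceil>. card P ^ t)" by (intro sum_mono Fam)
      also have "\<dots> < 2 ^ (2 ^ n)"
        by (rule counting_bound[OF \<kappa> q b]) (use k0 in \<open>simp add: b_def\<close>)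
      finally show False by (simp add: card_Pow)
    qed
  qed
qed simp

end
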